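(* Let $X$ be a CBB($K$) space which is homeomorphic to the unit disk and let $\gamma$ be its boundary. If $\overline{\kappa}_\gamma (s) \ge \kappa$ for almost all $s\in\gamma$, then $\kappa_{\gamma, K} \ge \kappa$ globally.
   Context: $K\ge 0$ and $S_K$ is the 2-dimensional model space of constant curvature $K$. $X$ is a two dimensional complete length space of curvature bounded below by $K$ (CBB($K$)), and $\gamma=\partial X$ is assumed rectifiable. For a subarc $I$ of $\gamma$ with endpoints $p,q$ (with $|I|+|pq|_X\le 2\pi/\sqrt K$ when $K>0$), $\kappa_K(I)$ is the curvature $\kappa$ of the unique arc of constant geodesic curvature $\kappa$ in $S_K$ having the same length as $I$ and the same endpoint distance $|pq|_X$. The upper arc/chord curvature is $\overline{\kappa}_\gamma(q)=\limsup \kappa_K(I)$, the limsup over subarcs $I$ of $\gamma$ containing $q$ with $|I|\to 0$. "$\kappa_{\gamma,K}\ge\kappa$ globally" means $\kappa_K(I)\ge\kappa$ for every subarc $I$ of $\gamma$ with endpoints $p,q$ satisfying $|I|+|pq|_X\le 2\pi/\sqrt K$ when $K>0$. *)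

theory Defs
  imports "HOL-Analysis.Analysis"
begin

definition path_length :: "(real \<Rightarrow> 'a::metric_space) \<Rightarrow> real \<Rightarrow> real \<Rightarrow> ereal" where
  "path_length g a b =
     (SUP p \<in> {(n::nat, t::nat \<Rightarrow> real). t 0 = a \<and> t n = b \<and> (\<forall>i<n. t i \<le> t (Suc i))}.
        ereal (\<Sum>i<fst p. dist (g (snd p i)) (g (snd p (Suc i)))))"

definition length_space :: "'a::metric_space set \<Rightarrow> bool" where
  "length_space X \<longleftrightarrow>
     (\<forall>x\<in>X. \<forall>y\<in>X. ereal (dist x y) =
        (INF g \<in> {g. continuous_on {0..1} g \<and> g ` {0..1} \<subseteq> X \<and> g 0 = x \<and> g 1 = y}.
           path_length g 0 1))"

text \<open>Angle at the vertex opposite to side c of the model triangle in S_K with side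
  lengths a, b, c (law of cosines).\<close>
definition cmp_angle :: "real \<Rightarrow> real \<Rightarrow> real \<Rightarrow> real \<Rightarrow> real" where
  "cmp_angle K a b c =
     (if K = 0 then arccos ((a\<^sup>2 + b\<^sup>2 - c\<^sup>2) / (2 * a * b))
      else if K > 0 then
        arccos ((cos (sqrt K * c) - cos (sqrt K * a) * cos (sqrt K * b))
                / (sin (sqrt K * a) * sin (sqrt K * b)))
      else
        arccos ((cosh (sqrt (-K) * a) * cosh (sqrt (-K) * b) - cosh (sqrt (-K) * c))
                / (sinh (sqrt (-K) * a) * sinh (sqrt (-K) * b))))"

definition cmp_angle_defined :: "real \<Rightarrow> 'a::metric_space \<Rightarrow> 'a \<Rightarrow> 'a \<Rightarrow> bool" where
  "cmp_angle_defined K p x y \<longleftrightarrow> p \<noteq> x \<and> p \<noteq> y \<and>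
     (K > 0 \<longrightarrow> dist p x + dist p y + dist x y < 2 * pi / sqrt K)"

definition cmp_ang :: "real \<Rightarrow> 'a::metric_space \<Rightarrow> 'a \<Rightarrow> 'a \<Rightarrow> real" where
  "cmp_ang K p x y = cmp_angle K (dist p x) (dist p y) (dist x y)"

text \<open>Curvature bounded below by K (Alexandrov), via the (1+3)-point comparison
  (as in Alexander--Kapovitch--Petrunin), for a complete length space.\<close>
definition cbb :: "real \<Rightarrow> 'a::metric_space set \<Rightarrow> bool" where
  "cbb K X \<longleftrightarrow>
     (\<forall>p\<in>X. \<forall>x1\<in>X. \<forall>x2\<in>X. \<forall>x3\<in>X.
        cmp_angle_defined K p x1 x2 \<and> cmp_angle_defined K p x2 x3 \<and> cmp_angle_defined K p x3 x1
        \<longrightarrow> cmp_ang K p x1 x2 + cmp_ang K p x2 x3 + cmp_ang K p x3 x1 \<le> 2 * pi)"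

definition snK :: "real \<Rightarrow> real \<Rightarrow> real" where
  "snK K x = (if K = 0 then x else sin (sqrt K * x) / sqrt K)"

text \<open>In S_K (K \<ge> 0), an arc of constant geodesic curvature \<kappa> \<ge> 0 and length L lies on a
  circle of circumference 2 pi / w with w = sqrt(\<kappa>^2 + K) (so w L \<le> 2 pi), and its chord d
  satisfies sn_K(d/2) = sin(w L / 2) / w (read as L/2 if w = 0).\<close>
definition half_chord_sn :: "real \<Rightarrow> real \<Rightarrow> real \<Rightarrow> real" where
  "half_chord_sn K \<kappa> L =
     (let w = sqrt (\<kappa>\<^sup>2 + K) in if w = 0 then L / 2 else sin (w * L / 2) / w)"

definition const_curv_arc :: "real \<Rightarrow> real \<Rightarrow> real \<Rightarrow> real \<Rightarrow> bool" where
  "const_curv_arc K \<kappa> L d \<longleftrightarrow>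
     \<kappa> \<ge> 0 \<and> sqrt (\<kappa>\<^sup>2 + K) * L \<le> 2 * pi \<and> snK K (d / 2) = half_chord_sn K \<kappa> L"

definition arc_chord_curv :: "real \<Rightarrow> real \<Rightarrow> real \<Rightarrow> real" where
  "arc_chord_curv K L d = (THE \<kappa>. const_curv_arc K \<kappa> L d)"

definition arclength_param :: "(real \<Rightarrow> 'a::metric_space) \<Rightarrow> real \<Rightarrow> 'a set \<Rightarrow> bool" where
  "arclength_param \<sigma> l G \<longleftrightarrow>
     l > 0 \<and> continuous_on UNIV \<sigma> \<and> (\<forall>t. \<sigma> (t + l) = \<sigma> t) \<and> inj_on \<sigma> {0..<l} \<and>
     \<sigma> ` {0..l} = G \<and> (\<forall>a b. a \<le> b \<longrightarrow> path_length \<sigma> a b = ereal (b - a))"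

definition upper_acc :: "real \<Rightarrow> (real \<Rightarrow> 'a::metric_space) \<Rightarrow> real \<Rightarrow> real \<Rightarrow> ereal" where
  "upper_acc K \<sigma> l s =
     (INF \<delta> \<in> {0<..}. SUP p \<in> {(a, b). a \<le> s \<and> s \<le> b \<and> a < b \<and> b - a < \<delta> \<and> b - a < l \<and>
                        (K > 0 \<longrightarrow> (b - a) + dist (\<sigma> a) (\<sigma> b) \<le> 2 * pi / sqrt K)}.
        ereal (arc_chord_curv K (snd p - fst p) (dist (\<sigma> (fst p)) (\<sigma> (snd p)))))"

end

theory Submission
  imports Defs
begin

text \<open>
  Write \<open>d\<close> for the distance along the boundary parameter and compare triangles with \<open>S_K\<close>.

  Geodesics joining interlaced boundary points cross in the disc, so the curvature bound makes
  comparison angles at a boundary point superadditive: \<open>A p q r + A p r s \<le> A p q s\<close>. Hence the angles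
  between an arc and its chord exist, and their sum \<open>Th\<close> is a superadditive function of the arc. A covering argument
  turns the pointwise condition into \<open>Th I \<ge> \<kappa> |I|\<close> for all short arcs: on a set of positive measure
  where \<open>Th\<close> grows more slowly, a subarc maximizing \<open>L - k\<^sup>2 L\<^sup>3 / 24 - d\<close> gives a contradiction by first variation of
  the chord.

  A maximum principle then gives the angles at least their values in the model circle, and integrating
  the first variation bounds the chord of arcs of length at most \<open>pi / w\<close>, where \<open>w = sqrt (\<kappa>\<^sup>2 + K)\<close>.
  Longer arcs are treated through their complements, once the curve is known to have length at most
  \<open>2 pi / w\<close>. For \<open>K = 0\<close> this is \<open>Th I + Th I' \<le> 2 pi\<close> for complementary arcs. For \<open>K > 0\<close> an inscribed
  polygon is developed on the sphere as a fan of comparison triangles based on a longest chord; the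
  phase of the height above the chord advances by at least \<open>w\<close> times the length, and by at most \<open>pi\<close>.
\<close>

section \<open>Trigonometry of the model plane\<close>

text \<open>The hypothesis speaks of chords only: almost every point lies on arbitrarily short arcs
  with \<open>d \<le> L - k^2 L^3 / 24\<close>, the first two terms of the chord
  \<open>2 sin (k L / 2) / k\<close> of a circle. Such an arc need not have angle sum at least
  \<open>k L\<close> itself: turning concentrated at its middle shortens the chord more cheaply. A
  subarc of maximal excess does have large angles, but it may miss the given point; near a suitable
  point of a set of positive measure, gaps of proportional size are impossible, and so the subarc
  still meets the set. The space enters only through comparison angles of boundary points. Apart
  from the crossing argument everything is about a function \<open>d\<close> on the real line; no
  tangent directions and no geodesics are used. The number \<open>w\<close> appears because a circle
  of geodesic curvature \<open>\<kappa>\<close> in \<open>S_K\<close> has circumference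
  \<open>2 pi / w\<close>. Direct comparison of an arc with the model ends at the half circle, where
  the model chord begins to decrease. Replacing an arc by its complement requires that the whole
  curve be no longer than the model circle, which is why its length has to be bounded.\<close>

definition csK :: "real \<Rightarrow> real \<Rightarrow> real" where "csK K x = cos (sqrt K * x)"

text \<open>The antiderivative of \<open>snK\<close> vanishing at 0. With it the law of cosines
  reads \<open>md c = md a + md b - K md a md b - sn a sn b cos C\<close>, so that flat and
  spherical triangles are treated by the same polynomial identities.\<close>

definition mdK :: "real \<Rightarrow> real \<Rightarrow> real" where
  "mdK K x = (if K = 0 then x\<^sup>2 / 2 else (1 - cos (sqrt K * x)) / K)"

definition tri :: "real \<Rightarrow> real \<Rightarrow> real \<Rightarrow> real \<Rightarrow> bool" where
  "tri K a b c \<longleftrightarrow> 0 \<le> a \<and> 0 \<le> b \<and> 0 \<le> c \<and> a \<le> b + c \<and> b \<le> a + c \<and> c \<le> a + b \<and>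
     sqrt K * (a + b + c) < 2 * pi"

text \<open>At the \<open>mdK\<close> values of the sides this is
  \<open>(sn a sn b sin C)^2\<close>: four times the squared area for \<open>K = 0\<close>, and for
  \<open>K > 0\<close> the Gram determinant of the three vertices as unit vectors, divided by
  \<open>K^2\<close>. Its symmetry in the sides is the sine rule.\<close>

definition heronK :: "real \<Rightarrow> real \<Rightarrow> real \<Rightarrow> real \<Rightarrow> real" where
  "heronK K x y z = 2 * x * y + 2 * x * z + 2 * y * z - x\<^sup>2 - y\<^sup>2 - z\<^sup>2 - 2 * K * x * y * z"

lemma mdK_0 [simp]: "mdK K 0 = 0" and snK_0 [simp]: "snK K 0 = 0" and csK_0 [simp]: "csK K 0 = 1"
  by (auto simp: mdK_def snK_def csK_def)

lemma mdK_minus [simp]: "mdK K (- x) = mdK K x" and snK_minus [simp]: "snK K (- x) = - snK K x"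
  by (auto simp: mdK_def snK_def)

context
  fixes K :: real
  assumes K: "0 \<le> K"
begin

lemma csK_md: "csK K x = 1 - K * mdK K x"
  by (auto simp: csK_def mdK_def)

lemma snK_sq: "(snK K x)\<^sup>2 = 2 * mdK K x - K * (mdK K x)\<^sup>2"
proof (cases "K = 0")
  case False
  have "K * (sin (sqrt K * x))\<^sup>2 = K - K * (cos (sqrt K * x))\<^sup>2"
    by (simp add: sin_squared_eq algebra_simps)
  with K False show ?thesis
    by (simp add: snK_def mdK_def power2_eq_square field_simps)
qed (auto simp: snK_def mdK_def)

lemma mdK_add: "mdK K (a + b) = mdK K a + mdK K b - K * mdK K a * mdK K b + snK K a * snK K b"
proof (cases "K = 0")
  case False
  with K show ?thesis
    by (simp add: snK_def mdK_def cos_add algebra_simps) (simp add: field_simps)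
qed (auto simp: snK_def mdK_def power2_eq_square algebra_simps)

lemma mdK_diff: "mdK K (a - b) = mdK K a + mdK K b - K * mdK K a * mdK K b - snK K a * snK K b"
  using mdK_add[of a "- b"] by simp

lemma snK_add: "snK K (a + b) = snK K a * (1 - K * mdK K b) + snK K b * (1 - K * mdK K a)"
  using K by (auto simp: snK_def mdK_def sin_add distrib_left add_divide_distrib mult.commute)

lemma mdK_half: "mdK K x = 2 * (snK K (x / 2))\<^sup>2"
  using K cos_double_sin[of "sqrt K * (x / 2)"]
  by (auto simp: snK_def mdK_def power2_eq_square field_simps)

lemma snK_double: "snK K x = 2 * snK K (x / 2) * csK K (x / 2)"
  using K sin_double[of "sqrt K * (x / 2)"] by (auto simp: snK_def csK_def)

lemma csK_sq: "(csK K x)\<^sup>2 = 1 - K * (snK K x)\<^sup>2"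
  using K by (auto simp: csK_def snK_def cos_squared_eq power_divide)

lemma mdK_nonneg: "0 \<le> mdK K x"
  using mdK_half[of x] by simp

lemma snK_pos: "0 < x \<Longrightarrow> sqrt K * x < pi \<Longrightarrow> 0 < snK K x"
  using K by (auto simp: snK_def intro!: sin_gt_zero divide_pos_pos)

lemma snK_nonneg: "0 \<le> x \<Longrightarrow> sqrt K * x \<le> pi \<Longrightarrow> 0 \<le> snK K x"
  using K by (auto simp: snK_def intro!: sin_ge_zero divide_nonneg_nonneg)

lemma snK_le: "0 \<le> x \<Longrightarrow> snK K x \<le> x"
  using K sin_x_le_x[of "sqrt K * x"] by (auto simp: snK_def divide_simps mult.commute)

lemma csK_pos: "0 \<le> x \<Longrightarrow> sqrt K * x < pi \<Longrightarrow> 0 < csK K (x / 2)"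
  using K pi_gt_zero mult_nonneg_nonneg[of "sqrt K" x] unfolding csK_def
  by (intro cos_gt_zero_pi) (auto simp: field_simps simp del: mult_nonneg_nonneg pi_gt_zero)

lemma mdK_le_sq: "mdK K x \<le> x\<^sup>2 / 2"
proof -
  have "\<bar>snK K (x / 2)\<bar> \<le> \<bar>x / 2\<bar>"
  proof (cases "K = 0")
    case False
    then show ?thesis using K abs_sin_x_le_abs_x[of "sqrt K * (x / 2)"]
      by (simp add: snK_def abs_mult field_simps)
  qed (simp add: snK_def)
  then have "(snK K (x / 2))\<^sup>2 \<le> (x / 2)\<^sup>2" by (simp only: abs_le_square_iff)
  then show ?thesis using mdK_half[of x] by (simp add: power_divide)
qed

lemma mdK_mono: "0 \<le> x \<Longrightarrow> x \<le> y \<Longrightarrow> sqrt K * y \<le> pi \<Longrightarrow> mdK K x \<le> mdK K y"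
proof (cases "K = 0")
  case False
  assume *: "0 \<le> x" "x \<le> y" "sqrt K * y \<le> pi"
  have "cos (sqrt K * y) \<le> cos (sqrt K * x)"
    using * K by (intro cos_monotone_0_pi_le) (auto intro: mult_left_mono)
  with False K show ?thesis by (simp add: mdK_def divide_right_mono)
qed (auto simp: mdK_def intro: power_mono)

lemma mdK_strict_mono: "0 \<le> x \<Longrightarrow> x < y \<Longrightarrow> sqrt K * y \<le> pi \<Longrightarrow> mdK K x < mdK K y"
proof (cases "K = 0")
  case False
  assume *: "0 \<le> x" "x < y" "sqrt K * y \<le> pi"
  have "cos (sqrt K * y) < cos (sqrt K * x)"
    using * K False by (intro cos_monotone_0_pi) auto
  with False K show ?thesis by (simp add: mdK_def divide_strict_right_mono)
qed (auto simp: mdK_def intro: power_strict_mono)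

lemma tri_sides:
  assumes "tri K a b c" shows "sqrt K * a < pi" "sqrt K * b < pi" "sqrt K * c < pi"
proof -
  have s: "0 \<le> sqrt K" using K by simp
  have "sqrt K * (2 * a) \<le> sqrt K * (a + b + c)" "sqrt K * (2 * b) \<le> sqrt K * (a + b + c)"
    "sqrt K * (2 * c) \<le> sqrt K * (a + b + c)"
    by (rule mult_left_mono; use assms s in \<open>auto simp: tri_def\<close>)+
  then show "sqrt K * a < pi" "sqrt K * b < pi" "sqrt K * c < pi" using assms by (auto simp: tri_def)
qed

text \<open>By the addition formula these are the extreme cases of the law of cosines, angle 0 and
  angle \<open>pi\<close>; they keep the argument of \<open>arccos\<close> in
  \<open>[-1, 1]\<close>.\<close>

lemma tri_md_bounds:
  assumes "tri K a b c"
  shows "mdK K (a - b) \<le> mdK K c" "mdK K c \<le> mdK K (a + b)"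
proof -
  note s = tri_sides[OF assms]
  have "mdK K \<bar>a - b\<bar> \<le> mdK K c"
    using assms s by (intro mdK_mono) (auto simp: tri_def)
  moreover have "mdK K \<bar>a - b\<bar> = mdK K (a - b)"
    using mdK_minus[of K "a - b"] by (simp only: abs_real_def minus_diff_eq split: if_split) auto
  ultimately show "mdK K (a - b) \<le> mdK K c" by simp
  show "mdK K c \<le> mdK K (a + b)"
  proof (cases "sqrt K * (a + b) \<le> pi")
    case True
    then show ?thesis using assms by (intro mdK_mono) (auto simp: tri_def)
  next
    case False
    then have K0: "K \<noteq> 0" by auto
    \<comment> \<open>Beyond \<open>pi / sqrt K\<close> the function \<open>md\<close> decreases, so
      \<open>c \<le> a + b\<close> is of no use; the perimeter bound
      \<open>c < 2 pi / sqrt K - (a + b)\<close> takes its place.\<close>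
    have "cos (2 * pi - sqrt K * (a + b)) \<le> cos (sqrt K * c)"
      using False assms K by (intro cos_monotone_0_pi_le) (auto simp: tri_def algebra_simps)
    then show ?thesis using K0 K by (simp add: mdK_def divide_right_mono cos_2pi_minus)
  qed
qed

lemma cmp_angle_eq:
  "cmp_angle K a b c = arccos ((mdK K a + mdK K b - K * mdK K a * mdK K b - mdK K c) / (snK K a * snK K b))"
proof (cases "K = 0")
  case True then show ?thesis
    by (simp add: cmp_angle_def mdK_def snK_def flip: add_divide_distrib diff_divide_distrib)
      (simp add: mult.assoc)
next
  case False
  have "mdK K a + mdK K b - K * mdK K a * mdK K b - mdK K c
      = (cos (sqrt K * c) - cos (sqrt K * a) * cos (sqrt K * b)) / K"
    using False by (simp add: mdK_def field_simps)
  moreover have "snK K a * snK K b = (sin (sqrt K * a) * sin (sqrt K * b)) / K"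
    using False K by (simp add: snK_def)
  ultimately show ?thesis using False K by (simp add: cmp_angle_def)
qed

lemma cmp_angle_commute: "cmp_angle K a b c = cmp_angle K b a c"
  by (simp add: cmp_angle_eq algebra_simps)

lemma cos_cmp_angle:
  assumes "tri K a b c" "0 < a" "0 < b"
  shows "snK K a * snK K b * cos (cmp_angle K a b c) = mdK K a + mdK K b - K * mdK K a * mdK K b - mdK K c"
    and "0 \<le> cmp_angle K a b c" "cmp_angle K a b c \<le> pi"
proof -
  note s = tri_sides[OF assms(1)]
  have p: "0 < snK K a * snK K b" using s assms by (simp add: snK_pos)
  let ?q = "(mdK K a + mdK K b - K * mdK K a * mdK K b - mdK K c) / (snK K a * snK K b)"
  have "-1 \<le> ?q" "?q \<le> 1"
    using tri_md_bounds[OF assms(1)] p mdK_add[of a b] mdK_diff[of a b] by (auto simp: divide_simps)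
  then show "snK K a * snK K b * cos (cmp_angle K a b c) = mdK K a + mdK K b - K * mdK K a * mdK K b - mdK K c"
    and "0 \<le> cmp_angle K a b c" "cmp_angle K a b c \<le> pi"
    using p by (auto simp: cmp_angle_eq arccos_lbound arccos_ubound)
qed

lemma heron_sin:
  assumes "tri K a b c" "0 < a" "0 < b"
  shows "snK K a * snK K b * sin (cmp_angle K a b c) = sqrt (heronK K (mdK K a) (mdK K b) (mdK K c))"
    and "0 \<le> heronK K (mdK K a) (mdK K b) (mdK K c)"
proof -
  note s = tri_sides[OF assms(1)] and c = cos_cmp_angle[OF assms]
  have p: "0 < snK K a * snK K b" using s assms by (simp add: snK_pos)
  let ?t = "cmp_angle K a b c"
  have "(snK K a * snK K b * sin ?t)\<^sup>2 = (snK K a)\<^sup>2 * (snK K b)\<^sup>2 - (snK K a * snK K b * cos ?t)\<^sup>2"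
    by (simp add: power_mult_distrib sin_squared_eq algebra_simps)
  also have "\<dots> = heronK K (mdK K a) (mdK K b) (mdK K c)"
    unfolding c(1) snK_sq heronK_def by (simp add: power2_eq_square algebra_simps)
  finally have *: "(snK K a * snK K b * sin ?t)\<^sup>2 = heronK K (mdK K a) (mdK K b) (mdK K c)" .
  have "0 \<le> snK K a * snK K b * sin ?t" using p c by (simp add: sin_ge_zero)
  with * show "snK K a * snK K b * sin ?t = sqrt (heronK K (mdK K a) (mdK K b) (mdK K c))"
    by (metis real_sqrt_abs abs_of_nonneg)
  show "0 \<le> heronK K (mdK K a) (mdK K b) (mdK K c)" using * by (metis zero_le_power2)
qed

lemma heronK_commute: "heronK K x y z = heronK K y x z" "heronK K x y z = heronK K x z y"
  by (auto simp: heronK_def)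

lemma tri_perm: "tri K a b c = tri K b a c" "tri K a b c = tri K a c b"
  by (auto simp: tri_def algebra_simps)

lemma sine_rule:
  assumes "tri K a b c" "0 < a" "0 < b" "0 < c"
  shows "snK K b * sin (cmp_angle K a b c) = snK K c * sin (cmp_angle K a c b)"
proof -
  have "snK K a * snK K b * sin (cmp_angle K a b c) = snK K a * snK K c * sin (cmp_angle K a c b)"
    using heron_sin(1)[of a b c] heron_sin(1)[of a c b] assms tri_perm(2)[of a b c]
    by (simp add: heronK_commute(2)[of "mdK K a" "mdK K b"])
  moreover have "0 < snK K a" using assms tri_sides[OF assms(1)] by (simp add: snK_pos)
  ultimately show ?thesis by simp
qed

text \<open>With \<open>A\<close>, \<open>B\<close>, \<open>C\<close> the angles and \<open>x\<close>, \<open>y\<close>, \<open>z\<close> the values of \<^term>\<open>mdK K\<close> at the opposite sides,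
  \<open>sin A sin B - cos A cos B - cos C\<close> is a positive multiple of \<open>K z\<close> times the Heron term.\<close>
lemma cmp_angle_sum:
  assumes t: "tri K a b c" and pos: "0 < a" "0 < b" "0 < c"
  shows "pi \<le> cmp_angle K b c a + cmp_angle K a c b + cmp_angle K a b c"
proof -
  define x y z where "x = mdK K a" and "y = mdK K b" and "z = mdK K c"
  define A B C where "A = cmp_angle K b c a" and "B = cmp_angle K a c b" and "C = cmp_angle K a b c"
  have t': "tri K b c a" "tri K a c b" using t by (auto simp: tri_def algebra_simps)
  note s = tri_sides[OF t]
  have p: "0 < snK K a" "0 < snK K b" "0 < snK K c" using s pos by (auto simp: snK_pos)
  define H where "H = heronK K x y z"
  have H: "H \<ge> 0" using heron_sin(2)[OF t] pos by (simp add: H_def x_def y_def z_def)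
  have cA: "snK K b * snK K c * cos A = y + z - K * y * z - x"
    and cB: "snK K a * snK K c * cos B = x + z - K * x * z - y"
    and cC: "snK K a * snK K b * cos C = x + y - K * x * y - z"
    using cos_cmp_angle(1)[OF t'(1)] cos_cmp_angle(1)[OF t'(2)] cos_cmp_angle(1)[OF t] pos
    by (auto simp: A_def B_def C_def x_def y_def z_def)
  have sA: "snK K b * snK K c * sin A = sqrt H" and sB: "snK K a * snK K c * sin B = sqrt H"
    using heron_sin(1)[OF t'(1)] heron_sin(1)[OF t'(2)] pos
    unfolding A_def B_def H_def x_def y_def z_def heronK_def by (simp_all add: algebra_simps)
  have bnd: "0 \<le> A" "A \<le> pi" "0 \<le> B" "B \<le> pi" "0 \<le> C" "C \<le> pi"
    using cos_cmp_angle[OF t'(1)] cos_cmp_angle[OF t'(2)] cos_cmp_angle[OF t] pos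
    by (auto simp: A_def B_def C_def)
  let ?P = "snK K a * snK K b * (snK K c)\<^sup>2"
  have P: "?P > 0" using p by simp
  have "?P * (sin A * sin B) = (snK K b * snK K c * sin A) * (snK K a * snK K c * sin B)"
    by (simp add: power2_eq_square)
  also have "\<dots> = H" using H by (simp add: sA sB)
  finally have 1: "?P * (sin A * sin B) = H" .
  have "?P * (cos A * cos B) = (snK K b * snK K c * cos A) * (snK K a * snK K c * cos B)"
    by (simp add: power2_eq_square)
  then have 2: "?P * (cos A * cos B) = (y + z - K * y * z - x) * (x + z - K * x * z - y)"
    by (simp add: cA cB)
  have "?P * cos C = (snK K a * snK K b * cos C) * (snK K c)\<^sup>2" by simp
  then have 3: "?P * cos C = (x + y - K * x * y - z) * (2 * z - K * z\<^sup>2)"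
    by (simp add: cC snK_sq z_def)
  have "?P * (sin A * sin B - cos A * cos B - cos C) = K * z * H"
    unfolding right_diff_distrib 1 2 3 by (simp add: H_def heronK_def power2_eq_square algebra_simps)
  moreover have "0 \<le> K * z * H" using K H mdK_nonneg[of c] by (simp add: z_def)
  ultimately have "0 \<le> sin A * sin B - cos A * cos B - cos C" using P by (metis mult_less_0_iff not_less order_less_imp_not_less)
  then have *: "cos C \<le> cos (pi - (A + B))" by (simp add: cos_add)
  show ?thesis
  proof (rule ccontr)
    assume "\<not> ?thesis"
    then have lt: "C < pi - (A + B)" by (simp add: A_def B_def C_def)
    have "cos (pi - (A + B)) < cos C" using bnd lt by (intro cos_monotone_0_pi) auto
    with * show False by simp
  qed
qed

end

context
  fixes K :: real
  assumes K: "0 \<le> K"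
begin

lemma continuous_mdK: "continuous_on UNIV (mdK K)"
  unfolding mdK_def by (cases "K = 0") (auto intro!: continuous_intros)

lemma continuous_snK: "continuous_on UNIV (snK K)"
  unfolding snK_def by (cases "K = 0") (use K in \<open>auto intro!: continuous_intros\<close>)

lemma cmp_angle_unique:
  assumes t: "tri K a b c" and pos: "0 < a" "0 < b" and th: "0 \<le> th" "th \<le> pi"
    and c: "mdK K c = mdK K a + mdK K b - K * mdK K a * mdK K b - snK K a * snK K b * cos th"
  shows "cmp_angle K a b c = th"
proof -
  have p: "0 < snK K a" "0 < snK K b" using tri_sides[OF K t] pos by (auto simp: snK_pos[OF K])
  have "snK K a * snK K b * cos (cmp_angle K a b c) = snK K a * snK K b * cos th"
    using cos_cmp_angle(1)[OF K t pos] c by simp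
  then have "cos (cmp_angle K a b c) = cos th" using p by simp
  then show ?thesis using cos_cmp_angle(2,3)[OF K t pos] th by (simp add: cos_inj_pi)
qed

lemma cmp_angle_straight:
  assumes "0 < a" "0 < b" "sqrt K * (a + b) < pi"
  shows "cmp_angle K a b (a + b) = pi"
proof -
  have t: "tri K a b (a + b)" using assms by (auto simp: tri_def algebra_simps)
  show ?thesis by (rule cmp_angle_unique[OF t]) (use assms mdK_add[OF K, of a b] in auto)
qed

lemma cmp_angle_zero:
  assumes "0 < a" "a \<le> b" "sqrt K * b < pi"
  shows "cmp_angle K a b (b - a) = 0"
proof -
  have t: "tri K a b (b - a)" using assms by (auto simp: tri_def algebra_simps)
  show ?thesis by (rule cmp_angle_unique[OF t]) (use assms mdK_diff[OF K, of b a] in \<open>auto simp: algebra_simps\<close>)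
qed

text \<open>The left-hand side is the value of \<^term>\<open>mdK K\<close> at the distance of the far vertices of two model triangles
  glued along the common side \<open>m\<close>.\<close>
lemma hinge_le:
  assumes t1: "tri K A m b1" and t2: "tri K m B b2" and pos: "0 < A" "0 < m" "0 < B"
  shows "mdK K A + mdK K B - K * mdK K A * mdK K B
      - snK K A * snK K B * cos (cmp_angle K A m b1 + cmp_angle K m B b2) \<le> mdK K (b1 + b2)"
proof -
  define x y u v M where "x = mdK K A" and "y = mdK K B" and "u = mdK K b1" and "v = mdK K b2"
    and "M = mdK K m"
  let ?s = snK and ?th1 = "cmp_angle K A m b1" and ?th2 = "cmp_angle K m B b2"
  note s1 = tri_sides[OF K t1] and s2 = tri_sides[OF K t2]
  define G1 G2 where "G1 = heronK K x M u" and "G2 = heronK K M y v"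
  have G: "G1 \<ge> 0" "G2 \<ge> 0"
    using heron_sin(2)[OF K t1] heron_sin(2)[OF K t2] pos
    by (auto simp: G1_def G2_def x_def y_def u_def v_def M_def)
  have c1: "snK K A * snK K m * cos ?th1 = x + M - K * x * M - u"
    and c2: "snK K m * snK K B * cos ?th2 = M + y - K * M * y - v"
    using cos_cmp_angle(1)[OF K t1] cos_cmp_angle(1)[OF K t2] pos
    by (auto simp: x_def y_def u_def v_def M_def)
  have h1: "snK K A * snK K m * sin ?th1 = sqrt G1" and h2: "snK K m * snK K B * sin ?th2 = sqrt G2"
    using heron_sin(1)[OF K t1] heron_sin(1)[OF K t2] pos
    by (auto simp: G1_def G2_def x_def y_def u_def v_def M_def)
  have mm: "(snK K m)\<^sup>2 = 2 * M - K * M\<^sup>2" by (simp add: snK_sq[OF K] M_def)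
  have mpos: "0 < (snK K m)\<^sup>2" using snK_pos[OF K pos(2) s1(2)] by simp
  have e1: "(snK K m)\<^sup>2 * (snK K A * snK K B * cos (?th1 + ?th2))
      = (x + M - K * x * M - u) * (M + y - K * M * y - v) - sqrt G1 * sqrt G2"
    unfolding c1[symmetric] c2[symmetric] h1[symmetric] h2[symmetric] cos_add
    by (simp add: power2_eq_square algebra_simps)
  \<comment> \<open>These are \<open>sn m sn b1\<close> and \<open>sn m sn b2\<close> times the
    cosines of the angles at the other end of \<open>m\<close>, while \<open>sqrt G1\<close> and
    \<open>sqrt G2\<close> are the same products with the sines. The claim thus becomes the
    Cauchy-Schwarz inequality for \<open>(- W1, sqrt G1)\<close> and
    \<open>(W2, sqrt G2)\<close>.\<close>
  define W1 W2 where "W1 = u + M - K * u * M - x" and "W2 = v + M - K * v * M - y"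
  have id: "(2 * M - K * M\<^sup>2) * (x + y - K * x * y) - (x + M - K * x * M - u) * (M + y - K * M * y - v)
      = (2 * M - K * M\<^sup>2) * (u + v - K * u * v) - W1 * W2"
    unfolding W1_def W2_def by (simp add: power2_eq_square algebra_simps)
  have q1: "W1\<^sup>2 + G1 = (snK K m)\<^sup>2 * (snK K b1)\<^sup>2" and q2: "W2\<^sup>2 + G2 = (snK K m)\<^sup>2 * (snK K b2)\<^sup>2"
    unfolding mm snK_sq[OF K] W1_def W2_def G1_def G2_def heronK_def u_def[symmetric] v_def[symmetric] M_def[symmetric]
    by (simp_all add: power2_eq_square algebra_simps)
  have b: "0 \<le> snK K b1" "0 \<le> snK K b2" "0 < snK K m"
    using s1 s2 t1 t2 pos by (auto simp: tri_def intro!: snK_nonneg[OF K] snK_pos[OF K])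
  have "- (W1 * W2) + sqrt G1 * sqrt G2 \<le> sqrt (W1\<^sup>2 + (sqrt G1)\<^sup>2) * sqrt (W2\<^sup>2 + (sqrt G2)\<^sup>2)"
  proof (rule order_trans[OF abs_ge_self], rule power2_le_imp_le)
    show "\<bar>- (W1 * W2) + sqrt G1 * sqrt G2\<bar>\<^sup>2 \<le> (sqrt (W1\<^sup>2 + (sqrt G1)\<^sup>2) * sqrt (W2\<^sup>2 + (sqrt G2)\<^sup>2))\<^sup>2"
    proof -
      have "(sqrt (W1\<^sup>2 + (sqrt G1)\<^sup>2) * sqrt (W2\<^sup>2 + (sqrt G2)\<^sup>2))\<^sup>2 - (- (W1 * W2) + sqrt G1 * sqrt G2)\<^sup>2
          = (W1 * sqrt G2 + W2 * sqrt G1)\<^sup>2"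
        by (simp add: power_mult_distrib) (simp add: power2_eq_square algebra_simps)
      then show ?thesis by (simp only: power2_abs) (metis diff_ge_0_iff_ge zero_le_power2)
    qed
  qed simp
  also have "\<dots> = (snK K m)\<^sup>2 * (snK K b1 * snK K b2)"
    using G b by (simp add: q1 q2 real_sqrt_mult) (simp add: power2_eq_square)
  finally have 3: "- (W1 * W2) + sqrt G1 * sqrt G2 \<le> (snK K m)\<^sup>2 * (snK K b1 * snK K b2)" .
  have "(snK K m)\<^sup>2 * (x + y - K * x * y - snK K A * snK K B * cos (?th1 + ?th2))
      = (snK K m)\<^sup>2 * (u + v - K * u * v) - W1 * W2 + sqrt G1 * sqrt G2"
    using e1 id unfolding mm by (simp add: algebra_simps)
  also have "\<dots> \<le> (snK K m)\<^sup>2 * (u + v - K * u * v + snK K b1 * snK K b2)"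
    using 3 by (simp add: algebra_simps)
  finally have "x + y - K * x * y - snK K A * snK K B * cos (?th1 + ?th2) \<le> u + v - K * u * v + snK K b1 * snK K b2"
    using mult_le_cancel_left_pos[OF mpos] by blast
  then show ?thesis by (simp add: mdK_add[OF K] x_def y_def u_def v_def)
qed

text \<open>Gluing along \<open>m\<close> produces far vertices at distance at most
  \<open>b1 + b2\<close>; straightening the broken side to this length can only open the angle. This
  comparison of cosines requires that the two angles add up to at most \<open>pi\<close>, which is
  shown first.\<close>

lemma cmp_angle_glue:
  assumes t1: "tri K A m b1" and t2: "tri K m B b2" and t: "tri K A B (b1 + b2)"
    and pos: "0 < A" "0 < m" "0 < B"
  shows "cmp_angle K A m b1 + cmp_angle K m B b2 \<le> cmp_angle K A B (b1 + b2)"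
proof -
  let ?th1 = "cmp_angle K A m b1" and ?th2 = "cmp_angle K m B b2"
  note a1 = cos_cmp_angle[OF K t1] and a2 = cos_cmp_angle[OF K t2] and a = cos_cmp_angle[OF K t]
  note s = tri_sides[OF K t] and s1 = tri_sides[OF K t1] and s2 = tri_sides[OF K t2]
  have p: "0 < snK K A * snK K B" using s pos by (simp add: snK_pos[OF K])
  have p2: "0 < snK K m * snK K B" using s2 pos by (simp add: snK_pos[OF K])
  have le: "?th1 + ?th2 \<le> pi"
  proof (rule ccontr)
    assume "\<not> ?thesis"
    then have gt: "pi - ?th1 < ?th2" by simp
    let ?th = "pi - ?th1"
    have th: "0 \<le> ?th" "?th \<le> pi" using a1 pos by auto
    \<comment> \<open>\<open>V\<close> is the value of \<open>md\<close> at the third side when the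
      angle is exactly \<open>pi - th1\<close>. A side \<open>c < b2\<close> realizing it makes the
      outer sides \<open>A\<close> and \<open>B\<close> collinear, so \<open>A + B\<close> would be
      bounded through \<open>b1 + c\<close>, against the triangle with sides \<open>A\<close>,
      \<open>B\<close>, \<open>b1 + b2\<close>.\<close>
    define V where "V = mdK K m + mdK K B - K * mdK K m * mdK K B - snK K m * snK K B * cos ?th"
    have "cos ?th2 < cos ?th" using gt th a2 pos by (intro cos_monotone_0_pi) auto
    then have "snK K m * snK K B * cos ?th2 < snK K m * snK K B * cos ?th" by (rule mult_strict_left_mono[OF _ p2])
    then have Vlt: "V < mdK K b2" using a2(1) pos by (simp add: V_def)
    have "snK K m * snK K B * cos ?th \<le> snK K m * snK K B * 1" using p2 by (intro mult_left_mono) auto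
    then have Vge: "mdK K \<bar>m - B\<bar> \<le> V"
      using mdK_diff[OF K, of m B] mdK_minus[of K "m - B"] by (auto simp: V_def abs_real_def)
    have mb: "\<bar>m - B\<bar> \<le> b2" using t2 by (auto simp: tri_def)
    obtain c where c: "\<bar>m - B\<bar> \<le> c" "c \<le> b2" "mdK K c = V"
      using IVT'[of "mdK K" "\<bar>m - B\<bar>" V b2] Vge Vlt mb continuous_on_subset[OF continuous_mdK] by auto
    have cb: "c < b2" using c Vlt by (cases "c = b2") auto
    have tc: "tri K m B c"
    proof -
      have "sqrt K * (m + B + c) \<le> sqrt K * (m + B + b2)" using K c by (intro mult_left_mono) auto
      then show ?thesis using c cb t2 by (auto simp: tri_def)
    qed
    have "cmp_angle K m B c = ?th" by (rule cmp_angle_unique[OF tc]) (use pos th c V_def in auto)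
    then have "mdK K A + mdK K B - K * mdK K A * mdK K B + snK K A * snK K B \<le> mdK K (b1 + c)"
      using hinge_le[OF t1 tc pos] by simp
    then have "mdK K (A + B) \<le> mdK K (b1 + c)" by (simp add: mdK_add[OF K])
    also have "\<dots> < mdK K (b1 + b2)"
      using cb s t1 c by (intro mdK_strict_mono[OF K]) (auto simp: tri_def)
    also have "\<dots> \<le> mdK K (A + B)" using tri_md_bounds(2)[OF K t] .
    finally show False by simp
  qed
  have "snK K A * snK K B * cos (cmp_angle K A B (b1 + b2)) \<le> snK K A * snK K B * cos (?th1 + ?th2)"
    using hinge_le[OF t1 t2 pos] a(1) pos by simp
  then have "cos (cmp_angle K A B (b1 + b2)) \<le> cos (?th1 + ?th2)"
    using mult_le_cancel_left_pos[OF p] by blast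
  then show ?thesis using le a a1 a2 pos by (subst (asm) cos_mono_le_eq) auto
qed

text \<open>Alexandrov's lemma: the cevian \<open>m\<close> meets the side \<open>a1 + a2\<close>.
  If the angles at its foot leave room, straightening the broken line \<open>a1\<close>,
  \<open>a2\<close> to one side decreases the angle between \<open>y\<close> and that side.\<close>

lemma cmp_angle_cevian:
  assumes t1: "tri K a1 m y" and t2: "tri K a2 m c" and t: "tri K y (a1 + a2) c"
    and pos: "0 < a1" "0 < a2" "0 < m" "0 < y"
    and sum: "cmp_angle K a1 m y + cmp_angle K a2 m c \<le> pi"
  shows "cmp_angle K y (a1 + a2) c \<le> cmp_angle K y a1 m"
proof -
  have t3: "tri K y a1 m" using t1 by (auto simp: tri_def algebra_simps)
  note s1 = tri_sides[OF K t1] and s2 = tri_sides[OF K t2] and s = tri_sides[OF K t]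
  note p = snK_pos[OF K pos(1) s1(1)] snK_pos[OF K pos(2) s2(1)] snK_pos[OF K pos(3) s1(2)]
    snK_pos[OF K pos(4) s1(3)]
  have pa: "0 < snK K (a1 + a2)" using pos s(2) by (intro snK_pos[OF K]) auto
  note c1 = cos_cmp_angle[OF K t1] and c2 = cos_cmp_angle[OF K t2] and c3 = cos_cmp_angle[OF K t]
    and c4 = cos_cmp_angle[OF K t3]
  let ?al = "cmp_angle K a1 m y" and ?be = "cmp_angle K a2 m c"
  define D1 D2 M Y C where "D1 = mdK K a1" and "D2 = mdK K a2" and "M = mdK K m" and "Y = mdK K y" and "C = mdK K c"
  define S1 S2 where "S1 = snK K a1" and "S2 = snK K a2"
  have "cos (pi - ?al) \<le> cos ?be" using sum c1 c2 pos by (intro cos_monotone_0_pi_le) auto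
  then have "0 \<le> cos ?al + cos ?be" by simp
  then have "0 \<le> S1 * S2 * snK K m * (cos ?al + cos ?be)" using p by (simp add: S1_def S2_def)
  also have "\<dots> = S2 * (S1 * snK K m * cos ?al) + S1 * (S2 * snK K m * cos ?be)" by (simp add: algebra_simps)
  also have "\<dots> = S2 * (D1 + M - K * D1 * M - Y) + S1 * (D2 + M - K * D2 * M - C)"
    using c1(1) c2(1) pos by (simp add: D1_def D2_def M_def Y_def C_def S1_def S2_def)
  finally have key: "0 \<le> S2 * (D1 + M - K * D1 * M - Y) + S1 * (D2 + M - K * D2 * M - C)" .
  have sa: "snK K (a1 + a2) = S1 * (1 - K * D2) + S2 * (1 - K * D1)"
    and da: "mdK K (a1 + a2) = D1 + D2 - K * D1 * D2 + S1 * S2"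
    by (simp_all add: snK_add[OF K] mdK_add[OF K] S1_def S2_def D1_def D2_def)
  have sq: "S1 * S1 = 2 * D1 - K * D1 * D1" "S2 * S2 = 2 * D2 - K * D2 * D2"
    using snK_sq[OF K, of a1] snK_sq[OF K, of a2] by (simp_all add: S1_def S2_def D1_def D2_def power2_eq_square)
  \<comment> \<open>After denominators are cleared, the difference of the two cosines at the vertex
    is the weighted sum of the cosines at the foot in \<open>key\<close>, up to a term that vanishes
    by the relation between \<open>sn\<close> and \<open>md\<close>.\<close>
  have "S1 * (Y + mdK K (a1 + a2) - K * Y * mdK K (a1 + a2) - C) - snK K (a1 + a2) * (Y + D1 - K * Y * D1 - M)
      = S2 * (D1 + M - K * D1 * M - Y) + S1 * (D2 + M - K * D2 * M - C)
        + S2 * (S1 * S1 - (2 * D1 - K * D1 * D1)) * (1 - K * Y)"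
    unfolding sa da by (simp add: algebra_simps)
  then have "snK K (a1 + a2) * (Y + D1 - K * Y * D1 - M) \<le> S1 * (Y + mdK K (a1 + a2) - K * Y * mdK K (a1 + a2) - C)"
    using key sq by simp
  then have "snK K (a1 + a2) * (snK K y * S1 * cos (cmp_angle K y a1 m))
      \<le> S1 * (snK K y * snK K (a1 + a2) * cos (cmp_angle K y (a1 + a2) c))"
    using c3(1) c4(1) pos by (simp add: D1_def M_def Y_def C_def S1_def)
  then have "(snK K (a1 + a2) * snK K y * S1) * cos (cmp_angle K y a1 m)
      \<le> (snK K (a1 + a2) * snK K y * S1) * cos (cmp_angle K y (a1 + a2) c)" by (simp add: algebra_simps)
  moreover have "0 < snK K (a1 + a2) * snK K y * S1" using p pa by (simp add: S1_def)
  ultimately have "cos (cmp_angle K y a1 m) \<le> cos (cmp_angle K y (a1 + a2) c)" by (metis mult_le_cancel_left_pos)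
  then show ?thesis using c3 c4 pos by (subst (asm) cos_mono_le_eq) auto
qed

section \<open>Comparison angles at the ends of crossing geodesics\<close>

lemma tri_dist:
  fixes p q r :: "'a::metric_space"
  assumes "sqrt K * (dist p q + dist q r + dist p r) < 2 * pi"
  shows "tri K (dist p q) (dist p r) (dist q r)"
  using assms dist_triangle[of p q r] dist_triangle[of p r q] dist_triangle[of q r p]
  by (auto simp: tri_def dist_commute algebra_simps)

lemma cmp_angle_definedI:
  assumes "p \<noteq> x" "p \<noteq> y" "sqrt K * (dist p x + dist x y + dist p y) < 2 * pi"
  shows "cmp_angle_defined K p x y"
  using assms K by (auto simp: cmp_angle_defined_def field_simps)

text \<open>In the four-point condition at \<open>x\<close> the comparison angle between
  \<open>p\<close> and \<open>r\<close> equals \<open>pi\<close>, because \<open>x\<close> lies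
  between them; the other two share the remaining \<open>pi\<close>.\<close>

lemma cbb_between:
  fixes p :: "'a::metric_space"
  assumes cbb: "cbb K X" and X: "x \<in> X" "p \<in> X" "q \<in> X" "r \<in> X"
    and bt: "dist p x + dist x r = dist p r" and ne: "x \<noteq> p" "x \<noteq> q" "x \<noteq> r"
    and per: "sqrt K * (dist p q + dist q r + dist p r) < 2 * pi"
  shows "cmp_ang K x p q + cmp_ang K x r q \<le> pi"
proof -
  have s: "0 \<le> sqrt K" using K by simp
  have "sqrt K * (dist x p + dist p q + dist x q) \<le> sqrt K * (dist p q + dist q r + dist p r)"
    "sqrt K * (dist x q + dist q r + dist x r) \<le> sqrt K * (dist p q + dist q r + dist p r)"
    "sqrt K * (dist x r + dist r p + dist x p) \<le> sqrt K * (dist p q + dist q r + dist p r)"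
    using dist_triangle[of x q r] dist_triangle[of x q p] dist_triangle[of p r q] bt
    by (auto intro!: mult_left_mono[OF _ s] simp: dist_commute)
  then have "cmp_angle_defined K x p q" "cmp_angle_defined K x q r" "cmp_angle_defined K x r p"
    using per ne by (auto intro!: cmp_angle_definedI)
  then have le: "cmp_ang K x p q + cmp_ang K x q r + cmp_ang K x r p \<le> 2 * pi"
    using cbb X unfolding cbb_def by blast
  have "sqrt K * (2 * dist p r) \<le> sqrt K * (dist p q + dist q r + dist p r)"
    using dist_triangle[of p r q] by (intro mult_left_mono[OF _ s]) simp
  then have "cmp_angle K (dist p x) (dist x r) (dist p x + dist x r) = pi"
    using ne per bt by (intro cmp_angle_straight) auto
  then have "cmp_ang K x r p = pi"
    using bt by (simp add: cmp_ang_def dist_commute cmp_angle_commute[OF K, of "dist p x"])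
  then show ?thesis using le by (simp add: cmp_ang_def dist_commute cmp_angle_commute[OF K])
qed

text \<open>Monotonicity of comparison angles: \<open>cbb_between\<close> supplies the angle
  condition at \<open>x\<close> under which Alexandrov's lemma applies.\<close>

lemma cbb_between_angle:
  fixes p :: "'a::metric_space"
  assumes cbb: "cbb K X" and X: "x \<in> X" "p \<in> X" "q \<in> X" "r \<in> X"
    and bt: "dist p x + dist x r = dist p r" and ne: "x \<noteq> p" "p \<noteq> q"
    and per: "sqrt K * (dist p q + dist q r + dist p r) < 2 * pi"
  shows "cmp_ang K p q r \<le> cmp_ang K p q x"
proof (cases "x = r")
  case False
  have s: "0 \<le> sqrt K" using K by simp
  have t: "tri K (dist p q) (dist p r) (dist q r)" using per by (rule tri_dist)
  have per1: "sqrt K * (dist x p + dist p q + dist x q) \<le> sqrt K * (dist p q + dist q r + dist p r)"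
    and per2: "sqrt K * (dist x r + dist r q + dist x q) \<le> sqrt K * (dist p q + dist q r + dist p r)"
    using dist_triangle[of x q r] dist_triangle[of x q p] dist_triangle[of p r q] bt
    by (auto intro!: mult_left_mono[OF _ s] simp: dist_commute)
  have t1: "tri K (dist x p) (dist x q) (dist p q)" "tri K (dist x r) (dist x q) (dist r q)"
    using per per1 per2 by (auto intro!: tri_dist)
  show ?thesis
  proof (cases "x = q")
    case True
    have "cmp_angle K (dist p q) (dist p r) (dist p r - dist p q) = 0"
      using True bt ne tri_sides[OF K t] zero_le_dist[of q r] by (intro cmp_angle_zero) (auto simp: dist_commute simp del: zero_le_dist)
    moreover have "dist q r = dist p r - dist p q" using True bt by (simp add: dist_commute)
    ultimately have "cmp_ang K p q r = 0" by (simp add: cmp_ang_def)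
    moreover have "tri K (dist p q) (dist p q) 0" using t1 True by (auto simp: tri_def dist_commute algebra_simps)
    then have "0 \<le> cmp_ang K p q x" using True ne cos_cmp_angle(2)[OF K, of "dist p q" "dist p q" 0]
      by (simp add: cmp_ang_def)
    ultimately show ?thesis by simp
  next
    case xq: False
    have sum: "cmp_angle K (dist x p) (dist x q) (dist p q) + cmp_angle K (dist x r) (dist x q) (dist r q) \<le> pi"
      using cbb_between[OF cbb X bt ne(1) xq False per] by (simp add: cmp_ang_def)
    have t': "tri K (dist p q) (dist x p + dist x r) (dist r q)" using t bt by (simp add: dist_commute)
    have pos: "0 < dist x p" "0 < dist x r" "0 < dist x q" "0 < dist p q" using xq ne False by auto
    have "cmp_angle K (dist p q) (dist x p + dist x r) (dist r q) \<le> cmp_angle K (dist p q) (dist x p) (dist x q)"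
      by (rule cmp_angle_cevian[OF t1 t' pos sum])
    then show ?thesis using bt by (simp add: cmp_ang_def dist_commute)
  qed
qed simp

text \<open>The point \<open>x\<close> lies on both geodesics. Replacing \<open>r\<close> by the
  nearer point \<open>x\<close> on the geodesic from \<open>p\<close> does not decrease the two
  left-hand angles; the resulting triangles share the side from \<open>p\<close> to \<open>x\<close>
  and have collinear opposite sides, so they can be glued.\<close>

lemma cbb_crossing:
  fixes p :: "'a::metric_space"
  assumes cbb: "cbb K X" and X: "x \<in> X" "p \<in> X" "q \<in> X" "r \<in> X" "s \<in> X"
    and bt: "dist p x + dist x r = dist p r" "dist q x + dist x s = dist q s"
    and ne: "p \<noteq> q" "p \<noteq> r" "p \<noteq> s"
    and per: "sqrt K * (dist p q + dist q r + dist p r) < 2 * pi"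
      "sqrt K * (dist p s + dist s r + dist p r) < 2 * pi"
      "sqrt K * (dist p q + dist q s + dist p s) < 2 * pi"
  shows "cmp_ang K p q r + cmp_ang K p r s \<le> cmp_ang K p q s"
proof (cases "x = p")
  case True
  \<comment> \<open>Now \<open>p\<close> itself lies between \<open>q\<close> and \<open>s\<close>,
    its angle is \<open>pi\<close>, and the four-point condition at \<open>p\<close> is the whole
    claim.\<close>
  have "cmp_angle_defined K p q r" "cmp_angle_defined K p r s" "cmp_angle_defined K p s q"
    using per ne by (auto intro!: cmp_angle_definedI simp: dist_commute add_ac)
  then have le: "cmp_ang K p q r + cmp_ang K p r s + cmp_ang K p s q \<le> 2 * pi"
    using cbb X unfolding cbb_def by blast
  have t: "tri K (dist p q) (dist p s) (dist q s)" using per by (intro tri_dist) auto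
  have "cmp_angle K (dist p q) (dist p s) (dist p q + dist p s) = pi"
    using ne tri_sides(3)[OF K t] bt True by (intro cmp_angle_straight) (auto simp: dist_commute)
  then have "cmp_ang K p q s = pi" using bt True by (simp add: cmp_ang_def dist_commute)
  moreover have "cmp_ang K p s q = cmp_ang K p q s"
    by (simp add: cmp_ang_def dist_commute cmp_angle_commute[OF K])
  ultimately show ?thesis using le by simp
next
  case False
  have s0: "0 \<le> sqrt K" using K by simp
  have 1: "cmp_ang K p q r \<le> cmp_ang K p q x"
    using cbb_between_angle[OF cbb X(1,2,3,4) bt(1) False ne(1) per(1)] .
  have 2: "cmp_ang K p s r \<le> cmp_ang K p s x"
    using cbb_between_angle[OF cbb X(1,2,5,4) bt(1) False ne(3) per(2)] .
  have e1: "sqrt K * (dist p q + dist q x + dist p x) \<le> sqrt K * (dist p q + dist q s + dist p s)"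
    and e2: "sqrt K * (dist p x + dist x s + dist p s) \<le> sqrt K * (dist p q + dist q s + dist p s)"
    using dist_triangle[of p x q] dist_triangle[of p x s] bt
    by (auto intro!: mult_left_mono[OF _ s0] simp: dist_commute)
  have t1: "tri K (dist p q) (dist p x) (dist q x)" "tri K (dist p x) (dist p s) (dist x s)"
    using e1 e2 per(3) by (auto intro!: tri_dist)
  have t: "tri K (dist p q) (dist p s) (dist q x + dist x s)" using tri_dist[OF per(3)] bt by simp
  have "cmp_angle K (dist p q) (dist p x) (dist q x) + cmp_angle K (dist p x) (dist p s) (dist x s)
      \<le> cmp_angle K (dist p q) (dist p s) (dist q x + dist x s)"
    by (rule cmp_angle_glue[OF t1 t]) (use ne False in auto)
  then have "cmp_ang K p q x + cmp_ang K p x s \<le> cmp_ang K p q s" using bt by (simp add: cmp_ang_def)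
  moreover have "cmp_ang K p s r = cmp_ang K p r s" "cmp_ang K p s x = cmp_ang K p x s"
    by (simp_all add: cmp_ang_def dist_commute cmp_angle_commute[OF K])
  ultimately show ?thesis using 1 2 by simp
qed

end

section \<open>Crossing geodesics in a disc\<close>

lemma periodic_int:
  fixes f :: "real \<Rightarrow> 'a"
  assumes per: "\<And>t. f (t + l) = f t"
  shows "f (t + of_int n * l) = f t"
proof -
  have pos: "f (t + of_nat m * l) = f t" for t and m :: nat
  proof (induction m)
    case (Suc m)
    have "f (t + of_nat (Suc m) * l) = f (t + of_nat m * l + l)" by (simp add: algebra_simps)
    then show ?case using Suc per by simp
  qed simp
  show ?thesis
  proof (cases "n \<ge> 0")
    case True then show ?thesis using pos[of t "nat n"] by simp
  next
    case False
    then have "f t = f (t + of_int n * l + of_nat (nat (- n)) * l)" by simp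
    then show ?thesis using pos[of "t + of_int n * l" "nat (- n)"] by simp
  qed
qed

lemma period_representative:
  fixes l t p :: real
  assumes "0 < l"
  obtains n :: int where "t + of_int n * l \<in> {p..<p + l}"
proof
  define n where "n = - \<lfloor>(t - p) / l\<rfloor>"
  have "of_int \<lfloor>(t - p) / l\<rfloor> \<le> (t - p) / l" "(t - p) / l < of_int \<lfloor>(t - p) / l\<rfloor> + 1" by linarith+
  then show "t + of_int (- \<lfloor>(t - p) / l\<rfloor>) * l \<in> {p..<p + l}" using assms by (auto simp: field_simps le_divide_eq divide_less_eq)
qed

lemma periodic_inj_iff:
  fixes f :: "real \<Rightarrow> 'a"
  assumes l: "0 < l" and per: "\<And>t. f (t + l) = f t" and inj: "inj_on f {0..<l}"
    and eq: "f x = f y" and lt: "\<bar>x - y\<bar> < l"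
  shows "x = y"
proof -
  obtain n where n: "x + of_int n * l \<in> {0..<0 + l}" using period_representative[OF l] .
  obtain m where m: "y + of_int m * l \<in> {0..<0 + l}" using period_representative[OF l] .
  have "f (x + of_int n * l) = f (y + of_int m * l)" using eq by (simp add: periodic_int[of f, OF per])
  then have e: "x + of_int n * l = y + of_int m * l" using inj n m by (auto dest: inj_onD)
  then have "x - y = of_int (m - n) * l" by (simp add: algebra_simps)
  then have "\<bar>of_int (m - n) * l\<bar> < 1 * l" using lt by simp
  then have "\<bar>real_of_int (m - n)\<bar> < 1" using l by (simp add: abs_mult)
  then have "m = n" by linarith
  then show ?thesis using e by simp
qed

definition clamp01 :: "real \<Rightarrow> real" where "clamp01 u = max 0 (min 1 u)"

text \<open>A homeomorphism of the circle takes the four points to the west, south, east and north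
  points; its radial extension to the disc turns the paths into a horizontal and a vertical crossing
  of a square, to which \<open>fashoda\<close> applies.\<close>

lemma disc_paths_cross:
  fixes rho :: "real \<Rightarrow> complex" and f g :: "real \<Rightarrow> complex"
  assumes l: "0 < l" and cont: "continuous_on UNIV rho" and per: "\<And>t. rho (t + l) = rho t"
    and inj: "inj_on rho {0..<l}" and im: "rho ` {0..l} = sphere 0 1"
    and ord: "p < q" "q < r" "r < s" "s < p + l"
    and f: "continuous_on {0..1} f" "f ` {0..1} \<subseteq> cball 0 1" "f 0 = rho p" "f 1 = rho r"
    and g: "continuous_on {0..1} g" "g ` {0..1} \<subseteq> cball 0 1" "g 0 = rho q" "g 1 = rho s"
  shows "\<exists>a\<in>{0..1}. \<exists>b\<in>{0..1}. f a = g b"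
proof -
  \<comment> \<open>Piecewise linear, with a quarter turn on each of the four subarcs. It starts at
    \<open>pi\<close>, so that \<open>p\<close> becomes the west point, as the coordinates in
    \<open>fashoda\<close> demand.\<close>
  define ang where "ang t = pi + (pi / 2) * (clamp01 ((t - p) / (q - p)) + clamp01 ((t - q) / (r - q))
     + clamp01 ((t - r) / (s - r)) + clamp01 ((t - s) / (p + l - s)))" for t
  have ang_cont: "continuous_on A ang" for A
    unfolding ang_def clamp01_def using ord by (intro continuous_intros) auto
  have cl_mono: "clamp01 u \<le> clamp01 v" if "u \<le> v" for u v using that by (auto simp: clamp01_def)
  have cl0: "clamp01 ((a - b) / c) = 0" if "a \<le> b" "0 < c" for a b c
    using that by (auto simp: clamp01_def max_def min_def divide_simps)
  have cl1: "clamp01 ((a - b) / c) = 1" if "c \<le> a - b" "0 < c" for a b c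
    using that by (simp add: clamp01_def min_def)
  have ang_p: "ang p = pi" and ang_q: "ang q = pi + pi / 2" and ang_r: "ang r = 2 * pi"
    and ang_s: "ang s = 2 * pi + pi / 2" and ang_l: "ang (p + l) = 3 * pi"
    unfolding ang_def using ord
      cl0[of p p "q - p"] cl0[of p q "r - q"] cl0[of p r "s - r"] cl0[of p s "p + l - s"]
      cl1[of "q - p" q p] cl0[of q q "r - q"] cl0[of q r "s - r"] cl0[of q s "p + l - s"]
      cl1[of "q - p" r p] cl1[of "r - q" r q] cl0[of r r "s - r"] cl0[of r s "p + l - s"]
      cl1[of "q - p" s p] cl1[of "r - q" s q] cl1[of "s - r" s r] cl0[of s s "p + l - s"]
      cl1[of "q - p" "p + l" p] cl1[of "r - q" "p + l" q] cl1[of "s - r" "p + l" r] cl1[of "p + l - s" "p + l" s]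
    by simp_all
  have ang_mono: "ang t < ang t'" if t: "p \<le> t" "t < t'" "t' \<le> p + l" for t t'
  proof -
    have 1: "(t - p) / (q - p) < (t' - p) / (q - p)" "(t - q) / (r - q) < (t' - q) / (r - q)"
      "(t - r) / (s - r) < (t' - r) / (s - r)" "(t - s) / (p + l - s) < (t' - s) / (p + l - s)"
      using t ord by (auto intro!: divide_strict_right_mono)
    have str: "clamp01 u < clamp01 v" if "u < v" "u < 1" "0 < v" "0 \<le> u \<or> 0 < v" for u v
      using that by (auto simp: clamp01_def)
    have "clamp01 ((t - p) / (q - p)) < clamp01 ((t' - p) / (q - p)) \<or> clamp01 ((t - q) / (r - q)) < clamp01 ((t' - q) / (r - q))
     \<or> clamp01 ((t - r) / (s - r)) < clamp01 ((t' - r) / (s - r)) \<or> clamp01 ((t - s) / (p + l - s)) < clamp01 ((t' - s) / (p + l - s))"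
    proof -
      consider "t < q" | "q \<le> t" "t < r" | "r \<le> t" "t < s" | "s \<le> t" by linarith
      then show ?thesis
      proof cases
        case 1 then have "clamp01 ((t - p) / (q - p)) < clamp01 ((t' - p) / (q - p))"
          using t ord by (intro str) (auto simp: divide_simps)
        then show ?thesis by simp
      next
        case 2 then have "clamp01 ((t - q) / (r - q)) < clamp01 ((t' - q) / (r - q))"
          using t ord by (intro str) (auto simp: divide_simps)
        then show ?thesis by simp
      next
        case 3 then have "clamp01 ((t - r) / (s - r)) < clamp01 ((t' - r) / (s - r))"
          using t ord by (intro str) (auto simp: divide_simps)
        then show ?thesis by simp
      next
        case 4 then have "clamp01 ((t - s) / (p + l - s)) < clamp01 ((t' - s) / (p + l - s))"
          using t ord by (intro str) (auto simp: divide_simps)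
        then show ?thesis by simp
      qed
    qed
    then have "clamp01 ((t - p) / (q - p)) + clamp01 ((t - q) / (r - q)) + clamp01 ((t - r) / (s - r)) + clamp01 ((t - s) / (p + l - s))
      < clamp01 ((t' - p) / (q - p)) + clamp01 ((t' - q) / (r - q)) + clamp01 ((t' - r) / (s - r)) + clamp01 ((t' - s) / (p + l - s))"
      using cl_mono[OF less_imp_le[OF 1(1)]] cl_mono[OF less_imp_le[OF 1(2)]]
        cl_mono[OF less_imp_le[OF 1(3)]] cl_mono[OF less_imp_le[OF 1(4)]] by linarith
    then show ?thesis unfolding ang_def by simp
  qed
  have cis_eq: "cis (ang t) = cis (ang t')" if "t \<in> {p..p + l}" "t' \<in> {p..p + l}" "rho t = rho t'" for t t'
  proof (cases "\<bar>t - t'\<bar> < l")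
    case True then show ?thesis using periodic_inj_iff[OF l per inj that(3)] by simp
  next
    case False
    then have "(t = p \<and> t' = p + l) \<or> (t' = p \<and> t = p + l)" using that by (auto simp: abs_real_def split: if_splits)
    moreover have "cis (3 * pi) = cis pi" using cis_mult[of "2 * pi" pi] by simp
    ultimately show ?thesis using ang_p ang_l by auto
  qed
  define G where "G z = cis (ang (SOME t. t \<in> {p..p + l} \<and> rho t = z))" for z
  have G: "G (rho t) = cis (ang t)" if "t \<in> {p..p + l}" for t
  proof -
    have "(SOME t'. t' \<in> {p..p + l} \<and> rho t' = rho t) \<in> {p..p + l} \<and> rho (SOME t'. t' \<in> {p..p + l} \<and> rho t' = rho t) = rho t"
      by (rule someI[where P = "\<lambda>t'. t' \<in> {p..p + l} \<and> rho t' = rho t"]) (use that in auto)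
    then show ?thesis unfolding G_def using that by (intro cis_eq) auto
  qed
  have surj: "\<exists>t\<in>{p..<p + l}. rho t = z" if "z \<in> sphere 0 1" for z
  proof -
    have "z \<in> rho ` {0..l}" unfolding im by (rule that)
    then obtain t where t: "rho t = z" by blast
    obtain n where n: "t + of_int n * l \<in> {p..<p + l}" using period_representative[OF l] .
    moreover have "rho (t + of_int n * l) = z" using t periodic_int[of rho, OF per] by simp
    ultimately show ?thesis by blast
  qed
  have sph: "rho t \<in> sphere 0 1" for t
  proof -
    obtain n where n: "t + of_int n * l \<in> {0..<0 + l}" using period_representative[OF l] .
    then have "rho (t + of_int n * l) \<in> rho ` {0..l}" by auto
    then show ?thesis using im periodic_int[of rho, OF per] by simp
  qed
  \<comment> \<open>On a compact period \<open>rho\<close> maps closed sets to closed sets, so the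
    continuity of \<open>cis (ang t)\<close> descends to the circle through closed
    preimages.\<close>
  have G_cont: "continuous_on (sphere 0 1) G"
    unfolding continuous_on_closed_invariant
  proof (intro allI impI)
    fix B :: "complex set" assume B: "closed B"
    let ?A = "rho ` ({p..p + l} \<inter> (\<lambda>t. cis (ang t)) -` B)"
    have "closed ({p..p + l} \<inter> (\<lambda>t. cis (ang t)) -` B)"
      by (rule continuous_closed_preimage[OF _ _ B]) (auto intro!: continuous_intros ang_cont)
    then have "compact ({p..p + l} \<inter> (\<lambda>t. cis (ang t)) -` B)"
      by (metis Int_left_absorb compact_Icc compact_Int_closed)
    then have "compact ?A" using cont by (intro compact_continuous_image) (auto intro: continuous_on_subset)
    moreover have "?A \<inter> sphere 0 1 = G -` B \<inter> sphere 0 1"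
    proof (intro equalityI subsetI)
      fix z assume "z \<in> ?A \<inter> sphere 0 1" then show "z \<in> G -` B \<inter> sphere 0 1" using G by auto
    next
      fix z assume z: "z \<in> G -` B \<inter> sphere 0 1"
      then obtain t where t: "t \<in> {p..<p + l}" "rho t = z" using surj by blast
      then have "t \<in> {p..p + l}" "cis (ang t) \<in> B" using z G[of t] by auto
      then show "z \<in> ?A \<inter> sphere 0 1" using t z by auto
    qed
    ultimately show "\<exists>A. closed A \<and> A \<inter> sphere 0 1 = G -` B \<inter> sphere 0 1" using compact_imp_closed by blast
  qed
  \<comment> \<open>Radial extension. At the origin the value of \<open>G\<close> is arbitrary but
    multiplied by 0, and continuity there follows from preservation of the norm.\<close>
  define Phi where "Phi z = of_real (norm z) * G (z / of_real (norm z))" for z :: complex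
  have nG: "norm (G z) = 1" for z by (simp add: G_def)
  have nPhi: "norm (Phi z) = norm z" for z by (simp add: Phi_def norm_mult nG)
  have Phi_rho: "Phi (rho t) = cis (ang t)" if "t \<in> {p..p + l}" for t
    using sph[of t] that by (simp add: Phi_def G)
  have Phi_cont: "continuous_on (cball 0 1) Phi"
    unfolding continuous_on_eq_continuous_within
  proof
    fix z :: complex assume z: "z \<in> cball 0 1"
    show "continuous (at z within cball 0 1) Phi"
    proof (cases "z = 0")
      case True
      have "((\<lambda>x. Phi x) \<longlongrightarrow> 0) (at 0 within cball 0 1)"
        by (rule Lim_null_comparison[where g = norm]) (auto simp: nPhi intro!: tendsto_eq_intros)
      moreover have "Phi 0 = 0" by (simp add: Phi_def)
      ultimately show ?thesis using True by (simp add: continuous_within)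
    next
      case False
      have "continuous_on (cball 0 1 - {0}) (\<lambda>z. G (z / of_real (norm z)))"
        by (rule continuous_on_compose2[OF G_cont]) (auto intro!: continuous_intros simp: norm_divide split: if_splits)
      then have "continuous_on (cball 0 1 - {0}) Phi" unfolding Phi_def by (intro continuous_intros)
      then have "continuous (at z within cball 0 1 - {0}) Phi"
        using z False by (auto simp: continuous_on_eq_continuous_within)
      moreover have "at z within cball 0 1 - {0} = at z within cball 0 1"
        by (rule at_within_nhd[of _ "- {0}"]) (use False in auto)
      ultimately show ?thesis by simp
    qed
  qed
  have Phi_inj: "z = z'" if zz: "z \<in> cball 0 1" "z' \<in> cball 0 1" "Phi z = Phi z'" for z z'
  proof -
    have n: "norm z = norm z'" using zz nPhi by metis
    show ?thesis
    proof (cases "z = 0")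
      case False
      then have z0: "norm z \<noteq> 0" "z' \<noteq> 0" using n by auto
      have GG: "G (z / of_real (norm z)) = G (z' / of_real (norm z))" using zz(3) z0 n by (simp add: Phi_def)
      have "z / of_real (norm z) \<in> sphere 0 1" "z' / of_real (norm z) \<in> sphere 0 1" using z0 n by (auto simp: norm_divide)
      then obtain t t' where t: "t \<in> {p..<p + l}" "rho t = z / of_real (norm z)"
        "t' \<in> {p..<p + l}" "rho t' = z' / of_real (norm z)" using surj by metis
      have "cis (ang t) = cis (ang t')" using GG t G[of t] G[of t'] by auto
      then have "cis (ang t - ang t') = 1" by (metis cis_divide divide_self cis_neq_zero)
      then have "cos (ang t - ang t') = 1" by (metis cis.simps(1) one_complex.simps(1))
      then obtain n :: int where n': "ang t - ang t' = of_int n * 2 * pi" using cos_one_2pi_int by blast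
      have "pi \<le> ang t" "ang t < 3 * pi" "pi \<le> ang t'" "ang t' < 3 * pi"
        using t ang_mono[of p t] ang_mono[of t "p + l"] ang_mono[of p t'] ang_mono[of t' "p + l"] ang_p ang_l
        by (auto simp: le_less)
      then have "\<bar>of_int n * 2 * pi\<bar> < 2 * pi" using n' by linarith
      then have "\<bar>real_of_int n\<bar> < 1" by (simp add: abs_mult)
      then have "n = 0" by linarith
      then have "ang t = ang t'" using n' by simp
      then have "t = t'" using ang_mono[of t t'] ang_mono[of t' t] t by (metis atLeastLessThan_iff less_imp_le less_irrefl linorder_neqE_linordered_idom)
      then have "z / of_real (norm z) = z' / of_real (norm z)" using t(2,4) by (simp only:)
      moreover have "complex_of_real (norm z) \<noteq> 0" using z0 by simp
      ultimately show ?thesis by (metis nonzero_divide_eq_eq)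
    qed (use n in auto)
  qed
  define V where "V z = (\<chi> i. if i = 1 then Re z else Im z :: real^2)" for z
  have V1: "V z $ 1 = Re z" "V z $ 2 = Im z" for z by (auto simp: V_def)
  have V_cont: "continuous_on A V" for A
    unfolding V_def
  proof (rule continuous_on_vec_lambda)
    fix i :: 2 show "continuous_on A (\<lambda>z. if i = 1 then Re z else Im z)"
      by (cases "i = 1") (auto intro!: continuous_intros)
  qed
  have V_inj: "V z = V w \<Longrightarrow> z = w" for z w using V1 by (metis complex_eqI)
  have V_box: "V z \<in> cbox (vector [-1, -1]) (vector [1, 1])" if "norm z \<le> 1" for z
    using that abs_Re_le_cmod[of z] abs_Im_le_cmod[of z] by (auto simp: mem_box_cart forall_2 V1)
  let ?F = "V \<circ> Phi \<circ> f" and ?G = "V \<circ> Phi \<circ> g"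
  have nf: "norm (f a) \<le> 1" "norm (g a) \<le> 1" if "a \<in> {0..1}" for a using f(2) g(2) that by (auto simp: image_subset_iff)
  have pf: "path ?F" unfolding path_def comp_assoc
    by (intro continuous_on_compose f continuous_on_subset[OF Phi_cont] f(2) V_cont)
  have pg: "path ?G" unfolding path_def comp_assoc
    by (intro continuous_on_compose g continuous_on_subset[OF Phi_cont] g(2) V_cont)
  have bf: "path_image ?F \<subseteq> cbox (vector [-1, -1]) (vector [1, 1])"
    "path_image ?G \<subseteq> cbox (vector [-1, -1]) (vector [1, 1])"
    using nf by (auto simp: path_image_def nPhi intro!: V_box)
  have c2: "cos (2 * pi + pi / 2) = 0" "sin (2 * pi + pi / 2) = 1" "cos (pi + pi/2) = 0" "sin (pi + pi/2) = -1"
    unfolding cos_add sin_add by simp_all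
  have e: "3 * pi / 2 = pi + pi / 2" "5 * pi / 2 = 2 * pi + pi / 2" by simp_all
  have c3: "sin (3 * pi / 2) = -1" "sin (5 * pi / 2) = 1" unfolding e by (rule c2)+
  have "pathstart ?F $ 1 = vector [-1, -1] $ (1::2)" "pathfinish ?F $ 1 = vector [1, 1] $ (1::2)"
    "pathstart ?G $ 2 = vector [-1, -1] $ (2::2)" "pathfinish ?G $ 2 = vector [1, 1] $ (2::2)"
    using ord by (auto simp: pathstart_def pathfinish_def f g Phi_rho ang_p ang_q ang_r ang_s V1 c3)
  from fashoda[OF pf pg bf this]
  obtain z where "z \<in> path_image ?F" "z \<in> path_image ?G" .
  then obtain a b where ab: "a \<in> {0..1}" "b \<in> {0..1}" "V (Phi (f a)) = V (Phi (g b))"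
    by (auto simp: path_image_def)
  have "f a = g b"
  proof (rule Phi_inj)
    show "f a \<in> cball 0 1" "g b \<in> cball 0 1" using nf(1)[OF ab(1)] nf(2)[OF ab(2)] by simp_all
    show "Phi (f a) = Phi (g b)" by (rule V_inj[OF ab(3)])
  qed
  then show ?thesis using ab by blast
qed

section \<open>Crossing points of boundary chords\<close>

lemma path_length_two:
  assumes "a \<in> {0..1::real}"
  shows "ereal (dist (g 0) (g a) + dist (g a) (g 1)) \<le> path_length g 0 1"
proof -
  define t where "t i = (if i = 0 then 0 else if i = 1 then a else 1)" for i :: nat
  have "(2::nat, t) \<in> {(n, t). t 0 = 0 \<and> t n = 1 \<and> (\<forall>i<n. t i \<le> t (Suc i))}"
    using assms by (auto simp: t_def less_2_cases_iff)
  from SUP_upper[OF this, of "\<lambda>p. ereal (\<Sum>i<fst p. dist (g (snd p i)) (g (snd p (Suc i))))"]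
  show ?thesis by (simp add: path_length_def t_def numeral_2_eq_2)
qed

lemma length_space_almost_geodesic:
  assumes "length_space X" "x \<in> X" "y \<in> X" "e > 0"
  shows "\<exists>g :: real \<Rightarrow> _. continuous_on {0..1} g \<and> g ` {0..1} \<subseteq> X \<and> g 0 = x \<and> g 1 = y \<and>
    (\<forall>a\<in>{0..1}. dist x (g a) + dist (g a) y < dist x y + e)"
proof -
  have eq: "ereal (dist x y) = (INF g \<in> {g. continuous_on {0..1} g \<and> g ` {0..1} \<subseteq> X \<and> g 0 = x \<and> g 1 = y}. path_length g 0 1)"
    using assms(1-3) unfolding length_space_def by blast
  have "(INF g \<in> {g. continuous_on {0..1} g \<and> g ` {0..1} \<subseteq> X \<and> g 0 = x \<and> g 1 = y}. path_length g 0 1) < ereal (dist x y + e)"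
    unfolding eq[symmetric] using assms(4) by simp
  then obtain g where g: "continuous_on {0..1} g" "g ` {0..1} \<subseteq> X" "g 0 = x" "g 1 = y"
    "path_length g 0 1 < ereal (dist x y + e)" by (auto simp: INF_less_iff)
  have k: "dist x (g a) + dist (g a) y < dist x y + e" if "a \<in> {0..1}" for a
    using order_le_less_trans[OF path_length_two[OF that, of g] g(5)] g(3,4) by simp
  show ?thesis by (intro exI[of _ g] conjI ballI g(1-4) k)
qed

text \<open>Shortest paths need not be constructed. The sum of the distances to the four points
  attains its minimum on the compact space; paths of almost minimal length cross, so the minimum is
  at most the sum of the two chords, and the triangle inequalities make both betweenness relations
  exact.\<close>

lemma boundary_geodesics_cross:
  fixes X :: "'a::metric_space set" and h :: "complex \<Rightarrow> 'a"
  assumes ls: "length_space X" and hom: "homeomorphism (cball 0 1) X h hinv"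
    and arc: "arclength_param \<sigma> l (h ` sphere 0 1)"
    and ord: "p < q" "q < r" "r < s" "s < p + l"
  obtains x where "x \<in> X" "dist (\<sigma> p) x + dist x (\<sigma> r) = dist (\<sigma> p) (\<sigma> r)"
    "dist (\<sigma> q) x + dist x (\<sigma> s) = dist (\<sigma> q) (\<sigma> s)"
proof -
  have l: "0 < l" and cont: "continuous_on UNIV \<sigma>" and per: "\<And>t. \<sigma> (t + l) = \<sigma> t"
    and inj: "inj_on \<sigma> {0..<l}" and im: "\<sigma> ` {0..l} = h ` sphere 0 1"
    using arc by (auto simp: arclength_param_def)
  have hom': "continuous_on (cball 0 1) h" "h ` cball 0 1 = X" "continuous_on X hinv"
    "\<And>z. z \<in> cball 0 1 \<Longrightarrow> hinv (h z) = z" "\<And>x. x \<in> X \<Longrightarrow> h (hinv x) = x" "hinv ` X = cball 0 1"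
    using hom by (auto simp: homeomorphism_def)
  have sX: "\<sigma> t \<in> h ` sphere 0 1" for t
  proof -
    obtain n where n: "t + of_int n * l \<in> {0..<0 + l}" using period_representative[OF l] .
    then have "\<sigma> (t + of_int n * l) \<in> \<sigma> ` {0..l}" by auto
    then show ?thesis using im periodic_int[of \<sigma>, OF per] by simp
  qed
  have sX': "\<sigma> t \<in> X" for t using sX[of t] hom'(2) by auto
  have X: "compact X" "X \<noteq> {}" using hom' compact_continuous_image[of "cball 0 1" h] by auto
  define rho where "rho t = hinv (\<sigma> t)" for t
  have r1: "continuous_on UNIV rho" unfolding rho_def
    by (rule continuous_on_compose2[OF hom'(3) cont]) (use sX' in auto)
  have r2: "rho (t + l) = rho t" for t by (simp add: rho_def per)
  have r3: "inj_on rho {0..<l}" using inj hom'(5) sX' unfolding rho_def inj_on_def by metis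
  have r4: "rho ` {0..l} = sphere 0 1"
  proof -
    have "rho ` {0..l} = hinv ` h ` sphere 0 1" using im unfolding rho_def by (metis image_image)
    also have "\<dots> = (\<lambda>z. z) ` sphere 0 1" unfolding image_image by (rule image_cong) (use hom'(4) in auto)
    finally show ?thesis by simp
  qed
  define F where "F x = dist (\<sigma> p) x + dist x (\<sigma> r) + (dist (\<sigma> q) x + dist x (\<sigma> s))" for x
  have "continuous_on X F" unfolding F_def by (intro continuous_intros)
  then obtain x where x: "x \<in> X" "\<And>y. y \<in> X \<Longrightarrow> F x \<le> F y"
    using continuous_attains_inf[OF X] by blast
  have Fx: "F x \<le> dist (\<sigma> p) (\<sigma> r) + dist (\<sigma> q) (\<sigma> s) + 2 * e" if e: "e > 0" for e
  proof -
    obtain f :: "real \<Rightarrow> 'a" where f: "continuous_on {0..1} f" "f ` {0..1} \<subseteq> X" "f 0 = \<sigma> p" "f 1 = \<sigma> r"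
      "\<forall>a\<in>{0..1}. dist (\<sigma> p) (f a) + dist (f a) (\<sigma> r) < dist (\<sigma> p) (\<sigma> r) + e"
      using length_space_almost_geodesic[OF ls sX'[of p] sX'[of r] e] by blast
    obtain g :: "real \<Rightarrow> 'a" where g: "continuous_on {0..1} g" "g ` {0..1} \<subseteq> X" "g 0 = \<sigma> q" "g 1 = \<sigma> s"
      "\<forall>a\<in>{0..1}. dist (\<sigma> q) (g a) + dist (g a) (\<sigma> s) < dist (\<sigma> q) (\<sigma> s) + e"
      using length_space_almost_geodesic[OF ls sX'[of q] sX'[of s] e] by blast
    have "\<exists>a\<in>{0..1}. \<exists>b\<in>{0..1}. (hinv \<circ> f) a = (hinv \<circ> g) b"
    proof (rule disc_paths_cross[where f = "hinv \<circ> f" and g = "hinv \<circ> g", OF l r1 r2 r3 r4 ord])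
      show "continuous_on {0..1} (hinv \<circ> f)"
        by (rule continuous_on_compose[OF f(1) continuous_on_subset[OF hom'(3) f(2)]])
      show "continuous_on {0..1} (hinv \<circ> g)"
        by (rule continuous_on_compose[OF g(1) continuous_on_subset[OF hom'(3) g(2)]])
      show "(hinv \<circ> f) ` {0..1} \<subseteq> cball 0 1" "(hinv \<circ> g) ` {0..1} \<subseteq> cball 0 1"
        using image_mono[OF f(2), of hinv] image_mono[OF g(2), of hinv] hom'(6) by (simp_all only: image_comp)
    qed (simp_all add: rho_def f(3,4) g(3,4))
    then obtain a b where ab: "a \<in> {0..1}" "b \<in> {0..1}" "hinv (f a) = hinv (g b)" by auto
    have fX: "f a \<in> X" "g b \<in> X" using f(2) g(2) ab(1,2) by blast+
    have e1: "f a = g b" using arg_cong[OF ab(3), of h] hom'(5)[OF fX(1)] hom'(5)[OF fX(2)] by simp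
    have "F x \<le> F (f a)" by (rule x(2)[OF fX(1)])
    also have "\<dots> \<le> dist (\<sigma> p) (\<sigma> r) + dist (\<sigma> q) (\<sigma> s) + 2 * e"
      using bspec[OF f(5) ab(1)] bspec[OF g(5) ab(2)] e1 by (simp add: F_def)
    finally show ?thesis .
  qed
  have "F x \<le> dist (\<sigma> p) (\<sigma> r) + dist (\<sigma> q) (\<sigma> s)"
  proof (rule field_le_epsilon)
    fix e :: real assume "e > 0" then show "F x \<le> dist (\<sigma> p) (\<sigma> r) + dist (\<sigma> q) (\<sigma> s) + e" using Fx[of "e / 2"] by simp
  qed
  then have "dist (\<sigma> p) x + dist x (\<sigma> r) = dist (\<sigma> p) (\<sigma> r)" "dist (\<sigma> q) x + dist x (\<sigma> s) = dist (\<sigma> q) (\<sigma> s)"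
    using dist_triangle[of "\<sigma> p" "\<sigma> r" x] dist_triangle[of "\<sigma> q" "\<sigma> s" x] by (auto simp: F_def)
  then show ?thesis using that x by blast
qed

section \<open>Angles between arcs and chords\<close>

definition ang3 :: "real \<Rightarrow> (real \<Rightarrow> real \<Rightarrow> real) \<Rightarrow> real \<Rightarrow> real \<Rightarrow> real \<Rightarrow> real" where
  "ang3 K d v x y = cmp_angle K (d v x) (d v y) (d x y)"

text \<open>Under \<open>star1\<close> the comparison angle grows as \<open>h\<close> decreases, so
  the supremum is the limit at 0: the angle at \<open>s\<close> between the curve and its chord to
  \<open>t\<close>. As a supremum it is lower semicontinuous.\<close>

definition start_angle :: "real \<Rightarrow> (real \<Rightarrow> real \<Rightarrow> real) \<Rightarrow> real \<Rightarrow> real \<Rightarrow> real" where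
  "start_angle K d s t = (SUP h\<in>{0<..<t - s}. ang3 K d s (s + h) t)"

definition end_angle :: "real \<Rightarrow> (real \<Rightarrow> real \<Rightarrow> real) \<Rightarrow> real \<Rightarrow> real \<Rightarrow> real" where
  "end_angle K d s t = (SUP h\<in>{0<..<t - s}. ang3 K d t s (t - h))"

text \<open>What remains of the space on a parameter window of length \<open>Lam\<close>. The facts
  \<open>d_le\<close> and \<open>d_length\<close> say that the parameter is arc length;
  \<open>KLam\<close> keeps all perimeters below \<open>2 pi / sqrt K\<close>. The four
  \<open>star\<close> axioms are one inequality, stated at each of four points in the cyclic order
  of the closed boundary.\<close>

locale convex_arc =
  fixes K Lam :: real and d :: "real \<Rightarrow> real \<Rightarrow> real"
  assumes K: "0 \<le> K" and Lam: "0 < Lam" and KLam: "sqrt K * Lam \<le> pi"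
    and d_sym: "d x y = d y x"
    and d_tri: "d x z \<le> d x y + d y z"
    and d_le: "d x y \<le> \<bar>x - y\<bar>"
    and d_pos: "x \<noteq> y \<Longrightarrow> \<bar>x - y\<bar> < Lam \<Longrightarrow> 0 < d x y"
    and d_length: "x < y \<Longrightarrow> y - x < Lam \<Longrightarrow> 0 < \<epsilon> \<Longrightarrow>
      \<exists>(n::nat) t. t 0 = x \<and> t n = y \<and> (\<forall>i<n. t i \<le> t (Suc i)) \<and> y - x - \<epsilon> < (\<Sum>i<n. d (t i) (t (Suc i)))"
    and star1: "a < b \<Longrightarrow> b < c \<Longrightarrow> c < e \<Longrightarrow> e - a < Lam \<Longrightarrow> ang3 K d a b c + ang3 K d a c e \<le> ang3 K d a b e"
    and star2: "a < b \<Longrightarrow> b < c \<Longrightarrow> c < e \<Longrightarrow> e - a < Lam \<Longrightarrow> ang3 K d b c e + ang3 K d b e a \<le> ang3 K d b c a"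
    and star3: "a < b \<Longrightarrow> b < c \<Longrightarrow> c < e \<Longrightarrow> e - a < Lam \<Longrightarrow> ang3 K d c e a + ang3 K d c a b \<le> ang3 K d c e b"
    and star4: "a < b \<Longrightarrow> b < c \<Longrightarrow> c < e \<Longrightarrow> e - a < Lam \<Longrightarrow> ang3 K d e a b + ang3 K d e b c \<le> ang3 K d e a c"
begin

abbreviation "A \<equiv> ang3 K d"
abbreviation "al \<equiv> start_angle K d"
abbreviation "be \<equiv> end_angle K d"
abbreviation "md \<equiv> mdK K"
abbreviation "sn \<equiv> snK K"

lemma A_commute: "A v x y = A v y x"
  by (simp add: ang3_def d_sym cmp_angle_commute[OF K])

lemma rev_ang3: "ang3 K (\<lambda>x y. d (- x) (- y)) v x y = A (- v) (- x) (- y)"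
  by (simp add: ang3_def)

text \<open>Reversal exchanges \<open>star1\<close> with \<open>star4\<close> and
  \<open>star2\<close> with \<open>star3\<close>; through it every fact about start angles yields
  one about end angles.\<close>

lemma rev: "convex_arc K Lam (\<lambda>x y. d (- x) (- y))"
proof
  show "0 \<le> K" "0 < Lam" "sqrt K * Lam \<le> pi" by (fact K Lam KLam)+
  show "d (- x) (- y) = d (- y) (- x)" for x y by (rule d_sym)
  show "d (- x) (- z) \<le> d (- x) (- y) + d (- y) (- z)" for x y z by (rule d_tri)
  show "d (- x) (- y) \<le> \<bar>x - y\<bar>" for x y using d_le[of "- x" "- y"] by simp
  show "0 < d (- x) (- y)" if "x \<noteq> y" "\<bar>x - y\<bar> < Lam" for x y
    by (rule d_pos) (use that in auto)
  show "\<exists>(n::nat) t. t 0 = x \<and> t n = y \<and> (\<forall>i<n. t i \<le> t (Suc i)) \<and> y - x - \<epsilon> < (\<Sum>i<n. d (- t i) (- t (Suc i)))"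
    if "x < y" "y - x < Lam" "0 < \<epsilon>" for x y \<epsilon>
  proof -
    have "\<exists>(n::nat) t. t 0 = - y \<and> t n = - x \<and> (\<forall>i<n. t i \<le> t (Suc i)) \<and> - x - (- y) - \<epsilon> < (\<Sum>i<n. d (t i) (t (Suc i)))"
      by (rule d_length) (use that in auto)
    then obtain n :: nat and t where t: "t 0 = - y" "t n = - x" "\<forall>i<n. t i \<le> t (Suc i)"
      "- x - (- y) - \<epsilon> < (\<Sum>i<n. d (t i) (t (Suc i)))" by blast
    have "(\<Sum>i<n. d (- (- t (n - i))) (- (- t (n - Suc i)))) = (\<Sum>i<n. d (t (Suc (n - Suc i))) (t (n - Suc i)))"
      by (intro sum.cong) (auto simp: Suc_diff_Suc)
    also have "\<dots> = (\<Sum>i<n. d (t (Suc i)) (t i))"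
      by (rule sum.nat_diff_reindex[where g = "\<lambda>i. d (t (Suc i)) (t i)"])
    finally have "(\<Sum>i<n. d (- (- t (n - i))) (- (- t (n - Suc i)))) = (\<Sum>i<n. d (t i) (t (Suc i)))"
      by (simp add: d_sym)
    moreover have "- t (n - i) \<le> - t (n - Suc i)" if "i < n" for i
    proof -
      have "t (n - Suc i) \<le> t (Suc (n - Suc i))" using t(3) that by simp
      then show ?thesis using that by (simp add: Suc_diff_Suc)
    qed
    ultimately show ?thesis using t by (intro exI[of _ n] exI[of _ "\<lambda>i. - t (n - i)"]) auto
  qed
next
  fix a b c e assume *: "a < b" "b < c" "c < (e::real)" "e - a < Lam"
  have **: "- e < - c" "- c < - b" "- b < - a" "- a - - e < Lam" using * by auto
  show "ang3 K (\<lambda>x y. d (- x) (- y)) a b c + ang3 K (\<lambda>x y. d (- x) (- y)) a c e \<le> ang3 K (\<lambda>x y. d (- x) (- y)) a b e"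
    unfolding rev_ang3 using star4[OF **] by (simp add: A_commute)
  show "ang3 K (\<lambda>x y. d (- x) (- y)) b c e + ang3 K (\<lambda>x y. d (- x) (- y)) b e a \<le> ang3 K (\<lambda>x y. d (- x) (- y)) b c a"
    unfolding rev_ang3 using star3[OF **] by (simp add: A_commute)
  show "ang3 K (\<lambda>x y. d (- x) (- y)) c e a + ang3 K (\<lambda>x y. d (- x) (- y)) c a b \<le> ang3 K (\<lambda>x y. d (- x) (- y)) c e b"
    unfolding rev_ang3 using star2[OF **] by (simp add: A_commute)
  show "ang3 K (\<lambda>x y. d (- x) (- y)) e a b + ang3 K (\<lambda>x y. d (- x) (- y)) e b c \<le> ang3 K (\<lambda>x y. d (- x) (- y)) e a c"
    unfolding rev_ang3 using star1[OF **] by (simp add: A_commute)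
qed

lemma be_rev: "be s t = start_angle K (\<lambda>x y. d (- x) (- y)) (- t) (- s)"
  unfolding end_angle_def start_angle_def rev_ang3 by (simp add: A_commute algebra_simps)

lemma al_rev: "al s t = end_angle K (\<lambda>x y. d (- x) (- y)) (- t) (- s)"
  unfolding end_angle_def start_angle_def rev_ang3 by (simp add: A_commute algebra_simps)

lemma d_self [simp]: "d x x = 0"
  using d_le[of x x] d_tri[of x x x] by simp

lemma d_nonneg: "0 \<le> d x y"
  using d_tri[of x x y] d_sym[of x y] by simp

lemma tri_d:
  assumes "{v, x, y} \<subseteq> {a..b}" "b - a < Lam"
  shows "tri K (d v x) (d v y) (d x y)"
proof -
  have "d v x + d v y + d x y \<le> \<bar>v - x\<bar> + \<bar>v - y\<bar> + \<bar>x - y\<bar>"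
    using d_le[of v x] d_le[of v y] d_le[of x y] by linarith
  also have "\<dots> \<le> 2 * (b - a)" using assms by (auto simp: abs_real_def)
  finally have 1: "d v x + d v y + d x y \<le> 2 * (b - a)" .
  have "sqrt K * (d v x + d v y + d x y) < 2 * pi"
  proof (cases "K = 0")
    case False
    then have "sqrt K * (d v x + d v y + d x y) < sqrt K * (2 * Lam)"
      using K 1 assms by (intro mult_strict_left_mono) auto
    then show ?thesis using KLam by simp
  qed simp
  then show ?thesis
    using d_tri[of v x y] d_tri[of v y x] d_tri[of x y v] d_sym d_nonneg by (auto simp: tri_def add.commute)
qed

lemma Kd_lt:
  assumes "\<bar>x - y\<bar> < Lam" shows "sqrt K * d x y < pi"
proof (cases "K = 0")
  case False
  then have "sqrt K * d x y < sqrt K * Lam"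
    using K d_le[of x y] assms by (intro mult_strict_left_mono) auto
  then show ?thesis using KLam by simp
qed simp

lemma sn_d_pos: "x \<noteq> y \<Longrightarrow> \<bar>x - y\<bar> < Lam \<Longrightarrow> 0 < sn (d x y)"
  using snK_pos[OF K d_pos Kd_lt] by blast

lemma A_bounds:
  assumes "{v, x, y} \<subseteq> {a..b}" "b - a < Lam" "v \<noteq> x" "v \<noteq> y"
  shows "0 \<le> A v x y" "A v x y \<le> pi"
  using cos_cmp_angle(2,3)[OF K tri_d[OF assms(1,2)]] d_pos[of v x] d_pos[of v y] assms
  by (auto simp: ang3_def abs_real_def)

lemma A_cos:
  assumes "{v, x, y} \<subseteq> {a..b}" "b - a < Lam" "v \<noteq> x" "v \<noteq> y"
  shows "sn (d v x) * sn (d v y) * cos (A v x y) = md (d v x) + md (d v y) - K * md (d v x) * md (d v y) - md (d x y)"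
  using cos_cmp_angle(1)[OF K tri_d[OF assms(1,2)]] d_pos[of v x] d_pos[of v y] assms
  by (auto simp: ang3_def abs_real_def)

lemma A_sum:
  assumes "{v, x, y} \<subseteq> {a..b}" "b - a < Lam" "v \<noteq> x" "v \<noteq> y" "x \<noteq> y"
  shows "pi \<le> A v x y + A x v y + A y v x"
proof -
  have "pi \<le> cmp_angle K (d v y) (d x y) (d v x) + cmp_angle K (d v x) (d x y) (d v y) + cmp_angle K (d v x) (d v y) (d x y)"
    using cmp_angle_sum[OF K tri_d[OF assms(1,2)]] d_pos[of v x] d_pos[of v y] d_pos[of x y] assms
    by (auto simp: abs_real_def)
  then show ?thesis by (simp add: ang3_def d_sym add_ac)
qed

lemma A_sine:
  assumes "{v, x, y} \<subseteq> {a..b}" "b - a < Lam" "v \<noteq> x" "v \<noteq> y" "x \<noteq> y"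
  shows "sn (d v x) * sin (A x v y) = sn (d v y) * sin (A y v x)"
proof -
  have t: "tri K (d x y) (d v x) (d v y)" using tri_d[OF assms(1,2)] tri_perm[OF K] by blast
  have "sn (d v x) * sin (cmp_angle K (d x y) (d v x) (d v y)) = sn (d v y) * sin (cmp_angle K (d x y) (d v y) (d v x))"
    using sine_rule[OF K t] d_pos[of v x] d_pos[of v y] d_pos[of x y] assms by (auto simp: abs_real_def)
  then show ?thesis by (simp add: ang3_def d_sym cmp_angle_commute[OF K])
qed

lemma A_start_mono:
  assumes "0 < h" "h < h'" "h' < t - s" "t - s < Lam"
  shows "A s (s + h') t \<le> A s (s + h) t"
  using star1[of s "s + h" "s + h'" t] A_bounds(1)[of s "s + h" "s + h'" s t] assms by auto

lemma al_bdd: "s < t \<Longrightarrow> t - s < Lam \<Longrightarrow> bdd_above ((\<lambda>h. A s (s + h) t) ` {0<..<t - s})"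
  by (rule bdd_aboveI[of _ pi]) (auto intro!: A_bounds(2)[of _ _ _ s t])

lemma al_upper: "s < x \<Longrightarrow> x < t \<Longrightarrow> t - s < Lam \<Longrightarrow> A s x t \<le> al s t"
  unfolding start_angle_def using cSUP_upper[OF _ al_bdd, of "x - s" t s] by auto

lemma al_bounds:
  assumes "s < t" "t - s < Lam" shows "0 \<le> al s t" "al s t \<le> pi"
proof -
  let ?m = "(s + t) / 2"
  have m: "s < ?m" "?m < t" using assms by auto
  have "0 \<le> A s ?m t" using A_bounds(1)[of s ?m t s t] assms m by auto
  also have "\<dots> \<le> al s t" using al_upper m assms by blast
  finally show "0 \<le> al s t" .
  show "al s t \<le> pi" unfolding start_angle_def
    by (rule cSUP_least) (use assms in \<open>auto intro!: A_bounds(2)[of _ _ _ s t]\<close>)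
qed

lemma al_approx:
  assumes "s < t" "t - s < Lam" "0 < e"
  shows "\<exists>h0. 0 < h0 \<and> h0 < t - s \<and> (\<forall>h. 0 < h \<longrightarrow> h \<le> h0 \<longrightarrow> al s t - e < A s (s + h) t)"
proof -
  have "al s t - e < al s t" using assms by simp
  then obtain h where h: "h \<in> {0<..<t - s}" "al s t - e < A s (s + h) t"
    unfolding start_angle_def using less_cSUP_iff[OF _ al_bdd[OF assms(1,2)]] assms by auto
  have "al s t - e < A s (s + h') t" if "0 < h'" "h' \<le> h" for h'
    using A_start_mono[of h' h t s] that h assms by (cases "h' = h") auto
  then show ?thesis using h by (intro exI[of _ h]) auto
qed

lemma al_tendsto:
  assumes "s < t" "t - s < Lam"
  shows "((\<lambda>h. A s (s + h) t) \<longlongrightarrow> al s t) (at_right 0)"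
proof (rule tendstoI)
  fix e :: real assume "e > 0"
  from al_approx[OF assms this] obtain h0 where h0: "0 < h0" "h0 < t - s"
    "\<And>h. 0 < h \<Longrightarrow> h \<le> h0 \<Longrightarrow> al s t - e < A s (s + h) t" by blast
  have "dist (A s (s + h) t) (al s t) < e" if "0 < h" "h < h0" for h
    using h0(3)[OF that(1) less_imp_le[OF that(2)]] al_upper[of s "s + h" t] that h0(1,2) assms
    by (auto simp: dist_real_def)
  then show "\<forall>\<^sub>F h in at_right 0. dist (A s (s + h) t) (al s t) < e"
    unfolding eventually_at_right_field using h0 by blast
qed

lemma be_tendsto:
  assumes "s < t" "t - s < Lam"
  shows "((\<lambda>h. A t s (t - h)) \<longlongrightarrow> be s t) (at_right 0)"
  using convex_arc.al_tendsto[OF rev, of "- t" "- s"] assms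
  by (simp add: be_rev rev_ang3 A_commute algebra_simps)

lemma be_upper: "s < x \<Longrightarrow> x < t \<Longrightarrow> t - s < Lam \<Longrightarrow> A t s x \<le> be s t"
  using convex_arc.al_upper[OF rev, of "- t" "- x" "- s"] by (simp add: be_rev rev_ang3 A_commute)

lemma be_bounds:
  assumes "s < t" "t - s < Lam" shows "0 \<le> be s t" "be s t \<le> pi"
  using convex_arc.al_bounds[OF rev, of "- t" "- s"] assms by (auto simp: be_rev)

lemma al_add:
  assumes "s < t" "t < u" "u - s < Lam"
  shows "al s t + A s t u \<le> al s u"
proof (rule tendsto_upperbound[OF tendsto_add[OF al_tendsto tendsto_const]])
  show "\<forall>\<^sub>F h in at_right 0. A s (s + h) t + A s t u \<le> al s u"
    unfolding eventually_at_right_field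
  proof (intro exI[of _ "t - s"] conjI allI impI)
    fix h assume h: "0 < h" "h < t - s"
    have "A s (s + h) t + A s t u \<le> A s (s + h) u" using star1[of s "s + h" t u] h assms by auto
    also have "\<dots> \<le> al s u" using al_upper[of s "s + h" u] h assms by auto
    finally show "A s (s + h) t + A s t u \<le> al s u" .
  qed (use assms in auto)
qed (use assms in auto)

lemma be_add:
  assumes "s < t" "t < u" "u - s < Lam"
  shows "be t u + A u s t \<le> be s u"
  using convex_arc.al_add[OF rev, of "- u" "- t" "- s"] assms by (simp add: be_rev rev_ang3 A_commute)

text \<open>The sum is approximated by three adjacent angles at \<open>t\<close>, towards
  \<open>t - h\<close>, \<open>s\<close>, \<open>u\<close> and \<open>t + h\<close>. By
  \<open>star2\<close> and \<open>star3\<close> they add up to at most the single angle between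
  \<open>t + h\<close> and \<open>t - h\<close>.\<close>

lemma vertex_angles:
  assumes "s < t" "t < u" "u - s < Lam"
  shows "be s t + A t s u + al t u \<le> pi"
proof (rule tendsto_upperbound[OF tendsto_add[OF tendsto_add[OF be_tendsto tendsto_const] al_tendsto]])
  show "\<forall>\<^sub>F h in at_right 0. A t s (t - h) + A t s u + A t (t + h) u \<le> pi"
    unfolding eventually_at_right_field
  proof (intro exI[of _ "min (t - s) (u - t)"] conjI allI impI)
    fix h assume h: "0 < h" "h < min (t - s) (u - t)"
    have "A t (t + h) u + A t u (t - h) \<le> A t (t + h) (t - h)"
      using star2[of "t - h" t "t + h" u] h assms by auto
    moreover have "A t u s + A t s (t - h) \<le> A t u (t - h)"
      using star3[of s "t - h" t u] h assms by auto
    moreover have "A t (t + h) (t - h) \<le> pi" using A_bounds(2)[of t "t + h" "t - h" s u] h assms by auto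
    ultimately show "A t s (t - h) + A t s u + A t (t + h) u \<le> pi" by (simp add: A_commute[of t u s])
  qed (use assms in auto)
qed (use assms in auto)

text \<open>For a smooth convex arc in the plane this is the total curvature of the arc.\<close>

definition "Th s t = al s t + be s t"

lemma Th_nonneg: "s < t \<Longrightarrow> t - s < Lam \<Longrightarrow> 0 \<le> Th s t"
  using al_bounds be_bounds by (simp add: Th_def)

text \<open>Add \<open>al_add\<close>, \<open>be_add\<close> and \<open>vertex_angles\<close>; since
  the angles of the comparison triangle \<open>s, t, u\<close> add up to at least \<open>pi\<close>,
  they cancel in the right direction. This is where \<open>K \<ge> 0\<close> matters.\<close>

lemma Th_superadd:
  assumes "s < t" "t < u" "u - s < Lam"
  shows "Th s t + Th t u \<le> Th s u"
  using al_add[OF assms] be_add[OF assms] vertex_angles[OF assms] A_sum[of t s u s u] assms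
  by (auto simp: Th_def A_commute)

lemma Th_mono:
  assumes "s \<le> s'" "s' < t'" "t' \<le> t" "t - s < Lam"
  shows "Th s' t' \<le> Th s t"
proof -
  have "Th s' t' \<le> Th s t'"
    using Th_superadd[of s s' t'] Th_nonneg[of s s'] assms by (cases "s = s'") auto
  also have "\<dots> \<le> Th s t" using Th_superadd[of s t' t] Th_nonneg[of t' t] assms by (cases "t = t'") auto
  finally show ?thesis .
qed

lemma d_lipschitz: "\<bar>d x y - d x' y'\<bar> \<le> \<bar>x - x'\<bar> + \<bar>y - y'\<bar>"
  using d_tri[of x y x'] d_tri[of x' y y'] d_tri[of x' y' x] d_tri[of x y' y] d_le[of x x'] d_le[of y y'] d_sym
  by (smt (verit))

lemma continuous_d: "continuous_on S f \<Longrightarrow> continuous_on S g \<Longrightarrow> continuous_on S (\<lambda>x. d (f x) (g x))"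
proof -
  have "continuous_on UNIV (\<lambda>p. d (fst p) (snd p))"
    unfolding continuous_on_def
  proof
    fix p :: "real \<times> real"
    have "((\<lambda>q. \<bar>fst q - fst p\<bar> + \<bar>snd q - snd p\<bar>) \<longlongrightarrow> \<bar>fst p - fst p\<bar> + \<bar>snd p - snd p\<bar>) (at p)"
      by (intro tendsto_intros)
    then have lim: "((\<lambda>q. \<bar>fst q - fst p\<bar> + \<bar>snd q - snd p\<bar>) \<longlongrightarrow> 0) (at p)" by simp
    have "((\<lambda>q. d (fst q) (snd q) - d (fst p) (snd p)) \<longlongrightarrow> 0) (at p)"
    proof (rule Lim_null_comparison[OF _ lim], rule always_eventually, rule allI)
      fix q show "norm (d (fst q) (snd q) - d (fst p) (snd p)) \<le> \<bar>fst q - fst p\<bar> + \<bar>snd q - snd p\<bar>"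
        using d_lipschitz[of "fst q" "snd q" "fst p" "snd p"] by simp
    qed
    then show "((\<lambda>q. d (fst q) (snd q)) \<longlongrightarrow> d (fst p) (snd p)) (at p)" by (simp add: LIM_zero_iff)
  qed
  moreover assume "continuous_on S f" "continuous_on S g"
  ultimately show ?thesis using continuous_on_compose2[of UNIV "\<lambda>p. d (fst p) (snd p)" S "\<lambda>x. (f x, g x)"]
    by (auto intro: continuous_on_Pair)
qed

lemma continuous_A:
  assumes "continuous_on S f" "continuous_on S g" "continuous_on S h"
    and "\<And>x. x \<in> S \<Longrightarrow> \<exists>a b. {f x, g x, h x} \<subseteq> {a..b} \<and> b - a < Lam \<and> f x \<noteq> g x \<and> f x \<noteq> h x"
  shows "continuous_on S (\<lambda>x. A (f x) (g x) (h x))"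
proof -
  have m: "continuous_on S (\<lambda>x. md (F x))" "continuous_on S (\<lambda>x. sn (F x))" if "continuous_on S F" for F
    using continuous_on_compose2[OF continuous_mdK[OF K] that] continuous_on_compose2[OF continuous_snK[OF K] that] by auto
  note dd = continuous_d[OF assms(1,2)] continuous_d[OF assms(1,3)] continuous_d[OF assms(2,3)]
  have ne: "sn (d (f x) (g x)) \<noteq> 0 \<and> sn (d (f x) (h x)) \<noteq> 0" if xS: "x \<in> S" for x
  proof -
    obtain a b where ab: "{f x, g x, h x} \<subseteq> {a..b}" "b - a < Lam" "f x \<noteq> g x" "f x \<noteq> h x"
      using assms(4)[OF xS] by blast
    then have "\<bar>f x - g x\<bar> < Lam" "\<bar>f x - h x\<bar> < Lam" by (simp_all add: abs_real_def)
    then show ?thesis using sn_d_pos[of "f x" "g x"] sn_d_pos[of "f x" "h x"] ab by simp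
  qed
  show ?thesis
    unfolding ang3_def cmp_angle_eq[OF K]
  proof (rule continuous_on_arccos)
    show "continuous_on S (\<lambda>x. (md (d (f x) (g x)) + md (d (f x) (h x)) - K * md (d (f x) (g x)) * md (d (f x) (h x)) - md (d (g x) (h x))) /
           (sn (d (f x) (g x)) * sn (d (f x) (h x))))"
      by (intro continuous_intros m dd) (use ne in auto)
    show "\<forall>x\<in>S. - 1 \<le> (md (d (f x) (g x)) + md (d (f x) (h x)) - K * md (d (f x) (g x)) * md (d (f x) (h x)) - md (d (g x) (h x))) /
           (sn (d (f x) (g x)) * sn (d (f x) (h x))) \<and>
       (md (d (f x) (g x)) + md (d (f x) (h x)) - K * md (d (f x) (g x)) * md (d (f x) (h x)) - md (d (g x) (h x))) /
           (sn (d (f x) (g x)) * sn (d (f x) (h x))) \<le> 1"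
    proof
      fix x assume x: "x \<in> S"
      then obtain a b where ab: "{f x, g x, h x} \<subseteq> {a..b}" "b - a < Lam" "f x \<noteq> g x" "f x \<noteq> h x"
        using assms(4) by blast
      have "(md (d (f x) (g x)) + md (d (f x) (h x)) - K * md (d (f x) (g x)) * md (d (f x) (h x)) - md (d (g x) (h x))) /
           (sn (d (f x) (g x)) * sn (d (f x) (h x))) = cos (A (f x) (g x) (h x))"
        using ne[OF x] A_cos[OF ab] by (simp add: field_simps)
      then show "- 1 \<le> (md (d (f x) (g x)) + md (d (f x) (h x)) - K * md (d (f x) (g x)) * md (d (f x) (h x)) - md (d (g x) (h x))) /
           (sn (d (f x) (g x)) * sn (d (f x) (h x))) \<and>
       (md (d (f x) (g x)) + md (d (f x) (h x)) - K * md (d (f x) (g x)) * md (d (f x) (h x)) - md (d (g x) (h x))) /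
           (sn (d (f x) (g x)) * sn (d (f x) (h x))) \<le> 1" by simp
    qed
  qed
qed

text \<open>Each approximating angle with fixed \<open>h\<close> is continuous in both endpoints,
  and \<open>al\<close> is their supremum.\<close>

lemma al_lsc:
  assumes st: "s < t" "t - s < Lam" and c: "c < al s t"
  shows "\<forall>\<^sub>F p in nhds (s, t). c < al (fst p) (snd p)"
proof -
  obtain h where h: "h \<in> {0<..<t - s}" "c < A s (s + h) t"
    using c unfolding start_angle_def using less_cSUP_iff[OF _ al_bdd[OF st]] st by auto
  let ?S = "{p :: real \<times> real. fst p + h < snd p \<and> snd p - fst p < Lam}"
  have op: "open ?S" by (intro open_Collect_conj open_Collect_less continuous_intros)
  have "continuous_on ?S (\<lambda>p. A (fst p) (fst p + h) (snd p))"
  proof (intro continuous_A continuous_intros)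
    fix p assume "p \<in> ?S"
    then show "\<exists>a b. {fst p, fst p + h, snd p} \<subseteq> {a..b} \<and> b - a < Lam \<and> fst p \<noteq> fst p + h \<and> fst p \<noteq> snd p"
      using h by (intro exI[of _ "fst p"] exI[of _ "snd p"]) auto
  qed
  moreover have "(s, t) \<in> ?S" using h st by auto
  ultimately have "isCont (\<lambda>p. A (fst p) (fst p + h) (snd p)) (s, t)"
    using op by (simp add: continuous_on_eq_continuous_at)
  from tendsto_at_iff_tendsto_nhds[THEN iffD1, OF this[unfolded isCont_def]]
  have "((\<lambda>p. A (fst p) (fst p + h) (snd p)) \<longlongrightarrow> A s (s + h) t) (nhds (s, t))" by simp
  then have "\<forall>\<^sub>F p in nhds (s, t). c < A (fst p) (fst p + h) (snd p)" using h order_tendstoD(1) by fastforce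
  moreover have "\<forall>\<^sub>F p in nhds (s, t). p \<in> ?S" by (rule eventually_nhds_in_open[OF op \<open>(s, t) \<in> ?S\<close>])
  ultimately show ?thesis
  proof eventually_elim
    case (elim p)
    then have "A (fst p) (fst p + h) (snd p) \<le> al (fst p) (snd p)" using h by (intro al_upper) auto
    then show ?case using elim by simp
  qed
qed

lemma be_lsc:
  assumes st: "s < t" "t - s < Lam" and c: "c < be s t"
  shows "\<forall>\<^sub>F p in nhds (s, t). c < be (fst p) (snd p)"
proof -
  have "\<forall>\<^sub>F p in nhds (- t, - s). c < start_angle K (\<lambda>x y. d (- x) (- y)) (fst p) (snd p)"
    by (rule convex_arc.al_lsc[OF rev]) (use assms in \<open>auto simp: be_rev\<close>)
  moreover have "((\<lambda>p. (- snd p, - fst p)) \<longlongrightarrow> (- t, - s)) (nhds (s, t))"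
    using filterlim_ident[of "nhds (s, t)"] by (auto intro!: tendsto_eq_intros)
  ultimately have "\<forall>\<^sub>F p in nhds (s, t). c < start_angle K (\<lambda>x y. d (- x) (- y)) (- snd p) (- fst p)"
    using eventually_compose_filterlim by fastforce
  then show ?thesis by (simp add: be_rev)
qed

end

section \<open>Superadditive interval functions\<close>

text \<open>Induction splits off the rightmost interval; the gaps are absorbed because
  \<open>\<Phi>\<close> is nonnegative.\<close>

lemma superadditive_disjoint_sum:
  fixes \<Phi> :: "real \<Rightarrow> real \<Rightarrow> real" and u v :: "'i \<Rightarrow> real"
  assumes nn: "\<And>a b. x \<le> a \<Longrightarrow> a < b \<Longrightarrow> b \<le> z \<Longrightarrow> 0 \<le> \<Phi> a b"
    and sa: "\<And>a b c. x \<le> a \<Longrightarrow> a < b \<Longrightarrow> b < c \<Longrightarrow> c \<le> z \<Longrightarrow> \<Phi> a b + \<Phi> b c \<le> \<Phi> a c"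
    and fin: "finite F"
  shows "x < y \<Longrightarrow> y \<le> z \<Longrightarrow> (\<And>i. i \<in> F \<Longrightarrow> x < u i \<and> u i < v i \<and> v i < y) \<Longrightarrow>
    pairwise (\<lambda>i j. {u i..v i} \<inter> {u j..v j} = {}) F \<Longrightarrow> (\<Sum>i\<in>F. \<Phi> (u i) (v i)) \<le> \<Phi> x y"
  using fin
proof (induction "card F" arbitrary: F y)
  case 0
  then show ?case using nn[of x y] by simp
next
  case (Suc n)
  then have ne: "F \<noteq> {}" "finite F" by auto
  have "Max (u ` F) \<in> u ` F" using ne by (intro Max_in) auto
  then obtain i where i0: "i \<in> F" "u i = Max (u ` F)" by auto
  have i: "i \<in> F" "\<And>j. j \<in> F \<Longrightarrow> u j \<le> u i" using i0 ne by auto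
  have iu: "x < u i" "u i < v i" "v i < y" using Suc.prems(3) i by auto
  have "(\<Sum>j\<in>F - {i}. \<Phi> (u j) (v j)) \<le> \<Phi> x (u i)"
  proof (rule Suc.hyps(1))
    show "n = card (F - {i})" using Suc.hyps(2) i ne by simp
    show "x < u i" "u i \<le> z" using iu Suc.prems by auto
    show "x < u j \<and> u j < v j \<and> v j < u i" if "j \<in> F - {i}" for j
    proof -
      have "{u j..v j} \<inter> {u i..v i} = {}" using pairwiseD[OF Suc.prems(4), of j i] that i(1) by blast
      moreover have "u j \<le> u i" "u j < v j" "x < u j" using i(2) that Suc.prems(3) by auto
      ultimately have "v j < u i"
        using iu by (metis Int_iff atLeastAtMost_iff empty_iff less_imp_le not_le order_refl)
      then show ?thesis using Suc.prems(3) that by auto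
    qed
    show "pairwise (\<lambda>i j. {u i..v i} \<inter> {u j..v j} = {}) (F - {i})" using Suc.prems(4) by (rule pairwise_subset) auto
    show "finite (F - {i})" using ne by simp
  qed
  then have "(\<Sum>j\<in>F. \<Phi> (u j) (v j)) \<le> \<Phi> x (u i) + \<Phi> (u i) (v i)"
    using sum.remove[OF ne(2) i(1), of "\<lambda>j. \<Phi> (u j) (v j)"] by simp
  also have "\<dots> \<le> \<Phi> x (v i)" using sa[of x "u i" "v i"] iu Suc.prems by simp
  also have "\<dots> \<le> \<Phi> x y" using sa[of x "v i" y] nn[of "v i" y] iu Suc.prems by simp
  finally show ?case .
qed

text \<open>A disjoint Vitali subfamily exhausts the interval up to a null set, and on each finite
  part of it superadditivity bounds \<open>k\<close> times the total length by
  \<open>\<Phi> x y\<close>.\<close>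

lemma superadditive_Vitali:
  fixes \<Phi> :: "real \<Rightarrow> real \<Rightarrow> real"
  assumes xy: "x < y"
    and nn: "\<And>a b. x \<le> a \<Longrightarrow> a < b \<Longrightarrow> b \<le> y \<Longrightarrow> 0 \<le> \<Phi> a b"
    and sa: "\<And>a b c. x \<le> a \<Longrightarrow> a < b \<Longrightarrow> b < c \<Longrightarrow> c \<le> y \<Longrightarrow> \<Phi> a b + \<Phi> b c \<le> \<Phi> a c"
    and k: "0 < k" and N: "negligible N"
    and cov: "\<And>s \<delta>. s \<in> {x<..<y} - N \<Longrightarrow> 0 < \<delta> \<Longrightarrow> \<exists>a b. a \<le> s \<and> s \<le> b \<and> a < b \<and> b - a < \<delta> \<and> k * (b - a) \<le> \<Phi> a b"
  shows "k * (y - x) \<le> \<Phi> x y"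
proof -
  \<comment> \<open>An interval is stored as midpoint and radius, since the covering theorem is
    about balls. The covering condition permits intervals not centred at \<open>s\<close>; it is
    enough that \<open>s\<close> lies in the ball.\<close>
  define I where "I = {i :: real \<times> real. 0 < snd i \<and> x < fst i - snd i \<and> fst i + snd i < y \<and>
     k * (2 * snd i) \<le> \<Phi> (fst i - snd i) (fst i + snd i)}"
  have "\<exists>i. i \<in> I \<and> s \<in> cball (fst i) (snd i) \<and> snd i < \<delta>" if s: "s \<in> {x<..<y} - N" "0 < \<delta>" for s \<delta>
  proof -
    have "0 < min \<delta> (min (s - x) (y - s))" using s by auto
    then obtain a b where ab: "a \<le> s" "s \<le> b" "a < b" "b - a < min \<delta> (min (s - x) (y - s))" "k * (b - a) \<le> \<Phi> a b"
      using cov[OF s(1)] by blast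
    have e: "(a + b) / 2 - (b - a) / 2 = a" "(a + b) / 2 + (b - a) / 2 = b" by (simp_all add: field_simps)
    show ?thesis
      by (rule exI[of _ "((a + b) / 2, (b - a) / 2)"])
        (use ab e in \<open>auto simp: I_def dist_real_def abs_real_def field_simps\<close>)
  qed
  then obtain C where C: "countable C" "C \<subseteq> I"
     "pairwise (\<lambda>i j. disjnt (cball (fst i) (snd i)) (cball (fst j) (snd j))) C"
     "negligible (({x<..<y} - N) - (\<Union>i \<in> C. cball (fst i) (snd i)))"
    using Vitali_covering_theorem_cballs[of I snd "{x<..<y} - N" fst] by (auto simp: I_def)
  have bound: "measure lebesgue (\<Union>i\<in>F. cball (fst i) (snd i)) \<le> \<Phi> x y / k" if F: "F \<subseteq> C" "finite F" for F
  proof -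
    have "k * measure lebesgue (\<Union>i\<in>F. cball (fst i) (snd i)) \<le> k * (\<Sum>i\<in>F. measure lebesgue (cball (fst i) (snd i)))"
      using k F by (intro mult_left_mono measure_UNION_le) auto
    also have "\<dots> = (\<Sum>i\<in>F. k * (2 * snd i))"
      unfolding sum_distrib_left using F C(2) by (intro sum.cong) (auto simp: I_def cball_eq_atLeastAtMost)
    also have "\<dots> \<le> (\<Sum>i\<in>F. \<Phi> (fst i - snd i) (fst i + snd i))"
      using F C(2) by (intro sum_mono) (auto simp: I_def)
    also have "\<dots> \<le> \<Phi> x y"
    proof (rule superadditive_disjoint_sum[where z = y, OF nn sa F(2)])
      show "x < fst i - snd i \<and> fst i - snd i < fst i + snd i \<and> fst i + snd i < y" if "i \<in> F" for i
        using that F C(2) by (auto simp: I_def)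
      show "pairwise (\<lambda>i j. {fst i - snd i..fst i + snd i} \<inter> {fst j - snd j..fst j + snd j} = {}) F"
        using pairwise_subset[OF C(3) F(1)] by (simp add: disjnt_def cball_eq_atLeastAtMost)
    qed (use xy in auto)
    finally show ?thesis using k by (simp add: field_simps)
  qed
  let ?U = "\<Union>i\<in>C. cball (fst i) (snd i)"
  have U: "?U \<in> lmeasurable" "measure lebesgue ?U \<le> \<Phi> x y / k"
    using fmeasurable_UN_bound[OF C(1) _ bound] measure_UN_bound[OF C(1) _ bound] by auto
  let ?Z = "N \<union> (({x<..<y} - N) - ?U)"
  have Z: "negligible ?Z" using N C(4) by (rule negligible_Un)
  have "y - x = measure lebesgue {x<..<y}" using xy by simp
  also have "\<dots> \<le> measure lebesgue (?U \<union> ?Z)"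
    using U Z by (intro measure_mono_fmeasurable) (auto simp: negligible_iff_measure)
  also have "\<dots> \<le> measure lebesgue ?U + measure lebesgue ?Z"
    using U Z by (intro measure_Un_le) (auto simp: negligible_iff_measure fmeasurableD)
  also have "\<dots> \<le> \<Phi> x y / k" using U(2) Z by (simp add: negligible_imp_measure0)
  finally show ?thesis using k by (simp add: field_simps)
qed

text \<open>A weak substitute for the Lebesgue density theorem.\<close>
lemma nonporous_point:
  fixes E N :: "real set"
  assumes E: "closed E" and pos: "\<not> negligible (E \<inter> {x<..<y})" and N: "negligible N" and c: "0 < c" "c < 1"
  shows "\<exists>s\<in>E \<inter> {x<..<y} - N. \<exists>\<delta>>0. \<forall>a b a' b'. a \<le> s \<and> s \<le> b \<and> b - a < \<delta> \<and> a \<le> a' \<and> a' < b' \<and> b' \<le> b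
     \<and> c * (b - a) \<le> b' - a' \<longrightarrow> (\<exists>u\<in>E. a' \<le> u \<and> u \<le> b')"
proof (rule ccontr)
  assume neg: "\<not> ?thesis"
  define P where "P = E \<inter> {x<..<y}"
  have "E \<in> sets lebesgue" using borel_closed[OF E] by (intro sets_completionI_sets) simp
  then have Pm: "P \<in> lmeasurable" unfolding P_def
    using fmeasurable_Int_fmeasurable[of "{x<..<y}" lebesgue E] by (simp add: Int_commute)
  define \<mu> where "\<mu> = measure lebesgue P"
  have \<mu>: "0 < \<mu>" using pos Pm unfolding \<mu>_def P_def[symmetric]
    by (metis negligible_iff_measure measure_nonneg order_le_less)
  \<comment> \<open>If the claim failed, Vitali balls inside \<open>U\<close> would cover almost all
    of \<open>P\<close>, each with a gap of relative size \<open>c\<close>. That gives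
    \<open>\<mu> \<le> (1 - c) (1 + c) \<mu>\<close>, so the excess of \<open>U\<close> over
    \<open>P\<close> must be below \<open>c \<mu>\<close>.\<close>
  obtain U where U: "open U" "P \<subseteq> U" "U - P \<in> lmeasurable" "emeasure lebesgue (U - P) < ennreal (c * \<mu>)"
    using sets_lebesgue_outer_open[of P "c * \<mu>"] Pm \<mu> c by (auto simp: fmeasurableD)
  have UU: "U = P \<union> (U - P)" using U by auto
  have Um: "U \<in> lmeasurable" using fmeasurable.Un[OF Pm U(3)] UU by simp
  have "measure lebesgue (U - P) < c * \<mu>"
    using U(4) emeasure_eq_measure2[OF U(3)] \<mu> c by (simp add: ennreal_less_iff)
  then have mU: "measure lebesgue U \<le> (1 + c) * \<mu>"
    using measure_Un_le[of P lebesgue "U - P"] Pm U(3) UU by (simp add: fmeasurableD \<mu>_def algebra_simps)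
  have neg': "\<exists>a b a' b'. (a \<le> s \<and> s \<le> b \<and> b - a < \<delta> \<and> a \<le> a' \<and> a' < b' \<and> b' \<le> b
     \<and> c * (b - a) \<le> b' - a') \<and> \<not> (\<exists>u\<in>E. a' \<le> u \<and> u \<le> b')" if s: "s \<in> P - N" and \<delta>: "0 < \<delta>" for s \<delta>
  proof (rule ccontr)
    assume "\<not> ?thesis"
    then have "\<forall>a b a' b'. a \<le> s \<and> s \<le> b \<and> b - a < \<delta> \<and> a \<le> a' \<and> a' < b' \<and> b' \<le> b
     \<and> c * (b - a) \<le> b' - a' \<longrightarrow> (\<exists>u\<in>E. a' \<le> u \<and> u \<le> b')" by blast
    then show False using neg s \<delta> unfolding P_def by blast
  qed
  define I where "I = {i :: real \<times> real. 0 < snd i \<and> cball (fst i) (snd i) \<subseteq> U \<and>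
    (\<exists>a' b'. fst i - snd i \<le> a' \<and> a' < b' \<and> b' \<le> fst i + snd i \<and> c * (2 * snd i) \<le> b' - a' \<and> E \<inter> {a'..b'} = {})}"
  have cov: "\<exists>i. i \<in> I \<and> s \<in> cball (fst i) (snd i) \<and> snd i < \<delta>" if s: "s \<in> P - N" "0 < \<delta>" for s \<delta>
  proof -
    obtain \<epsilon> where eps: "0 < \<epsilon>" "ball s \<epsilon> \<subseteq> U" using U s by (meson DiffD1 openE subsetD)
    have "0 < min \<delta> \<epsilon>" using eps s by simp
    then obtain a b a' b' where ab: "a \<le> s" "s \<le> b" "b - a < min \<delta> \<epsilon>" "a \<le> a'" "a' < b'" "b' \<le> b"
      "c * (b - a) \<le> b' - a'" "\<not> (\<exists>u\<in>E. a' \<le> u \<and> u \<le> b')"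
      using neg'[OF s(1)] by blast
    have e: "(a + b) / 2 - (b - a) / 2 = a" "(a + b) / 2 + (b - a) / 2 = b" by (simp_all add: field_simps)
    have "{a..b} \<subseteq> ball s \<epsilon>" using ab by (auto simp: dist_real_def)
    then have "cball ((a + b) / 2) ((b - a) / 2) \<subseteq> U" using eps by (simp add: cball_eq_atLeastAtMost e)
    moreover have "E \<inter> {a'..b'} = {}" using ab by auto
    moreover have "a < b" using ab by simp
    moreover have e2: "2 * ((b - a) / 2) = b - a" by simp
    have "c * (2 * ((b - a) / 2)) \<le> b' - a'" unfolding e2 by (rule ab(7))
    moreover note this
    ultimately have "((a + b) / 2, (b - a) / 2) \<in> I"
      unfolding I_def mem_Collect_eq fst_conv snd_conv e using ab(4-6)
      by (intro conjI exI[of _ a'] exI[of _ b']) simp_all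
    moreover have "s \<in> cball ((a + b) / 2) ((b - a) / 2)" using ab by (simp add: cball_eq_atLeastAtMost e)
    moreover have "(b - a) / 2 < \<delta>" using ab by auto
    ultimately show ?thesis by (intro exI[of _ "((a + b) / 2, (b - a) / 2)"]) simp
  qed
  have r: "0 < snd i" if "i \<in> I" for i using that by (simp add: I_def)
  obtain C where C: "countable C" "C \<subseteq> I"
     "pairwise (\<lambda>i j. disjnt (cball (fst i) (snd i)) (cball (fst j) (snd j))) C"
     "negligible ((P - N) - (\<Union>i \<in> C. cball (fst i) (snd i)))"
    using Vitali_covering_theorem_cballs[of I snd "P - N" fst, OF r cov] by blast
  have one: "measure lebesgue (P \<inter> cball (fst i) (snd i)) \<le> (1 - c) * measure lebesgue (cball (fst i) (snd i))"
    if iC: "i \<in> C" for i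
  proof -
    obtain a' b' where g: "0 < snd i" "fst i - snd i \<le> a'" "a' < b'" "b' \<le> fst i + snd i" "c * (2 * snd i) \<le> b' - a'" "E \<inter> {a'..b'} = {}"
      using subsetD[OF C(2) iC] unfolding I_def mem_Collect_eq by blast
    have "measure lebesgue (P \<inter> cball (fst i) (snd i)) \<le> measure lebesgue ({fst i - snd i..fst i + snd i} - {a'..b'})"
      using g Pm by (intro measure_mono_fmeasurable) (auto simp: P_def cball_eq_atLeastAtMost fmeasurableD)
    also have "\<dots> = measure lebesgue {fst i - snd i..fst i + snd i} - measure lebesgue {a'..b'}"
      using g by (intro measurable_measure_Diff) auto
    also have "\<dots> \<le> (1 - c) * measure lebesgue (cball (fst i) (snd i))"
      using g by (simp add: cball_eq_atLeastAtMost algebra_simps)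
    finally show ?thesis .
  qed
  have bound: "measure lebesgue (\<Union>i\<in>F. P \<inter> cball (fst i) (snd i)) \<le> (1 - c) * ((1 + c) * \<mu>)" if F: "F \<subseteq> C" "finite F" for F
  proof -
    have "measure lebesgue (\<Union>i\<in>F. P \<inter> cball (fst i) (snd i)) \<le> (\<Sum>i\<in>F. measure lebesgue (P \<inter> cball (fst i) (snd i)))"
      using F Pm by (intro measure_UNION_le) (auto simp: fmeasurableD)
    also have "\<dots> \<le> (\<Sum>i\<in>F. (1 - c) * measure lebesgue (cball (fst i) (snd i)))"
      using F one by (intro sum_mono) auto
    also have "\<dots> = (1 - c) * (\<Sum>i\<in>F. measure lebesgue (cball (fst i) (snd i)))" by (simp add: sum_distrib_left)
    also have "(\<Sum>i\<in>F. measure lebesgue (cball (fst i) (snd i))) = measure lebesgue (\<Union>i\<in>F. cball (fst i) (snd i))"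
    proof (rule measure_UNION_AE[symmetric, OF F(2)])
      show "pairwise (\<lambda>i j. AE x in lebesgue. x \<notin> cball (fst i) (snd i) \<or> x \<notin> cball (fst j) (snd j)) F"
        using pairwise_subset[OF C(3) F(1)] by (rule pairwise_mono) (auto simp: disjnt_def intro!: AE_I2)
    qed auto
    also have "\<dots> \<le> measure lebesgue U"
      using F C(2) Um by (intro measure_mono_fmeasurable) (auto simp: I_def)
    finally show ?thesis using mU c by (meson diff_ge_0_iff_ge less_imp_le mult_left_mono order_trans)
  qed
  let ?V = "\<Union>i\<in>C. P \<inter> cball (fst i) (snd i)"
  have fm: "P \<inter> cball (fst i) (snd i) \<in> lmeasurable" for i using Pm by (rule fmeasurable_Int_fmeasurable) auto
  have V: "?V \<in> lmeasurable" "measure lebesgue ?V \<le> (1 - c) * ((1 + c) * \<mu>)"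
    using fmeasurable_UN_bound[OF C(1) fm bound] measure_UN_bound[OF C(1) fm bound] by auto
  let ?Z = "N \<union> ((P - N) - (\<Union>i \<in> C. cball (fst i) (snd i)))"
  have Z: "negligible ?Z" using N C(4) by (rule negligible_Un)
  have "\<mu> \<le> measure lebesgue (?V \<union> ?Z)" unfolding \<mu>_def
    using V Z Pm by (intro measure_mono_fmeasurable) (auto simp: negligible_iff_measure fmeasurableD)
  also have "\<dots> \<le> measure lebesgue ?V + measure lebesgue ?Z"
    using V Z by (intro measure_Un_le) (auto simp: negligible_iff_measure fmeasurableD)
  also have "\<dots> \<le> (1 - c) * ((1 + c) * \<mu>)" using V(2) Z by (simp add: negligible_imp_measure0)
  also have "\<dots> = \<mu> - c * c * \<mu>" by (simp add: algebra_simps)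
  also have "\<dots> < \<mu>" using c \<mu> by simp
  finally show False by simp
qed

section \<open>First variation of the chord\<close>

lemma mdK_deriv:
  assumes "0 \<le> K" shows "(mdK K has_real_derivative snK K x) (at x within S)"
proof (cases "K = 0")
  case True
  have "((\<lambda>x. x\<^sup>2 / 2) has_real_derivative x) (at x within S)" by (auto intro!: derivative_eq_intros)
  then show ?thesis using True by (simp add: mdK_def[abs_def] snK_def)
next
  case False
  have s: "sqrt K * sqrt K = K" "sqrt K \<noteq> 0" using assms False by auto
  have "((\<lambda>x. (1 - cos (sqrt K * x)) / K) has_real_derivative sin (sqrt K * x) * sqrt K / K) (at x within S)"
    using False by (auto intro!: derivative_eq_intros)
  moreover have "sin (sqrt K * x) * sqrt K / K = sin (sqrt K * x) / sqrt K"
    using s False by (simp add: field_simps)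
  ultimately show ?thesis using False by (simp add: mdK_def[abs_def] snK_def)
qed

lemma snK_deriv:
  assumes "0 \<le> K" shows "(snK K has_real_derivative csK K x) (at x within S)"
proof (cases "K = 0")
  case True
  then show ?thesis by (simp add: snK_def[abs_def] csK_def)
next
  case False
  have "((\<lambda>x. sin (sqrt K * x) / sqrt K) has_real_derivative cos (sqrt K * x) * sqrt K / sqrt K) (at x within S)"
    by (rule DERIV_cdivide) (auto intro!: derivative_eq_intros)
  then show ?thesis using False assms by (simp add: snK_def[abs_def] csK_def)
qed

lemma mdK_convex:
  assumes K: "0 \<le> K" and a: "sqrt K * a \<le> pi / 2" shows "convex_on {-a..a} (mdK K)"
proof (rule f''_ge0_imp_convex[where f' = "snK K" and f'' = "csK K"])
  fix x assume x: "x \<in> {-a..a}"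
  show "(mdK K has_real_derivative snK K x) (at x)" "(snK K has_real_derivative csK K x) (at x)"
    using mdK_deriv[OF K] snK_deriv[OF K] by auto
  have "sqrt K * x \<le> sqrt K * a" "sqrt K * (- x) \<le> sqrt K * a" using x K by (intro mult_left_mono; simp)+
  then have "sqrt K * x \<le> pi / 2" "- (pi / 2) \<le> sqrt K * x" using a by auto
  then show "0 \<le> csK K x" unfolding csK_def by (intro cos_ge_zero) auto
qed simp

context convex_arc
begin

lemma md_law:
  assumes "s < x" "x < t" "t - s < Lam"
  shows "md (d s x) = md (d s t) * (1 - K * md (d x t)) + md (d x t) - sn (d s t) * sn (d x t) * cos (A t s x)"
  using A_cos[of t s x s t] assms by (simp add: d_sym algebra_simps)

lemma A_same:
  assumes "v \<noteq> x" "\<bar>v - x\<bar> < Lam" shows "A v x x = 0"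
  using cmp_angle_zero[OF K d_pos[OF assms] order_refl Kd_lt[OF assms(2)]] by (simp add: ang3_def)

text \<open>The turning angle \<open>om\<close> at \<open>x\<close> is at most \<open>Th s y\<close>
  because the triangle has angle sum at least \<open>pi\<close>. In the plane the projection of the
  broken line onto its first side would give the bound; on the sphere convexity of \<open>md\<close>
  does.\<close>

lemma chord_step:
  assumes "s < x" "x < y" "y - s < Lam" and small: "sqrt K * (y - s) \<le> pi / 2" and Th: "Th s y \<le> pi / 2"
  shows "d s x + d x y * cos (Th s y) \<le> d s y"
proof -
  define om where "om = pi - A x s y"
  have b: "0 \<le> A x s y" "A x s y \<le> pi" using A_bounds[of x s y s y] assms by auto
  have "pi \<le> A x s y + A s x y + A y x s" using A_sum[of x s y s y] assms by auto
  moreover have "A s x y \<le> al s y" "A y s x \<le> be s y" using al_upper be_upper assms by auto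
  ultimately have om: "0 \<le> om" "om \<le> Th s y" using b by (auto simp: om_def Th_def A_commute)
  define c where "c = cos om"
  have c: "cos (Th s y) \<le> c" "c \<le> 1" unfolding c_def using om Th by (auto intro!: cos_monotone_0_pi_le)
  have c0: "0 \<le> c" unfolding c_def using om Th by (intro cos_ge_zero) auto
  define r D where "r = d s x" and "D = d x y"
  have rD: "0 < r" "0 < D" "r + D \<le> y - s"
    using d_pos[of s x] d_pos[of x y] d_le[of s x] d_le[of x y] assms by (auto simp: r_def D_def)
  have Kr: "sqrt K * (r + D) \<le> pi / 2" using mult_left_mono[OF rD(3), of "sqrt K"] K small by simp
  have law: "md (d s y) = md r + md D - K * md r * md D + sn r * sn D * c"
    using A_cos[of x s y s y] assms by (simp add: c_def om_def r_def D_def d_sym algebra_simps)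
  \<comment> \<open>The law of cosines makes \<open>md (d s y)\<close> the average of
    \<open>md (r + D)\<close> and \<open>md (r - D)\<close> with weights \<open>(1 + c) / 2\<close>
    and \<open>(1 - c) / 2\<close>, and \<open>r + D c\<close> is the same average of the
    arguments.\<close>
  have "md (((1 + c) / 2) *\<^sub>R (r + D) + (1 - (1 + c) / 2) *\<^sub>R (r - D)) \<le> (1 + c) / 2 * md (r + D) + (1 - (1 + c) / 2) * md (r - D)"
    using mdK_convex[OF K Kr] rD c c0 unfolding convex_on_alt
    by (elim conjE ballE[of _ _ "r + D"] ballE[of _ _ "r - D"] allE[of _ "(1 + c) / 2"]) auto
  also have "((1 + c) / 2) *\<^sub>R (r + D) + (1 - (1 + c) / 2) *\<^sub>R (r - D) = r + D * c" by (simp add: field_simps)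
  also have "(1 + c) / 2 * md (r + D) + (1 - (1 + c) / 2) * md (r - D) = md (d s y)"
    unfolding law mdK_add[OF K] mdK_diff[OF K] by (simp add: field_simps)
  finally have le: "md (r + D * c) \<le> md (d s y)" .
  have Dc: "D * c \<le> D" using rD c by (simp add: mult_le_cancel_left1)
  have "r + D * c \<le> d s y"
  proof (rule ccontr)
    assume "\<not> ?thesis"
    then have "d s y < r + D * c" by simp
    moreover have "sqrt K * (r + D * c) \<le> sqrt K * (r + D)" using Dc K by (intro mult_left_mono) auto
    ultimately have "md (d s y) < md (r + D * c)"
      using Kr pi_gt_zero d_nonneg[of s y] by (intro mdK_strict_mono[OF K]) linarith+
    then show False using le by simp
  qed
  moreover have "D * cos (Th s y) \<le> D * c" using c rD by (intro mult_left_mono) auto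
  ultimately show ?thesis by (simp add: r_def D_def)
qed

text \<open>Summing \<open>chord_step\<close> over a partition whose polygon has almost the full
  length: an arc that turns little is almost as short as its chord.\<close>

lemma chord_lower:
  assumes st: "s < t" "t - s < Lam" and small: "sqrt K * (t - s) \<le> pi / 2" and Th: "Th s t \<le> pi / 2"
  shows "(t - s) * cos (Th s t) \<le> d s t"
proof -
  have Th0: "0 \<le> Th s t" using Th_nonneg st by simp
  have c0: "0 \<le> cos (Th s t)" using Th0 Th by (intro cos_ge_zero) auto
  have eps: "cos (Th s t) * (t - s - e) \<le> d s t" if e: "0 < e" for e
  proof -
    obtain n :: nat and u where u: "u 0 = s" "u n = t" "\<forall>i<n. u i \<le> u (Suc i)"
      "t - s - e < (\<Sum>i<n. d (u i) (u (Suc i)))" using d_length[OF st e] by blast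
    have mono: "u i \<le> u j" if "i \<le> j" "j \<le> n" for i j
      using that
    proof (induction j rule: dec_induct)
      case (step m) then show ?case using u(3)[rule_format, of m] by simp
    qed simp
    have "i \<le> n \<Longrightarrow> cos (Th s t) * (\<Sum>j<i. d (u j) (u (Suc j))) \<le> d s (u i)" for i
    proof (induction i)
      case 0 then show ?case using u by simp
    next
      case (Suc i)
      define x y where "x = u i" and "y = u (Suc i)"
      have xy: "s \<le> x" "x \<le> y" "y \<le> t" using mono[of 0 i] mono[of i "Suc i"] mono[of "Suc i" n] Suc.prems u by (auto simp: x_def y_def)
      have IH: "cos (Th s t) * (\<Sum>j<i. d (u j) (u (Suc j))) \<le> d s x" using Suc by (simp add: x_def)
      have "d s x + cos (Th s t) * d x y \<le> d s y"
      proof -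
        consider "x = s" | "x = y" | "s < x" "x < y" using xy by linarith
        then show ?thesis
        proof cases
          case 1 then show ?thesis using d_nonneg[of x y] mult_right_mono[of "cos (Th s t)" 1 "d s y"] by simp
        next
          case 2 then show ?thesis by simp
        next
          case 3
          have T: "Th s y \<le> Th s t" using Th_mono[of s s y t] 3 xy st by auto
          have y: "sqrt K * (y - s) \<le> sqrt K * (t - s)" using xy K by (intro mult_left_mono) auto
          have "d s x + d x y * cos (Th s y) \<le> d s y" using 3 xy st small Th T y by (intro chord_step) auto
          moreover have "cos (Th s t) \<le> cos (Th s y)"
            using T Th Th_nonneg[of s y] 3 xy st by (intro cos_monotone_0_pi_le) auto
          then have "cos (Th s t) * d x y \<le> d x y * cos (Th s y)" using d_nonneg[of x y] by (simp add: mult.commute mult_left_mono)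
          ultimately show ?thesis by simp
        qed
      qed
      then show ?case using IH by (simp add: x_def y_def algebra_simps)
    qed
    from this[of n] have "cos (Th s t) * (\<Sum>j<n. d (u j) (u (Suc j))) \<le> d s t" using u by simp
    moreover have "cos (Th s t) * (t - s - e) \<le> cos (Th s t) * (\<Sum>j<n. d (u j) (u (Suc j)))"
      using u(4) c0 by (intro mult_left_mono) auto
    ultimately show ?thesis by simp
  qed
  show ?thesis
  proof (rule field_le_epsilon)
    fix e :: real assume e: "0 < e"
    have "(t - s) * cos (Th s t) \<le> d s t + cos (Th s t) * e" using eps[OF e] by (simp add: algebra_simps)
    also have "cos (Th s t) * e \<le> e" using e by (simp add: mult_le_cancel_right1)
    finally show "(t - s) * cos (Th s t) \<le> d s t + e" by simp
  qed
qed

lemma A_thin_tendsto: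
  assumes "s < t" "t - s < Lam"
  shows "((\<lambda>h. A s (t - h) t) \<longlongrightarrow> 0) (at_right 0)"
proof -
  have "continuous_on {0..(t - s) / 2} (\<lambda>h. A s (t - h) t)"
  proof (intro continuous_A continuous_intros)
    fix h assume "h \<in> {0..(t - s) / 2}"
    then show "\<exists>a b. {s, t - h, t} \<subseteq> {a..b} \<and> b - a < Lam \<and> s \<noteq> t - h \<and> s \<noteq> t"
      using assms by (intro exI[of _ s] exI[of _ t]) auto
  qed
  then have "((\<lambda>h. A s (t - h) t) \<longlongrightarrow> A s (t - 0) t) (at 0 within {0..(t - s) / 2})"
    using assms unfolding continuous_on_def by (elim ballE[of _ _ 0]) auto
  then show ?thesis using assms A_same[of s t] at_within_Icc_at_right[of 0 "(t - s) / 2"] by simp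
qed

text \<open>By \<open>be_add\<close> the end angle of the short arc is the part of
  \<open>be s t\<close> that \<open>A t s (t - h)\<close> has not yet reached. Its start angle is
  controlled at the vertex \<open>t - h\<close>, where lower semicontinuity bounds
  \<open>be s (t - h)\<close> from below. Corners do no harm because the arcs approach
  \<open>t\<close> from one side.\<close>

lemma Th_small:
  assumes st: "s < t" "t - s < Lam" and e: "0 < e"
  shows "\<forall>\<^sub>F h in at_right 0. Th (t - h) t < e"
proof -
  have 1: "\<forall>\<^sub>F h in at_right 0. be s t - e / 3 < A t s (t - h)"
    using order_tendstoD(1)[OF be_tendsto[OF st]] e by simp
  have 2: "\<forall>\<^sub>F h in at_right 0. A s (t - h) t < e / 3"
    using order_tendstoD(2)[OF A_thin_tendsto[OF st], of "e / 3"] e by simp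
  have "((\<lambda>h. (s, t - h)) \<longlongrightarrow> (s, t - 0)) (at_right 0)" by (intro tendsto_intros)
  then have 3: "\<forall>\<^sub>F h in at_right 0. be s t - e / 3 < be (fst (s, t - h)) (snd (s, t - h))"
    using eventually_compose_filterlim[OF be_lsc[OF st, of "be s t - e / 3"], of "\<lambda>h. (s, t - h)" "at_right 0"] e by simp
  have 4: "\<forall>\<^sub>F h in at_right 0. 0 < h \<and> h < t - s"
    unfolding eventually_at_right_field using st by (intro exI[of _ "t - s"]) auto
  show ?thesis using 1 2 3 4
  proof eventually_elim
    case (elim h)
    have "be (t - h) t + A t s (t - h) \<le> be s t" using be_add[of s "t - h" t] elim st by auto
    moreover have "be s (t - h) + A (t - h) s t + al (t - h) t \<le> pi" using vertex_angles[of s "t - h" t] elim st by auto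
    moreover have "pi \<le> A (t - h) s t + A s (t - h) t + A t (t - h) s" using A_sum[of "t - h" s t s t] elim st by auto
    moreover have "A t s (t - h) \<le> be s t" using be_upper[of s "t - h" t] elim st by auto
    ultimately show ?case using elim by (simp add: Th_def A_commute)
  qed
qed

lemma chord_ratio:
  assumes st: "s < t" "t - s < Lam"
  shows "((\<lambda>h. d (t - h) t / h) \<longlongrightarrow> 1) (at_right 0)"
proof -
  have 4: "\<forall>\<^sub>F h in at_right 0. 0 < h \<and> h < t - s"
    unfolding eventually_at_right_field using st by (intro exI[of _ "t - s"]) auto
  have "((\<lambda>h. sqrt K * h) \<longlongrightarrow> sqrt K * 0) (at_right 0)" by (intro tendsto_intros)
  then have 5: "\<forall>\<^sub>F h in at_right 0. sqrt K * h < pi / 2" using order_tendstoD(2)[of _ 0 "at_right 0" "pi / 2"] by simp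
  have Th0: "((\<lambda>h. Th (t - h) t) \<longlongrightarrow> 0) (at_right 0)"
  proof (rule tendstoI)
    fix e :: real assume "0 < e"
    from Th_small[OF st this] 4 show "\<forall>\<^sub>F h in at_right 0. dist (Th (t - h) t) 0 < e"
    proof eventually_elim
      case (elim h) then show ?case using Th_nonneg[of "t - h" t] st by auto
    qed
  qed
  then have lim: "((\<lambda>h. cos (Th (t - h) t)) \<longlongrightarrow> 1) (at_right 0)" using tendsto_cos[OF Th0] by simp
  show ?thesis
  proof (rule tendsto_sandwich[OF _ _ lim tendsto_const])
    show "\<forall>\<^sub>F h in at_right 0. d (t - h) t / h \<le> 1"
      using 4
    proof eventually_elim
      case (elim h) then show ?case using d_le[of "t - h" t] by (simp add: field_simps)
    qed
    show "\<forall>\<^sub>F h in at_right 0. cos (Th (t - h) t) \<le> d (t - h) t / h"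
      using 4 5 Th_small[OF st, of "pi / 2", simplified]
    proof eventually_elim
      case (elim h)
      then have "(t - (t - h)) * cos (Th (t - h) t) \<le> d (t - h) t" using st by (intro chord_lower) auto
      then show ?case using elim by (simp add: field_simps)
    qed
  qed
qed

text \<open>The law of cosines in the triangle \<open>s, t - h, t\<close>: its short side is
  \<open>h\<close> to first order by \<open>chord_ratio\<close>, and its angle at \<open>t\<close>
  converges to \<open>be s t\<close> by definition.\<close>

lemma md_left_deriv:
  assumes st: "s < t" "t - s < Lam"
  shows "((\<lambda>h. (md (d s t) - md (d s (t - h))) / h) \<longlongrightarrow> sn (d s t) * cos (be s t)) (at_right 0)"
proof -
  define r where "r = d s t"
  have 4: "\<forall>\<^sub>F h in at_right 0. 0 < h \<and> h < t - s"
    unfolding eventually_at_right_field using st by (intro exI[of _ "t - s"]) auto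
  have snr: "0 < sn r" using sn_d_pos[of s t] st by (simp add: r_def)
  have e0: "((\<lambda>h. d (t - h) t) \<longlongrightarrow> 0) (at_right 0)"
  proof (rule Lim_null_comparison)
    show "\<forall>\<^sub>F h in at_right 0. norm (d (t - h) t) \<le> h"
      using 4
    proof eventually_elim
      case (elim h) then show ?case using d_le[of "t - h" t] d_nonneg[of "t - h" t] by simp
    qed
  qed (auto intro!: tendsto_eq_intros)
  have "((\<lambda>x. (sn x - sn 0) / (x - 0)) \<longlongrightarrow> csK K 0) (at 0)"
    using snK_deriv[OF K, of 0 UNIV] unfolding has_field_derivative_iff by simp
  moreover have "sn 0 = 0" "csK K 0 = 1" by (simp_all add: snK_def csK_def)
  ultimately have sn1: "((\<lambda>x. sn x / x) \<longlongrightarrow> 1) (at 0)" by simp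
  have ee: "filterlim (\<lambda>h. d (t - h) t) (at 0) (at_right 0)"
    unfolding filterlim_at
  proof
    show "\<forall>\<^sub>F h in at_right 0. d (t - h) t \<in> UNIV \<and> d (t - h) t \<noteq> 0"
      using 4
    proof eventually_elim
      case (elim h) then show ?case using d_pos[of "t - h" t] st by simp
    qed
  qed (rule e0)
  have sne: "((\<lambda>h. sn (d (t - h) t) / h) \<longlongrightarrow> 1) (at_right 0)"
  proof -
    have "((\<lambda>h. sn (d (t - h) t) / d (t - h) t * (d (t - h) t / h)) \<longlongrightarrow> 1 * 1) (at_right 0)"
      by (intro tendsto_mult filterlim_compose[OF sn1 ee] chord_ratio[OF st])
    moreover have "\<forall>\<^sub>F h in at_right 0. sn (d (t - h) t) / d (t - h) t * (d (t - h) t / h) = sn (d (t - h) t) / h"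
      using 4
    proof eventually_elim
      case (elim h) then show ?case using d_pos[of "t - h" t] st by simp
    qed
    ultimately have "((\<lambda>h. sn (d (t - h) t) / h) \<longlongrightarrow> 1 * 1) (at_right 0)" by (rule Lim_transform_eventually)
    then show ?thesis by simp
  qed
  have mde: "((\<lambda>h. md (d (t - h) t) / h) \<longlongrightarrow> 0) (at_right 0)"
  proof (rule Lim_null_comparison)
    show "\<forall>\<^sub>F h in at_right 0. norm (md (d (t - h) t) / h) \<le> h / 2" using 4
    proof eventually_elim
      case (elim h)
      have "md (d (t - h) t) \<le> (d (t - h) t)\<^sup>2 / 2" by (rule mdK_le_sq[OF K])
      also have "\<dots> \<le> h\<^sup>2 / 2" using d_le[of "t - h" t] d_nonneg[of "t - h" t] elim by (simp add: power_mono)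
      finally show ?case using elim mdK_nonneg[OF K, of "d (t - h) t"] by (simp add: field_simps power2_eq_square)
    qed
  qed (auto intro!: tendsto_eq_intros)
  have "((\<lambda>h. (K * md r - 1) * (md (d (t - h) t) / h) + sn r * (sn (d (t - h) t) / h) * cos (A t s (t - h)))
     \<longlongrightarrow> (K * md r - 1) * 0 + sn r * 1 * cos (be s t)) (at_right 0)"
    by (intro tendsto_intros mde sne be_tendsto st)
  moreover have "\<forall>\<^sub>F h in at_right 0. (K * md r - 1) * (md (d (t - h) t) / h) + sn r * (sn (d (t - h) t) / h) * cos (A t s (t - h))
      = (md r - md (d s (t - h))) / h" using 4
  proof eventually_elim
    case (elim h)
    then have "md r - md (d s (t - h)) = (K * md r - 1) * md (d (t - h) t) + sn r * sn (d (t - h) t) * cos (A t s (t - h))"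
      using md_law[of s "t - h" t] st by (simp add: r_def algebra_simps)
    then show ?case by (simp add: add_divide_distrib)
  qed
  ultimately have "((\<lambda>h. (md r - md (d s (t - h))) / h) \<longlongrightarrow> (K * md r - 1) * 0 + sn r * 1 * cos (be s t)) (at_right 0)"
    by (rule Lim_transform_eventually)
  then show ?thesis by (simp add: r_def)
qed

lemma d_left_deriv:
  assumes st: "s < t" "t - s < Lam"
  shows "((\<lambda>h. (d s t - d s (t - h)) / h) \<longlongrightarrow> cos (be s t)) (at_right 0)"
proof -
  define r where "r = d s t"
  have 4: "\<forall>\<^sub>F h in at_right 0. 0 < h \<and> h < t - s"
    unfolding eventually_at_right_field using st by (intro exI[of _ "t - s"]) auto
  have snr: "0 < sn r" using sn_d_pos[of s t] st by (simp add: r_def)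
  have q: "((\<lambda>h. (md r - md (d s (t - h))) / h) \<longlongrightarrow> sn r * cos (be s t)) (at_right 0)"
    unfolding r_def by (rule md_left_deriv[OF st])
  \<comment> \<open>A mean value that also covers coinciding chords, so that the derivative of
    \<open>md\<close> can be divided by \<open>sn\<close> without knowing that the chord
    changes.\<close>
  have "\<exists>\<xi>. \<bar>\<xi> - r\<bar> \<le> \<bar>y - r\<bar> \<and> md r - md y = sn \<xi> * (r - y)" for y
  proof -
    consider "y = r" | "y < r" | "r < y" by linarith
    then show ?thesis
    proof cases
      case 1 then show ?thesis by auto
    next
      case 2
      obtain z where "z > y" "z < r" "md r - md y = (r - y) * sn z"
        using MVT2[OF 2, of md sn] mdK_deriv[OF K] by auto
      then show ?thesis by (intro exI[of _ z]) auto
    next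
      case 3
      obtain z where "z > r" "z < y" "md y - md r = (y - r) * sn z"
        using MVT2[OF 3, of md sn] mdK_deriv[OF K] by auto
      then show ?thesis by (intro exI[of _ z]) (auto simp: algebra_simps)
    qed
  qed
  then obtain xi where xi: "\<And>y. \<bar>xi y - r\<bar> \<le> \<bar>y - r\<bar>" "\<And>y. md r - md y = sn (xi y) * (r - y)" by metis
  have dx: "((\<lambda>h. d s (t - h) - r) \<longlongrightarrow> 0) (at_right 0)"
  proof (rule Lim_null_comparison)
    show "\<forall>\<^sub>F h in at_right 0. norm (d s (t - h) - r) \<le> h"
      using 4
    proof eventually_elim
      case (elim h) then show ?case using d_lipschitz[of s "t - h" s t] by (simp add: r_def)
    qed
  qed (auto intro!: tendsto_eq_intros)
  have "((\<lambda>h. xi (d s (t - h)) - r) \<longlongrightarrow> 0) (at_right 0)"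
    by (rule Lim_null_comparison[OF _ tendsto_rabs_zero[OF dx]]) (use xi(1) in auto)
  then have "((\<lambda>h. xi (d s (t - h))) \<longlongrightarrow> r) (at_right 0)" by (simp add: LIM_zero_iff)
  moreover have "isCont sn r" using continuous_snK[OF K] by (simp add: continuous_on_eq_continuous_at)
  ultimately have sx: "((\<lambda>h. sn (xi (d s (t - h)))) \<longlongrightarrow> sn r) (at_right 0)" by (rule isCont_tendsto_compose[rotated])
  have "((\<lambda>h. ((md r - md (d s (t - h))) / h) / sn (xi (d s (t - h)))) \<longlongrightarrow> (sn r * cos (be s t)) / sn r) (at_right 0)"
    by (intro tendsto_divide q sx) (use snr in auto)
  moreover have "\<forall>\<^sub>F h in at_right 0. ((md r - md (d s (t - h))) / h) / sn (xi (d s (t - h))) = (d s t - d s (t - h)) / h"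
    using order_tendstoD(1)[OF sx snr]
  proof eventually_elim
    case (elim h) then show ?case using xi(2)[of "d s (t - h)"] by (simp add: r_def)
  qed
  ultimately have "((\<lambda>h. (d s t - d s (t - h)) / h) \<longlongrightarrow> (sn r * cos (be s t)) / sn r) (at_right 0)"
    by (rule Lim_transform_eventually)
  then show ?thesis using snr by simp
qed

end

section \<open>Total angle of short arcs\<close>

lemma cos_ge_one_minus_sq: "1 - x\<^sup>2 / 2 \<le> cos (x::real)"
  using mdK_le_sq[of 1 x] by (simp add: mdK_def)

lemma negligible_of_AE: "AE s in lborel. P (s::real) \<Longrightarrow> negligible {s. \<not> P s}"
proof -
  assume "AE s in lborel. P s"
  then obtain N where N: "{s \<in> space lborel. \<not> P s} \<subseteq> N" "emeasure lborel N = 0" "N \<in> sets lborel"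
    by (rule AE_E)
  then have "N \<in> null_sets lebesgue" by (intro null_sets_completionI) auto
  then have "negligible N" by (simp add: negligible_iff_null_sets)
  then show ?thesis by (rule negligible_subset) (use N in auto)
qed

context convex_arc
begin

lemma d_right_deriv:
  assumes st: "s < t" "t - s < Lam"
  shows "((\<lambda>h. (d s t - d (s + h) t) / h) \<longlongrightarrow> cos (al s t)) (at_right 0)"
  using convex_arc.d_left_deriv[OF rev, of "- t" "- s"] st by (simp add: al_rev d_sym add.commute)

text \<open>At a subarc maximizing the excess \<open>L - k\<^sup>2 L\<^sup>3 / 24 - d\<close>, the one-sided derivatives of the chord
  force both angles with the chord to be at least \<open>k L / 2\<close>.\<close>
lemma Th_at_max_excess:
  assumes ab: "a < b" "b - a < Lam" and k: "0 < k" "k * (b - a) \<le> pi"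
    and mx: "\<And>a' b'. a \<le> a' \<Longrightarrow> a' \<le> b' \<Longrightarrow> b' \<le> b \<Longrightarrow>
      (b' - a') - k\<^sup>2 * (b' - a') ^ 3 / 24 - d a' b' \<le> (b - a) - k\<^sup>2 * (b - a) ^ 3 / 24 - d a b"
  shows "k * (b - a) \<le> Th a b"
proof -
  define L where "L = b - a"
  have L: "0 < L" using ab by (simp add: L_def)
  \<comment> \<open>The difference quotient of \<open>L - k^2 L^3 / 24\<close>; its limit at 0 is
    \<open>1 - (k L / 2)^2 / 2\<close>, which is at most \<open>cos (k L / 2)\<close>.\<close>
  let ?g = "\<lambda>h. 1 - k\<^sup>2 * (3 * L\<^sup>2 - 3 * L * h + h\<^sup>2) / 24"
  have g: "(?g \<longlongrightarrow> 1 - k\<^sup>2 * (3 * L\<^sup>2 - 3 * L * 0 + 0\<^sup>2) / 24) (at_right 0)" by (intro tendsto_intros) auto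
  have ev: "\<forall>\<^sub>F h in at_right 0. 0 < h \<and> h < L"
    unfolding eventually_at_right_field using L by (intro exI[of _ L]) auto
  have key: "D / h \<le> ?g h" if h: "0 < h" "h < L" and le: "(L - h) - k\<^sup>2 * (L - h) ^ 3 / 24 + D \<le> L - k\<^sup>2 * L ^ 3 / 24" for D h
  proof -
    have "(L - k\<^sup>2 * L ^ 3 / 24) - ((L - h) - k\<^sup>2 * (L - h) ^ 3 / 24) = h * ?g h"
      by (simp add: power2_eq_square power3_eq_cube field_simps)
    then have "D \<le> h * ?g h" using le by simp
    then show ?thesis using h by (simp add: divide_le_eq mult.commute)
  qed
  have 1: "\<forall>\<^sub>F h in at_right 0. (d a b - d a (b - h)) / h \<le> ?g h" using ev
  proof eventually_elim
    case (elim h)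
    show ?case using mx[of a "b - h"] elim by (intro key) (auto simp: L_def algebra_simps)
  qed
  have 2: "\<forall>\<^sub>F h in at_right 0. (d a b - d (a + h) b) / h \<le> ?g h" using ev
  proof eventually_elim
    case (elim h)
    show ?case using mx[of "a + h" b] elim by (intro key) (auto simp: L_def algebra_simps)
  qed
  have c: "cos (be a b) \<le> 1 - (k * L / 2)\<^sup>2 / 2" "cos (al a b) \<le> 1 - (k * L / 2)\<^sup>2 / 2"
    using tendsto_le[OF _ g d_left_deriv[OF ab] 1] tendsto_le[OF _ g d_right_deriv[OF ab] 2]
    by (simp_all add: power2_eq_square mult_ac)
  have kL: "0 \<le> k * L / 2" "k * L / 2 \<le> pi" using k L pi_ge_zero unfolding L_def by (simp, linarith)
  have "cos (be a b) \<le> cos (k * L / 2)" "cos (al a b) \<le> cos (k * L / 2)"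
    using c cos_ge_one_minus_sq[of "k * L / 2"] by auto
  then have "k * L / 2 \<le> be a b" "k * L / 2 \<le> al a b"
    using cos_mono_le_eq[of "be a b" "k * L / 2"] cos_mono_le_eq[of "al a b" "k * L / 2"] kL al_bounds[OF ab] be_bounds[OF ab]
    by simp_all
  then have "k * L \<le> al a b + be a b" by linarith
  then show ?thesis unfolding Th_def L_def .
qed

text \<open>Two gaps are needed. Because \<open>k2 < k\<close>, the given arcs have positive cubic
  excess even with respect to \<open>k2\<close>, which keeps the maximizing subarc from being too
  short. Because \<open>k1 < k2\<close>, that subarc has \<open>Th \<ge> k2 L'\<close>,
  contradicting slow growth \<open>Th \<le> k1 L'\<close>.\<close>

lemma Th_lower_step:
  assumes k: "0 < k1" "k1 < k2" "k2 < k" and xy: "x < y" "y - x < Lam"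
    and H: "AE s in lborel. s \<in> {x<..<y} \<longrightarrow> (\<forall>\<delta>>0. \<exists>a b. a \<le> s \<and> s \<le> b \<and> a < b \<and> b - a < \<delta> \<and> d a b \<le> (b - a) - k\<^sup>2 * (b - a) ^ 3 / 24)"
  shows "k1 * (y - x) \<le> Th x y"
proof -
  \<comment> \<open>A point outside every \<open>E n\<close> lies on arbitrarily short arcs where
    \<open>Th\<close> exceeds \<open>k1\<close> times the length, which is the input of the Vitali
    argument.\<close>
  define E where "E n = {s \<in> {x..y}. \<forall>a b. x \<le> a \<and> a \<le> s \<and> s \<le> b \<and> b \<le> y \<and> a < b \<and> b - a < inverse (real (Suc n)) \<longrightarrow> Th a b \<le> k1 * (b - a)}" for n
  \<comment> \<open>An arc through the limit point is enlarged slightly to reach a nearby point of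
    the sequence; \<open>Th\<close> is monotone, and the strict length bound leaves room for
    this.\<close>
  have clE: "closed (E n)" for n
    unfolding closed_sequential_limits
  proof (intro allI impI)
    fix S s assume S: "(\<forall>j. S j \<in> E n) \<and> S \<longlonglongrightarrow> s"
    have SE: "S j \<in> E n" for j using S by blast
    have Sxy: "S j \<in> {x..y}" for j using SE[of j] unfolding E_def by blast
    have sxy: "s \<in> {x..y}"
      using closed_sequentially[OF closed_atLeastAtMost, of S] Sxy S by blast
    have "Th a b \<le> k1 * (b - a)"
      if ab: "x \<le> a" "a \<le> s" "s \<le> b" "b \<le> y" "a < b" "b - a < inverse (real (Suc n))" for a b
    proof (rule field_le_epsilon)
      fix e :: real assume e: "0 < e"
      define \<epsilon> where "\<epsilon> = min (e / k1) (inverse (real (Suc n)) - (b - a))"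
      have eps: "0 < \<epsilon>" using e k ab by (simp add: \<epsilon>_def)
      have eps2: "\<epsilon> \<le> e / k1" "\<epsilon> \<le> inverse (real (Suc n)) - (b - a)" by (auto simp: \<epsilon>_def)
      obtain j where j: "\<bar>S j - s\<bar> < \<epsilon>" using S eps unfolding lim_sequentially dist_real_def by blast
      have Sj: "x \<le> S j" "S j \<le> y" using Sxy[of j] by auto
      have "Th a b \<le> Th (min a (S j)) (max b (S j))"
        using ab Sj xy by (intro Th_mono) auto
      also have "\<dots> \<le> k1 * (max b (S j) - min a (S j))"
      proof -
        have "x \<le> min a (S j) \<and> min a (S j) \<le> S j \<and> S j \<le> max b (S j) \<and> max b (S j) \<le> y \<and> min a (S j) < max b (S j)
          \<and> max b (S j) - min a (S j) < inverse (real (Suc n))"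
          using ab Sj j eps2(2) by (auto simp: min_def max_def)
        then show ?thesis using SE[of j] unfolding E_def mem_Collect_eq by blast
      qed
      also have "\<dots> \<le> k1 * (b - a + e / k1)"
        using j k ab eps2(1) by (intro mult_left_mono) (auto simp: min_def max_def)
      also have "\<dots> = k1 * (b - a) + e" using k by (simp add: field_simps)
      finally show "Th a b \<le> k1 * (b - a) + e" .
    qed
    then show "s \<in> E n" using sxy unfolding E_def by blast
  qed
  show ?thesis
  proof (cases "\<forall>n. negligible (E n \<inter> {x<..<y})")
    case True
    define N where "N = (\<Union>n. E n \<inter> {x<..<y})"
    have N: "negligible N" unfolding N_def using True by (intro negligible_Union_nat) auto
    show ?thesis
    proof (rule superadditive_Vitali[OF xy(1) _ _ k(1) N])
      show "0 \<le> Th a b" if "x \<le> a" "a < b" "b \<le> y" for a b using that xy by (intro Th_nonneg) auto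
      show "Th a b + Th b c \<le> Th a c" if "x \<le> a" "a < b" "b < c" "c \<le> y" for a b c
        using that xy by (intro Th_superadd) auto
      fix s \<delta> :: real assume s: "s \<in> {x<..<y} - N" and \<delta>: "0 < \<delta>"
      obtain n where n: "inverse (real (Suc n)) < \<delta>" using reals_Archimedean[OF \<delta>] by blast
      have "s \<notin> E n" using s by (auto simp: N_def)
      then obtain a b where "a \<le> s" "s \<le> b" "a < b" "b - a < inverse (real (Suc n))" "k1 * (b - a) < Th a b"
        using s unfolding E_def by (auto simp: not_le)
      then show "\<exists>a b. a \<le> s \<and> s \<le> b \<and> a < b \<and> b - a < \<delta> \<and> k1 * (b - a) \<le> Th a b"
        using n by (intro exI[of _ a] exI[of _ b]) auto
    qed
  next
    case False
    then obtain n where n: "\<not> negligible (E n \<inter> {x<..<y})" by blast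
    \<comment> \<open>The relative length of the maximizing subarc. The quotient is what remains of
      \<open>(k^2 - k2^2) L^3 / 24 \<le> L' (k1 L)^2 / 2\<close> when solved for
      \<open>L' / L\<close>; the minimum ensures \<open>c < 1\<close>.\<close>
    define c where "c = min (1/2) ((k\<^sup>2 - k2\<^sup>2) / (12 * k1\<^sup>2))"
    have kk: "0 < k\<^sup>2 - k2\<^sup>2" using k by (simp add: power_strict_mono)
    have c: "0 < c" "c < 1" using kk k by (auto simp: c_def)
    define Q where "Q s \<longleftrightarrow> (\<forall>\<delta>>0. \<exists>a b. a \<le> s \<and> s \<le> b \<and> a < b \<and> b - a < \<delta> \<and> d a b \<le> (b - a) - k\<^sup>2 * (b - a) ^ 3 / 24)" for s
    define R where "R s \<delta> \<longleftrightarrow> (\<forall>a b a' b'. a \<le> s \<and> s \<le> b \<and> b - a < \<delta> \<and> a \<le> a' \<and> a' < b' \<and> b' \<le> b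
         \<and> c * (b - a) \<le> b' - a' \<longrightarrow> (\<exists>u\<in>E n. a' \<le> u \<and> u \<le> b'))" for s \<delta>
    have HQ: "AE s in lborel. s \<in> {x<..<y} \<longrightarrow> Q s" using H unfolding Q_def .
    obtain s \<delta> where s: "s \<in> E n" "x < s" "s < y" and Q: "Q s" and \<delta>: "0 < \<delta>" and np: "R s \<delta>"
      using nonporous_point[OF clE n negligible_of_AE[OF HQ] c] unfolding R_def[symmetric] by auto
    \<comment> \<open>The entries keep the arc within reach of the point \<open>s\<close>, short
      enough for \<open>E n\<close>, inside the open interval, and within the range of angles and
      distances where \<open>chord_lower\<close> and \<open>Th_at_max_excess\<close> hold.\<close>
    define \<delta>' where "\<delta>' = Min {\<delta>, inverse (real (Suc n)), s - x, y - s, pi / (2 * k2), pi / (2 * (sqrt K + 1))}"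
    have "0 < \<delta>'" using \<delta> s k K by (simp add: \<delta>'_def add_nonneg_pos)
    then obtain a b where ab: "a \<le> s" "s \<le> b" "a < b" "b - a < \<delta>'" and dab: "d a b \<le> (b - a) - k\<^sup>2 * (b - a) ^ 3 / 24"
      using Q unfolding Q_def by blast
    define L where "L = b - a"
    have L: "0 < L" "L < \<delta>" "L < inverse (real (Suc n))" "L < s - x" "L < y - s" "L < pi / (2 * k2)" "L < pi / (2 * (sqrt K + 1))"
      using ab by (auto simp: \<delta>'_def L_def)
    have axby: "x < a" "b < y" "b - a < Lam" using L ab xy by (auto simp: L_def)
    have k2L: "k2 * L \<le> pi / 2" using L(6) k by (simp add: field_simps)
    have KL: "sqrt K * L \<le> pi / 2"
    proof -
      have "0 < 2 * (sqrt K + 1)" using K by (simp add: add_nonneg_pos)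
      then have "(2 * (sqrt K + 1)) * L < pi" using L(7) by (metis pos_less_divide_eq mult.commute)
      then have "(sqrt K + 1) * L \<le> pi / 2" by (simp add: algebra_simps)
      then show ?thesis using L by (simp add: algebra_simps)
    qed
    have "x \<le> a \<and> a \<le> s \<and> s \<le> b \<and> b \<le> y \<and> a < b \<and> b - a < inverse (real (Suc n))"
      using ab L axby unfolding L_def by auto
    then have Thab: "Th a b \<le> k1 * L" using s(1) unfolding E_def L_def mem_Collect_eq by blast
    have k1L: "k1 * L \<le> pi / 2" 
    proof -
      have "k1 * L \<le> k2 * L" using k L by (intro mult_right_mono) auto
      then show ?thesis using k2L by linarith
    qed
    define F where "F p = (snd p - fst p) - k2\<^sup>2 * (snd p - fst p) ^ 3 / 24 - d (fst p) (snd p)" for p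
    let ?T = "{a..b} \<times> {a..b} \<inter> {p. fst p \<le> snd p}"
    have "compact ?T" by (intro compact_Int_closed compact_Times compact_Icc closed_Collect_le continuous_intros)
    moreover have "(a, b) \<in> ?T" using ab by auto
    moreover have "continuous_on ?T F" unfolding F_def by (intro continuous_intros continuous_d) auto
    ultimately obtain p where p: "p \<in> ?T" "\<forall>q\<in>?T. F q \<le> F p" using continuous_attains_sup[of ?T F] by blast
    define a' b' where "a' = fst p" and "b' = snd p"
    have p': "a \<le> a'" "a' \<le> b'" "b' \<le> b" using p by (auto simp: a'_def b'_def)
    have mx: "F (u, v) \<le> F (a', b')" if "a \<le> u" "u \<le> v" "v \<le> b" for u v
      using p(2) that by (auto simp: a'_def b'_def)
    have F0: "(k\<^sup>2 - k2\<^sup>2) * L ^ 3 / 24 \<le> F (a, b)" using dab by (simp add: F_def L_def algebra_simps diff_divide_distrib)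
    also have F1: "F (a, b) \<le> F (a', b')" using mx ab by auto
    finally have F: "(k\<^sup>2 - k2\<^sup>2) * L ^ 3 / 24 \<le> F (a', b')" .
    have "0 < (k\<^sup>2 - k2\<^sup>2) * L ^ 3 / 24" using kk L by simp
    then have "F (a', b') > 0" using F by simp
    then have ab': "a' < b'" using p' by (cases "a' = b'") (auto simp: F_def)
    define L' where "L' = b' - a'"
    have L': "0 < L'" "L' \<le> L" using ab' p' by (auto simp: L'_def L_def)
    have Th': "Th a' b' \<le> Th a b" using p' ab' axby by (intro Th_mono) auto
    have Th0: "0 \<le> Th a' b'" using ab' p' axby by (intro Th_nonneg) auto
    have sK: "sqrt K * (b' - a') \<le> sqrt K * L" using L' K by (intro mult_left_mono) (auto simp: L'_def)
    \<comment> \<open>Since \<open>Th\<close> is at most \<open>k1 L\<close> on the whole arc, every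
      subarc is nearly straight and has excess at most \<open>L' (k1 L)^2 / 2\<close>. The maximal
      excess is cubic in \<open>L\<close>, so \<open>L'\<close> must be a fixed fraction of
      \<open>L\<close>.\<close>
    have "L' * (1 - (k1 * L)\<^sup>2 / 2) \<le> L' * (1 - (Th a' b')\<^sup>2 / 2)"
      using L' Th' Thab Th0 by (intro mult_left_mono) (auto intro!: power_mono)
    also have "\<dots> \<le> L' * cos (Th a' b')" using cos_ge_one_minus_sq L' by (intro mult_left_mono) auto
    also have "\<dots> \<le> d a' b'" unfolding L'_def
      using ab' p' axby Th' Thab k1L KL sK by (intro chord_lower) auto
    finally have "L' - d a' b' \<le> L' * (k1 * L)\<^sup>2 / 2" by (simp add: algebra_simps)
    moreover have "F (a', b') \<le> L' - d a' b'" using L' by (simp add: F_def L'_def[symmetric])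
    ultimately have "F (a', b') \<le> L' * (k1 * L)\<^sup>2 / 2" by linarith
    then have "(k\<^sup>2 - k2\<^sup>2) * L ^ 3 / 24 \<le> L' * (k1 * L)\<^sup>2 / 2" by (rule order_trans[OF F])
    then have "L\<^sup>2 * ((k\<^sup>2 - k2\<^sup>2) * L) \<le> L\<^sup>2 * (12 * k1\<^sup>2 * L')"
      by (simp add: power2_eq_square power3_eq_cube algebra_simps)
    then have "(k\<^sup>2 - k2\<^sup>2) * L \<le> 12 * k1\<^sup>2 * L'" using L by simp
    then have "(k\<^sup>2 - k2\<^sup>2) / (12 * k1\<^sup>2) * L \<le> L'" using k by (simp add: field_simps)
    moreover have "c * L \<le> (k\<^sup>2 - k2\<^sup>2) / (12 * k1\<^sup>2) * L" using L by (intro mult_right_mono) (auto simp: c_def)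
    ultimately have "c * (b - a) \<le> b' - a'" by (simp add: L_def L'_def)
    then obtain u where u: "u \<in> E n" "a' \<le> u" "u \<le> b'"
      using np[unfolded R_def, rule_format, of a b a' b'] ab L p' ab' unfolding L_def by blast
    have "x \<le> a' \<and> a' \<le> u \<and> u \<le> b' \<and> b' \<le> y \<and> a' < b' \<and> b' - a' < inverse (real (Suc n))"
      using p' ab' axby L' L u unfolding L'_def by auto
    then have "Th a' b' \<le> k1 * (b' - a')" using u(1) unfolding E_def mem_Collect_eq by blast
    moreover have "k2 * (b' - a') \<le> Th a' b'"
    proof (rule Th_at_max_excess[OF ab'])
      show "b' - a' < Lam" using p' axby by auto
      have "k2 * (b' - a') \<le> k2 * L" using L' k by (intro mult_left_mono) (auto simp: L'_def)
      then show "k2 * (b' - a') \<le> pi" using k2L pi_gt_zero by linarith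
      show "(v - u) - k2\<^sup>2 * (v - u) ^ 3 / 24 - d u v \<le> (b' - a') - k2\<^sup>2 * (b' - a') ^ 3 / 24 - d a' b'"
        if "a' \<le> u" "u \<le> v" "v \<le> b'" for u v
        using mx[of u v] that p' by (simp add: F_def)
    qed (use k in auto)
    moreover have "k1 * (b' - a') < k2 * (b' - a')" using k ab' by simp
    ultimately show ?thesis by simp
  qed
qed

lemma Th_lower:
  assumes xy: "x < y" "y - x < Lam" and kap: "0 < kap"
    and H: "\<And>k. 0 < k \<Longrightarrow> k < kap \<Longrightarrow> AE s in lborel. s \<in> {x<..<y} \<longrightarrow>
      (\<forall>\<delta>>0. \<exists>a b. a \<le> s \<and> s \<le> b \<and> a < b \<and> b - a < \<delta> \<and> d a b \<le> (b - a) - k\<^sup>2 * (b - a) ^ 3 / 24)"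
  shows "kap * (y - x) \<le> Th x y"
proof (rule ccontr)
  assume "\<not> ?thesis"
  then have "Th x y / (y - x) < kap" using xy by (simp add: field_simps)
  then have "max 0 (Th x y / (y - x)) < kap" using kap by simp
  then obtain k1 where k1: "max 0 (Th x y / (y - x)) < k1" "k1 < kap" using dense by blast
  obtain k2 where k2: "k1 < k2" "k2 < kap" using dense k1 by blast
  obtain k where k: "k2 < k" "k < kap" using dense k2 by blast
  have "k1 * (y - x) \<le> Th x y" using k1 k2 k xy by (intro Th_lower_step[of k1 k2 k] H) auto
  then show False using k1 xy by (simp add: field_simps)
qed

end

section \<open>Chords of short arcs\<close>

lemma sin_ge_tangent:
  fixes B b :: real
  assumes "0 \<le> B" "0 \<le> b" "B + b \<le> pi"
  shows "sin B + b * cos (B + b) \<le> sin (B + b)"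
proof (cases "b = 0")
  case False
  then have "B < B + b" using assms by simp
  then obtain z where z: "z > B" "z < B + b" "sin (B + b) - sin B = (B + b - B) * cos z"
    using MVT2[of B "B + b" sin cos] DERIV_sin by blast
  have "cos (B + b) \<le> cos z" using z assms by (intro cos_monotone_0_pi_le) auto
  then have "b * cos (B + b) \<le> b * cos z" using assms by (intro mult_left_mono) auto
  moreover have "sin (B + b) - sin B = b * cos z" using z by simp
  ultimately show ?thesis by linarith
qed simp

locale curved_arc = convex_arc +
  fixes kap :: real
  assumes kap: "0 < kap" and Th_ge: "x < y \<Longrightarrow> y - x < Lam \<Longrightarrow> kap * (y - x) \<le> Th x y"
begin

text \<open>For an arc of curvature \<open>k\<close> in the model, up to a half circle, the end
  angle satisfies \<open>sn d sin \<beta> = k md d\<close>; so a nonpositive value says that the end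
  angle is at least as large as in the model. The minimum prevents the sine from decreasing for
  obtuse angles.\<close>

definition deficit :: "real \<Rightarrow> real \<Rightarrow> real \<Rightarrow> real" where
  "deficit k s t = k * md (d s t) - sn (d s t) * sin (min (be s t) (pi / 2))"

text \<open>Shortening the arc by \<open>h\<close> removes angle at least \<open>kap h\<close>,
  split between the two ends of the removed piece. The sine rule links the chords to
  \<open>x\<close> and \<open>y\<close>, so \<open>sn sin \<beta>\<close> loses about
  \<open>kap h sn cos \<beta>\<close>, while by first variation \<open>k md\<close> loses only about
  \<open>k h sn cos \<beta>\<close>.\<close>

lemma deficit_local:
  assumes sy: "s < y" "y - s < Lam" and k: "0 < k" "k < kap" and be: "be s y < pi / 2"
  shows "\<forall>\<^sub>F h in at_right 0. deficit k s y < deficit k s (y - h)"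
proof -
  define \<beta> where "\<beta> = be s y"
  have b0: "0 \<le> \<beta>" "\<beta> < pi / 2" using be_bounds[OF sy] be by (auto simp: \<beta>_def)
  have ry: "0 < sn (d s y)" using sn_d_pos[of s y] sy by simp
  have cb: "0 < cos \<beta>" using b0 by (intro cos_gt_zero_pi) auto
  \<comment> \<open>A common lower bound for the factors \<open>sn cos\<close> in the tangent
    estimates at both ends, with limit \<open>sn (d s y) cos \<beta>\<close>; thus it does not
    matter how the removed angle is divided.\<close>
  define m where "m h = min (sn (d s y) * cos \<beta>) (sn (d s (y - h)) * cos (\<beta> + A s (y - h) y))" for h
  have h0: "((\<lambda>h. y - h) \<longlongrightarrow> y - 0) (at_right 0)" by (intro tendsto_intros)
  have "continuous_on UNIV (\<lambda>x. sn (d s x))"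
    using continuous_on_compose2[OF continuous_snK[OF K] continuous_d[of UNIV "\<lambda>_. s" "\<lambda>x. x"]] by (auto intro: continuous_intros)
  then have "isCont (\<lambda>x. sn (d s x)) y" by (simp add: continuous_on_eq_continuous_at)
  then have snl: "((\<lambda>h. sn (d s (y - h))) \<longlongrightarrow> sn (d s y)) (at_right 0)"
    using isCont_tendsto_compose[of y "\<lambda>x. sn (d s x)"] h0 by simp
  have ml: "(m \<longlongrightarrow> min (sn (d s y) * cos \<beta>) (sn (d s y) * cos (\<beta> + 0))) (at_right 0)"
    unfolding m_def[abs_def] by (intro tendsto_intros snl A_thin_tendsto[OF sy])
  have "((\<lambda>h. kap * m h - k * ((md (d s y) - md (d s (y - h))) / h)) \<longlongrightarrow>
    kap * min (sn (d s y) * cos \<beta>) (sn (d s y) * cos (\<beta> + 0)) - k * (sn (d s y) * cos \<beta>)) (at_right 0)"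
    unfolding \<beta>_def by (intro tendsto_diff tendsto_mult tendsto_const md_left_deriv[OF sy] ml[unfolded \<beta>_def])
  moreover have "0 < kap * min (sn (d s y) * cos \<beta>) (sn (d s y) * cos (\<beta> + 0)) - k * (sn (d s y) * cos \<beta>)"
    using k ry cb by simp
  ultimately have 1: "\<forall>\<^sub>F h in at_right 0. 0 < kap * m h - k * ((md (d s y) - md (d s (y - h))) / h)"
    by (rule order_tendstoD(1))
  have 2: "\<forall>\<^sub>F h in at_right 0. A s (y - h) y < pi / 2 - \<beta>"
    using order_tendstoD(2)[OF A_thin_tendsto[OF sy]] b0 by simp
  have 3: "\<forall>\<^sub>F h in at_right 0. 0 < h \<and> h < y - s"
    unfolding eventually_at_right_field using sy by (intro exI[of _ "y - s"]) auto
  show ?thesis using 1 2 3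
  proof eventually_elim
    case (elim h)
    define x where "x = y - h"
    have x: "s < x" "x < y" "y - s < Lam" using elim sy by (auto simp: x_def)
    define a b B om where "a = al x y" and "b = be x y" and "B = A y s x" and "om = pi - A x s y"
    have a: "0 \<le> a" using al_bounds[of x y] x by (simp add: a_def)
    have b: "0 \<le> b" using be_bounds[of x y] x by (simp add: b_def)
    have ab: "kap * h \<le> a + b" using Th_ge[of x y] x by (simp add: Th_def a_def b_def x_def)
    have B: "0 \<le> B" using A_bounds[of y s x s y] x by (auto simp: B_def)
    have om0: "0 \<le> om" using A_bounds[of x s y s y] x by (auto simp: om_def)
    have Bb: "B + b \<le> \<beta>" using be_add[of s x y] x by (simp add: B_def b_def \<beta>_def A_commute add.commute)
    have oma: "be s x \<le> om - a" using vertex_angles[of s x y] x by (simp add: om_def a_def)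
    have bex: "0 \<le> be s x" using be_bounds[of s x] x by simp
    have om1: "om \<le> A s x y + B" using A_sum[of x s y s y] x by (auto simp: om_def B_def A_commute)
    have om2: "om \<le> pi / 2" using om1 Bb b elim by (simp add: x_def)
    have rx: "0 < sn (d s x)" using sn_d_pos[of s x] x by simp
    have sine: "sn (d s x) * sin om = sn (d s y) * sin B"
      using A_sine[of s x y s y] x by (simp add: om_def B_def)
    have mm: "m h \<le> sn (d s y) * cos \<beta>" "m h \<le> sn (d s x) * cos (\<beta> + A s x y)" by (auto simp: m_def x_def)
    have "cos (\<beta> + A s x y) \<le> cos om"
      using om0 om1 Bb b elim b0 by (intro cos_monotone_0_pi_le) (auto simp: x_def)
    then have m2: "m h \<le> sn (d s x) * cos om" using mm(2) rx by (meson less_imp_le mult_left_mono order_trans)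
    have "cos \<beta> \<le> cos (B + b)" using B b Bb b0 by (intro cos_monotone_0_pi_le) auto
    then have m1: "m h \<le> sn (d s y) * cos (B + b)" using mm(1) ry by (meson less_imp_le mult_left_mono order_trans)
    have "0 \<le> A s x y" using A_bounds[of s x y s y] x by auto
    then have "0 \<le> cos (\<beta> + A s x y)" using b0 elim by (intro cos_ge_zero) (auto simp: x_def)
    then have m0: "0 \<le> m h" using ry rx cb by (auto simp: m_def x_def)
    have s1: "sn (d s x) * sin (min (be s x) (pi / 2)) \<le> sn (d s x) * (sin om - a * cos om)"
    proof (rule mult_left_mono)
      have "sin (min (be s x) (pi / 2)) \<le> sin (om - a)"
        using oma om2 a bex by (intro sin_monotone_2pi_le) auto
      also have "\<dots> \<le> sin om - a * cos om"
        using sin_ge_tangent[of "om - a" a] a oma bex om2 by simp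
      finally show "sin (min (be s x) (pi / 2)) \<le> sin om - a * cos om" .
    qed (use rx in simp)
    have s2: "sn (d s y) * (sin B + b * cos (B + b)) \<le> sn (d s y) * sin (min \<beta> (pi / 2))"
    proof (rule mult_left_mono)
      have "sin B + b * cos (B + b) \<le> sin (B + b)" using B b Bb b0 by (intro sin_ge_tangent) auto
      also have "\<dots> \<le> sin (min \<beta> (pi / 2))" using B b Bb b0 by (intro sin_monotone_2pi_le) auto
      finally show "sin B + b * cos (B + b) \<le> sin (min \<beta> (pi / 2))" .
    qed (use ry in simp)
    have "kap * h * m h \<le> (a + b) * m h" using ab m0 by (rule mult_right_mono)
    also have "\<dots> \<le> a * (sn (d s x) * cos om) + b * (sn (d s y) * cos (B + b))"
      using mult_left_mono[OF m2 a] mult_left_mono[OF m1 b] by (simp add: distrib_right)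
    also have "\<dots> \<le> sn (d s y) * sin (min \<beta> (pi / 2)) - sn (d s x) * sin (min (be s x) (pi / 2))"
      using s1 s2 sine by (simp add: algebra_simps)
    finally have "kap * h * m h \<le> sn (d s y) * sin (min \<beta> (pi / 2)) - sn (d s x) * sin (min (be s x) (pi / 2))" .
    moreover have "k * (md (d s y) - md (d s x)) < kap * h * m h"
    proof -
      have "k * ((md (d s y) - md (d s x)) / h) < kap * m h" using elim by (simp add: x_def)
      then have "h * (k * ((md (d s y) - md (d s x)) / h)) < h * (kap * m h)" using elim by (intro mult_strict_left_mono) auto
      moreover have "h * (k * ((md (d s y) - md (d s x)) / h)) = k * (md (d s y) - md (d s x))" using elim by simp
      ultimately show ?thesis by (simp add: mult_ac)
    qed
    ultimately show ?case by (simp add: deficit_def x_def[symmetric] \<beta>_def algebra_simps)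
  qed
qed

text \<open>Maximum principle. The first point where the deficit reaches a positive value
  \<open>M\<close> has acute end angle by \<open>small\<close>, since otherwise the deficit is
  \<open>k md - sn < 0\<close>. Then \<open>deficit_local\<close> produces an even earlier such
  point.\<close>

lemma deficit_nonpos:
  assumes st: "s < t" "t - s < Lam" and k: "0 < k" "k < kap"
    and small: "\<And>u. s < u \<Longrightarrow> u \<le> t \<Longrightarrow> k * md (d s u) < sn (d s u)"
  shows "deficit k s t \<le> 0"
proof (rule ccontr)
  assume neg: "\<not> ?thesis"
  define M where "M = deficit k s t"
  have M: "0 < M" using neg by (simp add: M_def)
  define S where "S = {u. s < u \<and> u \<le> t \<and> M \<le> deficit k s u}"
  have tS: "t \<in> S" using st by (simp add: S_def M_def)
  have S0: "bdd_below S" by (rule bdd_belowI[of _ s]) (auto simp: S_def)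
  define c where "c = Inf S"
  have "continuous_on UNIV (\<lambda>u. md (d s u))" "continuous_on UNIV (\<lambda>u. sn (d s u))"
    using continuous_on_compose2[OF continuous_mdK[OF K] continuous_d[of UNIV "\<lambda>_. s" "\<lambda>x. x"]]
      continuous_on_compose2[OF continuous_snK[OF K] continuous_d[of UNIV "\<lambda>_. s" "\<lambda>x. x"]] by (auto intro: continuous_intros)
  then have cont: "isCont (\<lambda>u. md (d s u)) u" "isCont (\<lambda>u. sn (d s u)) u" for u by (simp_all add: continuous_on_eq_continuous_at)
  have pos: "0 \<le> sn (d s u) * sin (min (be s u) (pi / 2))" if "s < u" "u \<le> t" for u
    using that st sn_d_pos[of s u] be_bounds[of s u] by (intro mult_nonneg_nonneg sin_ge_zero) auto
  have "((\<lambda>u. k * md (d s u)) \<longlongrightarrow> k * md (d s s)) (at s)"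
    using cont(1)[of s] by (intro tendsto_intros) (simp add: isCont_def)
  then have "\<forall>\<^sub>F u in at s. k * md (d s u) < M" using order_tendstoD(2)[of _ "k * md (d s s)" "at s" M] M by simp
  then obtain e where e: "0 < e" "\<And>u. u \<noteq> s \<Longrightarrow> dist u s < e \<Longrightarrow> k * md (d s u) < M"
    unfolding eventually_at by auto
  have S1: "s + e \<le> u" if "u \<in> S" for u
  proof (rule ccontr)
    assume "\<not> s + e \<le> u"
    then have "k * md (d s u) < M" using that by (intro e(2)) (auto simp: S_def dist_real_def)
    then show False using that pos[of u] by (auto simp: S_def deficit_def)
  qed
  have "s + e \<le> c" unfolding c_def using S1 tS by (intro cInf_greatest) auto
  then have sc: "s < c" using e by simp
  have ct: "c \<le> t" unfolding c_def using tS S0 by (rule cInf_lower)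
  \<comment> \<open>The infimum is attained although \<open>be\<close> is only lower semicontinuous:
    lowering \<open>be s c\<close> slightly to \<open>b1\<close> keeps the value below
    \<open>M\<close>, and nearby end angles stay above \<open>b1\<close>, so the deficit would stay
    below \<open>M\<close> to the right of \<open>c\<close>.\<close>
  have cM: "M \<le> deficit k s c"
  proof (rule ccontr)
    assume "\<not> ?thesis"
    then have lt: "k * md (d s c) - sn (d s c) * sin (min (be s c) (pi / 2)) < M" by (simp add: deficit_def)
    have "((\<lambda>x. k * md (d s c) - sn (d s c) * sin (min x (pi / 2))) \<longlongrightarrow>
      k * md (d s c) - sn (d s c) * sin (min (be s c) (pi / 2))) (at_left (be s c))" by (intro tendsto_intros)
    then have "\<forall>\<^sub>F x in at_left (be s c). k * md (d s c) - sn (d s c) * sin (min x (pi / 2)) < M"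
      using lt by (rule order_tendstoD(2))
    moreover have "\<forall>\<^sub>F x in at_left (be s c). be s c - 1 < x \<and> x < be s c"
      unfolding eventually_at_left_field by (intro exI[of _ "be s c - 1"]) auto
    ultimately have "\<forall>\<^sub>F x in at_left (be s c). k * md (d s c) - sn (d s c) * sin (min x (pi / 2)) < M \<and> be s c - 1 < x \<and> x < be s c"
      by eventually_elim auto
    from eventually_happens'[OF trivial_limit_at_left_real this]
    obtain b1 where b1: "k * md (d s c) - sn (d s c) * sin (min b1 (pi / 2)) < M" "be s c - 1 < b1" "b1 < be s c" by blast
    have b1': "- (pi / 2) \<le> b1" using b1 be_bounds[of s c] sc ct st pi_gt3 by auto
    have "((\<lambda>u. k * md (d s u) - sn (d s u) * sin (min b1 (pi / 2))) \<longlongrightarrow> k * md (d s c) - sn (d s c) * sin (min b1 (pi / 2))) (at_right c)"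
      using cont[of c] unfolding isCont_def
      by (intro tendsto_diff tendsto_mult tendsto_const) (erule tendsto_mono[OF at_le[OF subset_UNIV]])+
    then have E1: "\<forall>\<^sub>F u in at_right c. k * md (d s u) - sn (d s u) * sin (min b1 (pi / 2)) < M"
      using b1(1) by (rule order_tendstoD(2))
    have "((\<lambda>u. (s, u)) \<longlongrightarrow> (s, c)) (at_right c)" by (intro tendsto_intros)
    then have E2: "\<forall>\<^sub>F u in at_right c. b1 < be (fst (s, u)) (snd (s, u))"
      using eventually_compose_filterlim[OF be_lsc[OF sc _ b1(3)], of "\<lambda>u. (s, u)" "at_right c"] ct st by simp
    have "\<forall>\<^sub>F u in at_right c. u \<le> t \<longrightarrow> deficit k s u < M" using E1 E2 eventually_at_right_less[of c]
    proof eventually_elim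
      case (elim u)
      show ?case
      proof
        assume ut: "u \<le> t"
        have "sin (min b1 (pi / 2)) \<le> sin (min (be s u) (pi / 2))"
          using elim b1' be_bounds[of s u] sc ut st by (intro sin_monotone_2pi_le) (auto simp: min_def)
        then have "sn (d s u) * sin (min b1 (pi / 2)) \<le> sn (d s u) * sin (min (be s u) (pi / 2))"
          using sn_d_pos[of s u] elim sc ut st by (intro mult_left_mono) auto
        then show "deficit k s u < M" using elim by (simp add: deficit_def)
      qed
    qed
    then obtain b where b: "c < b" "\<And>u. c < u \<Longrightarrow> u < b \<Longrightarrow> u \<le> t \<longrightarrow> deficit k s u < M"
      unfolding eventually_at_right_field by blast
    have "b \<le> u" if "u \<in> S" for u
    proof (rule ccontr)
      assume "\<not> b \<le> u"
      moreover have "c \<le> u" unfolding c_def using that S0 by (rule cInf_lower)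
      moreover have "u \<noteq> c" using that lt by (auto simp: S_def deficit_def)
      ultimately show False using b(2)[of u] that by (auto simp: S_def)
    qed
    then have "b \<le> c" unfolding c_def using tS by (intro cInf_greatest) auto
    then show False using b by simp
  qed
  have "be s c < pi / 2"
  proof (rule ccontr)
    assume "\<not> ?thesis"
    then have "min (be s c) (pi / 2) = pi / 2" by simp
    then have "deficit k s c = k * md (d s c) - sn (d s c)" by (simp add: deficit_def)
    then show False using cM M small[of c] sc ct by simp
  qed
  then have "\<forall>\<^sub>F h in at_right 0. deficit k s c < deficit k s (c - h)" using sc ct st k by (intro deficit_local) auto
  moreover have "\<forall>\<^sub>F h in at_right 0. 0 < h \<and> h < c - s"
    unfolding eventually_at_right_field using sc by (intro exI[of _ "c - s"]) auto
  ultimately have "\<forall>\<^sub>F h in at_right 0. deficit k s c < deficit k s (c - h) \<and> 0 < h \<and> h < c - s" by eventually_elim auto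
  from eventually_happens'[OF trivial_limit_at_right_real this]
  obtain h :: real where h: "deficit k s c < deficit k s (c - h)" "0 < h" "h < c - s" by blast
  then have "c - h \<in> S" using cM ct by (auto simp: S_def)
  then have "c \<le> c - h" unfolding c_def using S0 by (intro cInf_lower)
  then show False using h by simp
qed

lemma d_half_left_deriv:
  assumes st: "s < t" "t - s < Lam"
  shows "((\<lambda>h. sn (d s (t - h) / 2)) has_real_derivative - (csK K (d s t / 2) * cos (be s t) / 2)) (at 0 within {0<..})"
proof -
  have "((\<lambda>h. - ((d s t - d s (t - h)) / h)) \<longlongrightarrow> - cos (be s t)) (at_right 0)"
    by (intro tendsto_minus d_left_deriv st)
  then have "((\<lambda>h. d s (t - h)) has_real_derivative - cos (be s t)) (at 0 within {0<..})"
    unfolding has_field_derivative_iff by (simp add: minus_divide_left)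
  then have "((\<lambda>h. d s (t - h) / 2) has_real_derivative - cos (be s t) / 2) (at 0 within {0<..})" by (rule DERIV_cdivide)
  then have "((\<lambda>h. sn (d s (t - h) / 2)) has_real_derivative csK K (d s (t - 0) / 2) * (- cos (be s t) / 2)) (at 0 within {0<..})"
    by (rule DERIV_chain'[OF _ snK_deriv[OF K]])
  then show ?thesis by simp
qed

text \<open>At a positive maximum of half chord minus model half chord, first variation bounds
  \<open>cs cos \<beta>\<close> below and \<open>deficit_nonpos\<close> bounds
  \<open>cs sin \<beta>\<close> below, where \<open>cs\<close> is the cosine at the half chord.
  Adding squares contradicts \<open>v < w\<close>. No differential inequality has to be
  integrated.\<close>

lemma half_chord_le_step:
  assumes st: "s < t" "t - s < Lam" and k: "0 < k" "k < kap" and w: "w = sqrt (k\<^sup>2 + K)" "0 < v" "v < w"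
    and vL: "v * (t - s) < pi" and small: "\<And>u. s < u \<Longrightarrow> u \<le> t \<Longrightarrow> w * sn (d s u / 2) < 1"
  shows "sn (d s t / 2) \<le> sin (v * (t - s) / 2) / v"
proof (rule ccontr)
  assume neg: "\<not> ?thesis"
  define \<phi> where "\<phi> u = sn (d s u / 2) - sin (v * (u - s) / 2) / v" for u
  have "continuous_on {s..t} (\<lambda>u. sn (d s u / 2))"
    by (rule continuous_on_compose2[OF continuous_snK[OF K]]) (auto intro!: continuous_intros continuous_d)
  then have "continuous_on {s..t} \<phi>" unfolding \<phi>_def using w by (intro continuous_intros) auto
  then obtain c where c: "c \<in> {s..t}" "\<forall>u\<in>{s..t}. \<phi> u \<le> \<phi> c"
    using continuous_attains_sup[of "{s..t}" \<phi>] st by auto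
  have "0 < \<phi> t" using neg by (simp add: \<phi>_def)
  then have pc: "0 < \<phi> c" using c st by (meson atLeastAtMost_iff less_imp_le less_le_trans order_refl)
  have "c \<noteq> s" using pc by (auto simp: \<phi>_def)
  then have sc: "s < c" "c \<le> t" "c - s < Lam" using c st by auto
  define z where "z = sn (d s c / 2)"
  define S where "S = sin (v * (c - s) / 2) / v"
  define C where "C = cos (v * (c - s) / 2)"
  have vc: "0 < v * (c - s)" "v * (c - s) \<le> v * (t - s)" using sc w by auto
  have S0: "0 \<le> S" unfolding S_def using vc vL w(2) pi_gt_zero by (intro divide_nonneg_pos sin_ge_zero) linarith+
  have C0: "0 < C" unfolding C_def using vc vL by (intro cos_gt_zero) linarith+
  have zS: "S < z" using pc by (simp add: \<phi>_def z_def S_def)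
  have "((\<lambda>h. sin (v * ((c - h) - s) / 2) / v) has_real_derivative - (C / 2)) (at 0 within {0<..})"
    unfolding C_def using w by (auto intro!: derivative_eq_intros)
  \<comment> \<open>Only derivatives from the left exist, which is enough: at a maximum
    \<open>c > s\<close> the quotients with \<open>c - h\<close> are nonpositive.\<close>
  from DERIV_diff[OF d_half_left_deriv[OF sc(1,3)] this]
  have "((\<lambda>h. (\<phi> (c - h) - \<phi> c) / h) \<longlongrightarrow> - (csK K (d s c / 2) * cos (be s c) / 2) - - (C / 2)) (at_right 0)"
    unfolding has_field_derivative_iff \<phi>_def by simp
  moreover have "\<forall>\<^sub>F h in at_right 0. (\<phi> (c - h) - \<phi> c) / h \<le> 0"
  proof -
    have "\<forall>\<^sub>F h in at_right 0. 0 < h \<and> h < c - s"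
      unfolding eventually_at_right_field using sc by (intro exI[of _ "c - s"]) auto
    then show ?thesis
    proof eventually_elim
      case (elim h)
      then have "\<phi> (c - h) \<le> \<phi> c" using c sc by auto
      then show ?case using elim by (simp add: divide_nonpos_pos)
    qed
  qed
  ultimately have "- (csK K (d s c / 2) * cos (be s c) / 2) - - (C / 2) \<le> 0"
    by (intro tendsto_upperbound) auto
  then have le: "C \<le> csK K (d s c / 2) * cos (be s c)" by simp
  have dc: "0 < d s c" "sqrt K * d s c < pi" using d_pos[of s c] Kd_lt[of s c] sc by auto
  have cs: "0 < csK K (d s c / 2)" using csK_pos[OF K] dc by simp
  have z: "0 < z" unfolding z_def using S0 zS z_def by simp
  have "0 < csK K (d s c / 2) * cos (be s c)" using C0 le by simp
  then have "0 < cos (be s c)" using cs by (simp add: zero_less_mult_iff)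
  then have b2: "be s c < pi / 2"
    using cos_monotone_0_pi_le[of "pi / 2" "be s c"] be_bounds[of s c] sc by (auto simp: not_less[symmetric])
  have k2: "k\<^sup>2 + K = w\<^sup>2" using K by (simp add: w)
  have "deficit k s c \<le> 0"
  proof (rule deficit_nonpos[OF sc(1,3) k])
    fix u assume u: "s < u" "u \<le> c"
    have du: "0 < d s u" "sqrt K * d s u < pi" using d_pos[of s u] Kd_lt[of s u] u sc by auto
    have csu: "0 < csK K (d s u / 2)" using csK_pos[OF K] du by simp
    have "sqrt K * (d s u / 2) < pi" using du pi_gt_zero by linarith
    then have zu: "0 < sn (d s u / 2)" using snK_pos[OF K] du by simp
    have "(w * sn (d s u / 2))\<^sup>2 < 1\<^sup>2" using small[of u] u sc zu w(2,3) by (intro power_strict_mono) auto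
    then have "(k * sn (d s u / 2))\<^sup>2 < (csK K (d s u / 2))\<^sup>2"
      unfolding csK_sq[OF K] power_mult_distrib k2[symmetric] by (simp add: algebra_simps)
    then have "k * sn (d s u / 2) < csK K (d s u / 2)" by (rule power_less_imp_less_base) (use csu in simp)
    then have "2 * sn (d s u / 2) * (k * sn (d s u / 2)) < 2 * sn (d s u / 2) * csK K (d s u / 2)"
      using zu by (intro mult_strict_left_mono) auto
    then show "k * md (d s u) < sn (d s u)"
      unfolding mdK_half[OF K, of "d s u"] snK_double[OF K, of "d s u"] by (simp add: power2_eq_square algebra_simps)
  qed
  then have "2 * z * (k * z) \<le> 2 * z * (csK K (d s c / 2) * sin (be s c))"
    using b2 unfolding deficit_def mdK_half[OF K, of "d s c"] snK_double[OF K, of "d s c"] z_def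
    by (simp add: power2_eq_square algebra_simps min_def)
  then have "k * z \<le> csK K (d s c / 2) * sin (be s c)" using z by simp
  \<comment> \<open>The sum of squares gives \<open>(k z)^2 + C^2 \<le> 1 - K z^2\<close>, that is
    \<open>(w z)^2 \<le> 1 - C^2 = (v S)^2\<close>, although \<open>w > v\<close> and
    \<open>z > S\<close>.\<close>
  then have "(k * z)\<^sup>2 \<le> (csK K (d s c / 2) * sin (be s c))\<^sup>2" by (rule power_mono) (use k z in simp)
  also have "\<dots> = (csK K (d s c / 2))\<^sup>2 - (csK K (d s c / 2) * cos (be s c))\<^sup>2"
    by (simp add: power_mult_distrib sin_squared_eq algebra_simps)
  also have "\<dots> \<le> (csK K (d s c / 2))\<^sup>2 - C\<^sup>2" using le C0 by (simp add: power_mono)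
  finally have "(k * z)\<^sup>2 \<le> 1 - K * z\<^sup>2 - C\<^sup>2" by (simp add: csK_sq[OF K] z_def)
  moreover have "C\<^sup>2 = 1 - (v * S)\<^sup>2" using w by (simp add: C_def S_def cos_squared_eq)
  ultimately have "(w * z)\<^sup>2 \<le> (v * S)\<^sup>2" unfolding power_mult_distrib k2[symmetric] by (simp add: algebra_simps)
  then have "w * z \<le> v * S" by (rule power2_le_imp_le) (use S0 w(2) in simp)
  moreover have "v * S < w * z" using w(2,3) zS S0 by (intro mult_strict_mono) auto
  ultimately show False by simp
qed

lemma half_chord_tendsto: "((\<lambda>u. sn (d s u / 2)) \<longlongrightarrow> sn (d s t / 2)) (at t within S)"
proof -
  have "continuous_on UNIV (\<lambda>u. sn (d s u / 2))"
    by (rule continuous_on_compose2[OF continuous_snK[OF K]]) (auto intro!: continuous_intros continuous_d)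
  then have "(\<lambda>u. sn (d s u / 2)) \<midarrow>t\<rightarrow> sn (d s t / 2)" unfolding continuous_on_def by simp
  then show ?thesis by (rule tendsto_mono[OF at_le[OF subset_UNIV]])
qed

text \<open>Bootstrapping removes the smallness hypothesis: up to the first point where
  \<open>w sn (d / 2)\<close> reaches 1 the estimate is available, and by \<open>sv\<close> it keeps
  this quantity below 1 there as well.\<close>

lemma half_chord_le_approx:
  assumes st: "s < t" "t - s < Lam" and k: "0 < k" "k < kap" and w: "w = sqrt (k\<^sup>2 + K)" "0 < v" "v < w"
    and vL: "v * (t - s) < pi" and sv: "w * sin (v * (t - s) / 2) < v"
  shows "sn (d s t / 2) \<le> sin (v * (t - s) / 2) / v"
proof (rule half_chord_le_step[OF st k w vL])
  have w0: "0 < w" using w(2,3) by simp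
  have cont: "continuous_on UNIV (\<lambda>u. w * sn (d s u / 2))"
    by (intro continuous_intros continuous_on_compose2[OF continuous_snK[OF K]]) (auto intro!: continuous_intros continuous_d)
  fix u assume u: "s < u" "u \<le> t"
  show "w * sn (d s u / 2) < 1"
  proof (rule ccontr)
    assume neg: "\<not> ?thesis"
    let ?T = "{s..t} \<inter> {x. 1 \<le> w * sn (d s x / 2)}"
    have "compact ?T" by (intro compact_Int_closed compact_Icc closed_Collect_le continuous_on_const cont)
    moreover have "u \<in> ?T" using u neg by auto
    ultimately obtain c where c: "c \<in> ?T" "\<forall>x\<in>?T. c \<le> x" using compact_attains_inf[of ?T] by blast
    have cs: "c \<noteq> s" using c by auto
    then have sc: "s < c" "c \<le> t" using c by auto
    have le: "sn (d s x / 2) \<le> sin (v * (x - s) / 2) / v" if x: "s < x" "x < c" for x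
    proof (rule half_chord_le_step[OF x(1) _ k w])
      show "x - s < Lam" using x sc st by simp
      have "v * (x - s) \<le> v * (t - s)" using x sc w by (intro mult_left_mono) auto
      then show "v * (x - s) < pi" using vL by simp
      show "w * sn (d s y / 2) < 1" if "s < y" "y \<le> x" for y
      proof (rule ccontr)
        assume "\<not> ?thesis"
        then have "y \<in> ?T" using that x sc by auto
        then have "c \<le> y" using c(2) by blast
        then show False using that x by simp
      qed
    qed
    have "sn (d s c / 2) \<le> sin (v * (c - s) / 2) / v"
    proof (rule tendsto_le[of "at_left c"])
      show "((\<lambda>u. sn (d s u / 2)) \<longlongrightarrow> sn (d s c / 2)) (at_left c)" by (rule half_chord_tendsto)
      show "((\<lambda>u. sin (v * (u - s) / 2) / v) \<longlongrightarrow> sin (v * (c - s) / 2) / v) (at_left c)"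
        using w by (intro tendsto_intros) auto
      show "\<forall>\<^sub>F u in at_left c. sn (d s u / 2) \<le> sin (v * (u - s) / 2) / v"
        unfolding eventually_at_left_field using sc le by (intro exI[of _ s]) auto
    qed simp
    also have "\<dots> \<le> sin (v * (t - s) / 2) / v"
    proof (rule divide_right_mono)
      have vc: "0 < v * (c - s)" "v * (c - s) \<le> v * (t - s)" using sc w by auto
      show "sin (v * (c - s) / 2) \<le> sin (v * (t - s) / 2)" using vc vL pi_gt_zero by (intro sin_monotone_2pi_le) linarith+
    qed (use w in simp)
    finally have "w * sn (d s c / 2) \<le> w * (sin (v * (t - s) / 2) / v)" using w0 by (intro mult_left_mono) auto
    also have "\<dots> < 1" using sv w by (simp add: field_simps)
    finally show False using c by simp
  qed
qed

text \<open>The slack of the previous lemmas is removed by two limits: \<open>v\<close> tends to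
  \<open>w\<close> for arcs shorter than a half circle, then the end point moves to the full half
  circle.\<close>

lemma half_chord_le:
  assumes st: "s < t" "t - s < Lam" and w: "w = sqrt (kap\<^sup>2 + K)" and wL: "w * (t - s) \<le> pi"
  shows "sn (d s t / 2) \<le> sin (w * (t - s) / 2) / w"
proof -
  have wK: "sqrt K < w" unfolding w using kap by simp
  then have w0: "0 < w" using K real_sqrt_ge_zero[of K] by linarith
  have lt: "sn (d s t / 2) \<le> sin (w * (t - s) / 2) / w" if st: "s < t" "t - s < Lam" and wL: "w * (t - s) < pi" for t
  proof (rule ccontr)
    assume neg: "\<not> ?thesis"
    have lim: "((\<lambda>v. sin (v * (t - s) / 2) / v) \<longlongrightarrow> sin (w * (t - s) / 2) / w) (at_left w)"
      "((\<lambda>v. w * sin (v * (t - s) / 2) - v) \<longlongrightarrow> w * sin (w * (t - s) / 2) - w) (at_left w)"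
      using w0 by (intro tendsto_intros; simp)+
    have s1: "sin (w * (t - s) / 2) < 1"
    proof -
      have "sin (w * (t - s) / 2) < sin (pi / 2)" using mult_pos_pos[of w "t - s"] w0 st wL pi_gt_zero by (intro sin_monotone_2pi) linarith+
      then show ?thesis by simp
    qed
    have "w * sin (w * (t - s) / 2) - w < 0" using s1 w0 by simp
    then have E2: "\<forall>\<^sub>F v in at_left w. w * sin (v * (t - s) / 2) - v < 0" by (rule order_tendstoD(2)[OF lim(2)])
    have E1: "\<forall>\<^sub>F v in at_left w. sin (v * (t - s) / 2) / v < sn (d s t / 2)" using order_tendstoD(2)[OF lim(1)] neg by simp
    have E3: "\<forall>\<^sub>F v in at_left w. sqrt K < v \<and> v < w" unfolding eventually_at_left_field using wK by blast
    from E1 E2 E3 have "\<forall>\<^sub>F v in at_left w. sin (v * (t - s) / 2) / v < sn (d s t / 2) \<and> w * sin (v * (t - s) / 2) < v \<and> sqrt K < v \<and> v < w"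
      by eventually_elim auto
    from eventually_happens'[OF trivial_limit_at_left_real this]
    obtain v where v: "sin (v * (t - s) / 2) / v < sn (d s t / 2)" "w * sin (v * (t - s) / 2) < v" "sqrt K < v" "v < w" by blast
    have v0: "0 < v" using v(3) K real_sqrt_ge_zero[of K] by linarith
    \<comment> \<open>The curvature \<open>k\<close> belonging to this intermediate value is
      strictly below \<open>kap\<close>, and \<open>v\<close> is strictly below \<open>w'\<close>,
      as both strict hypotheses require.\<close>
    define w' where "w' = (v + w) / 2"
    have w': "v < w'" "w' < w" using v by (auto simp: w'_def)
    define k where "k = sqrt (w'\<^sup>2 - K)"
    have "(sqrt K)\<^sup>2 < w'\<^sup>2" using v w' K by (intro power_strict_mono) auto
    then have wK2: "K < w'\<^sup>2" using K by simp
    have "w'\<^sup>2 < w\<^sup>2" using w' v0 by (intro power_strict_mono) auto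
    also have "w\<^sup>2 = kap\<^sup>2 + K" using K by (simp add: w)
    finally have "sqrt (w'\<^sup>2 - K) < sqrt (kap\<^sup>2)" by (intro real_sqrt_less_mono) simp
    then have k: "0 < k" "k < kap" using wK2 kap by (auto simp: k_def)
    have kw: "w' = sqrt (k\<^sup>2 + K)" using wK2 w' v0 by (simp add: k_def)
    have "v * (t - s) < w * (t - s)" using v st by simp
    then have vL: "v * (t - s) < pi" using wL by simp
    have "0 \<le> sin (v * (t - s) / 2)" using mult_pos_pos[of v "t - s"] v0 st vL pi_gt_zero by (intro sin_ge_zero) linarith+
    then have "w' * sin (v * (t - s) / 2) \<le> w * sin (v * (t - s) / 2)" using w' by (intro mult_right_mono) auto
    then have "w' * sin (v * (t - s) / 2) < v" using v by simp
    then have "sn (d s t / 2) \<le> sin (v * (t - s) / 2) / v" by (rule half_chord_le_approx[OF st k kw v0 w'(1) vL])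
    then show False using v(1) by simp
  qed
  show ?thesis
  proof (rule tendsto_le[of "at_left t"])
    show "((\<lambda>u. sn (d s u / 2)) \<longlongrightarrow> sn (d s t / 2)) (at_left t)" by (rule half_chord_tendsto)
    show "((\<lambda>u. sin (w * (u - s) / 2) / w) \<longlongrightarrow> sin (w * (t - s) / 2) / w) (at_left t)"
      using w0 by (intro tendsto_intros) auto
    show "\<forall>\<^sub>F u in at_left t. sn (d s u / 2) \<le> sin (w * (u - s) / 2) / w"
      unfolding eventually_at_left_field
    proof (intro exI[of _ s] conjI allI impI)
      fix u assume u: "s < u" "u < t"
      have "w * (u - s) < w * (t - s)" using u w0 by simp
      then show "sn (d s u / 2) \<le> sin (w * (u - s) / 2) / w" using u st wL by (intro lt) auto
    qed (use st in simp)
  qed simp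
qed

end

section \<open>Spherical polygons\<close>

lemma Arg_upper:
  assumes "z \<noteq> 0" "0 \<le> Im z" shows "0 \<le> Arg z" "Arg z \<le> pi"
  using assms Arg_less_0[of z] Arg_le_pi[of z] by auto

lemma Arg_le_of_cross:
  assumes "0 < Im z" "u \<noteq> 0" "0 \<le> Im u" "0 \<le> Re z * Im u - Im z * Re u"
  shows "Arg z \<le> Arg u"
proof (rule ccontr)
  assume neg: "\<not> ?thesis"
  have z: "z \<noteq> 0" "0 < Arg z" "Arg z < pi" using assms Arg_lt_pi[of z] by auto
  have u: "0 \<le> Arg u" "Arg u \<le> pi" using Arg_upper[OF assms(2,3)] by auto
  have e: "Re z = cmod z * cos (Arg z)" "Im z = cmod z * sin (Arg z)" "Re u = cmod u * cos (Arg u)" "Im u = cmod u * sin (Arg u)"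
    using rcis_cmod_Arg[of z] rcis_cmod_Arg[of u] Re_rcis Im_rcis by metis+
  have "Re z * Im u - Im z * Re u = cmod z * cmod u * sin (Arg u - Arg z)"
    unfolding e sin_diff by (simp add: algebra_simps)
  moreover have "sin (Arg u - Arg z) < 0" 
  proof -
    have "0 < sin (Arg z - Arg u)" using neg z u by (intro sin_gt_zero) auto
    then show ?thesis using sin_minus[of "Arg z - Arg u"] by simp
  qed
  then have "cmod z * cmod u * sin (Arg u - Arg z) < 0" using z assms(2) by (simp add: mult_pos_neg)
  ultimately show False using assms(4) by simp
qed

lemma Arg_cis_mult:
  assumes z: "z \<noteq> 0" "0 \<le> Im z" and t: "0 \<le> t" "t < pi" and im: "0 \<le> Im (cis t * z)"
  shows "Arg (cis t * z) = Arg z + t"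
proof -
  note A = Arg_upper[OF z]
  have zz: "z = cmod z * cis (Arg z)" using rcis_cmod_Arg[of z] by (simp add: rcis_def)
  have eq: "cis t * z = cmod z * cis (Arg z + t)" by (subst zz) (simp add: cis_mult[symmetric] mult_ac)
  then have "0 \<le> cmod z * sin (Arg z + t)" using im by simp
  then have s: "0 \<le> sin (Arg z + t)" using z by (simp add: zero_le_mult_iff)
  have le: "Arg z + t \<le> pi"
  proof (rule ccontr)
    assume "\<not> ?thesis"
    then have "0 < sin (Arg z + t - pi)" using A t by (intro sin_gt_zero) auto
    then show False using s by simp
  qed
  have "sgn (cis t * z) = cis (Arg z + t)" unfolding eq using z by (simp add: sgn_mult sgn_of_real)
  then show ?thesis by (rule cis_Arg_unique) (use A t le pi_gt_zero in linarith)+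
qed

lemma polar_upper:
  fixes a b :: real
  assumes "0 < b" shows "\<exists>\<rho> \<eta>. 0 < \<rho> \<and> 0 < \<eta> \<and> \<eta> < pi \<and> \<rho> * cos \<eta> = a \<and> \<rho> * sin \<eta> = b"
proof -
  define z where "z = Complex a b"
  have z: "z \<noteq> 0" using assms by (auto simp: z_def complex_eq_iff)
  have "0 < Arg z \<and> Arg z < pi" using assms Arg_lt_pi[of z] by (simp add: z_def)
  moreover have "cmod z * cos (Arg z) = Re z" "cmod z * sin (Arg z) = Im z"
    using rcis_cmod_Arg[of z] Re_rcis Im_rcis by metis+
  ultimately show ?thesis using z by (intro exI[of _ "cmod z"] exI[of _ "Arg z"]) (simp add: z_def)
qed

text \<open>A unit vector with components \<open>Y, V, W\<close> along position, velocity and normal of a curve on the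
  unit sphere is transported along a geodesic edge of length \<open>e\<close>; in polar coordinates \<open>(r, \<phi>)\<close>
  around the apex of a fan, \<open>\<omega>\<close> and \<open>B\<close> are the directions of the edge at its two ends.\<close>
lemma geodesic_edge_transport:
  fixes a b e om B f f' :: real
  assumes e: "sin e > 0"
    and sr1: "sin om * sin e = sin b * sin (f - f')"
    and fp1: "sin e * cos om = sin b * cos a * cos (f - f') - cos b * sin a"
    and ce: "cos e = cos a * cos b + sin a * sin b * cos (f - f')"
    and sr2: "sin B * sin e = sin a * sin (f - f')"
    and fp2: "sin e * cos B = cos a * sin b - sin a * cos b * cos (f - f')"
  defines "V \<equiv> cos om * (cos a * sin f) - sin om * cos f" and "W \<equiv> sin om * (cos a * sin f) + cos om * cos f"
    and "V' \<equiv> cos B * (cos b * sin f') - sin B * cos f'" and "W' \<equiv> sin B * (cos b * sin f') + cos B * cos f'"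
  shows "sin b * sin f' = sin a * sin f * cos e + V * sin e"
    and "V' = V * cos e - sin a * sin f * sin e" and "W' = W"
proof -
  define D where "D = f - f'"
  have f: "sin f' = sin f * cos D - cos f * sin D" "cos f' = cos f * cos D + sin f * sin D"
    using sin_diff[of f D] cos_diff[of f D] by (simp_all add: D_def)
  have ff: "sin f = sin f' * cos D + cos f' * sin D" "cos f = cos f' * cos D - sin f' * sin D"
    using sin_add[of f' D] cos_add[of f' D] by (simp_all add: D_def)
  note r = sr1[folded D_def] fp1[folded D_def] ce[folded D_def] sr2[folded D_def] fp2[folded D_def]
  have aa: "cos a * cos a = 1 - sin a * sin a" "cos b * cos b = 1 - sin b * sin b"
    using sin_cos_squared_add3[of a] sin_cos_squared_add3[of b] by (simp_all add: algebra_simps)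
  have "V * sin e = (sin e * cos om) * cos a * sin f - (sin om * sin e) * cos f" by (simp add: V_def algebra_simps)
  also have "\<dots> = (sin b * cos a * cos D - cos b * sin a) * cos a * sin f - sin b * sin D * cos f" by (simp only: r)
  also have "\<dots> = sin b * (cos a * cos a) * cos D * sin f - cos b * sin a * cos a * sin f - sin b * sin D * cos f" by (simp add: algebra_simps)
  also have "\<dots> = sin b * (sin f * cos D - cos f * sin D) - sin a * sin f * (cos a * cos b + sin a * sin b * cos D)"
    unfolding aa by (simp add: algebra_simps)
  also have "\<dots> = sin b * sin f' - sin a * sin f * cos e" by (simp only: f r)
  finally have 1: "V * sin e = sin b * sin f' - sin a * sin f * cos e" .
  then show "sin b * sin f' = sin a * sin f * cos e + V * sin e" by simp
  have "V' * sin e = (sin e * cos B) * cos b * sin f' - (sin B * sin e) * cos f'" by (simp add: V'_def algebra_simps)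
  also have "\<dots> = (cos a * sin b - sin a * cos b * cos D) * cos b * sin f' - sin a * sin D * cos f'" by (simp only: r)
  also have "\<dots> = cos a * sin b * cos b * sin f' - sin a * (cos b * cos b) * cos D * sin f' - sin a * sin D * cos f'" by (simp add: algebra_simps)
  also have "\<dots> = sin b * sin f' * (cos a * cos b + sin a * sin b * cos D) - sin a * (sin f' * cos D + cos f' * sin D)"
    unfolding aa by (simp add: algebra_simps)
  also have "\<dots> = sin b * sin f' * cos e - sin a * sin f" by (simp only: ff r)
  finally have "V' * sin e = (sin a * sin f * cos e + V * sin e) * cos e - sin a * sin f" using 1 by simp
  also have "\<dots> = V * sin e * cos e - sin a * sin f * (1 - cos e * cos e)" by (simp add: algebra_simps)
  also have "1 - cos e * cos e = sin e * sin e" using sin_cos_squared_add3[of e] by linarith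
  finally have "V' * sin e = (V * cos e - sin a * sin f * sin e) * sin e" by (simp add: algebra_simps)
  then show "V' = V * cos e - sin a * sin f * sin e" using e by simp
  have "W * sin e = (sin om * sin e) * cos a * sin f + (sin e * cos om) * cos f" by (simp add: W_def algebra_simps)
  also have "\<dots> = sin b * sin D * cos a * sin f + (sin b * cos a * cos D - cos b * sin a) * cos f" by (simp only: r)
  also have "\<dots> = sin b * cos a * (cos f * cos D + sin f * sin D) - cos b * sin a * cos f" by (simp add: algebra_simps)
  also have "\<dots> = sin b * cos a * cos f' - cos b * sin a * cos f" by (simp only: f)
  finally have w1: "W * sin e = sin b * cos a * cos f' - cos b * sin a * cos f" .
  have "W' * sin e = (sin B * sin e) * cos b * sin f' + (sin e * cos B) * cos f'" by (simp add: W'_def algebra_simps)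
  also have "\<dots> = sin a * sin D * cos b * sin f' + (cos a * sin b - sin a * cos b * cos D) * cos f'" by (simp only: r)
  also have "\<dots> = cos a * sin b * cos f' - sin a * cos b * (cos f' * cos D - sin f' * sin D)" by (simp add: algebra_simps)
  also have "\<dots> = sin b * cos a * cos f' - cos b * sin a * cos f" by (simp only: ff) (simp add: algebra_simps)
  finally have "W' * sin e = W * sin e" using w1 by simp
  then show "W' = W" using e by simp
qed

text \<open>Turning by \<open>\<delta>\<close>, following a geodesic edge and turning by \<open>\<delta>\<close> again has the same effect as
  following an arc of constant curvature; there the phase \<open>V + i (Y - \<kappa> W) / w\<close> rotates uniformly.\<close>
lemma curved_edge_rotation:
  fixes Y V W :: real
  assumes w: "w\<^sup>2 = kk\<^sup>2 + 1" "w > 0" and e: "sin e > 0" and d: "sin \<delta> * (1 + cos e) = kk * sin e"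
    and cl: "cos t = (cos \<delta>)\<^sup>2 * (1 + cos e) - 1" and sl: "sin t = w * sin e * cos \<delta>"
  defines "V1 \<equiv> V * cos \<delta> + W * sin \<delta>" and "W1 \<equiv> W * cos \<delta> - V * sin \<delta>"
  defines "Y2 \<equiv> Y * cos e + V1 * sin e" and "V2 \<equiv> V1 * cos e - Y * sin e"
  shows "Complex (V2 * cos \<delta> + W1 * sin \<delta>) ((Y2 - kk * (W1 * cos \<delta> - V2 * sin \<delta>)) / w)
    = cis t * Complex V ((Y - kk * W) / w)"
proof -
  define S C c s where "S = sin e" and "C = cos e" and "c = cos \<delta>" and "s = sin \<delta>"
  have h: "s * s = 1 - c * c" "S * S = 1 - C * C" "s * (1 + C) = kk * S"
  proof -
    show "s * s = 1 - c * c" using sin_cos_squared_add3[of \<delta>] unfolding s_def c_def by linarith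
    show "S * S = 1 - C * C" using sin_cos_squared_add3[of e] unfolding S_def C_def by linarith
    show "s * (1 + C) = kk * S" using d by (simp add: s_def S_def C_def)
  qed
  have "1 + C \<noteq> 0"
  proof
    assume "1 + C = 0"
    then have "C = - 1" by simp
    then have "S * S = 0" using h(2) by simp
    then show False using e by (simp add: S_def)
  qed
  moreover have "(1 + C) * (S * s) = (1 + C) * (kk * (1 - C))"
  proof -
    have "(1 + C) * (S * s) = S * (s * (1 + C))" by (simp add: algebra_simps)
    also have "\<dots> = kk * (S * S)" unfolding h(3) by simp
    finally show ?thesis unfolding h(2) by (simp add: algebra_simps)
  qed
  ultimately have Ss: "S * s = kk * (1 - C)" by simp
  have t: "cos t = c * c * (1 + C) - 1" "sin t = w * S * c" using cl sl by (simp_all add: c_def S_def C_def power2_eq_square)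
  have ww: "w * w = kk * kk + 1" using w by (simp add: power2_eq_square)
  have re: "V2 * c + W1 * s = cos t * V - S * c * (Y - kk * W)"
  proof -
    have "V2 * c + W1 * s = V * (c * c * C - s * s) + W * c * (s * (1 + C)) - Y * S * c"
      by (simp add: V2_def W1_def V1_def S_def[symmetric] C_def[symmetric] c_def[symmetric] s_def[symmetric] algebra_simps)
    then show ?thesis unfolding h t by (simp add: algebra_simps)
  qed
  have im: "Y2 - kk * (W1 * c - V2 * s) = (w * w) * S * c * V + cos t * (Y - kk * W)"
  proof -
    have "Y2 - kk * (W1 * c - V2 * s) = V * c * (S + kk * (s * (1 + C))) + Y * (C - kk * (S * s)) + W * (S * s - kk * (c * c - (s * s) * C))"
      by (simp add: Y2_def V2_def W1_def V1_def S_def[symmetric] C_def[symmetric] c_def[symmetric] s_def[symmetric] algebra_simps)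
    also have "\<dots> = V * c * (S + kk * (kk * S)) + Y * (C - kk * (kk * (1 - C))) + W * (kk * (1 - C) - kk * (c * c - (1 - c * c) * C))"
      unfolding h(1,3) Ss ..
    also have "kk * (kk * (1 - C)) = 1 + C - c * c * (1 + C)"
    proof -
      have "kk * (kk * (1 - C)) = s * (kk * S)" using Ss by (simp add: mult_ac)
      also have "\<dots> = (s * s) * (1 + C)" unfolding h(3)[symmetric] by simp
      finally show ?thesis unfolding h(1) by (simp add: algebra_simps)
    qed
    finally show ?thesis unfolding t ww by (simp add: algebra_simps)
  qed
  show ?thesis
  proof (rule complex_eqI)
    show "Re (Complex (V2 * cos \<delta> + W1 * sin \<delta>) ((Y2 - kk * (W1 * cos \<delta> - V2 * sin \<delta>)) / w)) = Re (cis t * Complex V ((Y - kk * W) / w))"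
    proof -
      have "V2 * cos \<delta> + W1 * sin \<delta> = cos t * V - (w * S * c) * ((Y - kk * W) / w)" using re w(2) by (simp add: c_def s_def)
      then show ?thesis unfolding t(2)[symmetric] by simp
    qed
    show "Im (Complex (V2 * cos \<delta> + W1 * sin \<delta>) ((Y2 - kk * (W1 * cos \<delta> - V2 * sin \<delta>)) / w)) = Im (cis t * Complex V ((Y - kk * W) / w))"
    proof -
      have "(Y2 - kk * (W1 * cos \<delta> - V2 * sin \<delta>)) / w = ((w * w) * S * c * V + cos t * (Y - kk * W)) / w" using im by (simp add: c_def s_def)
      also have "\<dots> = cos t * ((Y - kk * W) / w) + (w * S * c) * V" using w(2) by (simp add: add_divide_distrib)
      finally show ?thesis unfolding t(2)[symmetric] by simp
    qed
  qed
qed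

text \<open>The polygon is given in polar coordinates \<open>(r, \<phi>)\<close> around its first
  vertex, with the last vertex on the axis \<open>\<phi> = 0\<close>. With \<open>Y\<close> the
  height over the axis, the phase of an arc of curvature \<open>kk\<close> over an edge advances by
  exactly \<open>w lam\<close>; it does not go back at vertices or on gap edges, where
  \<open>lam = 0\<close>. It starts at an argument at least 0 and never leaves the upper half
  plane.\<close>

lemma polygon_phase:
  fixes r \<phi> \<omega> B e \<delta> lam :: "nat \<Rightarrow> real"
  assumes n: "2 \<le> n" and kk: "0 \<le> kk" and w: "w\<^sup>2 = kk\<^sup>2 + 1" "0 < w"
    and r0: "r 0 = 0" and rpos: "\<And>i. 0 < i \<Longrightarrow> i \<le> n \<Longrightarrow> 0 < sin (r i)"
    and phn: "\<phi> n = 0" and ph: "\<And>i. i \<le> n \<Longrightarrow> \<phi> i < pi / 2" and phm: "\<And>i. i < n \<Longrightarrow> \<phi> (Suc i) \<le> \<phi> i"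
    and om: "\<And>i. i < n \<Longrightarrow> 0 \<le> \<omega> i \<and> \<omega> i \<le> pi" and B: "\<And>i. i < n \<Longrightarrow> 0 \<le> B i" and e: "\<And>i. i < n \<Longrightarrow> 0 < sin (e i)"
    and om0: "\<omega> 0 = 0" and om1: "0 < \<omega> (n - 1)"
    and sr1: "\<And>i. i < n \<Longrightarrow> sin (\<omega> i) * sin (e i) = sin (r (Suc i)) * sin (\<phi> i - \<phi> (Suc i))"
    and fp1: "\<And>i. i < n \<Longrightarrow> sin (e i) * cos (\<omega> i) = sin (r (Suc i)) * cos (r i) * cos (\<phi> i - \<phi> (Suc i)) - cos (r (Suc i)) * sin (r i)"
    and ce: "\<And>i. i < n \<Longrightarrow> cos (e i) = cos (r i) * cos (r (Suc i)) + sin (r i) * sin (r (Suc i)) * cos (\<phi> i - \<phi> (Suc i))"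
    and sr2: "\<And>i. i < n \<Longrightarrow> sin (B i) * sin (e i) = sin (r i) * sin (\<phi> i - \<phi> (Suc i))"
    and fp2: "\<And>i. i < n \<Longrightarrow> sin (e i) * cos (B i) = cos (r i) * sin (r (Suc i)) - sin (r i) * cos (r (Suc i)) * cos (\<phi> i - \<phi> (Suc i))"
    and turn: "\<And>i. Suc i < n \<Longrightarrow> B i + \<delta> i + \<delta> (Suc i) \<le> \<omega> (Suc i)"
    and start: "\<phi> 0 + \<delta> 0 \<le> pi / 2" and fin: "B (n - 1) + \<delta> (n - 1) \<le> pi / 2"
    and del: "\<And>i. i < n \<Longrightarrow> 0 \<le> \<delta> i"
    and edge: "\<And>i. i < n \<Longrightarrow> (lam i = 0 \<and> \<delta> i = 0 \<and> 0 < i \<and> Suc i < n) \<or> (0 \<le> lam i \<and> w * lam i < pi \<and> sin (\<delta> i) * (1 + cos (e i)) = kk * sin (e i)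
      \<and> cos (w * lam i) = (cos (\<delta> i))\<^sup>2 * (1 + cos (e i)) - 1 \<and> sin (w * lam i) = w * sin (e i) * cos (\<delta> i))"
  shows "(\<Sum>i<n. w * lam i) \<le> pi"
proof -
  have mono: "\<phi> j \<le> \<phi> i" if "i \<le> j" "j \<le> n" for i j
    using that
  proof (induction j rule: dec_induct)
    case (step m) then show ?case using phm[of m] by simp
  qed simp
  have ph0: "0 \<le> \<phi> i" if "i \<le> n" for i using mono[of i n] that phn by simp
  \<comment> \<open>If the last fan triangle were flat, its outer edge would leave pointing towards
    the apex and arrive pointing away from it.\<close>
  have phl: "0 < \<phi> (n - 1)"
  proof (rule ccontr)
    assume "\<not> ?thesis"
    then have z: "\<phi> (n - 1) = 0" using ph0[of "n - 1"] by simp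
    have n1: "n - 1 < n" "Suc (n - 1) = n" using n by auto
    have "sin (\<omega> (n - 1)) * sin (e (n - 1)) = 0" using sr1[OF n1(1)] z phn n1 by simp
    then have "sin (\<omega> (n - 1)) = 0" using e[OF n1(1)] by simp
    then have "\<omega> (n - 1) = pi" using om1 om[OF n1(1)] sin_gt_zero[of "\<omega> (n - 1)"] by force
    moreover have "sin (B (n - 1)) * sin (e (n - 1)) = 0" using sr2[OF n1(1)] z phn n1 by simp
    then have "sin (B (n - 1)) = 0" using e[OF n1(1)] by simp
    then have "B (n - 1) = 0" using B[OF n1(1)] fin del[OF n1(1)] sin_gt_zero[of "B (n - 1)"] pi_gt_zero by force
    ultimately have "- sin (e (n - 1)) = sin (e (n - 1))" using fp1[OF n1(1)] fp2[OF n1(1)] z phn n1 by (simp add: mult.commute)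
    then show False using e[OF n1(1)] by simp
  qed
  have phpos: "0 < \<phi> i" if "i < n" for i 
  proof -
    have "i \<le> n - 1" using that by simp
    from mono[OF this] show ?thesis using phl by simp
  qed
  have "\<exists>\<rho> \<eta>. 0 < \<rho> \<and> 0 < \<eta> \<and> \<eta> < pi \<and> \<rho> * cos \<eta> = cos (r i) * sin (\<phi> i) \<and> \<rho> * sin \<eta> = cos (\<phi> i)" if "i \<le> n" for i
    using ph[OF that] ph0[OF that] by (intro polar_upper cos_gt_zero_pi) auto
  then obtain \<rho> \<eta> where pe: "\<And>i. i \<le> n \<Longrightarrow> 0 < \<rho> i" "\<And>i. i \<le> n \<Longrightarrow> 0 < \<eta> i" "\<And>i. i \<le> n \<Longrightarrow> \<eta> i < pi"
    "\<And>i. i \<le> n \<Longrightarrow> \<rho> i * cos (\<eta> i) = cos (r i) * sin (\<phi> i)" "\<And>i. i \<le> n \<Longrightarrow> \<rho> i * sin (\<eta> i) = cos (\<phi> i)" by metis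
  \<comment> \<open>\<open>\<rho>\<close> and \<open>\<eta>\<close> are the length and direction of
    the gradient of \<open>Y\<close>. Hence \<open>P\<close> and \<open>Q\<close> are the angles
    between an edge and the gradient at its two ends, and \<open>\<rho> cos P\<close> is the
    derivative of the height along the edge.\<close>
  define Y where "Y i = sin (r i) * sin (\<phi> i)" for i
  define P where "P i = \<omega> i + \<eta> i" for i
  define Q where "Q i = B i + \<eta> (Suc i)" for i
  have V: "\<rho> i * cos (x + \<eta> i) = cos x * (cos (r i) * sin (\<phi> i)) - sin x * cos (\<phi> i)"
    and W: "\<rho> i * sin (x + \<eta> i) = sin x * (cos (r i) * sin (\<phi> i)) + cos x * cos (\<phi> i)" if "i \<le> n" for i x
    unfolding pe(4)[OF that, symmetric] pe(5)[OF that, symmetric] cos_add sin_add by (simp_all add: algebra_simps)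
  have E1: "Y (Suc i) = Y i * cos (e i) + \<rho> i * cos (P i) * sin (e i)"
    and E2: "\<rho> (Suc i) * cos (Q i) = \<rho> i * cos (P i) * cos (e i) - Y i * sin (e i)"
    and E3: "\<rho> (Suc i) * sin (Q i) = \<rho> i * sin (P i)" if i: "i < n" for i
    using geodesic_edge_transport[OF e sr1 fp1 ce sr2 fp2, OF i i i i i i] V[of i "\<omega> i"] W[of i "\<omega> i"] V[of "Suc i" "B i"] W[of "Suc i" "B i"] i
    by (simp_all add: Y_def P_def Q_def)
  have etan: "\<eta> n = pi / 2"
  proof -
    have "cos (\<eta> n) = cos (pi / 2)" using pe(4)[of n] pe(1)[of n] phn by simp
    then show ?thesis by (rule cos_inj_pi[rotated 4]) (use pe(2,3)[of n] pi_gt_zero in linarith)+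
  qed
  have eta0: "\<eta> 0 = pi / 2 - \<phi> 0" "\<rho> 0 = 1"
  proof -
    have 1: "\<rho> 0 * cos (\<eta> 0) = sin (\<phi> 0)" "\<rho> 0 * sin (\<eta> 0) = cos (\<phi> 0)" using pe(4,5)[of 0] r0 by auto
    have "(\<rho> 0 * cos (\<eta> 0))\<^sup>2 + (\<rho> 0 * sin (\<eta> 0))\<^sup>2 = (\<rho> 0)\<^sup>2 * ((cos (\<eta> 0))\<^sup>2 + (sin (\<eta> 0))\<^sup>2)" by (simp only: power_mult_distrib distrib_left)
    then have "(\<rho> 0)\<^sup>2 = 1" unfolding 1 by simp
    then show rho: "\<rho> 0 = 1" using pe(1)[of 0] by (simp add: power2_eq_1_iff)
    have "cos (\<eta> 0) = cos (pi / 2 - \<phi> 0)" using 1 rho by (simp add: cos_diff)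
    then show "\<eta> 0 = pi / 2 - \<phi> 0"
      by (rule cos_inj_pi[rotated 4]) (use pe(2,3)[of 0] ph[of 0] ph0[of 0] pi_gt_zero in linarith)+
  qed
  \<comment> \<open>The induction runs backwards because the final angle is controlled by
    \<open>fin\<close> and \<open>\<eta> n = pi / 2\<close>. By \<open>E3\<close> the sign of the
    sine passes from the end of an edge to its beginning, and \<open>turn\<close> passes the bound
    to the previous edge.\<close>
  have PQ: "P i \<le> pi \<and> Q i \<le> pi" if "i < n" for i
    using that
  proof (induction "n - i" arbitrary: i rule: less_induct)
    case less
    have Q: "Q i \<le> pi"
    proof (cases "Suc i = n")
      case True
      then have "i = n - 1" by simp
      then show ?thesis using fin del[of i] less True by (simp add: Q_def etan)
    next
      case False
      then have "P (Suc i) \<le> pi" using less by auto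
      moreover have "B i \<le> \<omega> (Suc i)" using turn[of i] del[of i] del[of "Suc i"] less False by simp
      ultimately show ?thesis by (simp add: P_def Q_def)
    qed
    have "0 \<le> sin (Q i)" using Q B[of i] pe(2)[of "Suc i"] less by (intro sin_ge_zero) (auto simp: Q_def)
    then have "0 \<le> \<rho> i * sin (P i)" using E3[of i] pe(1)[of "Suc i"] less by (metis Suc_leI less_imp_le zero_le_mult_iff)
    then have sP: "0 \<le> sin (P i)" using pe(1)[of i] less by (simp add: zero_le_mult_iff)
    have "P i \<le> pi"
    proof (rule ccontr)
      assume "\<not> ?thesis"
      then have "0 < sin (P i - pi)" using om[of i] pe(3)[of i] less by (intro sin_gt_zero) (auto simp: P_def)
      then show False using sP by simp
    qed
    then show ?case using Q by simp
  qed
  \<comment> \<open>The corresponding angles for the arcs of curvature \<open>kk\<close> erected on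
    the outer side of the edges, which make the angle \<open>\<delta>\<close> with them.\<close>
  define q where "q i = P i - \<delta> i" for i
  define q' where "q' i = Q i + \<delta> i" for i
  have qq: "q' i \<le> q (Suc i)" if "Suc i < n" for i using turn[OF that] by (simp add: q_def q'_def P_def Q_def)
  have q'b: "0 \<le> q' i \<and> q' i \<le> pi" if "i < n" for i
  proof
    show "0 \<le> q' i" using B[of i] del[of i] pe(2)[of "Suc i"] that by (simp add: q'_def Q_def)
    show "q' i \<le> pi"
    proof (cases "Suc i = n")
      case True
      then have "i = n - 1" by simp
      then show ?thesis using fin True by (simp add: q'_def Q_def etan)
    next
      case False
      then show ?thesis using qq[of i] PQ[of "Suc i"] del[of "Suc i"] that by (simp add: q_def)
    qed
  qed
  have qb: "0 \<le> q i \<and> q i \<le> pi" if "i < n" for i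
  proof
    show "q i \<le> pi" using PQ[of i] del[of i] that by (simp add: q_def)
    show "0 \<le> q i"
    proof (cases i)
      case 0 then show ?thesis using start by (simp add: q_def P_def om0 eta0)
    next
      case (Suc j) then show ?thesis using qq[of j] q'b[of j] that by simp
    qed
  qed
  have Y0: "0 \<le> Y i" if "i \<le> n" for i
  proof (cases "i = 0")
    case True then show ?thesis by (simp add: Y_def r0)
  next
    case False
    have "0 \<le> sin (\<phi> i)" using that ph[of i] ph0[of i] by (intro sin_ge_zero) auto
    then show ?thesis using rpos[of i] that False by (simp add: Y_def)
  qed
  have Ypos: "0 < Y i" if "0 < i" "i < n" for i
  proof -
    have "0 < sin (\<phi> i)" using that ph[of i] phpos[of i] by (intro sin_gt_zero) auto
    then show ?thesis using rpos[of i] that by (simp add: Y_def)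
  qed
  \<comment> \<open>Along such an arc, with \<open>W = - \<rho> sin q\<close>, one has
    \<open>Y' = V\<close>, \<open>V' = kk W - Y\<close> and \<open>W' = - kk V\<close>; hence
    \<open>V + i (Y - kk W) / w\<close> rotates with speed \<open>w\<close>. The values
    \<open>c i\<close> and \<open>c' i\<close> belong to its two ends.\<close>
  define c where "c i = Complex (\<rho> i * cos (q i)) ((Y i - kk * (- (\<rho> i * sin (q i)))) / w)" for i
  define c' where "c' i = Complex (\<rho> (Suc i) * cos (q' i)) ((Y (Suc i) - kk * (- (\<rho> (Suc i) * sin (q' i)))) / w)" for i
  have sq: "0 \<le> kk * (\<rho> i * sin (q i))" if "i < n" for i
    using kk pe(1)[of i] qb[of i] that by (intro mult_nonneg_nonneg sin_ge_zero) auto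
  have sq': "0 \<le> kk * (\<rho> (Suc i) * sin (q' i))" if "i < n" for i
    using kk pe(1)[of "Suc i"] q'b[of i] that by (intro mult_nonneg_nonneg sin_ge_zero) auto
  have Imc: "0 \<le> Im (c i)" if "i < n" for i
    using sq[OF that] Y0[of i] that w(2) by (simp add: c_def)
  have Imc': "0 \<le> Im (c' i)" if "i < n" for i
    using sq'[OF that] Y0[of "Suc i"] that w(2) by (simp add: c'_def)
  have Impos: "0 < Im (c i)" if "0 < i" "i < n" for i
    using sq[OF that(2)] Ypos[OF that] w(2) by (simp add: c_def add_pos_nonneg)
  have Impos': "0 < Im (c' i)" if "Suc i < n" for i
    using sq'[of i] Ypos[of "Suc i"] that w(2) by (simp add: c'_def add_pos_nonneg)
  have c0: "c i \<noteq> 0" if "i < n" for i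
  proof (cases "i = 0")
    case True
    have "q 0 = pi / 2 - (\<phi> 0 + \<delta> 0)" by (simp add: q_def P_def om0 eta0)
    then have "Re (c 0) = sin (\<phi> 0 + \<delta> 0)" by (simp add: c_def eta0 cos_diff)
    moreover have "0 < sin (\<phi> 0 + \<delta> 0)" using phpos[of 0] del[of 0] start that True pi_gt_zero by (intro sin_gt_zero) linarith+
    ultimately show ?thesis using True by (metis less_irrefl zero_complex.sel(1))
  next
    case False then show ?thesis using Impos[of i] that by auto
  qed
  have step: "c' i \<noteq> 0 \<and> Arg (c i) + w * lam i \<le> Arg (c' i)" if i: "i < n" for i
    using edge[OF i]
  proof
    \<comment> \<open>A gap edge is a geodesic, while the phase still contains \<open>kk\<close>.
      The cross product is nonnegative because both end heights are, which yields
      \<open>v (1 - C) + y S \<ge> 0\<close>.\<close>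
    assume g: "lam i = 0 \<and> \<delta> i = 0 \<and> 0 < i \<and> Suc i < n"
    have q: "q i = P i" "q' i = Q i" using g by (auto simp: q_def q'_def)
    define S C v x y where "S = sin (e i)" and "C = cos (e i)" and "v = \<rho> i * cos (P i)" and "x = \<rho> i * sin (P i)" and "y = Y i"
    have ci: "Re (c i) = v" "Im (c i) = (y + kk * x) / w" by (simp_all add: c_def q v_def x_def y_def)
    have ci': "Re (c' i) = v * C - y * S" "Im (c' i) = (y * C + v * S + kk * x) / w"
      using E1[OF i] E2[OF i] E3[OF i] by (simp_all add: c'_def q v_def x_def y_def S_def C_def)
    have x: "0 \<le> x" unfolding x_def using pe(1)[of i] qb[of i] i q by (intro mult_nonneg_nonneg sin_ge_zero) auto
    have SC: "S * S = 1 - C * C" "0 < S" using sin_cos_squared_add3[of "e i"] e[OF i] unfolding S_def C_def by linarith+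
    have yy: "0 \<le> y" "0 \<le> y * C + v * S" using Y0[of i] Y0[of "Suc i"] E1[OF i] i by (auto simp: y_def v_def S_def C_def mult_ac)
    have "S * (v * (1 - C) + y * S) = (1 - C) * (y + (y * C + v * S)) + y * (S * S - (1 - C * C))" by (simp add: algebra_simps)
    then have "S * (v * (1 - C) + y * S) = (1 - C) * (y + (y * C + v * S))" unfolding SC by simp
    moreover have "0 \<le> (1 - C) * (y + (y * C + v * S))" using yy by (intro mult_nonneg_nonneg) (auto simp: C_def)
    ultimately have m: "0 \<le> v * (1 - C) + y * S" using SC by (metis zero_le_mult_iff not_less)
    have "Re (c i) * Im (c' i) - Im (c i) * Re (c' i) = (S * (v * v + y * y) + kk * x * (v * (1 - C) + y * S)) / w"
      unfolding ci ci' using w(2) by (simp add: field_simps)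
    moreover have "0 \<le> (S * (v * v + y * y) + kk * x * (v * (1 - C) + y * S)) / w"
    proof -
      have "0 \<le> S * (v * v + y * y)" using SC by simp
      moreover have "0 \<le> kk * x * (v * (1 - C) + y * S)" using kk x m by simp
      ultimately show ?thesis using w(2) by simp
    qed
    moreover have "c' i \<noteq> 0" using Impos'[of i] g by auto
    ultimately show ?thesis using Arg_le_of_cross[of "c i" "c' i"] Impos[of i] Imc'[OF i] g i by simp
  next
    assume f: "0 \<le> lam i \<and> w * lam i < pi \<and> sin (\<delta> i) * (1 + cos (e i)) = kk * sin (e i)
      \<and> cos (w * lam i) = (cos (\<delta> i))\<^sup>2 * (1 + cos (e i)) - 1 \<and> sin (w * lam i) = w * sin (e i) * cos (\<delta> i)"
    have P: "cos (P i) = cos (q i) * cos (\<delta> i) - sin (q i) * sin (\<delta> i)" "sin (P i) = sin (q i) * cos (\<delta> i) + cos (q i) * sin (\<delta> i)"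
      using cos_add[of "q i" "\<delta> i"] sin_add[of "q i" "\<delta> i"] by (simp_all add: q_def)
    have Q: "cos (q' i) = cos (Q i) * cos (\<delta> i) - sin (Q i) * sin (\<delta> i)" "sin (q' i) = sin (Q i) * cos (\<delta> i) + cos (Q i) * sin (\<delta> i)"
      by (simp_all add: q'_def cos_add sin_add)
    let ?V = "\<rho> i * cos (q i)" and ?W = "- (\<rho> i * sin (q i))"
    have V1: "?V * cos (\<delta> i) + ?W * sin (\<delta> i) = \<rho> i * cos (P i)" unfolding P by (simp add: algebra_simps)
    have W1: "?W * cos (\<delta> i) - ?V * sin (\<delta> i) = - (\<rho> (Suc i) * sin (Q i))" unfolding E3[OF i] P by (simp add: algebra_simps)
    have eq: "c' i = cis (w * lam i) * c i"
      using curved_edge_rotation[OF w e[OF i], of "\<delta> i" "w * lam i" ?V ?W "Y i"] f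
      unfolding V1 W1 E1[OF i, symmetric] E2[OF i, symmetric] c_def c'_def Q by (simp add: algebra_simps)
    have "0 \<le> w * lam i" using f w(2) by simp
    then have "Arg (c' i) = Arg (c i) + w * lam i"
      unfolding eq using f Imc'[OF i] unfolding eq by (intro Arg_cis_mult c0[OF i] Imc[OF i]) auto
    moreover have "c' i \<noteq> 0" unfolding eq using c0[OF i] by simp
    ultimately show ?thesis by simp
  qed
  \<comment> \<open>At a vertex only the direction changes, from \<open>q'\<close> to a larger
    \<open>q\<close>, both in \<open>[0, pi]\<close>; the cosine drops and the sine of the
    difference is nonnegative.\<close>
  have vert: "Arg (c' i) \<le> Arg (c (Suc i))" if i: "Suc i < n" for i
  proof (rule Arg_le_of_cross[OF Impos'[OF i] c0[OF i] Imc[OF i]])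
    define R y p1 p2 where "R = \<rho> (Suc i)" and "y = Y (Suc i)" and "p1 = q' i" and "p2 = q (Suc i)"
    have R: "0 < R" using pe(1)[of "Suc i"] i by (simp add: R_def)
    have y: "0 \<le> y" using Y0[of "Suc i"] i by (simp add: y_def)
    have p: "0 \<le> p1" "p1 \<le> p2" "p2 \<le> pi" using q'b[of i] qb[of "Suc i"] qq[OF i] i by (auto simp: p1_def p2_def)
    have "Re (c' i) * Im (c (Suc i)) - Im (c' i) * Re (c (Suc i)) = R * (y * (cos p1 - cos p2) + kk * R * sin (p2 - p1)) / w"
      using w(2) by (simp add: c_def c'_def R_def[symmetric] y_def[symmetric] p1_def[symmetric] p2_def[symmetric] sin_diff field_simps)
    moreover have "0 \<le> y * (cos p1 - cos p2)" using y p cos_monotone_0_pi_le[of p1 p2] by simp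
    moreover have "0 \<le> kk * R * sin (p2 - p1)" using kk R p by (intro mult_nonneg_nonneg sin_ge_zero) auto
    ultimately show "0 \<le> Re (c' i) * Im (c (Suc i)) - Im (c' i) * Re (c (Suc i))" using R w(2) by simp
  qed
  have "(\<Sum>i<Suc m. w * lam i) \<le> Arg (c' m)" if "m < n" for m
    using that
  proof (induction m)
    case 0
    then show ?case using step[of 0] Arg_upper(1)[OF c0[of 0] Imc[of 0]] by simp
  next
    case (Suc m)
    then show ?case using step[of "Suc m"] vert[of m] by simp
  qed
  from this[of "n - 1"] have "(\<Sum>i<n. w * lam i) \<le> Arg (c' (n - 1))" using n by simp
  also have "\<dots> \<le> pi" by (rule Arg_le_pi)
  finally show ?thesis .
qed

lemma sinc_strict_antimono:
  fixes a b :: real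
  assumes "0 < a" "a < b" "b \<le> pi" shows "a * sin b < b * sin a"
proof -
  obtain z1 where z1: "0 < z1" "z1 < a" "sin a - sin 0 = (a - 0) * cos z1"
    using MVT2[of 0 a sin cos] assms DERIV_sin by blast
  obtain z2 where z2: "a < z2" "z2 < b" "sin b - sin a = (b - a) * cos z2"
    using MVT2[of a b sin cos] assms DERIV_sin by blast
  have "cos z2 < cos z1" using z1 z2 assms by (intro cos_monotone_0_pi) auto
  then have "a * ((b - a) * cos z2) < a * ((b - a) * cos z1)" using assms by (intro mult_strict_left_mono) auto
  moreover have "a * sin b = a * sin a + a * ((b - a) * cos z2)" unfolding z2(3)[symmetric] by (simp add: right_diff_distrib)
  moreover have "b * sin a = a * sin a + a * ((b - a) * cos z1)"
  proof -
    have "sin a = a * cos z1" using z1(3) by simp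
    then have "a * sin a + a * ((b - a) * cos z1) = a * sin a + (b - a) * sin a" by (simp add: mult_ac)
    then show ?thesis by (simp add: algebra_simps)
  qed
  ultimately show ?thesis by linarith
qed

text \<open>\<open>\<delta>\<close> and \<open>\<lambda>\<close> are the angle with the chord and the length of the arc of curvature \<open>kk\<close> on the
  unit sphere with chord \<open>e\<close>.\<close>
lemma curved_edge_exists:
  fixes e kk w :: real
  assumes e: "0 < e" "w * e < pi" and kk: "0 \<le> kk" "kk * sin e < 1 + cos e" and w: "w\<^sup>2 = kk\<^sup>2 + 1" "0 < w"
  defines "\<delta> \<equiv> arcsin (kk * sin e / (1 + cos e))"
  shows "0 \<le> \<delta>" and "\<delta> \<le> pi / 2" and "sin \<delta> = kk * sin e / (1 + cos e)"
    and "\<exists>lam. e \<le> lam \<and> w * lam < pi \<and> sin \<delta> * (1 + cos e) = kk * sin e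
      \<and> cos (w * lam) = (cos \<delta>)\<^sup>2 * (1 + cos e) - 1 \<and> sin (w * lam) = w * sin e * cos \<delta>"
proof -
  have w1: "1 \<le> w"
  proof (rule power2_le_imp_le)
    show "1\<^sup>2 \<le> w\<^sup>2" using w by simp
  qed (use w in simp)
  have ep: "e < pi" 
  proof -
    have "1 * e \<le> w * e" using w1 e by (intro mult_right_mono) auto
    then show ?thesis using e by linarith
  qed
  define S C where "S = sin e" and "C = cos e"
  have S: "0 < S" using e ep by (simp add: S_def sin_gt_zero)
  have kS: "0 \<le> kk * S" "kk * S < 1 + C" using kk S by (simp_all add: S_def C_def)
  have C1: "0 < 1 + C" using kS by simp
  define sd where "sd = kk * S / (1 + C)"
  have sd: "0 \<le> sd" "sd < 1" using kS C1 by (simp_all add: sd_def)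
  have d: "\<delta> = arcsin sd" by (simp add: \<delta>_def sd_def S_def C_def)
  show d0: "0 \<le> \<delta>" "\<delta> \<le> pi / 2" unfolding d using arcsin_bounded[of sd] arcsin_le_arcsin[of 0 sd] sd by auto
  have sind: "sin \<delta> = sd" unfolding d using sd by (intro sin_arcsin) auto
  then show "sin \<delta> = kk * sin e / (1 + cos e)" by (simp add: sd_def S_def C_def)
  have cosd: "0 \<le> cos \<delta>" using d0 by (intro cos_ge_zero) auto
  have SS: "S * S = (1 + C) * (1 - C)" using sin_cos_squared_add3[of e] unfolding S_def C_def by (simp add: algebra_simps)
  have cd: "(cos \<delta>)\<^sup>2 * (1 + C) = (1 + C) - kk\<^sup>2 * (1 - C)"
  proof -
    have "(cos \<delta>)\<^sup>2 = 1 - sd * sd" unfolding cos_squared_eq sind by (simp add: power2_eq_square)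
    then have "(cos \<delta>)\<^sup>2 * (1 + C) = (1 - sd * sd) * (1 + C)" by simp
    also have "\<dots> = (1 + C) - (sd * (1 + C)) * sd" by (simp add: algebra_simps)
    finally have "(cos \<delta>)\<^sup>2 * (1 + C) = (1 + C) - (sd * (1 + C)) * sd" .
    also have "sd * (1 + C) = kk * S" using C1 by (simp add: sd_def)
    also have "kk * S * sd = kk\<^sup>2 * (S * S) / (1 + C)" by (simp add: sd_def power2_eq_square)
    also have "\<dots> = kk\<^sup>2 * (1 - C)" unfolding SS using C1 by simp
    finally show ?thesis .
  qed
  have half: "2 * (sin (e / 2))\<^sup>2 = 1 - C" "2 * (cos (e / 2))\<^sup>2 = 1 + C" "2 * sin (e / 2) * cos (e / 2) = S"
    using cos_double_sin[of "e / 2"] cos_double_cos[of "e / 2"] sin_double[of "e / 2"] by (simp_all add: C_def S_def)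
  have sh: "0 < sin (e / 2)" using e ep by (intro sin_gt_zero) auto
  have ch: "0 < cos (e / 2)" using e ep by (intro cos_gt_zero) auto
  \<comment> \<open>The half chord formula \<open>sin (w lam / 2) = w sin (e / 2)\<close> of the
    model circle; \<open>t\<close> below is \<open>w lam / 2\<close>.\<close>
  define u where "u = w * sin (e / 2)"
  have u0: "0 < u" using w sh by (simp add: u_def)
  have u2: "2 * u\<^sup>2 = (kk\<^sup>2 + 1) * (1 - C)" using half(1) w by (simp add: u_def power_mult_distrib)
  have uc: "1 - u\<^sup>2 = (cos \<delta> * cos (e / 2))\<^sup>2"
  proof -
    have "2 * (cos \<delta> * cos (e / 2))\<^sup>2 = (cos \<delta>)\<^sup>2 * (2 * (cos (e / 2))\<^sup>2)" by (simp add: power_mult_distrib)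
    also have "\<dots> = (1 + C) - kk\<^sup>2 * (1 - C)" unfolding half by (rule cd)
    finally have "2 * (cos \<delta> * cos (e / 2))\<^sup>2 = 2 - 2 * u\<^sup>2" unfolding u2 by (simp add: algebra_simps)
    then show ?thesis by simp
  qed
  have "cos \<delta> \<noteq> 0"
  proof
    assume "cos \<delta> = 0"
    then have "(sin \<delta>)\<^sup>2 = 1" by (simp add: sin_squared_eq)
    then show False using sind sd by (simp add: power2_eq_1_iff)
  qed
  then have "0 < 1 - u\<^sup>2" unfolding uc using ch by simp
  then have "u\<^sup>2 < 1\<^sup>2" by simp
  then have u1: "u < 1" by (rule power_less_imp_less_base) simp
  define t where "t = arcsin u"
  have t: "sin t = u" "0 \<le> t" "t < pi / 2"
    using u0 u1 arcsin_lt_bounded[of u] arcsin_le_arcsin[of 0 u] by (auto simp: t_def)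
  have ct: "cos t = cos \<delta> * cos (e / 2)"
    unfolding t_def using u0 u1 cosd ch by (simp add: cos_arcsin uc)
  have we: "w * e / 2 \<le> t"
  proof -
    have "sin (w * (e / 2)) \<le> w * sin (e / 2)"
    proof (cases "w = 1")
      case False
      then have "e / 2 * sin (w * (e / 2)) < w * (e / 2) * sin (e / 2)" 
      proof (intro sinc_strict_antimono)
        show "w * (e / 2) \<le> pi" using e pi_gt_zero unfolding times_divide_eq_right by linarith
        show "e / 2 < w * (e / 2)" using False w1 e by simp
      qed (use e in simp)
      then show ?thesis using e by simp
    qed simp
    then have "arcsin (sin (w * (e / 2))) \<le> t" unfolding t_def u_def[symmetric]
      using u1 by (intro arcsin_le_arcsin) auto
    moreover have "arcsin (sin (w * (e / 2))) = w * (e / 2)" using e w mult_pos_pos[of w e] by (intro arcsin_sin) linarith+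
    ultimately show ?thesis by simp
  qed
  have wt: "w * (2 * t / w) = 2 * t" using w by simp
  show "\<exists>lam. e \<le> lam \<and> w * lam < pi \<and> sin \<delta> * (1 + cos e) = kk * sin e
      \<and> cos (w * lam) = (cos \<delta>)\<^sup>2 * (1 + cos e) - 1 \<and> sin (w * lam) = w * sin e * cos \<delta>"
  proof (intro exI[of _ "2 * t / w"] conjI)
    show "e \<le> 2 * t / w" using we w by (simp add: field_simps)
    show "w * (2 * t / w) < pi" unfolding wt using t by simp
    show "sin \<delta> * (1 + cos e) = kk * sin e" unfolding sind sd_def using C1 by (simp add: S_def C_def)
    have "cos (2 * t) = 1 - 2 * u\<^sup>2" using cos_double_sin[of t] t by simp
    also have "\<dots> = (cos \<delta>)\<^sup>2 * (1 + C) - 1" unfolding u2 cd by (simp add: algebra_simps)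
    finally show "cos (w * (2 * t / w)) = (cos \<delta>)\<^sup>2 * (1 + cos e) - 1" unfolding wt by (simp add: C_def)
    have "sin (2 * t) = w * (2 * sin (e / 2) * cos (e / 2)) * cos \<delta>" unfolding sin_double t(1) ct u_def by (simp add: algebra_simps)
    then show "sin (w * (2 * t / w)) = w * sin e * cos \<delta>" unfolding wt half by (simp add: S_def)
  qed
qed

text \<open>Rescaled to the unit sphere, these are the relations that \<open>polygon_phase\<close>
  requires of a fan triangle. \<open>om\<close> is an exterior angle because directions are measured
  from the outward radial one.\<close>

lemma spherical_triangle:
  assumes K: "0 < K" and t: "tri K a b c" and pos: "0 < a" "0 < b" "0 < c"
  defines "ra \<equiv> sqrt K * a" and "rb \<equiv> sqrt K * b" and "rc \<equiv> sqrt K * c"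
    and "D \<equiv> cmp_angle K a b c" and "om \<equiv> pi - cmp_angle K a c b" and "B \<equiv> cmp_angle K b c a"
  shows "sin om * sin rc = sin rb * sin D"
    and "sin rc * cos om = sin rb * cos ra * cos D - cos rb * sin ra"
    and "cos rc = cos ra * cos rb + sin ra * sin rb * cos D"
    and "sin B * sin rc = sin ra * sin D"
    and "sin rc * cos B = cos ra * sin rb - sin ra * cos rb * cos D"
    and "0 < sin ra" "0 < sin rb" "0 < sin rc"
proof -
  have K0: "0 \<le> K" using K by simp
  have law: "sin (sqrt K * x) * sin (sqrt K * y) * cos (cmp_angle K x y z) = cos (sqrt K * z) - cos (sqrt K * x) * cos (sqrt K * y)"
    if "tri K x y z" "0 < x" "0 < y" for x y z
  proof -
    have "snK K x * snK K y * cos (cmp_angle K x y z) = mdK K x + mdK K y - K * mdK K x * mdK K y - mdK K z"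
      by (rule cos_cmp_angle(1)[OF K0 that])
    then have "K * (snK K x * snK K y * cos (cmp_angle K x y z)) = K * (mdK K x + mdK K y - K * mdK K x * mdK K y - mdK K z)" by simp
    moreover have "K * (snK K x * snK K y * cos (cmp_angle K x y z)) = sin (sqrt K * x) * sin (sqrt K * y) * cos (cmp_angle K x y z)"
      using K by (simp add: snK_def)
    moreover have "K * (mdK K x + mdK K y - K * mdK K x * mdK K y - mdK K z) = cos (sqrt K * z) - cos (sqrt K * x) * cos (sqrt K * y)"
      using K by (simp add: mdK_def field_simps)
    ultimately show ?thesis by simp
  qed
  have t2: "tri K a c b" "tri K b c a" "tri K c a b" "tri K c b a" using t by (auto simp: tri_def algebra_simps)
  note sides = tri_sides[OF K0 t]
  show s: "0 < sin ra" "0 < sin rb" "0 < sin rc"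
    unfolding ra_def rb_def rc_def using sides pos K by (auto intro!: sin_gt_zero)
  have law1: "sin ra * sin rb * cos D = cos rc - cos ra * cos rb" using law[OF t pos(1,2)] by (simp add: ra_def rb_def rc_def D_def)
  have law2: "sin ra * sin rc * cos om = - (cos rb - cos ra * cos rc)" using law[OF t2(1) pos(1,3)] by (simp add: ra_def rb_def rc_def om_def)
  have law3: "sin rb * sin rc * cos B = cos ra - cos rb * cos rc" using law[OF t2(2) pos(2,3)] by (simp add: ra_def rb_def rc_def B_def)
  show ce: "cos rc = cos ra * cos rb + sin ra * sin rb * cos D" using law1 by simp
  have sq: "sin ra * sin ra = 1 - cos ra * cos ra" "sin rb * sin rb = 1 - cos rb * cos rb"
    using sin_cos_squared_add3[of ra] sin_cos_squared_add3[of rb] by linarith+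
  have "sin ra * (sin rc * cos om) = sin ra * (sin rb * cos ra * cos D - cos rb * sin ra)"
  proof -
    have "sin ra * (sin rb * cos ra * cos D - cos rb * sin ra) = cos ra * (sin ra * sin rb * cos D) - cos rb * (sin ra * sin ra)" by (simp add: algebra_simps)
    also have "\<dots> = - (cos rb - cos ra * cos rc)" unfolding law1 sq by (simp add: algebra_simps)
    finally show ?thesis using law2 by (simp add: mult.assoc)
  qed
  then show "sin rc * cos om = sin rb * cos ra * cos D - cos rb * sin ra" using s by simp
  have "sin rb * (sin rc * cos B) = sin rb * (cos ra * sin rb - sin ra * cos rb * cos D)"
  proof -
    have "sin rb * (cos ra * sin rb - sin ra * cos rb * cos D) = cos ra * (sin rb * sin rb) - cos rb * (sin ra * sin rb * cos D)" by (simp add: algebra_simps)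
    also have "\<dots> = cos ra - cos rb * cos rc" unfolding law1 sq by (simp add: algebra_simps)
    finally show ?thesis using law3 by (simp add: mult.assoc)
  qed
  then show "sin rc * cos B = cos ra * sin rb - sin ra * cos rb * cos D" using s by simp
  have sK: "0 < sqrt K" using K by simp
  have "snK K b * sin (cmp_angle K a b c) = snK K c * sin (cmp_angle K a c b)" by (rule sine_rule[OF K0 t pos])
  then show "sin om * sin rc = sin rb * sin D" using K sK by (simp add: snK_def om_def D_def rb_def rc_def mult.commute)
  have "snK K a * sin (cmp_angle K b a c) = snK K c * sin (cmp_angle K b c a)"
    by (rule sine_rule[OF K0 _ pos(2,1,3)]) (use t in \<open>auto simp: tri_def algebra_simps\<close>)
  then show "sin B * sin rc = sin ra * sin D" using K sK by (simp add: snK_def B_def D_def ra_def rc_def mult.commute cmp_angle_commute[OF K0, of b a])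
qed

section \<open>The length of the closed curve\<close>

text \<open>A single \<open>star\<close> suffices here: moving the first points ahead by one period
  rotates the cyclic order. The perimeter conditions are explicit, since long arcs are needed and
  their triangles may be too large to compare.\<close>

locale closed_curve =
  fixes K l :: real and d :: "real \<Rightarrow> real \<Rightarrow> real"
  assumes K: "0 \<le> K" and l: "0 < l"
    and per: "d (x + l) y = d x y"
    and d_sym: "d x y = d y x"
    and d_tri: "d x z \<le> d x y + d y z"
    and d_le: "d x y \<le> \<bar>x - y\<bar>"
    and d_pos: "x \<noteq> y \<Longrightarrow> \<bar>x - y\<bar> < l \<Longrightarrow> 0 < d x y"
    and d_length: "x < y \<Longrightarrow> 0 < \<epsilon> \<Longrightarrow>
      \<exists>(n::nat) t. t 0 = x \<and> t n = y \<and> (\<forall>i<n. t i \<le> t (Suc i)) \<and> y - x - \<epsilon> < (\<Sum>i<n. d (t i) (t (Suc i)))"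
    and star: "a < b \<Longrightarrow> b < c \<Longrightarrow> c < e \<Longrightarrow> e < a + l \<Longrightarrow>
      sqrt K * (d a b + d b c + d a c) < 2 * pi \<Longrightarrow> sqrt K * (d a e + d e c + d a c) < 2 * pi \<Longrightarrow> sqrt K * (d a b + d b e + d a e) < 2 * pi \<Longrightarrow>
      ang3 K d a b c + ang3 K d a c e \<le> ang3 K d a b e"
begin

abbreviation "A \<equiv> ang3 K d"

lemma per2: "d x (y + l) = d x y" using per d_sym by metis

lemma A_per: "A (v + l) x y = A v x y" "A v (x + l) y = A v x y" "A v x (y + l) = A v x y"
  by (simp_all add: ang3_def per per2)

lemma A_commute: "A v x y = A v y x"
  by (simp add: ang3_def d_sym cmp_angle_commute[OF K])

lemma d_self [simp]: "d x x = 0" using d_le[of x x] d_tri[of x x x] by simp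

lemma d_nonneg: "0 \<le> d x y" using d_tri[of x x y] d_sym[of x y] by simp

lemma arc:
  assumes L: "0 < Lam" "Lam \<le> l" "sqrt K * Lam \<le> pi"
  shows "convex_arc K Lam d"
proof
  show "0 \<le> K" "0 < Lam" "sqrt K * Lam \<le> pi" by (fact K L)+
  show "d x y = d y x" for x y by (rule d_sym)
  show "d x z \<le> d x y + d y z" for x y z by (rule d_tri)
  show "d x y \<le> \<bar>x - y\<bar>" for x y by (rule d_le)
  show "0 < d x y" if "x \<noteq> y" "\<bar>x - y\<bar> < Lam" for x y using d_pos that L by simp
  show "\<exists>(n::nat) t. t 0 = x \<and> t n = y \<and> (\<forall>i<n. t i \<le> t (Suc i)) \<and> y - x - \<epsilon> < (\<Sum>i<n. d (t i) (t (Suc i)))"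
    if "x < y" "y - x < Lam" "0 < \<epsilon>" for x y \<epsilon> using d_length that by simp
next
  fix a b c e assume o: "a < b" "b < c" "c < (e::real)" "e - a < Lam"
  have per3: "sqrt K * (d x y + d y z + d x z) < 2 * pi" if "x \<in> {a..e}" "y \<in> {a..e}" "z \<in> {a..e}" for x y z
  proof -
    have "d x y + d y z + d x z \<le> \<bar>x - y\<bar> + \<bar>y - z\<bar> + \<bar>x - z\<bar>" using d_le[of x y] d_le[of y z] d_le[of x z] by linarith
    also have "\<dots> \<le> 2 * (e - a)" using that by (auto simp: abs_real_def)
    finally have le: "d x y + d y z + d x z \<le> 2 * (e - a)" .
    show ?thesis
    proof (cases "K = 0")
      case False
      then have "sqrt K * (d x y + d y z + d x z) < sqrt K * (2 * Lam)" using K le o by (intro mult_strict_left_mono) auto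
      then show ?thesis using L by simp
    qed simp
  qed
  have m: "a \<in> {a..e}" "b \<in> {a..e}" "c \<in> {a..e}" "e \<in> {a..e}" using o by auto
  show "A a b c + A a c e \<le> A a b e" using o L by (intro star per3 m) auto
  have "A b c e + A b e (a + l) \<le> A b c (a + l)" using o L by (intro star) (auto simp: per per2 per3 m)
  then show "A b c e + A b e a \<le> A b c a" by (simp add: A_per)
  have "A c e (a + l) + A c (a + l) (b + l) \<le> A c e (b + l)" using o L by (intro star) (auto simp: per per2 per3 m)
  then show "A c e a + A c a b \<le> A c e b" by (simp add: A_per)
  have "A e (a + l) (b + l) + A e (b + l) (c + l) \<le> A e (a + l) (c + l)" using o L by (intro star) (auto simp: per per2 per3 m)
  then show "A e a b + A e b c \<le> A e a c" by (simp add: A_per)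
qed

text \<open>Repeated points are included, so every distance within a good set is below
  \<open>pi / sqrt K\<close>.\<close>

definition good :: "real set \<Rightarrow> bool" where
  "good S \<longleftrightarrow> (\<forall>x\<in>S. \<forall>y\<in>S. \<forall>z\<in>S. sqrt K * (d x y + d y z + d x z) < 2 * pi)"

lemma goodD: "good S \<Longrightarrow> x \<in> S \<Longrightarrow> y \<in> S \<Longrightarrow> z \<in> S \<Longrightarrow> sqrt K * (d x y + d y z + d x z) < 2 * pi"
  unfolding good_def by blast

lemma tri_good: "good S \<Longrightarrow> v \<in> S \<Longrightarrow> x \<in> S \<Longrightarrow> y \<in> S \<Longrightarrow> tri K (d v x) (d v y) (d x y)"
  using goodD[of S v x y] d_tri[of v x y] d_tri[of v y x] d_tri[of x y v] d_sym d_nonneg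
  by (auto simp: tri_def add_ac)

lemma good_A_bounds:
  assumes "good S" "v \<in> S" "x \<in> S" "y \<in> S" "0 < d v x" "0 < d v y"
  shows "0 \<le> A v x y" "A v x y \<le> pi"
  using cos_cmp_angle(2,3)[OF K tri_good[OF assms(1-4)] assms(5,6)] by (simp_all add: ang3_def)

lemma A_self: "0 < d v x \<Longrightarrow> sqrt K * d v x < pi \<Longrightarrow> A v x x = 0"
  using cmp_angle_zero[OF K, of "d v x" "d v x"] by (simp add: ang3_def)

lemma good_star:
  assumes S: "good S" "a \<in> S" "b \<in> S" "c \<in> S" "e \<in> S" and o: "a < b" "b < c" "c < e" "e < a + l"
  shows "A a b c + A a c e \<le> A a b e" and "A b c e + A b e a \<le> A b c a"
    and "A c e a + A c a b \<le> A c e b" and "A e a b + A e b c \<le> A e a c"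
proof -
  note g = goodD[OF S(1)]
  show "A a b c + A a c e \<le> A a b e" using o by (intro star g S) auto
  have "A b c e + A b e (a + l) \<le> A b c (a + l)" using o by (intro star) (auto simp: per per2 g S)
  then show "A b c e + A b e a \<le> A b c a" by (simp add: A_per)
  have "A c e (a + l) + A c (a + l) (b + l) \<le> A c e (b + l)" using o by (intro star) (auto simp: per per2 g S)
  then show "A c e a + A c a b \<le> A c e b" by (simp add: A_per)
  have "A e (a + l) (b + l) + A e (b + l) (c + l) \<le> A e (a + l) (c + l)" using o by (intro star) (auto simp: per per2 g S)
  then show "A e a b + A e b c \<le> A e a c" by (simp add: A_per)
qed

text \<open>Develops the polygon as a fan of comparison triangles with apex \<open>x 0\<close>;
  superadditivity at the vertices makes it convex, with arc-chord angles \<open>D\<close> fitting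
  outside. Indices in \<open>G\<close> mark gaps, edges bridged by a chord instead of the curve.
  Only \<open>\<delta> \<le> D\<close> is required, so the lemma applies both to the curved edges
  and to the bare polygon.\<close>

lemma fan_bound:
  fixes x D \<delta> lam :: "nat \<Rightarrow> real"
  assumes Kp: "0 < K" and n: "2 \<le> n" and inc: "\<And>i. i < n \<Longrightarrow> x i < x (Suc i)" and cl: "x n < x 0 + l"
    and S: "good S" and xS: "\<And>i. i \<le> n \<Longrightarrow> x i \<in> S"
    and G: "0 \<notin> G" "n - 1 \<notin> G"
    and curve: "\<And>i. i < n \<Longrightarrow> i \<notin> G \<Longrightarrow> {x i..x (Suc i)} \<subseteq> S"
    and DG: "\<And>i. i < n \<Longrightarrow> i \<in> G \<Longrightarrow> D i = 0" and Dpos: "\<And>i. i < n \<Longrightarrow> i \<notin> G \<Longrightarrow> 0 < D i"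
    and Dal: "\<And>i \<epsilon>. i < n \<Longrightarrow> i \<notin> G \<Longrightarrow> 0 < \<epsilon> \<Longrightarrow> \<exists>h0>0. \<forall>h. 0 < h \<and> h \<le> h0 \<longrightarrow> D i - \<epsilon> < A (x i) (x i + h) (x (Suc i))"
    and Dbe: "\<And>i \<epsilon>. i < n \<Longrightarrow> i \<notin> G \<Longrightarrow> 0 < \<epsilon> \<Longrightarrow> \<exists>h0>0. \<forall>h. 0 < h \<and> h \<le> h0 \<longrightarrow> D i - \<epsilon> < A (x (Suc i)) (x i) (x (Suc i) - h)"
    and start: "\<And>\<epsilon>. 0 < \<epsilon> \<Longrightarrow> \<exists>h0>0. \<forall>h. 0 < h \<and> h \<le> h0 \<longrightarrow> A (x 0) (x 0 + h) (x n) \<le> pi / 2 + \<epsilon>"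
    and fin: "\<And>\<epsilon>. 0 < \<epsilon> \<Longrightarrow> \<exists>h0>0. \<forall>h. 0 < h \<and> h \<le> h0 \<longrightarrow> A (x n) (x 0) (x n - h) \<le> pi / 2 + \<epsilon>"
    and kk: "0 \<le> kk" and w: "w\<^sup>2 = kk\<^sup>2 + 1" "0 < w"
    and del: "\<And>i. i < n \<Longrightarrow> 0 \<le> \<delta> i \<and> \<delta> i \<le> D i"
    and edge: "\<And>i. i < n \<Longrightarrow> (lam i = 0 \<and> \<delta> i = 0 \<and> 0 < i \<and> Suc i < n) \<or> (0 \<le> lam i \<and> w * lam i < pi
      \<and> sin (\<delta> i) * (1 + cos (sqrt K * d (x i) (x (Suc i)))) = kk * sin (sqrt K * d (x i) (x (Suc i)))
      \<and> cos (w * lam i) = (cos (\<delta> i))\<^sup>2 * (1 + cos (sqrt K * d (x i) (x (Suc i)))) - 1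
      \<and> sin (w * lam i) = w * sin (sqrt K * d (x i) (x (Suc i))) * cos (\<delta> i))"
  shows "(\<Sum>i<n. w * lam i) \<le> pi"
proof -
  have lt: "x i < x j" if "i < j" "j \<le> n" for i j
    using that
  proof (induction j)
    case (Suc j) then show ?case using inc[of j] by (cases "i = j") (auto intro: less_trans)
  qed simp
  have le: "x i \<le> x j" if "i \<le> j" "j \<le> n" for i j using lt[of i j] that by (cases "i = j") auto
  have dp: "0 < d (x i) (x j)" if "i \<noteq> j" "i \<le> n" "j \<le> n" for i j
  proof (rule d_pos)
    have "x 0 \<le> x i" "x 0 \<le> x j" "x i \<le> x n" "x j \<le> x n"
      using le[of 0 i] le[of 0 j] le[of i n] le[of j n] that by simp_all
    then show "\<bar>x i - x j\<bar> < l" using cl by auto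
    show "x i \<noteq> x j" using lt[of i j] lt[of j i] that by (cases "i < j") auto
  qed
  have Kd: "sqrt K * d (x i) (x j) < pi" if "i \<le> n" "j \<le> n" for i j
    using goodD[OF S xS[OF that(1)] xS[OF that(2)] xS[OF that(2)]] by (simp add: algebra_simps)
  define \<Delta> where "\<Delta> j = A (x 0) (x j) (x (Suc j))" for j
  define \<phi> where "\<phi> i = (\<Sum>j\<in>{max 1 i..<n}. \<Delta> j)" for i
  define \<omega> where "\<omega> i = (if i = 0 then 0 else pi - A (x i) (x 0) (x (Suc i)))" for i
  define B where "B i = A (x (Suc i)) (x 0) (x i)" for i
  have Ab: "0 \<le> A (x i) (x j) (x k)" "A (x i) (x j) (x k) \<le> pi" if "i \<noteq> j" "i \<noteq> k" "i \<le> n" "j \<le> n" "k \<le> n" for i j k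
    using good_A_bounds[OF S xS[OF that(3)] xS[OF that(4)] xS[OF that(5)]] dp that by auto
  have phi_step: "\<phi> i - \<phi> (Suc i) = (if i = 0 then 0 else \<Delta> i)" if "i < n" for i
  proof (cases "i = 0")
    case True then show ?thesis by (simp add: \<phi>_def)
  next
    case False
    then have "max 1 i = i" "max 1 (Suc i) = Suc i" by auto
    then show ?thesis using False that by (simp add: \<phi>_def sum.atLeast_Suc_lessThan)
  qed
  have Dl0: "0 \<le> \<Delta> j" if "0 < j" "j < n" for j unfolding \<Delta>_def using that by (intro Ab(1)) auto
  have fan: "A (x 0) y (x 1) + (\<Sum>j\<in>{1..<m}. \<Delta> j) \<le> A (x 0) y (x m)" if y: "x 0 < y" "y < x 1" "y \<in> S" and m: "1 \<le> m" "m \<le> n" for y m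
    using m
  proof (induction m rule: dec_induct)
    case (step m)
    have "A (x 0) y (x m) + A (x 0) (x m) (x (Suc m)) \<le> A (x 0) y (x (Suc m))"
    proof (rule good_star(1)[OF S xS y(3) xS xS])
      show "y < x m" using y lt[of 1 m] step by (cases "m = 1") auto
      show "x (Suc m) < x 0 + l" using cl lt[of "Suc m" n] step by (cases "Suc m = n") auto
    qed (use y lt step in auto)
    then show ?case using step by (simp add: \<Delta>_def)
  qed simp
  have start': "\<phi> 0 + D 0 \<le> pi / 2"
  proof (rule field_le_epsilon)
    fix \<epsilon> :: real assume e: "0 < \<epsilon>"
    have n0: "0 < n" using n by simp
    obtain h1 where h1: "0 < h1" "\<And>h. 0 < h \<Longrightarrow> h \<le> h1 \<Longrightarrow> D 0 - \<epsilon> / 2 < A (x 0) (x 0 + h) (x 1)"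
      using Dal[OF n0 G(1), of "\<epsilon> / 2"] e by auto
    obtain h2 where h2: "0 < h2" "\<And>h. 0 < h \<Longrightarrow> h \<le> h2 \<Longrightarrow> A (x 0) (x 0 + h) (x n) \<le> pi / 2 + \<epsilon> / 2"
      using start[of "\<epsilon> / 2"] e by auto
    define h where "h = min (min h1 h2) ((x 1 - x 0) / 2)"
    have x01: "x 0 < x 1" using inc[OF n0] by simp
    have h: "0 < h" "h \<le> h1" "h \<le> h2" "h < x 1 - x 0" using h1(1) h2(1) x01 by (auto simp: h_def min_def)
    have "x 0 + h \<in> S" using curve[OF n0 G(1)] h by auto
    then have "A (x 0) (x 0 + h) (x 1) + (\<Sum>j\<in>{1..<n}. \<Delta> j) \<le> A (x 0) (x 0 + h) (x n)" using h n by (intro fan) auto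
    then show "\<phi> 0 + D 0 \<le> pi / 2 + \<epsilon>" using h1(2)[OF h(1,2)] h2(2)[OF h(1,3)] by (simp add: \<phi>_def)
  qed
  have n1: "n - 1 < n" "Suc (n - 1) = n" using n by auto
  have fin': "B (n - 1) + D (n - 1) \<le> pi / 2"
  proof (rule field_le_epsilon)
    fix \<epsilon> :: real assume e: "0 < \<epsilon>"
    obtain h1 where h1: "0 < h1" "\<And>h. 0 < h \<Longrightarrow> h \<le> h1 \<Longrightarrow> D (n - 1) - \<epsilon> / 2 < A (x n) (x (n - 1)) (x n - h)"
      using Dbe[OF n1(1) G(2), of "\<epsilon> / 2"] e n1 by auto
    obtain h2 where h2: "0 < h2" "\<And>h. 0 < h \<Longrightarrow> h \<le> h2 \<Longrightarrow> A (x n) (x 0) (x n - h) \<le> pi / 2 + \<epsilon> / 2"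
      using fin[of "\<epsilon> / 2"] e by auto
    define h where "h = min (min h1 h2) ((x n - x (n - 1)) / 2)"
    have xn: "x (n - 1) < x n" using inc[OF n1(1)] n1 by simp
    have h: "0 < h" "h \<le> h1" "h \<le> h2" "h < x n - x (n - 1)" using h1(1) h2(1) xn by (auto simp: h_def min_def)
    have hS: "x n - h \<in> S" using curve[OF n1(1) G(2)] h n1 by auto
    have "A (x n) (x 0) (x (n - 1)) + A (x n) (x (n - 1)) (x n - h) \<le> A (x n) (x 0) (x n - h)"
      by (rule good_star(4)[OF S xS xS hS xS]) (use h lt[of 0 "n - 1"] n cl in auto)
    then show "B (n - 1) + D (n - 1) \<le> pi / 2 + \<epsilon>" using h1(2)[OF h(1,2)] h2(2)[OF h(1,3)] n1 by (simp add: B_def)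
  qed
  have turn: "B i + D i + D (Suc i) \<le> \<omega> (Suc i)" if i: "Suc i < n" for i
  proof -
    define k where "k = Suc i"
    have k: "0 < k" "k < n" "k \<le> n" "i < n" "i < k" using i by (auto simp: k_def)
    have xik: "x i < x k" "x k < x (Suc k)" using inc[of i] inc[of k] k by (auto simp: k_def)
    have x0i: "x 0 \<le> x i" using lt[of 0 i] k by (cases "i = 0") auto
    have xSk: "x (Suc k) < x 0 + l" using cl lt[of "Suc k" n] k by (cases "Suc k = n") auto
    have "D i + D k + B i + A (x k) (x 0) (x (Suc k)) \<le> pi"
    proof (rule field_le_epsilon)
      fix \<epsilon> :: real assume e: "0 < \<epsilon>"
      \<comment> \<open>Along the curve, \<open>b\<close> is a nearby point that realizes
        \<open>D k\<close> up to \<open>\<epsilon> / 2\<close>. On a gap the next vertex itself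
        serves, because \<open>D k = 0\<close> there.\<close>
      have R: "\<exists>b. x k < b \<and> b \<le> x (Suc k) \<and> b \<in> S \<and> D k - \<epsilon> / 2 + A (x k) (x (Suc k)) (x 0) \<le> A (x k) b (x 0)"
      proof (cases "k \<in> G")
        case True then show ?thesis using DG[of k] k xik xS[of "Suc k"] e by (intro exI[of _ "x (Suc k)"]) auto
      next
        case False
        obtain h1 where h1: "0 < h1" "\<And>h. 0 < h \<Longrightarrow> h \<le> h1 \<Longrightarrow> D k - \<epsilon> / 2 < A (x k) (x k + h) (x (Suc k))"
          using Dal[OF k(2) False, of "\<epsilon> / 2"] e by auto
        define h where "h = min h1 ((x (Suc k) - x k) / 2)"
        have h: "0 < h" "h \<le> h1" "h < x (Suc k) - x k" using h1(1) xik by (auto simp: h_def min_def)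
        have hS: "x k + h \<in> S" using curve[OF k(2) False] h by auto
        have "A (x k) (x k + h) (x (Suc k)) + A (x k) (x (Suc k)) (x 0) \<le> A (x k) (x k + h) (x 0)"
          by (rule good_star(2)[OF S xS xS hS xS]) (use h x0i xik xSk k in auto)
        then show ?thesis using h1(2)[OF h(1,2)] h hS by (intro exI[of _ "x k + h"]) auto
      qed
      then obtain b where b: "x k < b" "b \<le> x (Suc k)" "b \<in> S" "D k - \<epsilon> / 2 + A (x k) (x (Suc k)) (x 0) \<le> A (x k) b (x 0)" by blast
      have M: "A (x k) b (x 0) + A (x k) (x 0) (x i) \<le> A (x k) b (x i)"
      proof (cases "i = 0")
        case True
        then show ?thesis using A_self[of "x k" "x 0"] dp[of k 0] Kd[of k 0] k by simp
      next
        case False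
        show ?thesis by (rule good_star(3)[OF S xS xS xS b(3)]) (use b xik xSk lt[of 0 i] False k in auto)
      qed
      have "\<exists>c. x i \<le> c \<and> c < x k \<and> c \<in> S \<and> A (x k) b (x i) + (D i - \<epsilon> / 2) \<le> A (x k) b c"
      proof (cases "i \<in> G")
        case True then show ?thesis using DG[of i] k xik xS[of i] e by (intro exI[of _ "x i"]) auto
      next
        case False
        obtain h1 where h1: "0 < h1" "\<And>h. 0 < h \<Longrightarrow> h \<le> h1 \<Longrightarrow> D i - \<epsilon> / 2 < A (x k) (x i) (x k - h)"
          using Dbe[OF k(4) False, of "\<epsilon> / 2"] e by (auto simp: k_def)
        define h where "h = min h1 ((x k - x i) / 2)"
        have h: "0 < h" "h \<le> h1" "h < x k - x i" using h1(1) xik by (auto simp: h_def min_def)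
        have hS: "x k - h \<in> S" using curve[OF k(4) False] h by (auto simp: k_def)
        have "A (x k) b (x i) + A (x k) (x i) (x k - h) \<le> A (x k) b (x k - h)"
          by (rule good_star(3)[OF S xS hS xS b(3)]) (use b h x0i xik xSk k in auto)
        then show ?thesis using h1(2)[OF h(1,2)] h hS by (intro exI[of _ "x k - h"]) auto
      qed
      then obtain c where c: "x i \<le> c" "c < x k" "c \<in> S" "A (x k) b (x i) + (D i - \<epsilon> / 2) \<le> A (x k) b c" by blast
      have "0 < d (x k) b" "0 < d (x k) c" using b c x0i xSk xik by (auto intro!: d_pos)
      then have "A (x k) b c \<le> pi" using good_A_bounds(2)[OF S xS b(3) c(3)] k by simp
      then show "D i + D k + B i + A (x k) (x 0) (x (Suc k)) \<le> pi + \<epsilon>"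
        using b(4) M c(4) by (simp add: B_def k_def A_commute)
    qed
    then show ?thesis by (simp add: \<omega>_def k_def)
  qed
  have rel: "sin (\<omega> i) * sin (sqrt K * d (x i) (x (Suc i))) = sin (sqrt K * d (x 0) (x (Suc i))) * sin (\<phi> i - \<phi> (Suc i))"
    "sin (sqrt K * d (x i) (x (Suc i))) * cos (\<omega> i) = sin (sqrt K * d (x 0) (x (Suc i))) * cos (sqrt K * d (x 0) (x i)) * cos (\<phi> i - \<phi> (Suc i)) - cos (sqrt K * d (x 0) (x (Suc i))) * sin (sqrt K * d (x 0) (x i))"
    "cos (sqrt K * d (x i) (x (Suc i))) = cos (sqrt K * d (x 0) (x i)) * cos (sqrt K * d (x 0) (x (Suc i))) + sin (sqrt K * d (x 0) (x i)) * sin (sqrt K * d (x 0) (x (Suc i))) * cos (\<phi> i - \<phi> (Suc i))"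
    "sin (B i) * sin (sqrt K * d (x i) (x (Suc i))) = sin (sqrt K * d (x 0) (x i)) * sin (\<phi> i - \<phi> (Suc i))"
    "sin (sqrt K * d (x i) (x (Suc i))) * cos (B i) = cos (sqrt K * d (x 0) (x i)) * sin (sqrt K * d (x 0) (x (Suc i))) - sin (sqrt K * d (x 0) (x i)) * cos (sqrt K * d (x 0) (x (Suc i))) * cos (\<phi> i - \<phi> (Suc i))"
    if i: "i < n" for i
  proof -
    have *: "sin (\<omega> i) * sin (sqrt K * d (x i) (x (Suc i))) = sin (sqrt K * d (x 0) (x (Suc i))) * sin (\<phi> i - \<phi> (Suc i)) \<and>
      sin (sqrt K * d (x i) (x (Suc i))) * cos (\<omega> i) = sin (sqrt K * d (x 0) (x (Suc i))) * cos (sqrt K * d (x 0) (x i)) * cos (\<phi> i - \<phi> (Suc i)) - cos (sqrt K * d (x 0) (x (Suc i))) * sin (sqrt K * d (x 0) (x i)) \<and>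
      cos (sqrt K * d (x i) (x (Suc i))) = cos (sqrt K * d (x 0) (x i)) * cos (sqrt K * d (x 0) (x (Suc i))) + sin (sqrt K * d (x 0) (x i)) * sin (sqrt K * d (x 0) (x (Suc i))) * cos (\<phi> i - \<phi> (Suc i)) \<and>
      sin (B i) * sin (sqrt K * d (x i) (x (Suc i))) = sin (sqrt K * d (x 0) (x i)) * sin (\<phi> i - \<phi> (Suc i)) \<and>
      sin (sqrt K * d (x i) (x (Suc i))) * cos (B i) = cos (sqrt K * d (x 0) (x i)) * sin (sqrt K * d (x 0) (x (Suc i))) - sin (sqrt K * d (x 0) (x i)) * cos (sqrt K * d (x 0) (x (Suc i))) * cos (\<phi> i - \<phi> (Suc i))"
    proof (cases "i = 0")
      case True
      have "B 0 = 0" unfolding B_def using A_self[of "x 1" "x 0"] dp[of 1 0] Kd[of 1 0] n by simp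
      moreover have "\<phi> 0 - \<phi> (Suc 0) = 0" using phi_step[of 0] n by simp
      ultimately show ?thesis using True by (simp add: \<omega>_def)
    next
      case False
      have t: "tri K (d (x 0) (x i)) (d (x 0) (x (Suc i))) (d (x i) (x (Suc i)))" using i by (intro tri_good[OF S] xS) auto
      have p: "0 < d (x 0) (x i)" "0 < d (x 0) (x (Suc i))" "0 < d (x i) (x (Suc i))" using dp False i by auto
      have e: "\<phi> i - \<phi> (Suc i) = cmp_angle K (d (x 0) (x i)) (d (x 0) (x (Suc i))) (d (x i) (x (Suc i)))"
        using phi_step[OF i] False by (simp add: \<Delta>_def ang3_def)
      have o: "\<omega> i = pi - cmp_angle K (d (x 0) (x i)) (d (x i) (x (Suc i))) (d (x 0) (x (Suc i)))"
        using False by (simp add: \<omega>_def ang3_def d_sym[of "x i" "x 0"])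
      have b: "B i = cmp_angle K (d (x 0) (x (Suc i))) (d (x i) (x (Suc i))) (d (x 0) (x i))"
        by (simp add: B_def ang3_def d_sym[of "x (Suc i)"])
      show ?thesis unfolding e o b using spherical_triangle(1-5)[OF Kp t p] by (intro conjI)
    qed
    show "sin (\<omega> i) * sin (sqrt K * d (x i) (x (Suc i))) = sin (sqrt K * d (x 0) (x (Suc i))) * sin (\<phi> i - \<phi> (Suc i))"
      "sin (sqrt K * d (x i) (x (Suc i))) * cos (\<omega> i) = sin (sqrt K * d (x 0) (x (Suc i))) * cos (sqrt K * d (x 0) (x i)) * cos (\<phi> i - \<phi> (Suc i)) - cos (sqrt K * d (x 0) (x (Suc i))) * sin (sqrt K * d (x 0) (x i))"
      "cos (sqrt K * d (x i) (x (Suc i))) = cos (sqrt K * d (x 0) (x i)) * cos (sqrt K * d (x 0) (x (Suc i))) + sin (sqrt K * d (x 0) (x i)) * sin (sqrt K * d (x 0) (x (Suc i))) * cos (\<phi> i - \<phi> (Suc i))"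
      "sin (B i) * sin (sqrt K * d (x i) (x (Suc i))) = sin (sqrt K * d (x 0) (x i)) * sin (\<phi> i - \<phi> (Suc i))"
      "sin (sqrt K * d (x i) (x (Suc i))) * cos (B i) = cos (sqrt K * d (x 0) (x i)) * sin (sqrt K * d (x 0) (x (Suc i))) - sin (sqrt K * d (x 0) (x i)) * cos (sqrt K * d (x 0) (x (Suc i))) * cos (\<phi> i - \<phi> (Suc i))"
      using * by blast+
  qed
  have sn: "0 < sin (sqrt K * d (x i) (x j))" if "i \<noteq> j" "i \<le> n" "j \<le> n" for i j
    using Kd[of i j] dp[of i j] that Kp by (intro sin_gt_zero) auto
  have B0: "0 \<le> B i" if "i < n" for i unfolding B_def using Ab(1)[of "Suc i" 0 i] that by simp
  have phm: "\<phi> (Suc i) \<le> \<phi> i" if "i < n" for i using phi_step[OF that] Dl0[of i] that by (cases "i = 0") auto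
  have ph_le: "\<phi> i \<le> \<phi> 0" if "i \<le> n" for i
    using that
  proof (induction i)
    case (Suc i) then show ?case using phm[of i] by simp
  qed simp
  show ?thesis
  proof (rule polygon_phase[where r = "\<lambda>i. sqrt K * d (x 0) (x i)" and \<phi> = \<phi> and \<omega> = \<omega> and B = B
      and e = "\<lambda>i. sqrt K * d (x i) (x (Suc i))" and \<delta> = \<delta>, OF n kk w])
    show "0 < sin (sqrt K * d (x 0) (x i))" if "0 < i" "i \<le> n" for i using sn[of 0 i] that by simp
    show "\<phi> n = 0" using n by (simp add: \<phi>_def)
    show "\<phi> i < pi / 2" if "i \<le> n" for i using ph_le[OF that] start' Dpos[of 0] G n by simp
    show "0 \<le> \<omega> i \<and> \<omega> i \<le> pi" if "i < n" for i using Ab[of i 0 "Suc i"] that by (auto simp: \<omega>_def)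
    show "0 < sin (sqrt K * d (x i) (x (Suc i)))" if "i < n" for i using sn[of i "Suc i"] that by simp
    have "Suc (n - 2) < n" "Suc (n - 2) = n - 1" using n by auto
    then have "B (n - 2) + D (n - 2) + D (n - 1) \<le> \<omega> (n - 1)" "0 \<le> B (n - 2)" "0 \<le> D (n - 2)" "0 < D (n - 1)"
      using turn[of "n - 2"] B0[of "n - 2"] del[of "n - 2"] Dpos[OF n1(1) G(2)] by auto
    then show "0 < \<omega> (n - 1)" by linarith
    show "B i + \<delta> i + \<delta> (Suc i) \<le> \<omega> (Suc i)" if "Suc i < n" for i using turn[OF that] del[of i] del[of "Suc i"] that by simp
    show "\<phi> 0 + \<delta> 0 \<le> pi / 2" using start' del[of 0] n by simp
    show "B (n - 1) + \<delta> (n - 1) \<le> pi / 2" using fin' del[OF n1(1)] by simp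
  qed (use rel B0 phm del edge in \<open>auto simp: \<omega>_def\<close>)
qed

end

lemma sum_lessThan_plus: "(\<Sum>i<n + m. f i) = (\<Sum>i<n. f i) + (\<Sum>i<m. f (n + i))" for f :: "nat \<Rightarrow> real"
  by (induction m) (simp_all add: add.assoc)

context convex_arc
begin

text \<open>If moving from \<open>v\<close> to a nearby \<open>y\<close> does not increase the
  distance to \<open>p\<close>, the law of cosines makes the cosine of the angle at \<open>v\<close>
  at least \<open>- md r / (sn r sn D)\<close>, a quantity of order \<open>r\<close>. This describes
  a locally longest chord as seen from the complementary arc.\<close>

lemma almost_right_angle:
  assumes m: "{v, y, p} \<subseteq> {a..b}" "b - a < Lam" "v \<noteq> y" "v \<noteq> p" and le: "d p y \<le> d p v"
    and e: "0 < \<epsilon>" "\<epsilon> \<le> pi / 2" and small: "sqrt K * \<bar>v - y\<bar> \<le> 1" "\<bar>v - y\<bar> \<le> sin \<epsilon> * sn (d p v)"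
  shows "A v y p \<le> pi / 2 + \<epsilon>"
proof -
  define r D where "r = d v y" and "D = d v p"
  have abs: "\<bar>v - y\<bar> < Lam" "\<bar>v - p\<bar> < Lam" using m by (auto simp: abs_real_def)
  have r: "0 < r" "r \<le> \<bar>v - y\<bar>" using d_pos[OF m(3) abs(1)] d_le[of v y] by (auto simp: r_def)
  have snr: "0 < sn r" using sn_d_pos[OF m(3) abs(1)] by (simp add: r_def)
  have snD: "0 < sn D" using sn_d_pos[OF m(4) abs(2)] by (simp add: D_def)
  have Kr: "sqrt K * r \<le> 1"
  proof -
    have "sqrt K * r \<le> sqrt K * \<bar>v - y\<bar>" using r K by (intro mult_left_mono) auto
    then show ?thesis using small by linarith
  qed
  have cs: "1 / 2 \<le> csK K (r / 2)"
  proof -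
    have "0 \<le> sqrt K * (r / 2)" "sqrt K * (r / 2) \<le> 1" using Kr r K by auto
    then have "(sqrt K * (r / 2))\<^sup>2 \<le> 1" by (simp add: power_le_one)
    then show ?thesis using cos_ge_one_minus_sq[of "sqrt K * (r / 2)"] by (simp add: csK_def)
  qed
  have sh: "0 < sn (r / 2)" "sn (r / 2) \<le> r / 2"
    using snK_pos[OF K, of "r / 2"] snK_le[OF K, of "r / 2"] r Kr pi_gt3 by auto
  have mdr: "md r \<le> r * sn r"
  proof -
    have "md r = 2 * sn (r / 2) * sn (r / 2)" using mdK_half[OF K, of r] by (simp add: power2_eq_square)
    also have "\<dots> \<le> 2 * sn (r / 2) * (r / 2)" using sh by (intro mult_left_mono) auto
    also have "\<dots> = r * (2 * sn (r / 2) * (1 / 2))" by simp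
    also have "\<dots> \<le> r * (2 * sn (r / 2) * csK K (r / 2))" using sh cs r by (intro mult_left_mono) auto
    finally show ?thesis using snK_double[OF K, of r] by simp
  qed
  have dp: "md (d y p) \<le> md D"
    using le d_nonneg[of y p] Kd_lt[OF abs(2)] d_sym by (intro mdK_mono[OF K]) (auto simp: D_def)
  have "K * md D \<le> 2"
  proof -
    have "- 1 \<le> csK K D" by (simp add: csK_def)
    then show ?thesis using csK_md[OF K, of D] by linarith
  qed
  then have "K * md D * md r \<le> 2 * md r" using mdK_nonneg[OF K, of r] by (intro mult_right_mono) auto
  then have "- md r \<le> md r + md D - K * md r * md D - md (d y p)" using dp by (simp add: mult_ac)
  also have "\<dots> = sn r * sn D * cos (A v y p)" using A_cos[OF m] by (simp add: r_def D_def)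
  finally have 1: "- md r \<le> sn r * sn D * cos (A v y p)" .
  have "r \<le> sin \<epsilon> * sn D" using r small d_sym by (simp add: D_def)
  then have "r * sn r \<le> sin \<epsilon> * sn D * sn r" using snr by (intro mult_right_mono) auto
  then have "md r \<le> sn r * sn D * sin \<epsilon>" using mdr by (simp add: mult_ac)
  then have "sn r * sn D * (- sin \<epsilon>) \<le> sn r * sn D * cos (A v y p)" using 1 by simp
  moreover have "0 < sn r * sn D" using snr snD by simp
  ultimately have "- sin \<epsilon> \<le> cos (A v y p)" by (simp only: mult_le_cancel_left_pos)
  then have "cos (pi / 2 + \<epsilon>) \<le> cos (A v y p)" by (simp add: cos_add)
  then show ?thesis using cos_mono_le_eq[of "pi / 2 + \<epsilon>" "A v y p"] A_bounds[OF m] e by simp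
qed

end

context curved_arc
begin

lemma Th_rev: "convex_arc.Th K (\<lambda>x y. d (- x) (- y)) s t = Th (- t) (- s)"
  unfolding convex_arc.Th_def[OF rev] Th_def al_rev[of "- t" "- s"] be_rev[of "- t" "- s"] by simp

lemma rev_curved: "curved_arc K Lam (\<lambda>x y. d (- x) (- y)) kap"
proof -
  interpret R: convex_arc K Lam "\<lambda>x y. d (- x) (- y)" by (rule rev)
  show ?thesis
  proof
    show "0 < kap" by (rule kap)
    show "kap * (y - x) \<le> R.Th x y" if "x < y" "y - x < Lam" for x y
      unfolding Th_rev using Th_ge[of "- y" "- x"] that by simp
  qed
qed

text \<open>The value is the angle between a chord \<open>e\<close> and its arc of curvature
  \<open>kk\<close> on the unit sphere, \<open>sin \<delta> = kk tan (e / 2)\<close>. Smallness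
  keeps the sine below 1 and provides the hypothesis of \<open>deficit_nonpos\<close>.\<close>

lemma end_angle_ge:
  assumes Kp: "0 < K" and k: "0 < k" "k < kap" and st: "s < t" "t - s < Lam" and small: "sqrt K * (t - s) * (1 + k / sqrt K) < 1"
  shows "arcsin (k / sqrt K * sin (sqrt K * d s t) / (1 + cos (sqrt K * d s t))) \<le> be s t"
proof -
  define kk where "kk = k / sqrt K"
  have sK: "0 < sqrt K" using Kp by simp
  have kk: "0 < kk" using k sK by (simp add: kk_def)
  have conv: "k * md r < sn r \<longleftrightarrow> kk * (1 - cos (sqrt K * r)) < sin (sqrt K * r)"
    "k * md r \<le> sn r * x \<longleftrightarrow> kk * (1 - cos (sqrt K * r)) \<le> sin (sqrt K * r) * x" for r x
  proof -
    have "k * md r = kk * (1 - cos (sqrt K * r)) / sqrt K" using Kp by (simp add: mdK_def kk_def)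
    moreover have "sn r = sin (sqrt K * r) / sqrt K" using Kp by (simp add: snK_def)
    ultimately show "k * md r < sn r \<longleftrightarrow> kk * (1 - cos (sqrt K * r)) < sin (sqrt K * r)"
      "k * md r \<le> sn r * x \<longleftrightarrow> kk * (1 - cos (sqrt K * r)) \<le> sin (sqrt K * r) * x"
      using sK by (simp_all add: divide_less_cancel divide_le_cancel)
  qed
  have e: "0 < sqrt K * d s u" "sqrt K * d s u < 1" "kk * sin (sqrt K * d s u) < 1"
    if "s < u" "u \<le> t" for u
  proof -
    show p: "0 < sqrt K * d s u" using d_pos[of s u] that st sK by simp
    have "sqrt K * d s u \<le> sqrt K * (t - s)" using d_le[of s u] that sK by (intro mult_left_mono) auto
    then have "sqrt K * d s u * (1 + kk) \<le> sqrt K * (t - s) * (1 + kk)" using kk by (intro mult_right_mono) auto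
    then have le: "sqrt K * d s u * (1 + kk) < 1" using small by (simp add: kk_def)
    moreover have "0 < sqrt K * d s u * kk" using p kk by simp
    ultimately show "sqrt K * d s u < 1" unfolding distrib_left mult_1_right using p by linarith
    have "kk * sin (sqrt K * d s u) \<le> kk * (sqrt K * d s u)" using p kk sin_x_le_x[of "sqrt K * d s u"] by (intro mult_left_mono) auto
    then show "kk * sin (sqrt K * d s u) < 1" using le p unfolding distrib_left mult_1_right by (simp add: mult.commute)
  qed
  have pos: "0 < sin (sqrt K * d s u)" "0 < cos (sqrt K * d s u)" if "s < u" "u \<le> t" for u
    using e[OF that] pi_gt3 by (auto intro!: sin_gt_zero cos_gt_zero)
  have SS: "kk * (1 - cos x) * (1 + cos x) = (kk * sin x) * sin x" for x
  proof -
    have "(1 - cos x) * (1 + cos x) = 1 - cos x * cos x" by (simp add: algebra_simps)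
    also have "\<dots> = sin x * sin x" using sin_cos_squared_add3[of x] by linarith
    finally show ?thesis by (simp add: mult.assoc)
  qed
  have "deficit k s t \<le> 0"
  proof (rule deficit_nonpos[OF st k])
    fix u assume u: "s < u" "u \<le> t"
    define x where "x = sqrt K * d s u"
    have "(kk * sin x) * sin x < 1 * sin x" using e(3)[OF u] pos[OF u] unfolding x_def by (intro mult_strict_right_mono) auto
    also have "\<dots> \<le> (1 + cos x) * sin x" using pos[OF u] unfolding x_def by (intro mult_right_mono) auto
    finally have "kk * (1 - cos x) * (1 + cos x) < sin x * (1 + cos x)" unfolding SS by (simp add: mult.commute)
    moreover have "0 < 1 + cos x" using pos[OF u] by (simp add: x_def)
    ultimately have "kk * (1 - cos x) < sin x" using mult_less_cancel_right_pos by blast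
    then show "k * md (d s u) < sn (d s u)" unfolding conv x_def .
  qed
  then have "k * md (d s t) \<le> sn (d s t) * sin (min (be s t) (pi / 2))" by (simp add: deficit_def)
  then have le: "kk * (1 - cos (sqrt K * d s t)) \<le> sin (sqrt K * d s t) * sin (min (be s t) (pi / 2))" unfolding conv .
  define x where "x = sqrt K * d s t"
  have x: "0 < sin x" "0 < cos x" "kk * sin x < 1" using pos[of t] e(3)[of t] st by (auto simp: x_def)
  have "kk * sin x / (1 + cos x) \<le> sin (min (be s t) (pi / 2))"
  proof -
    have "kk * (1 - cos x) * (1 + cos x) \<le> sin x * sin (min (be s t) (pi / 2)) * (1 + cos x)"
      using le x unfolding x_def by (intro mult_right_mono) auto
    then have "sin x * (kk * sin x) \<le> sin x * (sin (min (be s t) (pi / 2)) * (1 + cos x))" unfolding SS by (simp add: mult_ac)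
    then have "kk * sin x \<le> sin (min (be s t) (pi / 2)) * (1 + cos x)" using x by simp
    then show ?thesis using x by (simp add: divide_le_eq)
  qed
  moreover have "- 1 \<le> kk * sin x / (1 + cos x)"
  proof -
    have "0 \<le> kk * sin x / (1 + cos x)" using x kk by simp
    then show ?thesis by linarith
  qed
  ultimately have "arcsin (kk * sin x / (1 + cos x)) \<le> arcsin (sin (min (be s t) (pi / 2)))"
    by (intro arcsin_le_arcsin) auto
  also have "arcsin (sin (min (be s t) (pi / 2))) = min (be s t) (pi / 2)"
    using be_bounds[OF st] by (intro arcsin_sin) auto
  finally show ?thesis by (simp add: kk_def x_def)
qed

lemma start_angle_ge:
  assumes Kp: "0 < K" and k: "0 < k" "k < kap" and st: "s < t" "t - s < Lam" and small: "sqrt K * (t - s) * (1 + k / sqrt K) < 1"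
  shows "arcsin (k / sqrt K * sin (sqrt K * d s t) / (1 + cos (sqrt K * d s t))) \<le> al s t"
  using curved_arc.end_angle_ge[OF rev_curved Kp k, of "- t" "- s"] st small by (simp add: al_rev d_sym)

end

context closed_curve
begin

lemma d_tri_sum: "d (x 0) (x n) \<le> (\<Sum>i<n. d (x i) (x (Suc i)))"
proof (induction n)
  case (Suc n) then show ?case using d_tri[of "x 0" "x (Suc n)" "x n"] by simp
qed simp

section \<open>Fine inscribed polygons\<close>

definition fine_chain :: "real \<Rightarrow> real \<Rightarrow> real \<Rightarrow> real \<Rightarrow> bool" where
  "fine_chain \<eta> a b c \<longleftrightarrow> (\<exists>(n::nat) x. 0 < n \<and> x 0 = a \<and> x n = b \<and> (\<forall>i<n. x i < x (Suc i) \<and> x (Suc i) - x i < \<eta>)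
     \<and> c \<le> (\<Sum>i<n. d (x i) (x (Suc i))))"

lemma fine_chain_single:
  assumes "a < b" "0 < \<eta>" shows "fine_chain \<eta> a b (d a b)"
proof -
  obtain M :: nat where M: "(b - a) / \<eta> < M" using reals_Archimedean2 by blast
  have "0 < (b - a) / \<eta>" using assms by simp
  then have M0: "0 < real M" using M by linarith
  define x where "x i = a + real i * ((b - a) / M)" for i :: nat
  have st: "x (Suc i) - x i = (b - a) / M" for i by (simp add: x_def algebra_simps add_divide_distrib diff_divide_distrib)
  have q: "0 < (b - a) / M" "(b - a) / M < \<eta>" using M0 M assms by (auto simp: field_simps)
  have "x 0 = a" "x M = b" using M0 by (auto simp: x_def)
  moreover have "x i < x (Suc i) \<and> x (Suc i) - x i < \<eta>" for i using st[of i] q by linarith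
  ultimately show ?thesis unfolding fine_chain_def using d_tri_sum[of x M] M0
    by (intro exI[of _ M] exI[of _ x]) auto
qed

lemma fine_chain_trans:
  assumes "fine_chain \<eta> a b c" "fine_chain \<eta> b e c'" shows "fine_chain \<eta> a e (c + c')"
proof -
  obtain n :: nat and x where x: "0 < n" "x 0 = a" "x n = b" "\<forall>i<n. x i < x (Suc i) \<and> x (Suc i) - x i < \<eta>" "c \<le> (\<Sum>i<n. d (x i) (x (Suc i)))"
    using assms(1) unfolding fine_chain_def by blast
  obtain m :: nat and y where y: "0 < m" "y 0 = b" "y m = e" "\<forall>i<m. y i < y (Suc i) \<and> y (Suc i) - y i < \<eta>" "c' \<le> (\<Sum>i<m. d (y i) (y (Suc i)))"
    using assms(2) unfolding fine_chain_def by blast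
  define z where "z i = (if i < n then x i else y (i - n))" for i
  have z1: "z i = x i" if "i \<le> n" for i using that x y by (cases "i = n") (auto simp: z_def)
  have z2: "z (n + i) = y i" for i by (simp add: z_def)
  have "(\<Sum>i<n + m. d (z i) (z (Suc i))) = (\<Sum>i<n. d (z i) (z (Suc i))) + (\<Sum>i<m. d (z (n + i)) (z (Suc (n + i))))"
    by (rule sum_lessThan_plus)
  also have "(\<Sum>i<n. d (z i) (z (Suc i))) = (\<Sum>i<n. d (x i) (x (Suc i)))" by (intro sum.cong) (auto simp: z1)
  also have "(\<Sum>i<m. d (z (n + i)) (z (Suc (n + i)))) = (\<Sum>i<m. d (y i) (y (Suc i)))"
    by (intro sum.cong) (auto simp: z2 simp flip: add_Suc_right)
  finally have "c + c' \<le> (\<Sum>i<n + m. d (z i) (z (Suc i)))" using x(5) y(5) by simp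
  moreover have "z i < z (Suc i) \<and> z (Suc i) - z i < \<eta>" if "i < n + m" for i
  proof (cases "i < n")
    case True then show ?thesis using x(4) by (simp add: z1)
  next
    case False
    then obtain j where j: "i = n + j" using le_Suc_ex by (metis not_less)
    then show ?thesis using y(4) that z2[of j] z2[of "Suc j"] by simp
  qed
  ultimately show ?thesis unfolding fine_chain_def using x y z1[of 0] z2[of m]
    by (intro exI[of _ "n + m"] exI[of _ z]) auto
qed

text \<open>Repeated vertices of an almost optimal partition are dropped and every edge is
  subdivided evenly; by the triangle inequality this does not shorten the polygon.\<close>

lemma fine_chain_exists:
  assumes ab: "a < b" and \<eta>: "0 < \<eta>" and \<epsilon>: "0 < \<epsilon>"
  shows "fine_chain \<eta> a b (b - a - \<epsilon>)"
proof -
  obtain n :: nat and t where t: "t 0 = a" "t n = b" "\<forall>i<n. t i \<le> t (Suc i)" "b - a - \<epsilon> < (\<Sum>i<n. d (t i) (t (Suc i)))"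
    using d_length[OF ab \<epsilon>] by blast
  have "m \<le> n \<Longrightarrow> (a = t m \<and> (\<Sum>i<m. d (t i) (t (Suc i))) = 0) \<or> (a < t m \<and> fine_chain \<eta> a (t m) (\<Sum>i<m. d (t i) (t (Suc i))))" for m
  proof (induction m)
    case 0 then show ?case using t by simp
  next
    case (Suc m)
    then have IH: "(a = t m \<and> (\<Sum>i<m. d (t i) (t (Suc i))) = 0) \<or> (a < t m \<and> fine_chain \<eta> a (t m) (\<Sum>i<m. d (t i) (t (Suc i))))" by simp
    have "t m \<le> t (Suc m)" using t(3) Suc.prems by simp
    then consider "t (Suc m) = t m" | "t m < t (Suc m)" by linarith
    then show ?case
    proof cases
      case 1 then show ?thesis using IH by simp
    next
      case 2
      then have "fine_chain \<eta> (t m) (t (Suc m)) (d (t m) (t (Suc m)))" using \<eta> by (intro fine_chain_single)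
      then show ?thesis using IH fine_chain_trans[of \<eta> a "t m"] 2 by auto
    qed
  qed
  from this[of n] have "fine_chain \<eta> a b (\<Sum>i<n. d (t i) (t (Suc i)))" using t ab by auto
  then obtain m :: nat and x where "0 < m \<and> x 0 = a \<and> x m = b \<and> (\<forall>i<m. x i < x (Suc i) \<and> x (Suc i) - x i < \<eta>)
     \<and> (\<Sum>i<n. d (t i) (t (Suc i))) \<le> (\<Sum>i<m. d (x i) (x (Suc i)))" unfolding fine_chain_def by blast
  then show ?thesis unfolding fine_chain_def using t(4) by (intro exI[of _ m] exI[of _ x]) auto
qed

end

locale curved_closed = closed_curve +
  fixes kap Lam :: real
  assumes Kp: "0 < K" and Lam: "Lam \<le> l" and ca: "curved_arc K Lam d kap"
begin

text \<open>The two bounds are two uses of the fan. With arcs of curvature \<open>k\<close> over the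
  edges, gaps count nothing but the factor is \<open>sqrt (k^2 + K)\<close>; with straight edges the
  gap chords are counted too, with factor \<open>sqrt K\<close>.\<close>

lemma curved_path_bound:
  fixes x :: "nat \<Rightarrow> real"
  assumes n: "2 \<le> n" and inc: "\<And>i. i < n \<Longrightarrow> x i < x (Suc i)" and cl: "x n < x 0 + l"
    and S: "good S" and xS: "\<And>i. i \<le> n \<Longrightarrow> x i \<in> S"
    and G: "0 \<notin> G" "n - 1 \<notin> G"
    and curve: "\<And>i. i < n \<Longrightarrow> i \<notin> G \<Longrightarrow> {x i..x (Suc i)} \<subseteq> S"
    and k: "0 < k" "k < kap"
    and mesh: "\<And>i. i < n \<Longrightarrow> i \<notin> G \<Longrightarrow> x (Suc i) - x i < Lam \<and> sqrt K * (x (Suc i) - x i) * (1 + k / sqrt K) < 1"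
    and start: "\<And>\<epsilon>. 0 < \<epsilon> \<Longrightarrow> \<exists>h0>0. \<forall>h. 0 < h \<and> h \<le> h0 \<longrightarrow> A (x 0) (x 0 + h) (x n) \<le> pi / 2 + \<epsilon>"
    and fin: "\<And>\<epsilon>. 0 < \<epsilon> \<Longrightarrow> \<exists>h0>0. \<forall>h. 0 < h \<and> h \<le> h0 \<longrightarrow> A (x n) (x 0) (x n - h) \<le> pi / 2 + \<epsilon>"
  shows "sqrt (k\<^sup>2 + K) * (\<Sum>i\<in>{..<n} - G. d (x i) (x (Suc i))) \<le> pi" and "sqrt K * (\<Sum>i<n. d (x i) (x (Suc i))) \<le> pi"
proof -
  interpret CA: curved_arc K Lam d kap by (rule ca)
  have sK: "0 < sqrt K" using Kp by simp
  define kk where "kk = k / sqrt K"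
  have kk: "0 < kk" using k sK by (simp add: kk_def)
  define w where "w = sqrt (kk\<^sup>2 + 1)"
  have w: "w\<^sup>2 = kk\<^sup>2 + 1" "0 < w" by (simp_all add: w_def add_nonneg_pos)
  have w1: "w \<le> 1 + kk"
  proof (rule power2_le_imp_le)
    show "w\<^sup>2 \<le> (1 + kk)\<^sup>2" unfolding w using kk by (simp add: power2_eq_square algebra_simps)
  qed (use kk in simp)
  define e where "e i = sqrt K * d (x i) (x (Suc i))" for i
  define D where "D i = (if i \<in> G then 0 else arcsin (kk * sin (e i) / (1 + cos (e i))))" for i
  have e: "0 < e i" "w * e i < pi" "kk * sin (e i) < 1 + cos (e i)" "e i < 1" if i: "i < n" "i \<notin> G" for i
  proof -
    have xi: "x i < x (Suc i)" "x (Suc i) - x i < Lam" "sqrt K * (x (Suc i) - x i) * (1 + kk) < 1" using inc mesh i by (auto simp: kk_def)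
    show p: "0 < e i" using d_pos[of "x i" "x (Suc i)"] xi Lam sK by (simp add: e_def)
    have "e i \<le> sqrt K * (x (Suc i) - x i)" unfolding e_def using d_le[of "x i" "x (Suc i)"] xi sK by (intro mult_left_mono) auto
    then have "e i * (1 + kk) \<le> sqrt K * (x (Suc i) - x i) * (1 + kk)" using kk by (intro mult_right_mono) auto
    then have le: "e i * (1 + kk) < 1" using xi by linarith
    have pk: "0 < e i * kk" using p kk by simp
    show e1: "e i < 1" using le pk unfolding distrib_left mult_1_right by linarith
    have "w * e i \<le> (1 + kk) * e i" using w1 p by (intro mult_right_mono) auto
    then show "w * e i < pi" using le pi_gt3 by (simp add: mult.commute)
    have "kk * sin (e i) \<le> kk * e i" using p kk sin_x_le_x[of "e i"] by (intro mult_left_mono) auto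
    moreover have "0 < cos (e i)" using p e1 pi_gt3 by (intro cos_gt_zero) auto
    ultimately show "kk * sin (e i) < 1 + cos (e i)" using le p unfolding distrib_left mult_1_right by (simp add: mult.commute)
  qed
  have edges: "0 \<le> D i" "sin (D i) = kk * sin (e i) / (1 + cos (e i))"
    "\<exists>lam. e i \<le> lam \<and> w * lam < pi \<and> sin (D i) * (1 + cos (e i)) = kk * sin (e i)
      \<and> cos (w * lam) = (cos (D i))\<^sup>2 * (1 + cos (e i)) - 1 \<and> sin (w * lam) = w * sin (e i) * cos (D i)" if i: "i < n" "i \<notin> G" for i
    using curved_edge_exists[OF e(1,2)[OF i] less_imp_le[OF kk] e(3)[OF i] w] i by (simp_all add: D_def)
  have Dpos: "0 < D i" if i: "i < n" "i \<notin> G" for i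
  proof -
    have "0 < sin (e i)" "0 < cos (e i)" using e(1,4)[OF i] pi_gt3 by (auto intro!: sin_gt_zero cos_gt_zero)
    then have "0 < sin (D i)" unfolding edges(2)[OF i] using kk by simp
    then have "D i \<noteq> 0" by auto
    then show ?thesis using edges(1)[OF i] by simp
  qed
  have Dal: "D i \<le> CA.al (x i) (x (Suc i))" and Dbe: "D i \<le> CA.be (x i) (x (Suc i))" if i: "i < n" "i \<notin> G" for i
    using CA.start_angle_ge[OF Kp k inc[OF i(1)]] CA.end_angle_ge[OF Kp k inc[OF i(1)]] mesh[OF i] i
    by (simp_all add: D_def kk_def e_def)
  have Dal': "\<exists>h0>0. \<forall>h. 0 < h \<and> h \<le> h0 \<longrightarrow> D i - \<epsilon> < A (x i) (x i + h) (x (Suc i))" if i: "i < n" "i \<notin> G" and eps: "0 < \<epsilon>" for i \<epsilon>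
  proof -
    obtain h0 where "0 < h0" "\<forall>h. 0 < h \<longrightarrow> h \<le> h0 \<longrightarrow> CA.al (x i) (x (Suc i)) - \<epsilon> < A (x i) (x i + h) (x (Suc i))"
      using CA.al_approx[OF inc[OF i(1)] _ eps] mesh[OF i] by blast
    then show ?thesis using Dal[OF i] by (intro exI[of _ h0]) fastforce
  qed
  have Dbe': "\<exists>h0>0. \<forall>h. 0 < h \<and> h \<le> h0 \<longrightarrow> D i - \<epsilon> < A (x (Suc i)) (x i) (x (Suc i) - h)" if i: "i < n" "i \<notin> G" and eps: "0 < \<epsilon>" for i \<epsilon>
  proof -
    have "CA.be (x i) (x (Suc i)) - \<epsilon> < CA.be (x i) (x (Suc i))" using eps by simp
    then have "\<forall>\<^sub>F h in at_right 0. CA.be (x i) (x (Suc i)) - \<epsilon> < A (x (Suc i)) (x i) (x (Suc i) - h)"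
      using order_tendstoD(1)[OF CA.be_tendsto[OF inc[OF i(1)]]] mesh[OF i] by blast
    then obtain b where b: "0 < b" "\<forall>h>0. h < b \<longrightarrow> CA.be (x i) (x (Suc i)) - \<epsilon> < A (x (Suc i)) (x i) (x (Suc i) - h)"
      unfolding eventually_at_right_field by blast
    then show ?thesis using Dbe[OF i] by (intro exI[of _ "b / 2"]) fastforce
  qed
  have DG: "D i = 0" if "i \<in> G" for i using that by (simp add: D_def)
  note F = fan_bound[OF Kp n inc cl S xS G curve DG Dpos Dal' Dbe' start fin]
  have n0: "0 < n" using n by simp
  have "\<exists>lam. \<forall>i. i < n \<longrightarrow> i \<notin> G \<longrightarrow> e i \<le> lam i \<and> w * lam i < pi \<and> sin (D i) * (1 + cos (e i)) = kk * sin (e i)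
      \<and> cos (w * lam i) = (cos (D i))\<^sup>2 * (1 + cos (e i)) - 1 \<and> sin (w * lam i) = w * sin (e i) * cos (D i)"
    by (rule choice) (use edges(3) in blast)
  then obtain lam where lam: "\<And>i. i < n \<Longrightarrow> i \<notin> G \<Longrightarrow> e i \<le> lam i \<and> w * lam i < pi \<and> sin (D i) * (1 + cos (e i)) = kk * sin (e i)
      \<and> cos (w * lam i) = (cos (D i))\<^sup>2 * (1 + cos (e i)) - 1 \<and> sin (w * lam i) = w * sin (e i) * cos (D i)" by blast
  define lm where "lm i = (if i \<in> G then 0 else lam i)" for i
  have "(\<Sum>i<n. w * lm i) \<le> pi"
  proof (rule F[where kk = kk and w = w and \<delta> = D and lam = lm])
    show "0 \<le> D i \<and> D i \<le> D i" if "i < n" for i using edges(1)[of i] DG[of i] that by (cases "i \<in> G") auto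
    show "(lm i = 0 \<and> D i = 0 \<and> 0 < i \<and> Suc i < n) \<or> (0 \<le> lm i \<and> w * lm i < pi
      \<and> sin (D i) * (1 + cos (sqrt K * d (x i) (x (Suc i)))) = kk * sin (sqrt K * d (x i) (x (Suc i)))
      \<and> cos (w * lm i) = (cos (D i))\<^sup>2 * (1 + cos (sqrt K * d (x i) (x (Suc i)))) - 1
      \<and> sin (w * lm i) = w * sin (sqrt K * d (x i) (x (Suc i))) * cos (D i))" if i: "i < n" for i
    proof (cases "i \<in> G")
      case True
      have "i \<noteq> 0" "i \<noteq> n - 1" using True G by metis+
      then show ?thesis using True DG[OF True] i by (intro disjI1) (auto simp: lm_def)
    next
      case False
      then show ?thesis using lam[OF i False] e(1)[OF i False] by (intro disjI2) (simp add: lm_def e_def)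
    qed
  qed (use kk w in auto)
  moreover have "(\<Sum>i\<in>{..<n} - G. w * e i) \<le> (\<Sum>i\<in>{..<n} - G. w * lm i)"
    using lam w(2) by (intro sum_mono mult_left_mono) (auto simp: lm_def)
  moreover have "(\<Sum>i\<in>{..<n} - G. w * lm i) = (\<Sum>i<n. w * lm i)"
    by (intro sum.mono_neutral_left) (auto simp: lm_def)
  ultimately have "(\<Sum>i\<in>{..<n} - G. w * e i) \<le> pi" by linarith
  moreover have "(\<Sum>i\<in>{..<n} - G. w * e i) = w * sqrt K * (\<Sum>i\<in>{..<n} - G. d (x i) (x (Suc i)))"
    by (simp add: e_def sum_distrib_left mult.assoc)
  moreover have "w * sqrt K = sqrt (k\<^sup>2 + K)"
  proof -
    have "(kk\<^sup>2 + 1) * K = k\<^sup>2 + K" using Kp by (simp add: kk_def power_divide field_simps)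
    then show ?thesis unfolding w_def by (metis real_sqrt_mult)
  qed
  ultimately show "sqrt (k\<^sup>2 + K) * (\<Sum>i\<in>{..<n} - G. d (x i) (x (Suc i))) \<le> pi" by simp
  have e0: "0 \<le> e i \<and> e i < pi" if "i < n" for i
    using goodD[OF S xS[of i] xS[of "Suc i"] xS[of "Suc i"]] d_nonneg[of "x i" "x (Suc i)"] sK that by (auto simp: e_def algebra_simps)
  have "(\<Sum>i<n. 1 * e i) \<le> pi"
  proof (rule F[where kk = 0 and w = 1 and \<delta> = "\<lambda>i. 0" and lam = e])
    show "0 \<le> (0::real) \<and> 0 \<le> D i" if "i < n" for i using edges(1)[of i] DG[of i] that by (cases "i \<in> G") auto
  qed (use e0 in \<open>auto simp: e_def\<close>)
  then show "sqrt K * (\<Sum>i<n. d (x i) (x (Suc i))) \<le> pi" by (simp add: e_def sum_distrib_left)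
qed

end

lemma le_of_left_limit:
  fixes f :: "real \<Rightarrow> real"
  assumes "0 < b" "isCont f b" "\<And>k. 0 < k \<Longrightarrow> k < b \<Longrightarrow> f k \<le> c"
  shows "f b \<le> c"
proof (rule tendsto_upperbound)
  show "(f \<longlongrightarrow> f b) (at_left b)"
    using assms(2) unfolding isCont_def by (rule tendsto_mono[OF at_le[OF subset_UNIV]])
  show "\<forall>\<^sub>F k in at_left b. f k \<le> c"
    unfolding eventually_at_left_field using assms by (intro exI[of _ 0]) auto
qed simp

context closed_curve
begin

lemma perimeter_arc:
  assumes "{a, b, c} \<subseteq> {s..t}" shows "d a b + d b c + d a c \<le> (t - s) + d s t"
proof -
  have sorted: "d a b + d b c + d a c \<le> (t - s) + d s t" if "s \<le> a" "a \<le> b" "b \<le> c" "c \<le> t" for a b c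
  proof -
    have "d a c \<le> d a s + d s t + d t c" using d_tri[of a c s] d_tri[of s c t] by linarith
    then show ?thesis using d_le[of a b] d_le[of b c] d_le[of a s] d_le[of t c] that by simp
  qed
  consider "a \<le> b" "b \<le> c" | "a \<le> c" "c \<le> b" | "b \<le> a" "a \<le> c" | "b \<le> c" "c \<le> a" | "c \<le> a" "a \<le> b" | "c \<le> b" "b \<le> a" by linarith
  then show ?thesis
    using sorted[of a b c] sorted[of a c b] sorted[of b a c] sorted[of b c a] sorted[of c a b] sorted[of c b a]
      d_sym[of a b] d_sym[of b c] d_sym[of a c] assms by cases auto
qed

lemma good_Icc:
  assumes "sqrt K * (b - a) < pi" "a \<le> b" shows "good {a..b}"
  unfolding good_def
proof (intro ballI)
  fix x y z assume "x \<in> {a..b}" "y \<in> {a..b}" "z \<in> {a..b}"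
  then have "d x y + d y z + d x z \<le> (b - a) + d a b" by (intro perimeter_arc) auto
  also have "\<dots> \<le> 2 * (b - a)" using d_le[of a b] assms by simp
  finally have "sqrt K * (d x y + d y z + d x z) \<le> sqrt K * (2 * (b - a))" using K by (intro mult_left_mono) auto
  also have "sqrt K * (2 * (b - a)) = 2 * (sqrt K * (b - a))" by (simp only: mult.left_commute)
  also have "\<dots> < 2 * pi" using assms by simp
  finally show "sqrt K * (d x y + d y z + d x z) < 2 * pi" .
qed

text \<open>Moving the second arc back by one period puts all points on the arc from
  \<open>s' - l\<close> to \<open>t\<close>, where any triangle has perimeter at most that arc plus
  its chord.\<close>

lemma good_two_arcs:
  assumes o: "v \<le> t" "t < s'" "s' \<le> u'" "u' < v + l" and N: "sqrt K * ((t - (s' - l)) + d s' t) < 2 * pi"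
  shows "good ({v..t} \<union> {s'..u'})"
  unfolding good_def
proof (intro ballI)
  define g where "g p = (if p \<le> t then p else p - l)" for p
  have dg: "d (g p) (g q) = d p q" for p q
    using per[of "p - l" q] per2[of p "q - l"] per2[of "p - l" "q - l"] per[of "p - l" "q - l"] per[of "p - l" "q"] by (auto simp: g_def)
  have gr: "g p \<in> {s' - l..t}" if "p \<in> {v..t} \<union> {s'..u'}" for p using that o by (auto simp: g_def)
  fix x y z assume "x \<in> {v..t} \<union> {s'..u'}" "y \<in> {v..t} \<union> {s'..u'}" "z \<in> {v..t} \<union> {s'..u'}"
  then have "d (g x) (g y) + d (g y) (g z) + d (g x) (g z) \<le> (t - (s' - l)) + d (s' - l) t"
    using gr by (intro perimeter_arc) auto
  moreover have "d (s' - l) t = d s' t" using per[of "s' - l" t] by simp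
  ultimately have "d x y + d y z + d x z \<le> (t - (s' - l)) + d s' t" by (simp add: dg)
  then have "sqrt K * (d x y + d y z + d x z) \<le> sqrt K * ((t - (s' - l)) + d s' t)" using K by (intro mult_left_mono) auto
  then show "sqrt K * (d x y + d y z + d x z) < 2 * pi" using N by simp
qed

lemma continuous_d: "continuous_on S f \<Longrightarrow> continuous_on S g \<Longrightarrow> continuous_on S (\<lambda>x. d (f x) (g x))"
proof -
  obtain m where m: "0 < m" "m \<le> l" "sqrt K * m \<le> pi"
  proof (cases "K = 0")
    case True then show ?thesis using that[of l] l by simp
  next
    case False
    then have "0 < sqrt K" using K by simp
    then have "sqrt K * min l (pi / sqrt K) \<le> sqrt K * (pi / sqrt K)" by (intro mult_left_mono) auto
    then show ?thesis using that[of "min l (pi / sqrt K)"] l \<open>0 < sqrt K\<close> by simp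
  qed
  show "continuous_on S f \<Longrightarrow> continuous_on S g \<Longrightarrow> continuous_on S (\<lambda>x. d (f x) (g x))"
    by (rule convex_arc.continuous_d[OF arc[OF m]])
qed

lemma d_shift: "d (x + of_int n * l) (y + of_int n * l) = d x y"
  using periodic_int[of "\<lambda>x. d x (y + of_int n * l)" l x n] periodic_int[of "\<lambda>y. d x y" l y n] per per2 by simp

end

context curved_closed
begin

text \<open>Both arc-chord angles are at most \<open>pi / 2\<close>, so the chord itself serves as
  the base of the fan; an inscribed polygon without gaps then bounds the length.\<close>

lemma inner_bound:
  assumes uv: "u < v" "v - u < Lam" and al: "start_angle K d u v \<le> pi / 2" and be: "end_angle K d u v \<le> pi / 2"
  shows "sqrt (kap\<^sup>2 + K) * (v - u) \<le> pi"
proof -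
  interpret CA: curved_arc K Lam d kap by (rule ca)
  have sK: "0 < sqrt K" using Kp by simp
  \<comment> \<open>\<open>kap - k\<close> also serves as the error of the polygonal length, so that
    one limit \<open>k\<close> to \<open>kap\<close> removes both losses.\<close>
  have step: "sqrt (k\<^sup>2 + K) * (v - u - (kap - k)) \<le> pi" if k: "0 < k" "k < kap" for k
  proof -
    define q where "q = sqrt K * (1 + k / sqrt K)"
    have q: "0 < q" using sK k by (simp add: q_def add_pos_pos)
    define \<eta> where "\<eta> = min ((v - u) / 2) (1 / q)"
    have eta: "0 < \<eta>" "\<eta> \<le> (v - u) / 2" "\<eta> \<le> 1 / q" using uv q unfolding \<eta>_def by (simp, intro min.cobounded1, intro min.cobounded2)
    have "fine_chain \<eta> u v (v - u - (kap - k))" using uv eta k by (intro fine_chain_exists) auto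
    then obtain n :: nat and x where x: "0 < n" "x 0 = u" "x n = v" "\<forall>i<n. x i < x (Suc i) \<and> x (Suc i) - x i < \<eta>"
      "v - u - (kap - k) \<le> (\<Sum>i<n. d (x i) (x (Suc i)))" unfolding fine_chain_def by blast
    have mono: "x i \<le> x j" if "i \<le> j" "j \<le> n" for i j
      using that
    proof (induction j rule: dec_induct)
      case (step m) then show ?case using x(4)[rule_format, of m] by simp
    qed simp
    have n2: "2 \<le> n"
    proof (rule ccontr)
      assume "\<not> 2 \<le> n"
      then have "n = 1" using x(1) by simp
      then show False using x(4)[rule_format, of 0] x(2,3) eta uv by simp
    qed
    have Ku: "sqrt K * (v - u) < pi"
    proof -
      have "sqrt K * (v - u) < sqrt K * Lam" using uv sK by simp
      then show ?thesis using CA.KLam by simp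
    qed
    have "sqrt (k\<^sup>2 + K) * (\<Sum>i\<in>{..<n} - {}. d (x i) (x (Suc i))) \<le> pi"
    proof (rule curved_path_bound(1)[OF n2, where S = "{u..v}", OF _ _ good_Icc[OF Ku]])
      show "x i < x (Suc i)" if "i < n" for i using x(4) that by blast
      show "x n < x 0 + l" using x uv Lam by simp
      show "x i \<in> {u..v}" if "i \<le> n" for i using mono[of 0 i] mono[of i n] that x by simp
      show "{x i..x (Suc i)} \<subseteq> {u..v}" if "i < n" for i using mono[of 0 i] mono[of "Suc i" n] that x by auto
      show "x (Suc i) - x i < Lam \<and> sqrt K * (x (Suc i) - x i) * (1 + k / sqrt K) < 1" if "i < n" for i
      proof
        have h: "x (Suc i) - x i < \<eta>" using x(4) that by blast
        then show "x (Suc i) - x i < Lam" using eta(2) uv by auto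
        have "x (Suc i) - x i < 1 / q" using h eta by linarith
        then have "(x (Suc i) - x i) * q < 1" using q by (simp add: less_divide_eq)
        then show "sqrt K * (x (Suc i) - x i) * (1 + k / sqrt K) < 1" by (simp add: q_def mult_ac)
      qed
      show "\<exists>h0>0. \<forall>h. 0 < h \<and> h \<le> h0 \<longrightarrow> A (x 0) (x 0 + h) (x n) \<le> pi / 2 + \<epsilon>" if "0 < \<epsilon>" for \<epsilon>
      proof (intro exI[of _ "(v - u) / 2"] conjI allI impI)
        fix h assume "0 < h \<and> h \<le> (v - u) / 2"
        then have "A u (u + h) v \<le> CA.al u v" using uv by (intro CA.al_upper) auto
        then show "A (x 0) (x 0 + h) (x n) \<le> pi / 2 + \<epsilon>" using al that x by simp
      qed (use uv in simp)
      show "\<exists>h0>0. \<forall>h. 0 < h \<and> h \<le> h0 \<longrightarrow> A (x n) (x 0) (x n - h) \<le> pi / 2 + \<epsilon>" if "0 < \<epsilon>" for \<epsilon>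
      proof (intro exI[of _ "(v - u) / 2"] conjI allI impI)
        fix h assume "0 < h \<and> h \<le> (v - u) / 2"
        then have "A v u (v - h) \<le> CA.be u v" using uv by (intro CA.be_upper) auto
        then show "A (x n) (x 0) (x n - h) \<le> pi / 2 + \<epsilon>" using be that x by simp
      qed (use uv in simp)
    qed (use uv k in auto)
    moreover have "sqrt (k\<^sup>2 + K) * (v - u - (kap - k)) \<le> sqrt (k\<^sup>2 + K) * (\<Sum>i<n. d (x i) (x (Suc i)))"
      using x(5) Kp by (intro mult_left_mono) auto
    ultimately show ?thesis by simp
  qed
  have "sqrt (kap\<^sup>2 + K) * (v - u - (kap - kap)) \<le> pi"
    by (rule le_of_left_limit[OF CA.kap _ step]) (auto intro!: continuous_intros)
  then show ?thesis by simp
qed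

text \<open>The polygon runs along the two arcs and crosses from \<open>t\<close> to
  \<open>s'\<close> by a single gap edge. The triangles at its vertices thus avoid the part of the
  curve between \<open>t\<close> and \<open>s'\<close>, where perimeters could be too large.\<close>

lemma outer_bound:
  assumes o: "v < t" "t < s'" "s' < u'" "u' < v + l" and N: "sqrt K * ((t - (s' - l)) + d s' t) < 2 * pi"
    and start: "\<And>\<epsilon>. 0 < \<epsilon> \<Longrightarrow> \<exists>h0>0. \<forall>h. 0 < h \<and> h \<le> h0 \<longrightarrow> A v (v + h) u' \<le> pi / 2 + \<epsilon>"
    and fin: "\<And>\<epsilon>. 0 < \<epsilon> \<Longrightarrow> \<exists>h0>0. \<forall>h. 0 < h \<and> h \<le> h0 \<longrightarrow> A u' v (u' - h) \<le> pi / 2 + \<epsilon>"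
  shows "sqrt (kap\<^sup>2 + K) * ((t - v) + (u' - s')) \<le> pi" and "sqrt K * ((t - v) + d t s' + (u' - s')) \<le> pi"
proof -
  interpret CA: curved_arc K Lam d kap by (rule ca)
  have sK: "0 < sqrt K" using Kp by simp
  have step: "sqrt (k\<^sup>2 + K) * ((t - v) + (u' - s') - 2 * (kap - k)) \<le> pi \<and> sqrt K * ((t - v) + d t s' + (u' - s') - 2 * (kap - k)) \<le> pi"
    if k: "0 < k" "k < kap" for k
  proof -
    define q where "q = sqrt K * (1 + k / sqrt K)"
    have q: "0 < q" using sK k by (simp add: q_def add_pos_pos)
    define \<eta> where "\<eta> = min Lam (1 / q)"
    have eta: "0 < \<eta>" "\<eta> \<le> Lam" "\<eta> \<le> 1 / q" using CA.Lam q by (auto simp: \<eta>_def)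
    have "fine_chain \<eta> v t (t - v - (kap - k))" using o eta k by (intro fine_chain_exists) auto
    then obtain n :: nat and x where x: "0 < n" "x 0 = v" "x n = t" "\<forall>i<n. x i < x (Suc i) \<and> x (Suc i) - x i < \<eta>"
      "t - v - (kap - k) \<le> (\<Sum>i<n. d (x i) (x (Suc i)))" unfolding fine_chain_def by blast
    have "fine_chain \<eta> s' u' (u' - s' - (kap - k))" using o eta k by (intro fine_chain_exists) auto
    then obtain m :: nat and y where y: "0 < m" "y 0 = s'" "y m = u'" "\<forall>i<m. y i < y (Suc i) \<and> y (Suc i) - y i < \<eta>"
      "u' - s' - (kap - k) \<le> (\<Sum>i<m. d (y i) (y (Suc i)))" unfolding fine_chain_def by blast
    \<comment> \<open>Index \<open>n\<close> is the gap edge from \<open>t\<close> to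
      \<open>s'\<close>; the second chain is shifted by \<open>Suc n\<close>.\<close>
    define z where "z i = (if i \<le> n then x i else y (i - Suc n))" for i
    define M where "M = Suc n + m"
    have z1: "z i = x i" if "i \<le> n" for i using that by (simp add: z_def)
    have z2: "z (Suc n + i) = y i" for i by (simp add: z_def)
    have xmono: "x i \<le> x j" if "i \<le> j" "j \<le> n" for i j
      using that
    proof (induction j rule: dec_induct)
      case (step j) then show ?case using x(4)[rule_format, of j] by simp
    qed simp
    have ymono: "y i \<le> y j" if "i \<le> j" "j \<le> m" for i j
      using that
    proof (induction j rule: dec_induct)
      case (step j) then show ?case using y(4)[rule_format, of j] by simp
    qed simp
    have split: "i < n \<or> i = n \<or> (\<exists>j<m. i = Suc n + j)" if "i < M" for i
    proof (cases "i \<le> n")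
      case False
      then have "i = Suc n + (i - Suc n)" "i - Suc n < m" using that by (auto simp: M_def)
      then show ?thesis by blast
    qed auto
    have inc: "z i < z (Suc i)" if i: "i < M" for i
    proof -
      consider "i < n" | "i = n" | j where "j < m" "i = Suc n + j" using split[OF i] by blast
      then show ?thesis
      proof cases
        case 1 then show ?thesis using x(4) z1[of i] z1[of "Suc i"] by simp
      next
        case 2 then show ?thesis using z1[of n] z2[of 0] x y o by simp
      next
        case 3
        then have "z i = y j" "z (Suc i) = y (Suc j)" using z2[of j] z2[of "Suc j"] by simp_all
        then show ?thesis using y(4) 3 by simp
      qed
    qed
    let ?S = "{v..t} \<union> {s'..u'}"
    have zS: "z i \<in> ?S" if "i \<le> M" for i
    proof (cases "i \<le> n")
      case True then show ?thesis using xmono[of 0 i] xmono[of i n] x z1 by simp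
    next
      case False
      then have "z i = y (i - Suc n)" "i - Suc n \<le> m" using that by (auto simp: z_def M_def)
      then show ?thesis using ymono[of 0 "i - Suc n"] ymono[of "i - Suc n" m] y by simp
    qed
    have edge: "{z i..z (Suc i)} \<subseteq> ?S \<and> z (Suc i) - z i < \<eta>" if i: "i < M" "i \<notin> {n}" for i
    proof -
      consider "i < n" | j where "j < m" "i = Suc n + j" using split[OF i(1)] i(2) by blast
      then show ?thesis
      proof cases
        case 1
        then have "z i = x i" "z (Suc i) = x (Suc i)" "v \<le> x i" "x (Suc i) \<le> t" "x (Suc i) - x i < \<eta>"
          using z1 xmono[of 0 i] xmono[of "Suc i" n] x by auto
        then show ?thesis by auto
      next
        case 2
        then have "z i = y j" "z (Suc i) = y (Suc j)" using z2[of j] z2[of "Suc j"] by simp_all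
        moreover have "s' \<le> y j" "y (Suc j) \<le> u'" "y (Suc j) - y j < \<eta>"
          using ymono[of 0 j] ymono[of "Suc j" m] y 2 by auto
        ultimately show ?thesis by auto
      qed
    qed
    have zM: "z 0 = v" "z M = u'" using z1[of 0] z2[of m] x y by (auto simp: M_def)
    have mesh: "z (Suc i) - z i < Lam \<and> sqrt K * (z (Suc i) - z i) * (1 + k / sqrt K) < 1" if "i < M" "i \<notin> {n}" for i
    proof
      have h: "z (Suc i) - z i < \<eta>" using edge[OF that] by blast
      then show "z (Suc i) - z i < Lam" using eta by linarith
      have "z (Suc i) - z i < 1 / q" using h eta by linarith
      then have "(z (Suc i) - z i) * q < 1" using q by (simp add: less_divide_eq)
      then show "sqrt K * (z (Suc i) - z i) * (1 + k / sqrt K) < 1" by (simp add: q_def mult_ac)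
    qed
    have g: "good ?S" using o N by (intro good_two_arcs) auto
    have M2: "2 \<le> M" using x(1) y(1) by (simp add: M_def)
    have cl: "z M < z 0 + l" using zM o by simp
    have G: "0 \<notin> {n}" "M - 1 \<notin> {n}" using x(1) y(1) by (auto simp: M_def)
    have edge': "{z i..z (Suc i)} \<subseteq> ?S" if "i < M" "i \<notin> {n}" for i using edge[OF that] by blast
    note B = curved_path_bound[OF M2 inc cl g zS G edge' k mesh, unfolded zM]
    have B1: "sqrt (k\<^sup>2 + K) * (\<Sum>i\<in>{..<M} - {n}. d (z i) (z (Suc i))) \<le> pi" and B2: "sqrt K * (\<Sum>i<M. d (z i) (z (Suc i))) \<le> pi"
      by (rule B; (assumption | erule start | erule fin))+
    have s1: "(\<Sum>i<n. d (z i) (z (Suc i))) = (\<Sum>i<n. d (x i) (x (Suc i)))" by (intro sum.cong) (auto simp: z1)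
    have s2: "(\<Sum>i<m. d (z (Suc n + i)) (z (Suc (Suc n + i)))) = (\<Sum>i<m. d (y i) (y (Suc i)))"
      using z2 by (intro sum.cong) (auto simp flip: add_Suc_right)
    have zn: "d (z n) (z (Suc n)) = d t s'" using z1[of n] z2[of 0] x y by simp
    have all: "(\<Sum>i<M. d (z i) (z (Suc i))) = (\<Sum>i<n. d (x i) (x (Suc i))) + d t s' + (\<Sum>i<m. d (y i) (y (Suc i)))"
      unfolding M_def sum_lessThan_plus using s1 s2 zn by simp
    have "(\<Sum>i<M. d (z i) (z (Suc i))) = d (z n) (z (Suc n)) + (\<Sum>i\<in>{..<M} - {n}. d (z i) (z (Suc i)))"
      by (rule sum.remove) (auto simp: M_def)
    then have part: "(\<Sum>i\<in>{..<M} - {n}. d (z i) (z (Suc i))) = (\<Sum>i<n. d (x i) (x (Suc i))) + (\<Sum>i<m. d (y i) (y (Suc i)))"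
      using all zn by simp
    have "sqrt (k\<^sup>2 + K) * ((t - v) + (u' - s') - 2 * (kap - k)) \<le> sqrt (k\<^sup>2 + K) * (\<Sum>i\<in>{..<M} - {n}. d (z i) (z (Suc i)))"
      unfolding part using x(5) y(5) Kp by (intro mult_left_mono) auto
    moreover have "sqrt K * ((t - v) + d t s' + (u' - s') - 2 * (kap - k)) \<le> sqrt K * (\<Sum>i<M. d (z i) (z (Suc i)))"
      unfolding all using x(5) y(5) Kp by (intro mult_left_mono) auto
    ultimately show ?thesis using B1 B2 by linarith
  qed
  have "sqrt (kap\<^sup>2 + K) * ((t - v) + (u' - s') - 2 * (kap - kap)) \<le> pi"
    by (rule le_of_left_limit[OF CA.kap]) (use step in \<open>auto intro!: continuous_intros\<close>)
  then show "sqrt (kap\<^sup>2 + K) * ((t - v) + (u' - s')) \<le> pi" by simp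
  have "sqrt K * ((t - v) + d t s' + (u' - s') - 2 * (kap - kap)) \<le> pi"
    by (rule le_of_left_limit[OF CA.kap]) (use step in \<open>auto intro!: continuous_intros\<close>)
  then show "sqrt K * ((t - v) + d t s' + (u' - s')) \<le> pi" by simp
qed

text \<open>The inner arc of a longest chord among short arcs has length at most \<open>pi / w\<close>. Then the chord
  is locally longest, so the same estimate applies to the complementary arc, possibly cut short by
  another chord to keep the perimeters of triangles below \<open>2 pi / sqrt K\<close>.\<close>
lemma closed_bound_pos:
  assumes LamK: "Lam = min l (pi / sqrt K)"
  shows "sqrt (kap\<^sup>2 + K) * l \<le> 2 * pi"
proof (rule ccontr)
  assume "\<not> ?thesis"
  define w where "w = sqrt (kap\<^sup>2 + K)"
  have wl: "2 * pi < w * l" using \<open>\<not> sqrt (kap\<^sup>2 + K) * l \<le> 2 * pi\<close> by (simp add: w_def)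
  interpret CA: curved_arc K Lam d kap by (rule ca)
  have sK: "0 < sqrt K" using Kp by simp
  have wK: "sqrt K < w" unfolding w_def using CA.kap by simp
  have w0: "0 < w" using wK sK by linarith
  have pw: "pi / w < Lam"
  proof -
    have "pi / w < pi / sqrt K" using wK sK w0 pi_gt_zero by (simp add: field_simps)
    moreover have "pi < w * l" using wl pi_gt_zero by linarith
    then have "pi / w < l" using w0 by (simp add: divide_less_eq mult.commute)
    ultimately show ?thesis by (simp add: LamK)
  qed
  \<comment> \<open>Strictly more than \<open>pi / w\<close>: the inner arc of the longest chord
    turns out to have length at most \<open>pi / w\<close>, so it may be prolonged at either end
    without leaving the range of the maximum.\<close>
  then obtain L0 where L0: "pi / w < L0" "L0 < Lam" using dense by blast
  have L00: "0 < L0" using L0 w0 pi_gt_zero by (meson divide_pos_pos less_trans)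
  define T where "T = {0..l} \<times> {0..l + L0} \<inter> {p. fst p \<le> snd p} \<inter> {p. snd p \<le> fst p + L0}"
  have "compact T" unfolding T_def
    by (intro compact_Int_closed compact_Times compact_Icc closed_Collect_le continuous_intros)
  moreover have "(0, L0) \<in> T" using l L00 by (simp add: T_def)
  moreover have "continuous_on T (\<lambda>p. d (fst p) (snd p))" by (intro continuous_d continuous_intros)
  ultimately obtain p where p: "p \<in> T" "\<forall>q\<in>T. d (fst q) (snd q) \<le> d (fst p) (snd p)"
    using continuous_attains_sup[of T "\<lambda>p. d (fst p) (snd p)"] by blast
  define u v where "u = fst p" and "v = snd p"
  have uv': "u \<le> v" "v \<le> u + L0" using p by (auto simp: T_def u_def v_def)
  have mx: "d a b \<le> d u v" if ab: "a \<le> b" "b \<le> a + L0" for a b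
  proof -
    obtain n where n: "a + of_int n * l \<in> {0..<0 + l}" using period_representative[OF l] .
    have "(a + of_int n * l, b + of_int n * l) \<in> T" using n ab by (auto simp: T_def)
    then have "d (a + of_int n * l) (b + of_int n * l) \<le> d u v" using p(2) by (force simp: u_def v_def)
    then show ?thesis by (simp only: d_shift)
  qed
  have "0 < d 0 L0" using L00 L0 Lam by (intro d_pos) auto
  also have "\<dots> \<le> d u v" using L00 by (intro mx) auto
  finally have duv: "0 < d u v" .
  have uv: "u < v" "v - u < Lam" using uv' duv L0 by (auto simp: order.order_iff_strict)
  have ev: "\<forall>\<^sub>F h in at_right 0. 0 < h \<and> h < v - u"
    unfolding eventually_at_right_field using uv by (intro exI[of _ "v - u"]) auto
  have "0 \<le> cos (CA.be u v)"
  proof (rule tendsto_lowerbound[OF CA.d_left_deriv[OF uv]])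
    show "\<forall>\<^sub>F h in at_right 0. 0 \<le> (d u v - d u (v - h)) / h" using ev
    proof eventually_elim
      case (elim h) then show ?case using mx[of u "v - h"] uv' by simp
    qed
  qed simp
  then have be: "CA.be u v \<le> pi / 2"
    using CA.be_bounds[OF uv] cos_mono_le_eq[of "pi / 2" "CA.be u v"] by simp
  have "0 \<le> cos (CA.al u v)"
  proof (rule tendsto_lowerbound[OF CA.d_right_deriv[OF uv]])
    show "\<forall>\<^sub>F h in at_right 0. 0 \<le> (d u v - d (u + h) v) / h" using ev
    proof eventually_elim
      case (elim h) then show ?case using mx[of "u + h" v] uv' by simp
    qed
  qed simp
  then have al: "CA.al u v \<le> pi / 2"
    using CA.al_bounds[OF uv] cos_mono_le_eq[of "pi / 2" "CA.al u v"] by simp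
  have wuv: "w * (v - u) \<le> pi" unfolding w_def by (rule inner_bound[OF uv al be])
  then have vu: "v - u \<le> pi / w" using w0 by (simp add: field_simps)
  define h1 where "h1 = L0 - (v - u)"
  have h1: "0 < h1" using vu L0 by (simp add: h1_def)
  have snD: "0 < CA.sn (d u v)" using CA.sn_d_pos[of u v] uv by simp
  have angle: "\<exists>h0>0. h0 \<le> h1 \<and> (\<forall>h. 0 < h \<and> h \<le> h0 \<longrightarrow> h \<le> sin \<epsilon>' * CA.sn (d u v) \<and> sqrt K * h \<le> 1)" if "0 < \<epsilon>'" "\<epsilon>' \<le> pi / 2" for \<epsilon>'
  proof -
    have se: "0 < sin \<epsilon>'" using that pi_gt_zero by (intro sin_gt_zero) linarith+
    define h0 where "h0 = min h1 (min (sin \<epsilon>' * CA.sn (d u v)) (1 / sqrt K))"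
    have "0 < h0" using h1 se snD sK by (simp add: h0_def)
    moreover have "h \<le> sin \<epsilon>' * CA.sn (d u v) \<and> sqrt K * h \<le> 1" if "0 < h \<and> h \<le> h0" for h
    proof
      show "h \<le> sin \<epsilon>' * CA.sn (d u v)" using that by (simp add: h0_def)
      have "h \<le> 1 / sqrt K" using that by (simp add: h0_def)
      then show "sqrt K * h \<le> 1" using sK by (simp add: field_simps)
    qed
    moreover have "h0 \<le> h1" by (simp add: h0_def)
    ultimately show ?thesis by blast
  qed
  \<comment> \<open>Since \<open>v - u < L0\<close>, prolonging the inner arc beyond either end does
    not lengthen the chord; this is the hypothesis of \<open>almost_right_angle\<close> for the
    complementary arc.\<close>
  have start: "\<exists>h0>0. \<forall>h. 0 < h \<and> h \<le> h0 \<longrightarrow> A v (v + h) (u + l) \<le> pi / 2 + \<epsilon>"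
    and fin: "\<exists>h0>0. \<forall>h. 0 < h \<and> h \<le> h0 \<longrightarrow> A (u + l) v (u + l - h) \<le> pi / 2 + \<epsilon>" if e: "0 < \<epsilon>" for \<epsilon>
  proof -
    define \<epsilon>' where "\<epsilon>' = min \<epsilon> (pi / 2)"
    have e': "0 < \<epsilon>'" "\<epsilon>' \<le> pi / 2" "\<epsilon>' \<le> \<epsilon>" using e by (auto simp: \<epsilon>'_def)
    obtain h0 where h0: "0 < h0" "h0 \<le> h1" "\<And>h. 0 < h \<and> h \<le> h0 \<Longrightarrow> h \<le> sin \<epsilon>' * CA.sn (d u v) \<and> sqrt K * h \<le> 1"
      using angle[OF e'(1,2)] by blast
    show "\<exists>h0>0. \<forall>h. 0 < h \<and> h \<le> h0 \<longrightarrow> A v (v + h) (u + l) \<le> pi / 2 + \<epsilon>"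
    proof (intro exI[of _ h0] conjI allI impI)
      fix h assume h: "0 < h \<and> h \<le> h0"
      have "A v (v + h) u \<le> pi / 2 + \<epsilon>'"
      proof (rule CA.almost_right_angle[where a = u and b = "v + h"])
        show "v + h - u < Lam" using h h0 L0 by (simp add: h1_def)
        show "d u (v + h) \<le> d u v" using h h0 uv by (intro mx) (auto simp: h1_def)
        show "sqrt K * \<bar>v - (v + h)\<bar> \<le> 1" "\<bar>v - (v + h)\<bar> \<le> sin \<epsilon>' * CA.sn (d u v)" using h0(3)[OF h] h by auto
      qed (use h uv e' in auto)
      then show "A v (v + h) (u + l) \<le> pi / 2 + \<epsilon>" using e' by (simp add: A_per)
    qed (use h0 in auto)
    show "\<exists>h0>0. \<forall>h. 0 < h \<and> h \<le> h0 \<longrightarrow> A (u + l) v (u + l - h) \<le> pi / 2 + \<epsilon>"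
    proof (intro exI[of _ h0] conjI allI impI)
      fix h assume h: "0 < h \<and> h \<le> h0"
      have "A u (u - h) v \<le> pi / 2 + \<epsilon>'"
      proof (rule CA.almost_right_angle[where a = "u - h" and b = v])
        show "v - (u - h) < Lam" using h h0 L0 by (simp add: h1_def)
        show "d v (u - h) \<le> d v u" using h h0 uv mx[of "u - h" v] d_sym by (auto simp: h1_def)
        show "sqrt K * \<bar>u - (u - h)\<bar> \<le> 1" "\<bar>u - (u - h)\<bar> \<le> sin \<epsilon>' * CA.sn (d v u)" using h0(3)[OF h] h d_sym[of v u] by auto
      qed (use h uv e' in auto)
      moreover have "A (u + l) v (u + l - h) = A u (u - h) v"
        using A_per(1)[of u v "u + l - h"] A_per(3)[of u v "u - h"] A_commute[of u v "u - h"] by (simp add: algebra_simps)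
      ultimately show "A (u + l) v (u + l - h) \<le> pi / 2 + \<epsilon>" using e' by simp
    qed (use h0 in auto)
  qed
  define g where "g = (l - (v - u)) / 2"
  have g: "0 < g" "v - u + 2 * g = l" using uv Lam by (simp_all add: g_def field_simps)
  \<comment> \<open>The quantity that must stay below \<open>2 pi\<close> when the complementary arc
    is reduced to its two end pieces of length \<open>x g\<close>, joined by a chord.
    \<open>x = 1\<close> would give the whole complement.\<close>
  define f where "f x = sqrt K * ((v - u) + 2 * x * g + d (u - x * g) (v + x * g))" for x
  have out: "w * (2 * x * g) \<le> pi" "sqrt K * (2 * x * g + d (u - x * g) (v + x * g)) \<le> pi"
    if x: "0 < x" "x < 1" and fx: "f x < 2 * pi" for x
  proof -
    have xg: "0 < x * g" "x * g < g" using x g by auto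
    have o: "v < v + x * g" "v + x * g < u - x * g + l" "u - x * g + l < u + l" "u + l < v + l"
      using xg g uv by auto
    have dd: "d (u - x * g + l) (v + x * g) = d (u - x * g) (v + x * g)" by (rule per)
    have N: "sqrt K * ((v + x * g - (u - x * g + l - l)) + d (u - x * g + l) (v + x * g)) < 2 * pi"
      using fx unfolding dd f_def by (simp add: algebra_simps)
    note O = outer_bound[OF o N start fin]
    show "w * (2 * x * g) \<le> pi" using O(1) by (simp add: w_def algebra_simps)
    show "sqrt K * (2 * x * g + d (u - x * g) (v + x * g)) \<le> pi" 
    proof -
      have d3: "d (v + x * g) (u - x * g + l) = d (u - x * g) (v + x * g)" by (simp only: per2 d_sym[of "v + x * g"])
      show ?thesis using O(2)[unfolded d3] by (simp add: algebra_simps)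
    qed
  qed
  have Kw: "sqrt K * (pi / w) < pi" using wK w0 pi_gt_zero by (simp add: field_simps)
  then have "pi + sqrt K * (pi / w) < 2 * pi" by simp
  \<comment> \<open>A threshold that cannot be reached: where \<open>f x = N1 < 2 pi\<close>, the
    straight bound gives \<open>f x \<le> pi + sqrt K pi / w < N1\<close>. If \<open>f\<close> stays
    below it, \<open>x\<close> can be taken close to 1 and the curved bound contradicts
    \<open>w l > 2 pi\<close>.\<close>
  then obtain N1 where N1: "pi + sqrt K * (pi / w) < N1" "N1 < 2 * pi" using dense by blast
  have Kvu: "sqrt K * (v - u) \<le> sqrt K * (pi / w)" using vu sK by (intro mult_left_mono) auto
  have f0: "f 0 < N1"
  proof -
    have "f 0 \<le> sqrt K * (2 * (v - u))" unfolding f_def using d_le[of u v] uv sK by (intro mult_left_mono) auto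
    then show ?thesis using Kvu Kw N1 by (simp add: algebra_simps)
  qed
  have contf: "continuous_on {0..x} f" for x unfolding f_def by (intro continuous_intros continuous_d)
  show False
  proof (cases "\<forall>x. 0 < x \<and> x < 1 \<longrightarrow> f x < N1")
    case True
    have "pi < w * (2 * g)" using wl wuv g(2) w0 by (simp add: g_def algebra_simps)
    then have "pi / (w * (2 * g)) < 1" using w0 g by simp
    then obtain x where x: "pi / (w * (2 * g)) < x" "x < 1" using dense by blast
    have "0 < pi / (w * (2 * g))" using w0 g by simp
    then have x0: "0 < x" using x by linarith
    have "pi < x * (w * (2 * g))" using x(1) w0 g by (simp add: divide_less_eq)
    moreover have "w * (2 * x * g) \<le> pi" using True x x0 N1 by (intro out(1)) (auto intro: less_trans)
    ultimately show False by (simp add: mult_ac)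
  next
    case False
    then obtain x1 where x1: "0 < x1" "x1 < 1" "N1 \<le> f x1" by (auto simp: not_less)
    obtain x where x: "0 \<le> x" "x \<le> x1" "f x = N1" using IVT'[of f 0 N1 x1] f0 x1 contf by auto
    have "x \<noteq> 0" using x f0 by auto
    then have "sqrt K * (2 * x * g + d (u - x * g) (v + x * g)) \<le> pi" using x x1 N1 by (intro out(2)) auto
    then have "f x \<le> sqrt K * (pi / w) + pi" using Kvu by (simp add: f_def algebra_simps)
    then show False using x N1 by simp
  qed
qed

end

context closed_curve
begin

text \<open>The complementary arcs share their chord at \<open>m\<close>, so the two angles are
  adjacent and lie within the single angle between \<open>m - h\<close> and
  \<open>m + h\<close>.\<close>

lemma opposite_angles:
  assumes c: "convex_arc K l d" and m: "s < m" "m < s + l"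
  shows "end_angle K d s m + start_angle K d m (s + l) \<le> pi"
proof -
  interpret CA: convex_arc K l d by (rule c)
  have ml: "m - s < l" "s + l - m < l" "m < s + l" using m by auto
  show ?thesis
  proof (rule tendsto_upperbound[OF tendsto_add[OF CA.be_tendsto[OF m(1) ml(1)] CA.al_tendsto[OF m(2) ml(2)]]])
    have "\<forall>\<^sub>F h in at_right 0. 0 < h \<and> h < min (m - s) (s + l - m)"
      unfolding eventually_at_right_field using m by (intro exI[of _ "min (m - s) (s + l - m)"]) auto
    then show "\<forall>\<^sub>F h in at_right 0. A m s (m - h) + A m (m + h) (s + l) \<le> pi"
    proof eventually_elim
      case (elim h)
      have "A m (m + h) s + A m s (m - h) \<le> A m (m + h) (m - h)" using elim m by (intro CA.star3) auto
      moreover have "A m (m + h) (m - h) \<le> pi" using elim m by (intro CA.A_bounds(2)[of m "m + h" "m - h" s "m + h"]) auto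
      ultimately show ?case by (simp add: A_per)
    qed
  qed simp
qed

text \<open>The curve is cut into two halves. Adding the opposite angles at both cut points bounds
  the two angle sums together by \<open>2 pi\<close>.\<close>

lemma closed_bound_flat:
  assumes c: "curved_arc K l d kap" shows "kap * l \<le> 2 * pi"
proof -
  interpret CA: curved_arc K l d kap by (rule c)
  have cc: "convex_arc K l d" by unfold_locales
  have "end_angle K d 0 (l / 2) + start_angle K d (l / 2) (0 + l) \<le> pi" using l by (intro opposite_angles cc) auto
  moreover have "end_angle K d (l / 2) l + start_angle K d l (l / 2 + l) \<le> pi" using l by (intro opposite_angles cc) auto
  moreover have "start_angle K d l (l / 2 + l) = start_angle K d 0 (l / 2)"
  proof -
    have "A l (l + h) (l / 2 + l) = A 0 (0 + h) (l / 2)" for h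
      using A_per(1)[of 0 "l + h" "l / 2 + l"] A_per(2)[of 0 h "l / 2 + l"] A_per(3)[of 0 h "l / 2"] by (simp add: add.commute)
    then show ?thesis by (simp add: start_angle_def)
  qed
  moreover have "kap * (l / 2 - 0) \<le> CA.Th 0 (l / 2)" "kap * (l - l / 2) \<le> CA.Th (l / 2) l" using l by (intro CA.Th_ge; simp)+
  ultimately show ?thesis by (simp add: CA.Th_def)
qed

end

section \<open>Arc/chord curvature\<close>

lemma half_chord_sn_strict_antimono:
  assumes K: "0 \<le> K" and L: "0 < L" and k: "0 \<le> k1" "k1 < k2" and le: "sqrt (k2\<^sup>2 + K) * L \<le> 2 * pi"
  shows "half_chord_sn K k2 L < half_chord_sn K k1 L"
proof -
  define w1 w2 where "w1 = sqrt (k1\<^sup>2 + K)" and "w2 = sqrt (k2\<^sup>2 + K)"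
  have "k1\<^sup>2 < k2\<^sup>2" using k by (intro power_strict_mono) auto
  then have w: "0 \<le> w1" "w1 < w2" using K by (auto simp: w1_def w2_def)
  have b: "w2 * L / 2 \<le> pi" using le by (simp add: w2_def)
  show ?thesis
  proof (cases "w1 = 0")
    case True
    have p: "0 < w2 * L / 2" using w L True by simp
    obtain z where z: "0 < z" "z < w2 * L / 2" "sin (w2 * L / 2) - sin 0 = (w2 * L / 2 - 0) * cos z"
      using MVT2[OF p, of sin cos] DERIV_sin by blast
    have "cos z < cos 0" using z b by (intro cos_monotone_0_pi) auto
    then have "w2 * L / 2 * cos z < w2 * L / 2 * 1" using p by (intro mult_strict_left_mono) auto
    then have "sin (w2 * L / 2) < w2 * L / 2" using z(3) by simp
    then have "sin (w2 * L / 2) / w2 < L / 2" using w True by (simp add: field_simps)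
    then show ?thesis using True w by (simp add: half_chord_sn_def w1_def[symmetric] w2_def[symmetric] Let_def)
  next
    case False
    then have w1: "0 < w1" using w by simp
    have "w1 * L / 2 * sin (w2 * L / 2) < w2 * L / 2 * sin (w1 * L / 2)"
      using w1 w L b by (intro sinc_strict_antimono) auto
    then have "w1 * sin (w2 * L / 2) < w2 * sin (w1 * L / 2)" using L by (simp add: mult_ac)
    then have "sin (w2 * L / 2) / w2 < sin (w1 * L / 2) / w1" using w1 w by (simp add: field_simps)
    then show ?thesis using w1 w by (simp add: half_chord_sn_def w1_def[symmetric] w2_def[symmetric] Let_def)
  qed
qed

text \<open>With \<open>L\<close> fixed, the half chord \<open>sin (w L / 2) / w\<close> goes from
  that of a geodesic arc at \<open>w = sqrt K\<close> to 0 at the full circle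
  \<open>w = 2 pi / L\<close>; the intermediate value theorem supplies \<open>w\<close>. Together
  with strict monotonicity this makes the \<open>THE\<close> in \<open>arc_chord_curv\<close>
  meaningful.\<close>

lemma const_curv_arc_exists:
  assumes K: "0 \<le> K" and L: "0 < L" and d: "0 \<le> d" "d \<le> L" and le: "sqrt K * (L + d) \<le> 2 * pi"
  shows "\<exists>k. const_curv_arc K k L d"
proof -
  define f where "f x = (if x = 0 then L / 2 else sin (x * L / 2) / x)" for x
  have KL: "sqrt K * L \<le> 2 * pi"
  proof -
    have "sqrt K * L \<le> sqrt K * (L + d)" using K d by (intro mult_left_mono) auto
    then show ?thesis using le by linarith
  qed
  have contf: "isCont f x" for x
  proof (cases "x = 0")
    case False
    have "\<forall>\<^sub>F y in nhds x. f y = sin (y * L / 2) / y"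
      using t1_space_nhds[OF False] by (rule eventually_mono) (simp add: f_def)
    moreover have "isCont (\<lambda>y. sin (y * L / 2) / y) x" using False by (intro continuous_intros) auto
    ultimately show ?thesis using isCont_cong[of f "\<lambda>y. sin (y * L / 2) / y" x] by simp
  next
    case True
    have "((\<lambda>y. sin (y * L / 2)) has_real_derivative L / 2) (at 0)" by (auto intro!: derivative_eq_intros)
    then have "((\<lambda>y. sin (y * L / 2) / y) \<longlongrightarrow> L / 2) (at 0)" unfolding has_field_derivative_iff by simp
    moreover have "\<forall>\<^sub>F y in at 0. sin (y * L / 2) / y = f y" by (simp add: eventually_at_filter f_def)
    ultimately have "(f \<longlongrightarrow> L / 2) (at 0)" by (rule Lim_transform_eventually)
    then show ?thesis using True by (simp add: isCont_def f_def)
  qed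
  have ab: "sqrt K \<le> 2 * pi / L" using KL L by (simp add: field_simps)
  have "f (2 * pi / L) = 0" using L by (simp add: f_def)
  moreover have "0 \<le> snK K (d / 2)"
  proof (rule snK_nonneg[OF K])
    have "sqrt K * (d / 2) \<le> sqrt K * (L + d) / 2" using K d L by (simp add: mult_left_mono)
    then show "sqrt K * (d / 2) \<le> pi" using le by linarith
  qed (use d in simp)
  moreover have "snK K (d / 2) \<le> f (sqrt K)"
  proof (cases "K = 0")
    case True then show ?thesis using d by (simp add: snK_def f_def)
  next
    case False
    then have sK: "0 < sqrt K" using K by simp
    define x y where "x = sqrt K * (d / 2)" and "y = sqrt K * (L / 2)"
    have xy: "0 \<le> x" "x \<le> y" "x + y \<le> pi" using sK d le by (auto simp: x_def y_def algebra_simps)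
    have "sin x \<le> sin y"
    \<comment> \<open>Here the admissibility bound enters: \<open>x + y \<le> pi\<close> gives
      \<open>sin x \<le> sin y\<close> even when the half arc \<open>y\<close> lies past
      \<open>pi / 2\<close>.\<close>
    proof (cases "y \<le> pi / 2")
      case True then show ?thesis using xy by (intro sin_monotone_2pi_le) auto
    next
      case False
      have "sin x \<le> sin (pi - y)" using xy False by (intro sin_monotone_2pi_le) auto
      then show ?thesis by simp
    qed
    then have "sin x / sqrt K \<le> sin y / sqrt K" using sK by (intro divide_right_mono) auto
    then show ?thesis using False K by (simp add: snK_def f_def x_def y_def mult_ac)
  qed
  ultimately obtain w where w: "sqrt K \<le> w" "w \<le> 2 * pi / L" "f w = snK K (d / 2)"
    using IVT2[of f "2 * pi / L" "snK K (d / 2)" "sqrt K"] ab contf by auto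
  define k where "k = sqrt (w\<^sup>2 - K)"
  have "(sqrt K)\<^sup>2 \<le> w\<^sup>2" using w K by (intro power_mono) auto
  then have wK: "K \<le> w\<^sup>2" using K by simp
  have w0: "0 \<le> w" using w(1) K real_sqrt_ge_zero[of K] by linarith
  have kw: "sqrt (k\<^sup>2 + K) = w" using wK w0 by (simp add: k_def)
  have "const_curv_arc K k L d" unfolding const_curv_arc_def half_chord_sn_def kw Let_def
    using w wK L w(3)[symmetric] by (simp add: k_def f_def field_simps)
  then show ?thesis by blast
qed

lemma arc_chord_curv:
  assumes K: "0 \<le> K" and L: "0 < L" and d: "0 \<le> d" "d \<le> L" and le: "sqrt K * (L + d) \<le> 2 * pi"
  shows "const_curv_arc K (arc_chord_curv K L d) L d"
proof -
  obtain k where k: "const_curv_arc K k L d" using const_curv_arc_exists[OF assms] by blast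
  have "k' = k" if "const_curv_arc K k' L d" for k'
    using half_chord_sn_strict_antimono[OF K L, of k k'] half_chord_sn_strict_antimono[OF K L, of k' k] k that
    unfolding const_curv_arc_def by (cases k k' rule: linorder_cases) auto
  then show ?thesis unfolding arc_chord_curv_def using k by (metis theI)
qed

lemma arc_chord_curv_ge:
  assumes K: "0 \<le> K" and L: "0 < L" and d: "0 \<le> d" "d \<le> L" and le: "sqrt K * (L + d) \<le> 2 * pi"
    and k: "0 \<le> k" "sqrt (k\<^sup>2 + K) * L \<le> 2 * pi" "snK K (d / 2) \<le> half_chord_sn K k L"
  shows "k \<le> arc_chord_curv K L d"
proof (rule ccontr)
  assume "\<not> ?thesis"
  then have "half_chord_sn K k L < half_chord_sn K (arc_chord_curv K L d) L"
    using arc_chord_curv[OF assms(1-5)] k by (intro half_chord_sn_strict_antimono[OF K L]) (auto simp: const_curv_arc_def)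
  then show False using k arc_chord_curv[OF assms(1-5)] by (simp add: const_curv_arc_def)
qed

lemma sin_taylor: "\<bar>sin x - (x - x ^ 3 / 6)\<bar> \<le> \<bar>x\<bar> ^ 5 / 120" for x :: real
proof -
  have S: "(\<Sum>m<5. sin_coeff m * x ^ m) = x - x ^ 3 / 6"
    by (simp add: eval_nat_numeral sin_coeff_Suc cos_coeff_Suc)
  have "\<bar>sin x - (x - x ^ 3 / 6)\<bar> \<le> inverse (fact 5) * \<bar>x\<bar> ^ 5" using Maclaurin_sin_bound[of x 5] unfolding S .
  also have "\<dots> = \<bar>x\<bar> ^ 5 / 120" by (simp add: fact_numeral field_simps)
  finally show ?thesis .
qed

text \<open>To third order \<open>snK (d / 2)\<close> and the model half chord contain the same
  \<open>K L^3 / 48\<close>, so the term in \<open>K\<close> cancels and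
  \<open>d \<le> L - k'^2 L^3 / 24\<close> up to order five. The gap between \<open>k\<close> and
  \<open>k'\<close> absorbs the remainder.\<close>

lemma chord_excess:
  assumes K: "0 \<le> K" and k: "0 < k" "k < k'"
  shows "\<exists>L1>0. \<forall>L d. 0 < L \<and> L < L1 \<and> 0 \<le> d \<and> d \<le> L \<and> snK K (d / 2) \<le> half_chord_sn K k' L
    \<longrightarrow> d \<le> L - k\<^sup>2 * L ^ 3 / 24"
proof -
  define w where "w = sqrt (k'\<^sup>2 + K)"
  have w2: "w\<^sup>2 = k'\<^sup>2 + K" using K by (simp add: w_def)
  have w0: "0 < w" using K k by (simp add: w_def add_pos_nonneg)
  have kk: "0 < k'\<^sup>2 - k\<^sup>2" using k by (simp add: power_strict_mono)
  \<comment> \<open>\<open>Q L^5 / 3840\<close> bounds the two fifth order remainders together, with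
    \<open>3840 = 120 * 32\<close>; the 80 in \<open>L1\<close> is \<open>3840 / 48\<close>. The
    other two entries of \<open>L1\<close> ensure \<open>k L < 1\<close> and
    \<open>sqrt K L < 1\<close>.\<close>
  define Q where "Q = w ^ 4 + K\<^sup>2"
  have Q: "0 < Q" using w0 by (simp add: Q_def add_pos_nonneg)
  define L1 where "L1 = Min {1 / (k + 1), 1 / (sqrt K + 1), sqrt (80 * (k'\<^sup>2 - k\<^sup>2) / Q)}"
  have L1: "0 < L1" using K k kk Q by (simp add: L1_def add_nonneg_pos)
  have "d \<le> L - k\<^sup>2 * L ^ 3 / 24" if L: "0 < L" "L < L1" and d: "0 \<le> d" "d \<le> L" and le: "snK K (d / 2) \<le> half_chord_sn K k' L" for L d
  proof (rule ccontr)
    assume neg: "\<not> ?thesis"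
    define D where "D = L - k\<^sup>2 * L ^ 3 / 24"
    have Ls: "L < 1 / (k + 1)" "L < 1 / (sqrt K + 1)" "L < sqrt (80 * (k'\<^sup>2 - k\<^sup>2) / Q)" using L by (auto simp: L1_def)
    have "k * L < 1"
    proof -
      have "L * (k + 1) < 1" using Ls(1) k by (simp add: less_divide_eq)
      then show ?thesis using L by (simp add: algebra_simps)
    qed
    then have "(k * L)\<^sup>2 \<le> 1" using k L by (simp add: power_le_one)
    then have "L * (k * L)\<^sup>2 \<le> L * 1" using L by (intro mult_left_mono) auto
    then have "k\<^sup>2 * L ^ 3 \<le> L" by (simp add: power2_eq_square power3_eq_cube algebra_simps)
    then have D: "0 \<le> D" "D \<le> L" using L by (auto simp: D_def)
    have dD: "D < d" using neg by (simp add: D_def)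
    have KL: "sqrt K * L < 1"
    proof -
      have "L * (sqrt K + 1) < 1" using Ls(2) K by (simp add: less_divide_eq add_nonneg_pos)
      then show ?thesis using L by (simp add: algebra_simps)
    qed
    have "snK K (D / 2) \<le> snK K (d / 2)"
    proof (cases "K = 0")
      case True then show ?thesis using dD by (simp add: snK_def)
    next
      case False
      then have sK: "0 < sqrt K" using K by simp
      have a1: "0 \<le> sqrt K * (D / 2)" using sK D by simp
      have a2: "sqrt K * (D / 2) \<le> sqrt K * (d / 2)" using sK dD by (intro mult_left_mono) auto
      have a3: "sqrt K * (d / 2) \<le> sqrt K * L" using d L sK by (intro mult_left_mono) auto
      have "sin (sqrt K * (D / 2)) \<le> sin (sqrt K * (d / 2))"
        using a1 a2 a3 KL pi_gt3 by (intro sin_monotone_2pi_le) linarith+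
      then show ?thesis using False sK by (simp add: snK_def divide_right_mono)
    qed
    then have up: "snK K (D / 2) \<le> sin (w * L / 2) / w" using le w0 by (simp add: half_chord_sn_def w_def[symmetric] Let_def)
    have u2: "sin (w * L / 2) / w \<le> L / 2 - w\<^sup>2 * L ^ 3 / 48 + w ^ 4 * L ^ 5 / 3840"
    proof -
      have "sin (w * L / 2) \<le> w * L / 2 - (w * L / 2) ^ 3 / 6 + \<bar>w * L / 2\<bar> ^ 5 / 120" using sin_taylor[of "w * L / 2"] by linarith
      also have "\<dots> = w * (L / 2 - w\<^sup>2 * L ^ 3 / 48 + w ^ 4 * L ^ 5 / 3840)"
        using w0 L by (simp add: abs_mult power_mult_distrib power_divide eval_nat_numeral algebra_simps)
      finally show ?thesis using w0 by (simp add: divide_le_eq mult.commute)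
    qed
    have lo: "D / 2 - K * L ^ 3 / 48 - K\<^sup>2 * L ^ 5 / 3840 \<le> snK K (D / 2)"
    proof (cases "K = 0")
      case False
      then have sK: "0 < sqrt K" "sqrt K * sqrt K = K" using K by auto
      define x where "x = sqrt K * (D / 2)"
      have x0: "0 \<le> x" "x \<le> sqrt K * (L / 2)" using sK D by (auto simp: x_def)
      have "x - x ^ 3 / 6 - x ^ 5 / 120 \<le> sin x" using sin_taylor[of x, unfolded abs_of_nonneg[OF x0(1)]] by linarith
      moreover have "x ^ 3 \<le> (sqrt K * (L / 2)) ^ 3" "x ^ 5 \<le> (sqrt K * (L / 2)) ^ 5" using x0 by (intro power_mono; simp)+
      ultimately have "x - (sqrt K * (L / 2)) ^ 3 / 6 - (sqrt K * (L / 2)) ^ 5 / 120 \<le> sin x" by linarith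
      moreover have "(sqrt K * (L / 2)) ^ 3 / 6 = sqrt K * (K * L ^ 3 / 48)"
      proof -
        have "(sqrt K) ^ 3 = sqrt K * K" using sK(2) by (simp add: power3_eq_cube)
        then show ?thesis by (simp add: power_mult_distrib power_divide)
      qed
      moreover have "(sqrt K * (L / 2)) ^ 5 / 120 = sqrt K * (K\<^sup>2 * L ^ 5 / 3840)"
      proof -
        have "(sqrt K) ^ 5 = (sqrt K) ^ (1 + 2 * 2)" by simp
        also have "\<dots> = sqrt K * ((sqrt K)\<^sup>2)\<^sup>2" by (simp only: power_add power_mult power_one_right)
        also have "(sqrt K)\<^sup>2 = K" using K by simp
        finally show ?thesis by (simp add: power_mult_distrib power_divide)
      qed
      ultimately have "sqrt K * (D / 2) - sqrt K * (K * L ^ 3 / 48) - sqrt K * (K\<^sup>2 * L ^ 5 / 3840) \<le> sin x" by (simp only: x_def)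
      then have "(D / 2 - K * L ^ 3 / 48 - K\<^sup>2 * L ^ 5 / 3840) * sqrt K \<le> sin x" by (simp add: algebra_simps)
      then have "D / 2 - K * L ^ 3 / 48 - K\<^sup>2 * L ^ 5 / 3840 \<le> sin x / sqrt K" using sK(1) by (simp only: pos_le_divide_eq)
      then show ?thesis using False by (simp add: snK_def x_def)
    qed (simp add: snK_def)
    have strict: "Q * L\<^sup>2 < 80 * (k'\<^sup>2 - k\<^sup>2)"
    proof -
      have "L\<^sup>2 < (sqrt (80 * (k'\<^sup>2 - k\<^sup>2) / Q))\<^sup>2" using Ls(3) L by (intro power_strict_mono) auto
      then have "L\<^sup>2 < 80 * (k'\<^sup>2 - k\<^sup>2) / Q" using kk Q by simp
      then show ?thesis using Q by (simp add: less_divide_eq mult.commute)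
    qed
    have "L / 2 - k\<^sup>2 * L ^ 3 / 48 - K * L ^ 3 / 48 - K\<^sup>2 * L ^ 5 / 3840 \<le> L / 2 - (k'\<^sup>2 + K) * L ^ 3 / 48 + w ^ 4 * L ^ 5 / 3840"
      using lo up u2 unfolding w2 D_def by (simp add: diff_divide_distrib)
    then have "L ^ 3 * (80 * (k'\<^sup>2 - k\<^sup>2)) \<le> Q * L ^ 5" by (simp add: Q_def algebra_simps)
    also have "Q * L ^ 5 = L ^ 3 * (Q * L\<^sup>2)" by (simp add: eval_nat_numeral)
    finally have "80 * (k'\<^sup>2 - k\<^sup>2) \<le> Q * L\<^sup>2" using L by simp
    then show False using strict by simp
  qed
  then show ?thesis using L1 by blast
qed

text \<open>The link between the space and the abstract curve: crossing boundary geodesics and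
  \<open>cbb_crossing\<close> give \<open>star\<close>, and the arc length parameter gives the
  metric axioms.\<close>

lemma arclength_closed_curve:
  fixes X :: "'a::metric_space set" and h :: "complex \<Rightarrow> 'a"
  assumes K: "0 \<le> K" and ls: "length_space X" and cbb: "cbb K X"
    and hom: "homeomorphism (cball 0 1) X h hinv" and arc: "arclength_param \<sigma> l (h ` sphere 0 1)"
  shows "closed_curve K l (\<lambda>x y. dist (\<sigma> x) (\<sigma> y))"
proof -
  have l: "0 < l" and per: "\<And>t. \<sigma> (t + l) = \<sigma> t" and inj: "inj_on \<sigma> {0..<l}" and im: "\<sigma> ` {0..l} = h ` sphere 0 1"
    and len: "\<And>a b. a \<le> b \<Longrightarrow> path_length \<sigma> a b = ereal (b - a)"
    using arc by (auto simp: arclength_param_def)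
  have X: "\<sigma> t \<in> X" for t
  proof -
    obtain n where n: "t + of_int n * l \<in> {0..<0 + l}" using period_representative[OF l] .
    have "\<sigma> t = \<sigma> (t + of_int n * l)" by (simp add: periodic_int[of \<sigma>, OF per])
    also have "\<dots> \<in> h ` sphere 0 1" unfolding im[symmetric] using n by auto
    also have "\<dots> \<subseteq> X" using hom by (auto simp: homeomorphism_def)
    finally show ?thesis .
  qed
  have le: "dist (\<sigma> a) (\<sigma> b) \<le> b - a" if "a \<le> b" for a b
  proof -
    define t where "t i = (if i = 0 then a else b)" for i :: nat
    have "(1::nat, t) \<in> {(n, t). t 0 = a \<and> t n = b \<and> (\<forall>i<n. t i \<le> t (Suc i))}" using that by (auto simp: t_def)
    from SUP_upper[OF this, of "\<lambda>p. ereal (\<Sum>i<fst p. dist (\<sigma> (snd p i)) (\<sigma> (snd p (Suc i))))"]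
    have "ereal (dist (\<sigma> a) (\<sigma> b)) \<le> path_length \<sigma> a b" by (simp add: path_length_def t_def)
    then show ?thesis using len[OF that] by simp
  qed
  show ?thesis
  proof
    show "0 \<le> K" "0 < l" by (fact K l)+
    show "dist (\<sigma> (x + l)) (\<sigma> y) = dist (\<sigma> x) (\<sigma> y)" for x y by (simp add: per)
    show "dist (\<sigma> x) (\<sigma> y) = dist (\<sigma> y) (\<sigma> x)" for x y by (rule dist_commute)
    show "dist (\<sigma> x) (\<sigma> z) \<le> dist (\<sigma> x) (\<sigma> y) + dist (\<sigma> y) (\<sigma> z)" for x y z by (rule dist_triangle)
    show "dist (\<sigma> x) (\<sigma> y) \<le> \<bar>x - y\<bar>" for x y using le[of x y] le[of y x] by (cases "x \<le> y") (auto simp: dist_commute)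
    show "0 < dist (\<sigma> x) (\<sigma> y)" if "x \<noteq> y" "\<bar>x - y\<bar> < l" for x y
      using periodic_inj_iff[OF l per inj _ that(2)] that(1) by auto
    show "\<exists>(n::nat) t. t 0 = x \<and> t n = y \<and> (\<forall>i<n. t i \<le> t (Suc i)) \<and> y - x - \<epsilon> < (\<Sum>i<n. dist (\<sigma> (t i)) (\<sigma> (t (Suc i))))"
      if "x < y" "0 < \<epsilon>" for x y \<epsilon>
    proof -
      have "ereal (y - x - \<epsilon>) < path_length \<sigma> x y" using len[of x y] that by simp
      then obtain p where "p \<in> {(n::nat, t). t 0 = x \<and> t n = y \<and> (\<forall>i<n. t i \<le> t (Suc i))}"
        "ereal (y - x - \<epsilon>) < ereal (\<Sum>i<fst p. dist (\<sigma> (snd p i)) (\<sigma> (snd p (Suc i))))"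
        unfolding path_length_def less_SUP_iff by blast
      then show ?thesis by (intro exI[of _ "fst p"] exI[of _ "snd p"]) auto
    qed
  next
    fix a b c e assume o: "a < b" "b < c" "c < e" "e < a + l"
      and p: "sqrt K * (dist (\<sigma> a) (\<sigma> b) + dist (\<sigma> b) (\<sigma> c) + dist (\<sigma> a) (\<sigma> c)) < 2 * pi"
        "sqrt K * (dist (\<sigma> a) (\<sigma> e) + dist (\<sigma> e) (\<sigma> c) + dist (\<sigma> a) (\<sigma> c)) < 2 * pi"
        "sqrt K * (dist (\<sigma> a) (\<sigma> b) + dist (\<sigma> b) (\<sigma> e) + dist (\<sigma> a) (\<sigma> e)) < 2 * pi"
    obtain x where x: "x \<in> X" "dist (\<sigma> a) x + dist x (\<sigma> c) = dist (\<sigma> a) (\<sigma> c)" "dist (\<sigma> b) x + dist x (\<sigma> e) = dist (\<sigma> b) (\<sigma> e)"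
      by (rule boundary_geodesics_cross[OF ls hom arc o])
    have ne: "\<sigma> a \<noteq> \<sigma> b" "\<sigma> a \<noteq> \<sigma> c" "\<sigma> a \<noteq> \<sigma> e"
      using periodic_inj_iff[OF l per inj, of a b] periodic_inj_iff[OF l per inj, of a c] periodic_inj_iff[OF l per inj, of a e] o by auto
    have "cmp_ang K (\<sigma> a) (\<sigma> b) (\<sigma> c) + cmp_ang K (\<sigma> a) (\<sigma> c) (\<sigma> e) \<le> cmp_ang K (\<sigma> a) (\<sigma> b) (\<sigma> e)"
      by (rule cbb_crossing[OF K cbb x(1) X X X X x(2,3) ne p])
    then show "ang3 K (\<lambda>x y. dist (\<sigma> x) (\<sigma> y)) a b c + ang3 K (\<lambda>x y. dist (\<sigma> x) (\<sigma> y)) a c e \<le> ang3 K (\<lambda>x y. dist (\<sigma> x) (\<sigma> y)) a b e"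
      by (simp add: ang3_def cmp_ang_def)
  qed
qed

text \<open>The exceptional set is contained in the countably many translates, by multiples of the
  period, of the exceptional set in one period.\<close>

lemma AE_periodic:
  fixes P :: "real \<Rightarrow> bool"
  assumes l: "0 < l" and AE: "AE s in lborel. s \<in> {0..l} \<longrightarrow> P s" and per: "\<And>s. P s \<Longrightarrow> P (s + l)" "\<And>s. P s \<Longrightarrow> P (s - l)"
  shows "AE s in lborel. P s"
proof -
  define N where "N = {s. \<not> (s \<in> {0..l} \<longrightarrow> P s)}"
  have N: "negligible N" unfolding N_def by (rule negligible_of_AE[OF AE])
  have shift: "P (s + of_int n * l)" if "P s" for s n
  proof (induction n rule: int_induct[where k = 0])
    case base then show ?case using that by simp
  next
    case (step1 i) then show ?case using per(1)[of "s + of_int i * l"] by (simp add: algebra_simps)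
  next
    case (step2 i) then show ?case using per(2)[of "s + of_int i * l"] by (simp add: algebra_simps)
  qed
  have "{s. \<not> P s} \<subseteq> (\<Union>n::int. (+) (of_int n * l) ` N)"
  proof
    fix s assume s: "s \<in> {s. \<not> P s}"
    obtain n where n: "s + of_int n * l \<in> {0..<0 + l}" using period_representative[OF l] .
    have "\<not> P (s + of_int n * l)" using shift[of "s + of_int n * l" "- n"] s by (auto simp: algebra_simps)
    then have "s + of_int n * l \<in> N" using n by (auto simp: N_def)
    then have "s \<in> (+) (of_int (- n) * l) ` N" by (rule rev_image_eqI) simp
    then show "s \<in> (\<Union>n::int. (+) (of_int n * l) ` N)" by blast
  qed
  moreover have "negligible (\<Union>n::int. (+) (of_int n * l) ` N)"
    by (rule negligible_countable_Union) (auto intro: negligible_translation N)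
  ultimately have "negligible {s. \<not> P s}" by (rule negligible_subset[rotated])
  then have "{s. \<not> P s} \<in> null_sets lebesgue" by (simp add: negligible_iff_null_sets)
  then have "AE s in lebesgue. P s" by (rule AE_I') auto
  then show ?thesis by (simp add: AE_completion_iff)
qed

theorem theorem4p3:
  fixes X :: "'a::metric_space set" and K \<kappa> l :: real
    and h :: "complex \<Rightarrow> 'a" and hinv :: "'a \<Rightarrow> complex" and \<sigma> :: "real \<Rightarrow> 'a"
  assumes "K \<ge> 0"
    and "complete X" and "length_space X" and "cbb K X"
    and "homeomorphism (cball 0 1) X h hinv"
    and "arclength_param \<sigma> l (h ` sphere 0 1)"
    and "AE s in lborel. s \<in> {0..l} \<longrightarrow> upper_acc K \<sigma> l s \<ge> ereal \<kappa>"
  shows "\<forall>a b. a < b \<and> b - a < l \<and>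
           (K > 0 \<longrightarrow> (b - a) + dist (\<sigma> a) (\<sigma> b) \<le> 2 * pi / sqrt K)
           \<longrightarrow> arc_chord_curv K (b - a) (dist (\<sigma> a) (\<sigma> b)) \<ge> \<kappa>"
proof (intro allI impI)
  note K = assms(1) and acc = assms(7)
  define d where "d x y = dist (\<sigma> x) (\<sigma> y)" for x y
  interpret C: closed_curve K l d
    unfolding d_def by (rule arclength_closed_curve[OF K assms(3-6)])
  have adm: "0 < L \<and> 0 \<le> d a b \<and> d a b \<le> L \<and> sqrt K * (L + d a b) \<le> 2 * pi"
    if "a < b" "L = b - a" "K > 0 \<longrightarrow> L + d a b \<le> 2 * pi / sqrt K" for a b L
  proof -
    have "sqrt K * (L + d a b) \<le> 2 * pi"
    proof (cases "K = 0")
      case False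
      then have "0 < sqrt K" "K > 0" using K by auto
      then show ?thesis using that(3) by (simp add: field_simps)
    qed simp
    then show ?thesis using that C.d_nonneg[of a b] C.d_le[of a b] by auto
  qed
  fix a b assume ab: "a < b \<and> b - a < l \<and> (K > 0 \<longrightarrow> (b - a) + dist (\<sigma> a) (\<sigma> b) \<le> 2 * pi / sqrt K)"
  define L where "L = b - a"
  have L: "0 < L" "0 \<le> d a b" "d a b \<le> L" "sqrt K * (L + d a b) \<le> 2 * pi" "L < l"
    using adm[of a b L] ab by (auto simp: L_def d_def)
  have "\<kappa> \<le> arc_chord_curv K L (d a b)"
  proof (cases "\<kappa> \<le> 0")
    case True
    then show ?thesis using arc_chord_curv[OF K L(1-4)] by (simp add: const_curv_arc_def)
  next
    case False
    then have kap: "0 < \<kappa>" by simp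
    \<comment> \<open>The form in which the curvature hypothesis enters \<open>Th_lower\<close>;
      unlike \<open>upper_acc\<close> it mentions only \<open>d\<close>, so it is invariant under
      the period shift.\<close>
    define P where "P k s \<longleftrightarrow> (\<forall>\<delta>>0. \<exists>a b. a \<le> s \<and> s \<le> b \<and> a < b \<and> b - a < \<delta> \<and> d a b \<le> (b - a) - k\<^sup>2 * (b - a) ^ 3 / 24)" for k s
    have P: "P k s" if k: "0 < k" "k < \<kappa>" and s: "ereal \<kappa> \<le> upper_acc K \<sigma> l s" for k s
      unfolding P_def
    proof (intro allI impI)
      fix \<delta> :: real assume \<delta>: "0 < \<delta>"
      obtain k' where k': "k < k'" "k' < \<kappa>" using dense k by blast
      obtain L1 where L1: "0 < L1" "\<And>L d. 0 < L \<and> L < L1 \<and> 0 \<le> d \<and> d \<le> L \<and> snK K (d / 2) \<le> half_chord_sn K k' L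
        \<Longrightarrow> d \<le> L - k\<^sup>2 * L ^ 3 / 24" using chord_excess[OF K k(1) k'(1)] by blast
      define \<delta>' where "\<delta>' = min \<delta> L1"
      have d': "0 < \<delta>'" using \<delta> L1 by (simp add: \<delta>'_def)
      let ?I = "{(a, b). a \<le> s \<and> s \<le> b \<and> a < b \<and> b - a < \<delta>' \<and> b - a < l \<and> (K > 0 \<longrightarrow> (b - a) + dist (\<sigma> a) (\<sigma> b) \<le> 2 * pi / sqrt K)}"
      have "upper_acc K \<sigma> l s \<le> (SUP p\<in>?I. ereal (arc_chord_curv K (snd p - fst p) (dist (\<sigma> (fst p)) (\<sigma> (snd p)))))"
        unfolding upper_acc_def using d' by (intro INF_lower) auto
      then have "ereal k' < (SUP p\<in>?I. ereal (arc_chord_curv K (snd p - fst p) (dist (\<sigma> (fst p)) (\<sigma> (snd p)))))"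
        using s k' by (meson ereal_less(2) less_ereal.simps(1) less_le_trans order_trans)
      then obtain p where p: "p \<in> ?I" "ereal k' < ereal (arc_chord_curv K (snd p - fst p) (dist (\<sigma> (fst p)) (\<sigma> (snd p))))"
        unfolding less_SUP_iff by blast
      define a b where "a = fst p" and "b = snd p"
      have ab: "a \<le> s" "s \<le> b" "a < b" "b - a < \<delta>'" "K > 0 \<longrightarrow> (b - a) + d a b \<le> 2 * pi / sqrt K"
        using p(1) by (auto simp: a_def b_def d_def)
      note adm1 = adm[OF ab(3) refl ab(5)]
      have cc: "const_curv_arc K (arc_chord_curv K (b - a) (d a b)) (b - a) (d a b)" using adm1 by (intro arc_chord_curv[OF K]) auto
      \<comment> \<open>Larger curvature at equal length means a shorter model chord, so an arc with
        arc/chord curvature above \<open>k'\<close> has a chord below that of curvature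
        \<open>k'\<close>.\<close>
      have "half_chord_sn K (arc_chord_curv K (b - a) (d a b)) (b - a) < half_chord_sn K k' (b - a)"
        using cc p(2) adm1 k k' by (intro half_chord_sn_strict_antimono[OF K]) (auto simp: const_curv_arc_def a_def b_def d_def)
      then have "snK K (d a b / 2) \<le> half_chord_sn K k' (b - a)" using cc by (simp add: const_curv_arc_def)
      then have "d a b \<le> (b - a) - k\<^sup>2 * (b - a) ^ 3 / 24" using adm1 ab(4) by (intro L1(2)) (auto simp: \<delta>'_def)
      then show "\<exists>a b. a \<le> s \<and> s \<le> b \<and> a < b \<and> b - a < \<delta> \<and> d a b \<le> (b - a) - k\<^sup>2 * (b - a) ^ 3 / 24"
        using ab by (intro exI[of _ a] exI[of _ b]) (auto simp: \<delta>'_def)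
    qed
    have AEP: "AE s in lborel. P k s" if k: "0 < k" "k < \<kappa>" for k
    proof (rule AE_periodic[OF C.l])
      show "AE s in lborel. s \<in> {0..l} \<longrightarrow> P k s" using acc by (rule AE_mp) (use P[OF k] in auto)
      have dm: "d (a - l) (b - l) = d a b" for a b using C.per[of "a - l" "b - l"] C.per2[of a "b - l"] by simp
      show "P k (s + l)" if Ps: "P k s" for s
        unfolding P_def
      proof (intro allI impI)
        fix \<delta> :: real assume "0 < \<delta>"
        then obtain a b where "a \<le> s" "s \<le> b" "a < b" "b - a < \<delta>" "d a b \<le> (b - a) - k\<^sup>2 * (b - a) ^ 3 / 24"
          using Ps unfolding P_def by blast
        then show "\<exists>a b. a \<le> s + l \<and> s + l \<le> b \<and> a < b \<and> b - a < \<delta> \<and> d a b \<le> (b - a) - k\<^sup>2 * (b - a) ^ 3 / 24"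
          by (intro exI[of _ "a + l"] exI[of _ "b + l"]) (simp add: C.per C.per2)
      qed
      show "P k (s - l)" if Ps: "P k s" for s
        unfolding P_def
      proof (intro allI impI)
        fix \<delta> :: real assume "0 < \<delta>"
        then obtain a b where "a \<le> s" "s \<le> b" "a < b" "b - a < \<delta>" "d a b \<le> (b - a) - k\<^sup>2 * (b - a) ^ 3 / 24"
          using Ps unfolding P_def by blast
        then show "\<exists>a b. a \<le> s - l \<and> s - l \<le> b \<and> a < b \<and> b - a < \<delta> \<and> d a b \<le> (b - a) - k\<^sup>2 * (b - a) ^ 3 / 24"
          by (intro exI[of _ "a - l"] exI[of _ "b - l"]) (simp add: dm)
      qed
    qed
    \<comment> \<open>The largest window on which all comparison triangles are automatically
      admissible. For \<open>K = 0\<close> it is the whole period, as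
      \<open>closed_bound_flat\<close> requires.\<close>
    define Lam where "Lam = (if K = 0 then l else min l (pi / sqrt K))"
    have Lam: "0 < Lam" "Lam \<le> l" "sqrt K * Lam \<le> pi"
    proof -
      show "0 < Lam" "Lam \<le> l" using C.l K by (auto simp: Lam_def)
      show "sqrt K * Lam \<le> pi"
      proof (cases "K = 0")
        case False
        then have "0 < sqrt K" using K by simp
        then have "sqrt K * min l (pi / sqrt K) \<le> sqrt K * (pi / sqrt K)" by (intro mult_left_mono) auto
        then show ?thesis using False \<open>0 < sqrt K\<close> by (simp add: Lam_def)
      qed simp
    qed
    interpret A: convex_arc K Lam d by (rule C.arc[OF Lam])
    have ca: "curved_arc K Lam d \<kappa>"
    proof
      show "0 < \<kappa>" by (rule kap)
      show "\<kappa> * (y - x) \<le> A.Th x y" if "x < y" "y - x < Lam" for x y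
      proof (rule A.Th_lower[OF that kap])
        fix k assume "0 < k" "k < \<kappa>"
        from AEP[OF this] show "AE s in lborel. s \<in> {x<..<y} \<longrightarrow> (\<forall>\<delta>>0. \<exists>a b. a \<le> s \<and> s \<le> b \<and> a < b \<and> b - a < \<delta> \<and> d a b \<le> b - a - k\<^sup>2 * (b - a) ^ 3 / 24)"
          unfolding P_def by (rule AE_mp) (rule AE_I2, blast)
      qed
    qed
    interpret B: curved_arc K Lam d \<kappa> by (rule ca)
    define w where "w = sqrt (\<kappa>\<^sup>2 + K)"
    have wK: "sqrt K < w" unfolding w_def using kap by simp
    have w0: "0 < w" using wK K real_sqrt_ge_zero[of K] by linarith
    have closed: "w * l \<le> 2 * pi"
    proof (cases "K = 0")
      case True
      then show ?thesis using C.closed_bound_flat[of \<kappa>] ca kap by (simp add: Lam_def w_def)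
    next
      case False
      interpret D: curved_closed K l d \<kappa> Lam
        by unfold_locales (use False K Lam ca in auto)
      show ?thesis unfolding w_def by (rule D.closed_bound_pos) (use False in \<open>simp add: Lam_def\<close>)
    qed
    \<comment> \<open>Up to a half circle the window is long enough, because
      \<open>sqrt K < w\<close> turns \<open>w (y - x) \<le> pi\<close> into
      \<open>y - x < pi / sqrt K\<close>.\<close>
    have short: "snK K (d x y / 2) \<le> sin (w * (y - x) / 2) / w" if xy: "x < y" "y - x < l" "w * (y - x) \<le> pi" for x y
    proof (rule B.half_chord_le[OF xy(1) _ w_def xy(3)])
      show "y - x < Lam"
      proof (cases "K = 0")
        case False
        then have sK: "0 < sqrt K" using K by simp
        have "sqrt K * (y - x) < w * (y - x)" using wK xy by simp
        then have "sqrt K * (y - x) < pi" using xy by linarith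
        then have "y - x < pi / sqrt K" using sK by (simp add: less_divide_eq mult.commute)
        then show ?thesis using xy False by (simp add: Lam_def)
      qed (use xy in \<open>simp add: Lam_def\<close>)
    qed
    \<comment> \<open>Beyond a half circle the complementary arc, which has the same chord, is short
      by the length bound. Its phase is at most \<open>pi - w L / 2\<close>, and the sine is
      symmetric about \<open>pi / 2\<close>.\<close>
    have "snK K (d a b / 2) \<le> sin (w * L / 2) / w"
    proof (cases "w * L \<le> pi")
      case True then show ?thesis using short[of a b] ab by (simp add: L_def)
    next
      case False
      have wl: "w * (a + l - b) \<le> 2 * pi - w * L" using closed by (simp add: L_def algebra_simps)
      have "snK K (d b (a + l) / 2) \<le> sin (w * (a + l - b) / 2) / w"
        using ab wl False by (intro short) (auto simp: L_def)
      also have "\<dots> \<le> sin (w * L / 2) / w"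
      proof (rule divide_right_mono)
        have "0 \<le> w * (a + l - b)" using w0 ab by simp
        then have "sin (w * (a + l - b) / 2) \<le> sin (pi - w * L / 2)"
          using wl False pi_gt_zero by (intro sin_monotone_2pi_le) linarith+
        then show "sin (w * (a + l - b) / 2) \<le> sin (w * L / 2)" by simp
      qed (use w0 in simp)
      finally show ?thesis by (simp add: C.per2 C.d_sym[of b a])
    qed
    moreover have "w * L \<le> 2 * pi"
    proof -
      have "w * L \<le> w * l" using w0 L by simp
      then show ?thesis using closed by linarith
    qed
    ultimately show ?thesis using kap w0
      by (intro arc_chord_curv_ge[OF K L(1-4)]) (simp_all add: half_chord_sn_def w_def[symmetric] Let_def)
  qed
  then show "\<kappa> \<le> arc_chord_curv K (b - a) (dist (\<sigma> a) (\<sigma> b))" by (simp add: L_def d_def)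
qed

end
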